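(* Let $R$ be a commutative preordered ring in $\mathscr V$. Suppose that $R$ is strong and that $\mathscr V$ has a generating class $\mathscr G$ such that for each object $G\in\mathscr G$, the preordered ring $\mathscr V(G,R)$ in $\mathrm{Set}$ is a firmly archimedean preordered $\mathbb D$-algebra. Then for each object $V$ of $\mathscr V$, functional distributions on $V$ in the positive $R$-convex context $(\mathscr V,\mathrm{Mat}_{R_+}^{\mathrm{aff}},R_+)$ are the same as homomorphisms of pointed $R_+$-modules $\mu:[V,R_+]\to R_+$. Moreover, $$D_{(\mathrm{Mat}_{R_+}^{\mathrm{aff}},R_+)}(V)=R_+\text{-Mod}^*([V,R_+],R_+).$$
   Context: $\mathscr V$ is a locally small cartesian closed category with equalizers, countable colimits, and intersections of countable families of strong subobjects; $\underline{\mathscr V}$ is $\mathscr V$ as a $\mathscr V$-category, with internal homs $\underline{\mathscr V}(V,W)$. \emph{Theories.} A theory (discretely finitary, enriched in $\mathscr V$) is a $\mathscr V$-category $\mathscr T$ whose objects are the natural numbers, equipped for each $n$ with morphisms $\pi_i:n\to1$ ($1\le i\le n$) exhibiting $n$ as a conical ($\mathscr V$-enriched) $n$-th power of $1$, with $\pi_1=\mathrm{id}$ if $n=1$. A $\mathscr T$-algebra is a $\mathscr V$-functor $A:\mathscr T\to\underline{\mathscr V}$ preserving conical finite powers, with carrier $|A|=A(1)$; it is normal if it sends the designated power $n$ of $1$ to the designated power $|A|^n$. $\mathscr T\text{-Alg}$ is the $\mathscr V$-category of $\mathscr T$-algebras, with hom-objects the objects of $\mathscr V$-natural transformations; it has pointwise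 cotensors $[V,A]$, with carrier $\underline{\mathscr V}(V,|A|)$. \emph{Commutant and functional distributions.} The commutant of $\mathscr T$ with respect to a $\mathscr T$-algebra $S$ is the theory $\mathscr T^\perp$ with $\mathscr T^\perp(n,m)=\mathscr T\text{-Alg}(S^n,S^m)$ and composition as in $\mathscr T\text{-Alg}$; $n\mapsto|S|^n$ is a $\mathscr T^\perp$-algebra with carrier $|S|$, again denoted $S$. A finitary functional-analytic context $(\mathscr V,\mathscr T,S)$ consists of $\mathscr V$, a commutative theory $\mathscr T$, and a $\mathscr T$-algebra $S$ such that $\mathscr T$ is saturated with respect to $S$ (i.e. canonically isomorphic to its double commutant with respect to $S$). In such a context, the object of functional distributions on $V\in\mathscr V$ is $D_{(\mathscr T,S)}(V)=\mathscr T^\perp\text{-Alg}([V,S],S)$, and functional distributions on $V$ are the $\mathscr T^\perp$-algebra homomorphisms $[V,S]\to S$. \emph{Preordered rings.} A rig in $\mathscr V$ is an object $P$ with a commutative monoid structure $(+,0)$ and a monoid structure $(\bullet,1)$ in $\mathscr V$ such that $\bullet$ preserves $+$ and $0$ in each variable separately; it is a ring if $(P,+,0)$ is an abelian group in $\mathscr V$. A preordered ring in $\mathscr V$ is a ring $R$ in $\mathscr V$ with a sub-rig $R_+\hookrightarrow R$ (its positive part); it is strong if $R_+\hookrightarrow R$ is a strong monomorphism. For $V\in\mathscr V$, $\mathscr V(V,R)$ is a preordered ring in $\mathrm{Set}$ with positive part the set of morphisms $V\to R$ factoring through $R_+$. In a preordered ring $Q$ in $\mathrm{Set}$, $r\le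 s$ means $s-r\in Q_+$. $Q$ is archimedean if for every $r\in Q$, whenever $\{nr\mid n\in\mathbb N\}$ has an upper bound, $r\le0$; it is firmly archimedean if moreover for every $s\in Q_+$ there is $n\in\mathbb N$ with $s\le n\cdot1$. $\mathbb D$ is the ring of dyadic rationals with its usual order; $Q$ is a preordered $\mathbb D$-algebra if there is a monotone ring homomorphism $\mathbb D\to Q$. \emph{Generating class.} A class $\mathscr G\subseteq\mathrm{ob}\,\mathscr V$ is generating if, for all $f,g:A\to B$ in $\mathscr V$, $f\cdot x=g\cdot x$ for all $G\in\mathscr G$ and $x:G\to A$ implies $f=g$. \emph{Positive $R$-convex context.} For a rig $P$ in $\mathscr V$, $\mathrm{Mat}_P$ is the theory with $\mathrm{Mat}_P(n,m)=P^{m\times n}$, composition given by matrix multiplication, and designated projections the standard basis row vectors; $\mathrm{Mat}_P^{\mathrm{aff}}$ is its subtheory whose hom-objects are the equalizers expressing that each row sums to $1$. $P$ is the carrier of a normal $\mathrm{Mat}_P^{\mathrm{aff}}$-algebra in which $a$ acts as $x\mapsto(\sum_ia_{ji}x_i)_j$. For a commutative preordered ring $R$, $(\mathscr V,\mathrm{Mat}_{R_+}^{\mathrm{aff}},R_+)$ is a finitary functional-analytic context, called the positive $R$-convex context. \emph{Pointed modules.} A pointed $R_+$-module is an $R_+$-module $M$ in $\mathscr V$ with a morphism $*:1\to M$ in $\mathscr V$. $R_+\text{-Mod}^*$ is the $\mathscr V$-category of pointed $R_+$-modules: its hom-object from $(M,* )$ to $(N,* )$ is the subobject of $\underline{\mathscr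 V}(M,N)$ of $R_+$-linear morphisms preserving the point (an equalizer). $R_+$ is pointed by $1:1\to R_+$, and $[V,R_+]$ is $\underline{\mathscr V}(V,R_+)$ with the pointwise pointed $R_+$-module structure (point: the constant morphism $1$). *)

theory Defs
  imports Complex_Main "HOL-Algebra.Ring"
begin

section \<open>Categories\<close>

record ('o, 'm) category =
  Ob :: "'o set"
  Arr :: "'m set"
  Dom :: "'m \<Rightarrow> 'o"
  Cod :: "'m \<Rightarrow> 'o"
  Ident :: "'o \<Rightarrow> 'm"
  Comp :: "'m \<Rightarrow> 'm \<Rightarrow> 'm"  (infixr "\<bullet>\<index>" 70)

context
  fixes C :: "('o, 'm, 'z) category_scheme" (structure)
begin

definition Hom :: "'o \<Rightarrow> 'o \<Rightarrow> 'm set" where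
  "Hom A B = {f \<in> Arr C. Dom C f = A \<and> Cod C f = B}"

definition is_category :: bool where
  "is_category \<longleftrightarrow>
     (\<forall>f \<in> Arr C. Dom C f \<in> Ob C \<and> Cod C f \<in> Ob C) \<and>
     (\<forall>A \<in> Ob C. Ident C A \<in> Hom A A) \<and>
     (\<forall>f \<in> Arr C. \<forall>g \<in> Arr C. Cod C f = Dom C g \<longrightarrow> g \<bullet> f \<in> Hom (Dom C f) (Cod C g)) \<and>
     (\<forall>f \<in> Arr C. f \<bullet> Ident C (Dom C f) = f \<and> Ident C (Cod C f) \<bullet> f = f) \<and>
     (\<forall>f \<in> Arr C. \<forall>g \<in> Arr C. \<forall>h \<in> Arr C. Cod C f = Dom C g \<longrightarrow> Cod C g = Dom C h \<longrightarrow>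
        (h \<bullet> g) \<bullet> f = h \<bullet> (g \<bullet> f))"

definition monic :: "'m \<Rightarrow> bool" where
  "monic m \<longleftrightarrow> m \<in> Arr C \<and>
     (\<forall>f \<in> Arr C. \<forall>g \<in> Arr C. Dom C f = Dom C g \<and> Cod C f = Dom C m \<and> Cod C g = Dom C m \<and>
        m \<bullet> f = m \<bullet> g \<longrightarrow> f = g)"

definition epic :: "'m \<Rightarrow> bool" where
  "epic e \<longleftrightarrow> e \<in> Arr C \<and>
     (\<forall>f \<in> Arr C. \<forall>g \<in> Arr C. Cod C f = Cod C g \<and> Dom C f = Cod C e \<and> Dom C g = Cod C e \<and>
        f \<bullet> e = g \<bullet> e \<longrightarrow> f = g)"

definition strong_mono :: "'m \<Rightarrow> bool" where
  "strong_mono m \<longleftrightarrow> monic m \<and>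
     (\<forall>e u v. epic e \<longrightarrow> u \<in> Hom (Dom C e) (Dom C m) \<longrightarrow> v \<in> Hom (Cod C e) (Cod C m) \<longrightarrow>
        m \<bullet> u = v \<bullet> e \<longrightarrow>
        (\<exists>!d. d \<in> Hom (Cod C e) (Dom C m) \<and> d \<bullet> e = u \<and> m \<bullet> d = v))"

definition same_subobject :: "'m \<Rightarrow> 'm \<Rightarrow> bool" where
  "same_subobject m n \<longleftrightarrow> monic m \<and> monic n \<and> Cod C m = Cod C n \<and>
     (\<exists>\<phi> \<psi>. \<phi> \<in> Hom (Dom C m) (Dom C n) \<and> \<psi> \<in> Hom (Dom C n) (Dom C m) \<and>
        \<psi> \<bullet> \<phi> = Ident C (Dom C m) \<and> \<phi> \<bullet> \<psi> = Ident C (Dom C n) \<and> n \<bullet> \<phi> = m)"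

definition is_equalizer :: "'m \<Rightarrow> 'm \<Rightarrow> 'm \<Rightarrow> bool" where
  "is_equalizer f g e \<longleftrightarrow> f \<in> Arr C \<and> g \<in> Hom (Dom C f) (Cod C f) \<and>
     e \<in> Arr C \<and> Cod C e = Dom C f \<and> f \<bullet> e = g \<bullet> e \<and>
     (\<forall>h \<in> Arr C. Cod C h = Dom C f \<and> f \<bullet> h = g \<bullet> h \<longrightarrow>
        (\<exists>!k. k \<in> Hom (Dom C h) (Dom C e) \<and> e \<bullet> k = h))"

definition has_equalizers :: bool where
  "has_equalizers \<longleftrightarrow>
     (\<forall>f \<in> Arr C. \<forall>g \<in> Arr C. Dom C f = Dom C g \<and> Cod C f = Cod C g \<longrightarrow> (\<exists>e. is_equalizer f g e))"

definition equalizer :: "'m \<Rightarrow> 'm \<Rightarrow> 'm" where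
  "equalizer f g = (SOME e. is_equalizer f g e)"

definition is_intersection :: "nat set \<Rightarrow> (nat \<Rightarrow> 'm) \<Rightarrow> 'o \<Rightarrow> 'm \<Rightarrow> bool" where
  "is_intersection I m B l \<longleftrightarrow> monic l \<and> Cod C l = B \<and>
     (\<forall>i \<in> I. \<exists>k \<in> Hom (Dom C l) (Dom C (m i)). m i \<bullet> k = l) \<and>
     (\<forall>f \<in> Arr C. Cod C f = B \<and> (\<forall>i \<in> I. \<exists>k \<in> Hom (Dom C f) (Dom C (m i)). m i \<bullet> k = f) \<longrightarrow>
        (\<exists>k \<in> Hom (Dom C f) (Dom C l). l \<bullet> k = f))"

definition has_countable_strong_intersections :: bool where
  "has_countable_strong_intersections \<longleftrightarrow>
     (\<forall>I m. \<forall>B \<in> Ob C. (\<forall>i \<in> I. strong_mono (m i) \<and> Cod C (m i) = B) \<longrightarrow>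
        (\<exists>l. is_intersection I m B l))"

end

definition is_functor ::
  "('i, 'j, 'y) category_scheme \<Rightarrow> ('o, 'm, 'z) category_scheme \<Rightarrow> ('i \<Rightarrow> 'o) \<Rightarrow> ('j \<Rightarrow> 'm) \<Rightarrow> bool"
  where
  "is_functor J C F\<^sub>o F\<^sub>a \<longleftrightarrow>
     (\<forall>i \<in> Ob J. F\<^sub>o i \<in> Ob C) \<and>
     (\<forall>f \<in> Arr J. F\<^sub>a f \<in> Hom C (F\<^sub>o (Dom J f)) (F\<^sub>o (Cod J f))) \<and>
     (\<forall>i \<in> Ob J. F\<^sub>a (Ident J i) = Ident C (F\<^sub>o i)) \<and>
     (\<forall>f \<in> Arr J. \<forall>g \<in> Arr J. Cod J f = Dom J g \<longrightarrow>
        F\<^sub>a (g \<bullet>\<^bsub>J\<^esub> f) = F\<^sub>a g \<bullet>\<^bsub>C\<^esub> F\<^sub>a f)"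

definition is_cocone ::
  "('i, 'j, 'y) category_scheme \<Rightarrow> ('o, 'm, 'z) category_scheme \<Rightarrow> ('i \<Rightarrow> 'o) \<Rightarrow> ('j \<Rightarrow> 'm) \<Rightarrow>
   'o \<Rightarrow> ('i \<Rightarrow> 'm) \<Rightarrow> bool"
  where
  "is_cocone J C F\<^sub>o F\<^sub>a L l \<longleftrightarrow> L \<in> Ob C \<and> (\<forall>i \<in> Ob J. l i \<in> Hom C (F\<^sub>o i) L) \<and>
     (\<forall>f \<in> Arr J. l (Cod J f) \<bullet>\<^bsub>C\<^esub> F\<^sub>a f = l (Dom J f))"

definition is_colimit ::
  "('i, 'j, 'y) category_scheme \<Rightarrow> ('o, 'm, 'z) category_scheme \<Rightarrow> ('i \<Rightarrow> 'o) \<Rightarrow> ('j \<Rightarrow> 'm) \<Rightarrow>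
   'o \<Rightarrow> ('i \<Rightarrow> 'm) \<Rightarrow> bool"
  where
  "is_colimit J C F\<^sub>o F\<^sub>a L l \<longleftrightarrow> is_cocone J C F\<^sub>o F\<^sub>a L l \<and>
     (\<forall>X x. is_cocone J C F\<^sub>o F\<^sub>a X x \<longrightarrow>
        (\<exists>!h. h \<in> Hom C L X \<and> (\<forall>i \<in> Ob J. h \<bullet>\<^bsub>C\<^esub> l i = x i)))"

text \<open>Every countable category is isomorphic to one whose objects and arrows are natural numbers.\<close>

definition has_countable_colimits :: "('o, 'm, 'z) category_scheme \<Rightarrow> bool" where
  "has_countable_colimits C \<longleftrightarrow>
     (\<forall>(J :: (nat, nat) category) F\<^sub>o F\<^sub>a. is_category J \<longrightarrow> is_functor J C F\<^sub>o F\<^sub>a \<longrightarrow>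
        (\<exists>L l. is_colimit J C F\<^sub>o F\<^sub>a L l))"

section \<open>Cartesian closed categories with chosen finite products and exponentials\<close>

record ('o, 'm) ccc = "('o, 'm) category" +
  Term :: 'o
  Prod :: "'o \<Rightarrow> 'o \<Rightarrow> 'o"
  Pr1 :: "'o \<Rightarrow> 'o \<Rightarrow> 'm"
  Pr2 :: "'o \<Rightarrow> 'o \<Rightarrow> 'm"
  Exp :: "'o \<Rightarrow> 'o \<Rightarrow> 'o"   \<comment> \<open>\<open>Exp A B\<close> is the internal hom from \<open>A\<close> to \<open>B\<close>\<close>
  Ev :: "'o \<Rightarrow> 'o \<Rightarrow> 'm"    \<comment> \<open>\<open>Ev A B : Exp A B \<times> A \<rightarrow> B\<close>\<close>

text \<open>A \<open>\<V>\<close>-category: \<open>VComp A b c d : A(c,d) \<times> A(b,c) \<rightarrow> A(b,d)\<close>.\<close>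

record ('x, 'o, 'm) vcat =
  VObj :: "'x set"
  VHom :: "'x \<Rightarrow> 'x \<Rightarrow> 'o"
  VComp :: "'x \<Rightarrow> 'x \<Rightarrow> 'x \<Rightarrow> 'm"
  VId :: "'x \<Rightarrow> 'm"

text \<open>Indices of projections run over \<open>i < n\<close>, i.e. start at \<open>0\<close> rather than \<open>1\<close>.\<close>

record ('o, 'm) theory_data = "(nat, 'o, 'm) vcat" +
  VProj :: "nat \<Rightarrow> nat \<Rightarrow> 'm"

record ('x, 'y, 'm) vfun =
  FObj :: "'x \<Rightarrow> 'y"
  FMap :: "'x \<Rightarrow> 'x \<Rightarrow> 'm"

record ('o, 'm) rig_data =
  Car :: 'o
  Plus :: 'm
  Null :: 'm
  Times :: 'm
  Unit :: 'm

record ('o, 'm) pmod_data =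
  MCar :: 'o
  MPlus :: 'm
  MNull :: 'm
  MAct :: 'm
  MPt :: 'm

context
  fixes \<V> :: "('o, 'm) ccc" (structure)
begin

definition is_terminal_chosen :: bool where
  "is_terminal_chosen \<longleftrightarrow> Term \<V> \<in> Ob \<V> \<and> (\<forall>X \<in> Ob \<V>. \<exists>!f. f \<in> Hom \<V> X (Term \<V>))"

definition is_product_chosen :: bool where
  "is_product_chosen \<longleftrightarrow> (\<forall>A \<in> Ob \<V>. \<forall>B \<in> Ob \<V>.
     Prod \<V> A B \<in> Ob \<V> \<and> Pr1 \<V> A B \<in> Hom \<V> (Prod \<V> A B) A \<and> Pr2 \<V> A B \<in> Hom \<V> (Prod \<V> A B) B \<and>
     (\<forall>X \<in> Ob \<V>. \<forall>f \<in> Hom \<V> X A. \<forall>g \<in> Hom \<V> X B.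
        \<exists>!h. h \<in> Hom \<V> X (Prod \<V> A B) \<and> Pr1 \<V> A B \<bullet> h = f \<and> Pr2 \<V> A B \<bullet> h = g))"

definition bang :: "'o \<Rightarrow> 'm" where
  "bang X = (THE f. f \<in> Hom \<V> X (Term \<V>))"

definition pair :: "'m \<Rightarrow> 'm \<Rightarrow> 'm" where
  "pair f g = (THE h. h \<in> Hom \<V> (Dom \<V> f) (Prod \<V> (Cod \<V> f) (Cod \<V> g)) \<and>
     Pr1 \<V> (Cod \<V> f) (Cod \<V> g) \<bullet> h = f \<and> Pr2 \<V> (Cod \<V> f) (Cod \<V> g) \<bullet> h = g)"

definition parr :: "'m \<Rightarrow> 'm \<Rightarrow> 'm" where
  "parr f g = pair (f \<bullet> Pr1 \<V> (Dom \<V> f) (Dom \<V> g)) (g \<bullet> Pr2 \<V> (Dom \<V> f) (Dom \<V> g))"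

definition is_exponential_chosen :: bool where
  "is_exponential_chosen \<longleftrightarrow> (\<forall>A \<in> Ob \<V>. \<forall>B \<in> Ob \<V>.
     Exp \<V> A B \<in> Ob \<V> \<and> Ev \<V> A B \<in> Hom \<V> (Prod \<V> (Exp \<V> A B) A) B \<and>
     (\<forall>X \<in> Ob \<V>. \<forall>f \<in> Hom \<V> (Prod \<V> X A) B.
        \<exists>!g. g \<in> Hom \<V> X (Exp \<V> A B) \<and> Ev \<V> A B \<bullet> parr g (Ident \<V> A) = f))"

definition is_base_category :: bool where
  "is_base_category \<longleftrightarrow> is_category \<V> \<and> is_terminal_chosen \<and> is_product_chosen \<and>
     is_exponential_chosen \<and> has_equalizers \<V> \<and> has_countable_colimits \<V> \<and>
     has_countable_strong_intersections \<V>"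

text \<open>Transpose of \<open>f : X \<times> A \<rightarrow> B\<close>.\<close>

definition curry' :: "'o \<Rightarrow> 'o \<Rightarrow> 'm \<Rightarrow> 'm" where
  "curry' X A f = (THE g. g \<in> Hom \<V> X (Exp \<V> A (Cod \<V> f)) \<and>
     Ev \<V> A (Cod \<V> f) \<bullet> parr g (Ident \<V> A) = f)"

text \<open>\<open>app A B f x\<close> is the application of \<open>f : X \<rightarrow> Exp A B\<close> to \<open>x : X \<rightarrow> A\<close>.\<close>

definition app :: "'o \<Rightarrow> 'o \<Rightarrow> 'm \<Rightarrow> 'm \<Rightarrow> 'm" where
  "app A B f x = Ev \<V> A B \<bullet> pair f x"

definition name_of :: "'m \<Rightarrow> 'm" where
  "name_of f = curry' (Term \<V>) (Dom \<V> f) (f \<bullet> Pr2 \<V> (Term \<V>) (Dom \<V> f))"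

text \<open>Designated powers, chosen such that the first power of \<open>X\<close> is \<open>X\<close> itself.\<close>

fun pow :: "'o \<Rightarrow> nat \<Rightarrow> 'o" where
  "pow X 0 = Term \<V>"
| "pow X (Suc 0) = X"
| "pow X (Suc (Suc n)) = Prod \<V> (pow X (Suc n)) X"

fun proj :: "'o \<Rightarrow> nat \<Rightarrow> nat \<Rightarrow> 'm" where
  "proj X (Suc 0) i = Ident \<V> X"
| "proj X (Suc (Suc n)) i =
     (if i = Suc n then Pr2 \<V> (pow X (Suc n)) X
      else proj X (Suc n) i \<bullet> Pr1 \<V> (pow X (Suc n)) X)"

definition tuple :: "'o \<Rightarrow> 'o \<Rightarrow> nat \<Rightarrow> (nat \<Rightarrow> 'm) \<Rightarrow> 'm" where
  "tuple Y X n F = (THE h. h \<in> Hom \<V> Y (pow X n) \<and> (\<forall>i<n. proj X n i \<bullet> h = F i))"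

definition is_power_cone :: "'o \<Rightarrow> 'o \<Rightarrow> nat \<Rightarrow> (nat \<Rightarrow> 'm) \<Rightarrow> bool" where
  "is_power_cone Q X n q \<longleftrightarrow> Q \<in> Ob \<V> \<and> X \<in> Ob \<V> \<and> (\<forall>i<n. q i \<in> Hom \<V> Q X) \<and>
     (\<forall>Y \<in> Ob \<V>. \<forall>F. (\<forall>i<n. F i \<in> Hom \<V> Y X) \<longrightarrow>
        (\<exists>!h. h \<in> Hom \<V> Y Q \<and> (\<forall>i<n. q i \<bullet> h = F i)))"

definition generating :: "'o set \<Rightarrow> bool" where
  "generating \<G> \<longleftrightarrow> \<G> \<subseteq> Ob \<V> \<and>
     (\<forall>A \<in> Ob \<V>. \<forall>B \<in> Ob \<V>. \<forall>f \<in> Hom \<V> A B. \<forall>g \<in> Hom \<V> A B.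
        (\<forall>G \<in> \<G>. \<forall>x \<in> Hom \<V> G A. f \<bullet> x = g \<bullet> x) \<longrightarrow> f = g)"

section \<open>Enriched categories, functors and natural transformations\<close>

definition is_vcat :: "('x, 'o, 'm, 'z) vcat_scheme \<Rightarrow> bool" where
  "is_vcat A \<longleftrightarrow>
     (\<forall>a \<in> VObj A. \<forall>b \<in> VObj A. VHom A a b \<in> Ob \<V>) \<and>
     (\<forall>a \<in> VObj A. VId A a \<in> Hom \<V> (Term \<V>) (VHom A a a)) \<and>
     (\<forall>a \<in> VObj A. \<forall>b \<in> VObj A. \<forall>c \<in> VObj A.
        VComp A a b c \<in> Hom \<V> (Prod \<V> (VHom A b c) (VHom A a b)) (VHom A a c)) \<and>
     (\<forall>a \<in> VObj A. \<forall>b \<in> VObj A.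
        VComp A a b b \<bullet> pair (VId A b \<bullet> bang (VHom A a b)) (Ident \<V> (VHom A a b))
          = Ident \<V> (VHom A a b) \<and>
        VComp A a a b \<bullet> pair (Ident \<V> (VHom A a b)) (VId A a \<bullet> bang (VHom A a b))
          = Ident \<V> (VHom A a b)) \<and>
     (\<forall>a \<in> VObj A. \<forall>b \<in> VObj A. \<forall>c \<in> VObj A. \<forall>d \<in> VObj A.
        let H = VHom A c d; K = VHom A b c; L = VHom A a b;
            h = Pr1 \<V> H K \<bullet> Pr1 \<V> (Prod \<V> H K) L;
            k = Pr2 \<V> H K \<bullet> Pr1 \<V> (Prod \<V> H K) L;
            l = Pr2 \<V> (Prod \<V> H K) L
        in VComp A a b d \<bullet> pair (VComp A b c d \<bullet> pair h k) l
             = VComp A a c d \<bullet> pair h (VComp A a b c \<bullet> pair k l))"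

definition self_vcat :: "('o, 'o, 'm) vcat" where
  "self_vcat = \<lparr> VObj = Ob \<V>, VHom = Exp \<V>,
     VComp = (\<lambda>A B C.
       let H = Exp \<V> B C; K = Exp \<V> A B;
           h = Pr1 \<V> H K \<bullet> Pr1 \<V> (Prod \<V> H K) A;
           k = Pr2 \<V> H K \<bullet> Pr1 \<V> (Prod \<V> H K) A;
           x = Pr2 \<V> (Prod \<V> H K) A
       in curry' (Prod \<V> H K) A (app B C h (app A B k x))),
     VId = (\<lambda>A. name_of (Ident \<V> A)) \<rparr>"

definition is_vfunctor ::
  "('x, 'o, 'm, 'z) vcat_scheme \<Rightarrow> ('y, 'o, 'm, 'w) vcat_scheme \<Rightarrow> ('x, 'y, 'm) vfun \<Rightarrow> bool" where
  "is_vfunctor A B F \<longleftrightarrow>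
     (\<forall>a \<in> VObj A. FObj F a \<in> VObj B) \<and>
     (\<forall>a \<in> VObj A. \<forall>b \<in> VObj A. FMap F a b \<in> Hom \<V> (VHom A a b) (VHom B (FObj F a) (FObj F b))) \<and>
     (\<forall>a \<in> VObj A. FMap F a a \<bullet> VId A a = VId B (FObj F a)) \<and>
     (\<forall>a \<in> VObj A. \<forall>b \<in> VObj A. \<forall>c \<in> VObj A.
        FMap F a c \<bullet> VComp A a b c
          = VComp B (FObj F a) (FObj F b) (FObj F c) \<bullet> parr (FMap F b c) (FMap F a b))"

text \<open>
  A family \<open>\<alpha>\<^sub>a : X \<rightarrow> [F a, G a]\<close> that is \<open>\<V>\<close>-natural in \<open>a\<close>; the object of \<open>\<V>\<close>-natural
  transformations is the universal such family (an end). It is determined only up to isomorphism,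
  so an arbitrary one is chosen; for algebras over a theory it exists when \<open>\<V>\<close> has equalizers and
  countable intersections of strong subobjects.
\<close>

definition vnat_wedge ::
  "('x, 'o, 'm, 'z) vcat_scheme \<Rightarrow> ('x, 'o, 'm) vfun \<Rightarrow> ('x, 'o, 'm) vfun \<Rightarrow> 'o \<Rightarrow> ('x \<Rightarrow> 'm) \<Rightarrow> bool"
  where
  "vnat_wedge A F G X \<alpha> \<longleftrightarrow> X \<in> Ob \<V> \<and>
     (\<forall>a \<in> VObj A. \<alpha> a \<in> Hom \<V> X (Exp \<V> (FObj F a) (FObj G a))) \<and>
     (\<forall>a \<in> VObj A. \<forall>b \<in> VObj A.
        let H = VHom A a b; x = Pr1 \<V> X H; h = Pr2 \<V> X H
        in VComp self_vcat (FObj F a) (FObj F b) (FObj G b) \<bullet> pair (\<alpha> b \<bullet> x) (FMap F a b \<bullet> h)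
             = VComp self_vcat (FObj F a) (FObj G a) (FObj G b) \<bullet> pair (FMap G a b \<bullet> h) (\<alpha> a \<bullet> x))"

definition is_vnat_object ::
  "('x, 'o, 'm, 'z) vcat_scheme \<Rightarrow> ('x, 'o, 'm) vfun \<Rightarrow> ('x, 'o, 'm) vfun \<Rightarrow> 'o \<times> ('x \<Rightarrow> 'm) \<Rightarrow> bool"
  where
  "is_vnat_object A F G E \<longleftrightarrow> vnat_wedge A F G (fst E) (snd E) \<and>
     (\<forall>X \<alpha>. vnat_wedge A F G X \<alpha> \<longrightarrow>
        (\<exists>!h. h \<in> Hom \<V> X (fst E) \<and> (\<forall>a \<in> VObj A. snd E a \<bullet> h = \<alpha> a)))"

definition vnat_object ::
  "('x, 'o, 'm, 'z) vcat_scheme \<Rightarrow> ('x, 'o, 'm) vfun \<Rightarrow> ('x, 'o, 'm) vfun \<Rightarrow> 'o \<times> ('x \<Rightarrow> 'm)" where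
  "vnat_object A F G = (SOME E. is_vnat_object A F G E)"

definition is_vnat ::
  "('x, 'o, 'm, 'z) vcat_scheme \<Rightarrow> ('x, 'o, 'm) vfun \<Rightarrow> ('x, 'o, 'm) vfun \<Rightarrow> ('x \<Rightarrow> 'm) \<Rightarrow> bool" where
  "is_vnat A F G \<theta> \<longleftrightarrow>
     (\<forall>a \<in> VObj A. \<theta> a \<in> Hom \<V> (FObj F a) (FObj G a)) \<and>
     (\<forall>a \<in> VObj A. \<forall>b \<in> VObj A.
        let H = VHom A a b
        in VComp self_vcat (FObj F a) (FObj F b) (FObj G b) \<bullet>
             pair (name_of (\<theta> b) \<bullet> bang H) (FMap F a b)
           = VComp self_vcat (FObj F a) (FObj G a) (FObj G b) \<bullet>
             pair (FMap G a b) (name_of (\<theta> a) \<bullet> bang H))"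

section \<open>Theories and their algebras\<close>

text \<open>\<open>p\<^sub>i : 1 \<rightarrow> A(c,x)\<close>, \<open>i < n\<close>, exhibit \<open>c\<close> as a conical \<open>n\<close>-th power of \<open>x\<close>.\<close>

definition is_conical_power ::
  "('x, 'o, 'm, 'z) vcat_scheme \<Rightarrow> 'x \<Rightarrow> 'x \<Rightarrow> nat \<Rightarrow> (nat \<Rightarrow> 'm) \<Rightarrow> bool" where
  "is_conical_power A c x n p \<longleftrightarrow> c \<in> VObj A \<and> x \<in> VObj A \<and>
     (\<forall>i<n. p i \<in> Hom \<V> (Term \<V>) (VHom A c x)) \<and>
     (\<forall>k \<in> VObj A. is_power_cone (VHom A k c) (VHom A k x) n
        (\<lambda>i. VComp A k c x \<bullet> pair (p i \<bullet> bang (VHom A k c)) (Ident \<V> (VHom A k c))))"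

definition is_theory :: "('o, 'm) theory_data \<Rightarrow> bool" where
  "is_theory T \<longleftrightarrow> is_vcat T \<and> VObj T = UNIV \<and>
     (\<forall>n. is_conical_power T n 1 n (VProj T n)) \<and> VProj T 1 0 = VId T 1"

definition is_algebra :: "('o, 'm) theory_data \<Rightarrow> (nat, 'o, 'm) vfun \<Rightarrow> bool" where
  "is_algebra T A \<longleftrightarrow> is_theory T \<and> is_vfunctor T self_vcat A \<and>
     (\<forall>c x n p. is_conical_power T c x n p \<longrightarrow>
        is_conical_power self_vcat (FObj A c) (FObj A x) n (\<lambda>i. FMap A c x \<bullet> p i))"

text \<open>The \<open>\<V>\<close>-category of \<open>T\<close>-algebras, and the homomorphisms (arrows of its underlying category).\<close>

definition Alg :: "('o, 'm) theory_data \<Rightarrow> ((nat, 'o, 'm) vfun, 'o, 'm) vcat" where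
  "Alg T = \<lparr> VObj = {A. is_algebra T A},
     VHom = (\<lambda>A B. fst (vnat_object T A B)),
     VComp = (\<lambda>A B C.
       let H = vnat_object T B C; K = vnat_object T A B; L = vnat_object T A C
       in THE h. h \<in> Hom \<V> (Prod \<V> (fst H) (fst K)) (fst L) \<and>
            (\<forall>n \<in> VObj T. snd L n \<bullet> h =
               VComp self_vcat (FObj A n) (FObj B n) (FObj C n) \<bullet> parr (snd H n) (snd K n))),
     VId = (\<lambda>A.
       let H = vnat_object T A A
       in THE h. h \<in> Hom \<V> (Term \<V>) (fst H) \<and>
            (\<forall>n \<in> VObj T. snd H n \<bullet> h = name_of (Ident \<V> (FObj A n)))) \<rparr>"

definition is_alg_hom ::
  "('o, 'm) theory_data \<Rightarrow> (nat, 'o, 'm) vfun \<Rightarrow> (nat, 'o, 'm) vfun \<Rightarrow> (nat \<Rightarrow> 'm) \<Rightarrow> bool" where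
  "is_alg_hom T A B \<theta> \<longleftrightarrow> A \<in> VObj (Alg T) \<and> B \<in> VObj (Alg T) \<and> is_vnat T A B \<theta>"

definition carrier_of :: "(nat, 'o, 'm) vfun \<Rightarrow> 'o" where
  "carrier_of A = FObj A 1"

text \<open>Component at the carrier, \<open>T-Alg(A,B) \<rightarrow> [|A|,|B|]\<close>.\<close>

definition alg_hom_carrier ::
  "('o, 'm) theory_data \<Rightarrow> (nat, 'o, 'm) vfun \<Rightarrow> (nat, 'o, 'm) vfun \<Rightarrow> 'm" where
  "alg_hom_carrier T A B = snd (vnat_object T A B) 1"

text \<open>Pointwise cotensor \<open>[X, A]\<close> and pointwise conical power \<open>A\<^sup>n\<close> of an algebra.\<close>

definition alg_cotensor :: "('o, 'm) theory_data \<Rightarrow> 'o \<Rightarrow> (nat, 'o, 'm) vfun \<Rightarrow> (nat, 'o, 'm) vfun" where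
  "alg_cotensor T X A = \<lparr> FObj = (\<lambda>k. Exp \<V> X (FObj A k)),
     FMap = (\<lambda>k l.
       let H = VHom T k l; K = Exp \<V> X (FObj A k); Z = Prod \<V> H K;
           t = Pr1 \<V> H K \<bullet> Pr1 \<V> Z X; u = Pr2 \<V> H K \<bullet> Pr1 \<V> Z X; x = Pr2 \<V> Z X
       in curry' H K (curry' Z X
            (app (FObj A k) (FObj A l) (FMap A k l \<bullet> t) (app X (FObj A k) u x)))) \<rparr>"

definition alg_pow :: "('o, 'm) theory_data \<Rightarrow> (nat, 'o, 'm) vfun \<Rightarrow> nat \<Rightarrow> (nat, 'o, 'm) vfun" where
  "alg_pow T A n = \<lparr> FObj = (\<lambda>k. pow (FObj A k) n),
     FMap = (\<lambda>k l.
       let H = VHom T k l; K = pow (FObj A k) n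
       in curry' H K (tuple (Prod \<V> H K) (FObj A l) n
            (\<lambda>i. app (FObj A k) (FObj A l) (FMap A k l \<bullet> Pr1 \<V> H K)
                   (proj (FObj A k) n i \<bullet> Pr2 \<V> H K)))) \<rparr>"

section \<open>Commutants and functional distributions\<close>

definition commutant :: "('o, 'm) theory_data \<Rightarrow> (nat, 'o, 'm) vfun \<Rightarrow> ('o, 'm) theory_data" where
  "commutant T S = \<lparr> VObj = UNIV,
     VHom = (\<lambda>n m. VHom (Alg T) (alg_pow T S n) (alg_pow T S m)),
     VComp = (\<lambda>n m k. VComp (Alg T) (alg_pow T S n) (alg_pow T S m) (alg_pow T S k)),
     VId = (\<lambda>n. VId (Alg T) (alg_pow T S n)),
     VProj = (\<lambda>n i.
       let H = vnat_object T (alg_pow T S n) (alg_pow T S 1)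
       in THE h. h \<in> Hom \<V> (Term \<V>) (fst H) \<and>
            (\<forall>k \<in> VObj T. snd H k \<bullet> h = name_of (proj (FObj S k) n i))) \<rparr>"

text \<open>The algebra of the commutant carried by \<open>|S|\<close>, which sends \<open>n\<close> to \<open>|S|\<^sup>n\<close>.\<close>

definition commutant_alg :: "('o, 'm) theory_data \<Rightarrow> (nat, 'o, 'm) vfun \<Rightarrow> (nat, 'o, 'm) vfun" where
  "commutant_alg T S = \<lparr> FObj = (\<lambda>n. pow (carrier_of S) n),
     FMap = (\<lambda>n m. alg_hom_carrier T (alg_pow T S n) (alg_pow T S m)) \<rparr>"

definition functional_distribution ::
  "('o, 'm) theory_data \<Rightarrow> (nat, 'o, 'm) vfun \<Rightarrow> 'o \<Rightarrow> (nat \<Rightarrow> 'm) \<Rightarrow> bool" where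
  "functional_distribution T S X \<theta> \<longleftrightarrow>
     is_alg_hom (commutant T S) (alg_cotensor (commutant T S) X (commutant_alg T S))
       (commutant_alg T S) \<theta>"

definition functional_distribution_object ::
  "('o, 'm) theory_data \<Rightarrow> (nat, 'o, 'm) vfun \<Rightarrow> 'o \<Rightarrow> 'o" where
  "functional_distribution_object T S X =
     VHom (Alg (commutant T S)) (alg_cotensor (commutant T S) X (commutant_alg T S))
       (commutant_alg T S)"

definition functional_distribution_incl ::
  "('o, 'm) theory_data \<Rightarrow> (nat, 'o, 'm) vfun \<Rightarrow> 'o \<Rightarrow> 'm" where
  "functional_distribution_incl T S X =
     alg_hom_carrier (commutant T S) (alg_cotensor (commutant T S) X (commutant_alg T S))
       (commutant_alg T S)"

section \<open>Internal rigs and preordered rings\<close>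

definition gplus :: "('o, 'm) rig_data \<Rightarrow> 'm \<Rightarrow> 'm \<Rightarrow> 'm" where
  "gplus P f g = Plus P \<bullet> pair f g"

definition gtimes :: "('o, 'm) rig_data \<Rightarrow> 'm \<Rightarrow> 'm \<Rightarrow> 'm" where
  "gtimes P f g = Times P \<bullet> pair f g"

definition gnull :: "('o, 'm) rig_data \<Rightarrow> 'o \<Rightarrow> 'm" where
  "gnull P X = Null P \<bullet> bang X"

definition gunit :: "('o, 'm) rig_data \<Rightarrow> 'o \<Rightarrow> 'm" where
  "gunit P X = Unit P \<bullet> bang X"

primrec gsum :: "('o, 'm) rig_data \<Rightarrow> 'o \<Rightarrow> nat \<Rightarrow> (nat \<Rightarrow> 'm) \<Rightarrow> 'm" where
  "gsum P X 0 F = gnull P X"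
| "gsum P X (Suc n) F = gplus P (gsum P X n F) (F n)"

definition is_comm_monoid :: "'o \<Rightarrow> 'm \<Rightarrow> 'm \<Rightarrow> bool" where
  "is_comm_monoid M a z \<longleftrightarrow> M \<in> Ob \<V> \<and> a \<in> Hom \<V> (Prod \<V> M M) M \<and> z \<in> Hom \<V> (Term \<V>) M \<and>
     (let x = proj M 3 0; y = proj M 3 1; w = proj M 3 2
      in a \<bullet> pair (a \<bullet> pair x y) w = a \<bullet> pair x (a \<bullet> pair y w)) \<and>
     (let x = proj M 2 0; y = proj M 2 1 in a \<bullet> pair x y = a \<bullet> pair y x) \<and>
     a \<bullet> pair (z \<bullet> bang M) (Ident \<V> M) = Ident \<V> M"

definition is_rig :: "('o, 'm) rig_data \<Rightarrow> bool" where
  "is_rig P \<longleftrightarrow> is_comm_monoid (Car P) (Plus P) (Null P) \<and>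
     Times P \<in> Hom \<V> (Prod \<V> (Car P) (Car P)) (Car P) \<and> Unit P \<in> Hom \<V> (Term \<V>) (Car P) \<and>
     (let x = proj (Car P) 3 0; y = proj (Car P) 3 1; w = proj (Car P) 3 2
      in gtimes P (gtimes P x y) w = gtimes P x (gtimes P y w) \<and>
         gtimes P x (gplus P y w) = gplus P (gtimes P x y) (gtimes P x w) \<and>
         gtimes P (gplus P x y) w = gplus P (gtimes P x w) (gtimes P y w)) \<and>
     (let x = Ident \<V> (Car P); o1 = gunit P (Car P); o0 = gnull P (Car P)
      in gtimes P o1 x = x \<and> gtimes P x o1 = x \<and> gtimes P o0 x = o0 \<and> gtimes P x o0 = o0)"

definition is_ring :: "('o, 'm) rig_data \<Rightarrow> bool" where
  "is_ring R \<longleftrightarrow> is_rig R \<and>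
     (\<exists>\<nu> \<in> Hom \<V> (Car R) (Car R). gplus R \<nu> (Ident \<V> (Car R)) = gnull R (Car R))"

definition is_rig_hom :: "('o, 'm) rig_data \<Rightarrow> ('o, 'm) rig_data \<Rightarrow> 'm \<Rightarrow> bool" where
  "is_rig_hom P Q f \<longleftrightarrow> f \<in> Hom \<V> (Car P) (Car Q) \<and>
     f \<bullet> Plus P = Plus Q \<bullet> parr f f \<and> f \<bullet> Null P = Null Q \<and>
     f \<bullet> Times P = Times Q \<bullet> parr f f \<and> f \<bullet> Unit P = Unit Q"

text \<open>\<open>\<iota>\<close> is the inclusion of the positive part \<open>P\<close> of \<open>R\<close>.\<close>

definition is_preordered_ring :: "('o, 'm) rig_data \<Rightarrow> ('o, 'm) rig_data \<Rightarrow> 'm \<Rightarrow> bool" where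
  "is_preordered_ring R P \<iota> \<longleftrightarrow> is_ring R \<and> is_rig P \<and> is_rig_hom P R \<iota> \<and> monic \<V> \<iota>"

definition is_comm_preordered_ring :: "('o, 'm) rig_data \<Rightarrow> ('o, 'm) rig_data \<Rightarrow> 'm \<Rightarrow> bool" where
  "is_comm_preordered_ring R P \<iota> \<longleftrightarrow> is_preordered_ring R P \<iota> \<and>
     (let x = proj (Car R) 2 0; y = proj (Car R) 2 1 in gtimes R x y = gtimes R y x)"

definition hom_ring :: "'o \<Rightarrow> ('o, 'm) rig_data \<Rightarrow> 'm ring" where
  "hom_ring G R = \<lparr> carrier = Hom \<V> G (Car R), monoid.mult = gtimes R, one = gunit R G,
     zero = gnull R G, add = gplus R \<rparr>"

definition hom_pos :: "'o \<Rightarrow> 'm \<Rightarrow> 'm set" where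
  "hom_pos G \<iota> = (\<lambda>k. \<iota> \<bullet> k) ` Hom \<V> G (Dom \<V> \<iota>)"

section \<open>Matrices and affine matrices\<close>

text \<open>\<open>P\<^bsup>m\<times>n\<^esup>\<close> is the \<open>m\<close>-th power of the object \<open>P\<^sup>n\<close> of rows; entries are \<open>(row, column)\<close>.\<close>

definition mat :: "('o, 'm) rig_data \<Rightarrow> nat \<Rightarrow> nat \<Rightarrow> 'o" where
  "mat P n m = pow (pow (Car P) n) m"

definition entry :: "('o, 'm) rig_data \<Rightarrow> nat \<Rightarrow> nat \<Rightarrow> nat \<Rightarrow> nat \<Rightarrow> 'm" where
  "entry P n m j i = proj (Car P) n i \<bullet> proj (pow (Car P) n) m j"

definition mk_mat :: "('o, 'm) rig_data \<Rightarrow> 'o \<Rightarrow> nat \<Rightarrow> nat \<Rightarrow> (nat \<Rightarrow> nat \<Rightarrow> 'm) \<Rightarrow> 'm" where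
  "mk_mat P X n m F = tuple X (pow (Car P) n) m (\<lambda>j. tuple X (Car P) n (F j))"

definition Mat :: "('o, 'm) rig_data \<Rightarrow> ('o, 'm) theory_data" where
  "Mat P = \<lparr> VObj = UNIV,
     VHom = mat P,
     VComp = (\<lambda>n m l.
       let Z = Prod \<V> (mat P m l) (mat P n m);
           b = Pr1 \<V> (mat P m l) (mat P n m); a = Pr2 \<V> (mat P m l) (mat P n m)
       in mk_mat P Z n l (\<lambda>k i.
            gsum P Z m (\<lambda>j. gtimes P (entry P m l k j \<bullet> b) (entry P n m j i \<bullet> a)))),
     VId = (\<lambda>n. mk_mat P (Term \<V>) n n (\<lambda>j i. if i = j then Unit P else Null P)),
     VProj = (\<lambda>n i. mk_mat P (Term \<V>) n 1 (\<lambda>_ i'. if i' = i then Unit P else Null P)) \<rparr>"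

definition aff_incl :: "('o, 'm) rig_data \<Rightarrow> nat \<Rightarrow> nat \<Rightarrow> 'm" where
  "aff_incl P n m = equalizer \<V>
     (tuple (mat P n m) (Car P) m (\<lambda>j. gsum P (mat P n m) n (entry P n m j)))
     (tuple (mat P n m) (Car P) m (\<lambda>j. gunit P (mat P n m)))"

definition Mat_aff :: "('o, 'm) rig_data \<Rightarrow> ('o, 'm) theory_data" where
  "Mat_aff P = \<lparr> VObj = UNIV,
     VHom = (\<lambda>n m. Dom \<V> (aff_incl P n m)),
     VComp = (\<lambda>n m l. THE h.
       h \<in> Hom \<V> (Prod \<V> (Dom \<V> (aff_incl P m l)) (Dom \<V> (aff_incl P n m))) (Dom \<V> (aff_incl P n l)) \<and>
       aff_incl P n l \<bullet> h = VComp (Mat P) n m l \<bullet> parr (aff_incl P m l) (aff_incl P n m)),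
     VId = (\<lambda>n. THE h.
       h \<in> Hom \<V> (Term \<V>) (Dom \<V> (aff_incl P n n)) \<and> aff_incl P n n \<bullet> h = VId (Mat P) n),
     VProj = (\<lambda>n i. THE h.
       h \<in> Hom \<V> (Term \<V>) (Dom \<V> (aff_incl P n 1)) \<and> aff_incl P n 1 \<bullet> h = VProj (Mat P) n i) \<rparr>"

text \<open>The normal algebra with carrier \<open>P\<close> in which a matrix \<open>a\<close> acts by
  \<open>x \<mapsto> (\<Sum>\<^sub>i a\<^sub>j\<^sub>i x\<^sub>i)\<^sub>j\<close>.\<close>

definition aff_alg :: "('o, 'm) rig_data \<Rightarrow> (nat, 'o, 'm) vfun" where
  "aff_alg P = \<lparr> FObj = (\<lambda>n. pow (Car P) n),
     FMap = (\<lambda>n m.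
       let H = Dom \<V> (aff_incl P n m); K = pow (Car P) n; Z = Prod \<V> H K
       in curry' H K (tuple Z (Car P) m (\<lambda>j. gsum P Z n (\<lambda>i.
            gtimes P (entry P n m j i \<bullet> aff_incl P n m \<bullet> Pr1 \<V> H K)
              (proj (Car P) n i \<bullet> Pr2 \<V> H K))))) \<rparr>"

section \<open>Pointed modules\<close>

definition is_pmod :: "('o, 'm) rig_data \<Rightarrow> ('o, 'm) pmod_data \<Rightarrow> bool" where
  "is_pmod P M \<longleftrightarrow> is_comm_monoid (MCar M) (MPlus M) (MNull M) \<and>
     MAct M \<in> Hom \<V> (Prod \<V> (Car P) (MCar M)) (MCar M) \<and> MPt M \<in> Hom \<V> (Term \<V>) (MCar M) \<and>
     (let K = Car P; N = MCar M;
          r = Pr1 \<V> K K \<bullet> Pr1 \<V> (Prod \<V> K K) N; s = Pr2 \<V> K K \<bullet> Pr1 \<V> (Prod \<V> K K) N;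
          x = Pr2 \<V> (Prod \<V> K K) N
      in MAct M \<bullet> pair (gtimes P r s) x = MAct M \<bullet> pair r (MAct M \<bullet> pair s x) \<and>
         MAct M \<bullet> pair (gplus P r s) x = MPlus M \<bullet> pair (MAct M \<bullet> pair r x) (MAct M \<bullet> pair s x)) \<and>
     (let K = Car P; N = MCar M;
          r = Pr1 \<V> K (Prod \<V> N N); x = Pr1 \<V> N N \<bullet> Pr2 \<V> K (Prod \<V> N N);
          y = Pr2 \<V> N N \<bullet> Pr2 \<V> K (Prod \<V> N N)
      in MAct M \<bullet> pair r (MPlus M \<bullet> pair x y) = MPlus M \<bullet> pair (MAct M \<bullet> pair r x) (MAct M \<bullet> pair r y)) \<and>
     MAct M \<bullet> pair (gunit P (MCar M)) (Ident \<V> (MCar M)) = Ident \<V> (MCar M) \<and>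
     MAct M \<bullet> pair (gnull P (MCar M)) (Ident \<V> (MCar M)) = MNull M \<bullet> bang (MCar M) \<and>
     MAct M \<bullet> pair (Ident \<V> (Car P)) (MNull M \<bullet> bang (Car P)) = MNull M \<bullet> bang (Car P)"

definition is_pmod_hom ::
  "('o, 'm) rig_data \<Rightarrow> ('o, 'm) pmod_data \<Rightarrow> ('o, 'm) pmod_data \<Rightarrow> 'm \<Rightarrow> bool" where
  "is_pmod_hom P M N \<mu> \<longleftrightarrow> is_pmod P M \<and> is_pmod P N \<and> \<mu> \<in> Hom \<V> (MCar M) (MCar N) \<and>
     \<mu> \<bullet> MPlus M = MPlus N \<bullet> parr \<mu> \<mu> \<and> \<mu> \<bullet> MNull M = MNull N \<and>
     \<mu> \<bullet> MAct M = MAct N \<bullet> parr (Ident \<V> (Car P)) \<mu> \<and> \<mu> \<bullet> MPt M = MPt N"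

text \<open>
  The hom-object of pointed modules as a subobject of the internal hom: the equalizer of two
  arrows whose four components express preservation of addition, zero, scalar action and point.
\<close>

definition pmod_hom_incl ::
  "('o, 'm) rig_data \<Rightarrow> ('o, 'm) pmod_data \<Rightarrow> ('o, 'm) pmod_data \<Rightarrow> 'm" where
  "pmod_hom_incl P M N =
     (let A = MCar M; B = MCar N; K = Car P; H = Exp \<V> A B;
          f2 = Pr1 \<V> H (Prod \<V> A A); x = Pr1 \<V> A A \<bullet> Pr2 \<V> H (Prod \<V> A A);
          y = Pr2 \<V> A A \<bullet> Pr2 \<V> H (Prod \<V> A A);
          f3 = Pr1 \<V> H (Prod \<V> K A); r = Pr1 \<V> K A \<bullet> Pr2 \<V> H (Prod \<V> K A);
          w = Pr2 \<V> K A \<bullet> Pr2 \<V> H (Prod \<V> K A);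
          add1 = curry' H (Prod \<V> A A) (app A B f2 (MPlus M \<bullet> pair x y));
          add2 = curry' H (Prod \<V> A A) (MPlus N \<bullet> pair (app A B f2 x) (app A B f2 y));
          null1 = app A B (Ident \<V> H) (MNull M \<bullet> bang H);
          null2 = MNull N \<bullet> bang H;
          act1 = curry' H (Prod \<V> K A) (app A B f3 (MAct M \<bullet> pair r w));
          act2 = curry' H (Prod \<V> K A) (MAct N \<bullet> pair r (app A B f3 w));
          pt1 = app A B (Ident \<V> H) (MPt M \<bullet> bang H);
          pt2 = MPt N \<bullet> bang H
      in equalizer \<V> (pair (pair add1 null1) (pair act1 pt1))
                     (pair (pair add2 null2) (pair act2 pt2)))"

definition rig_pmod :: "('o, 'm) rig_data \<Rightarrow> ('o, 'm) pmod_data" where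
  "rig_pmod P = \<lparr> MCar = Car P, MPlus = Plus P, MNull = Null P, MAct = Times P, MPt = Unit P \<rparr>"

definition cotensor_pmod :: "('o, 'm) rig_data \<Rightarrow> 'o \<Rightarrow> ('o, 'm) pmod_data" where
  "cotensor_pmod P X =
     (let K = Car P; F = Exp \<V> X K
      in \<lparr> MCar = F,
           MPlus = (let Z = Prod \<V> F F; x = Pr2 \<V> Z X
                    in curry' Z X (gplus P (app X K (Pr1 \<V> F F \<bullet> Pr1 \<V> Z X) x)
                                           (app X K (Pr2 \<V> F F \<bullet> Pr1 \<V> Z X) x))),
           MNull = curry' (Term \<V>) X (gnull P (Prod \<V> (Term \<V>) X)),
           MAct = (let Z = Prod \<V> K F
                   in curry' Z X (gtimes P (Pr1 \<V> K F \<bullet> Pr1 \<V> Z X)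
                                           (app X K (Pr2 \<V> K F \<bullet> Pr1 \<V> Z X) (Pr2 \<V> Z X)))),
           MPt = curry' (Term \<V>) X (gunit P (Prod \<V> (Term \<V>) X)) \<rparr>)"

end

section \<open>Preordered rings in Set\<close>

definition pre_le :: "('a, 'z) ring_scheme \<Rightarrow> 'a set \<Rightarrow> 'a \<Rightarrow> 'a \<Rightarrow> bool" where
  "pre_le Q Qp r s \<longleftrightarrow> s \<ominus>\<^bsub>Q\<^esub> r \<in> Qp"

definition archimedean_preordered_ring :: "('a, 'z) ring_scheme \<Rightarrow> 'a set \<Rightarrow> bool" where
  "archimedean_preordered_ring Q Qp \<longleftrightarrow>
     (\<forall>r \<in> carrier Q.
        (\<exists>b \<in> carrier Q. \<forall>n::nat. pre_le Q Qp ([n] \<cdot>\<^bsub>Q\<^esub> r) b) \<longrightarrow> pre_le Q Qp r \<zero>\<^bsub>Q\<^esub>)"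

definition firmly_archimedean :: "('a, 'z) ring_scheme \<Rightarrow> 'a set \<Rightarrow> bool" where
  "firmly_archimedean Q Qp \<longleftrightarrow> archimedean_preordered_ring Q Qp \<and>
     (\<forall>s \<in> Qp. \<exists>n::nat. pre_le Q Qp s ([n] \<cdot>\<^bsub>Q\<^esub> \<one>\<^bsub>Q\<^esub>))"

definition dyadic_ring :: "rat ring" where
  "dyadic_ring = \<lparr> carrier = {of_int a / 2 ^ k | (a :: int) (k :: nat). True},
     monoid.mult = (*), one = 1, zero = 0, add = (+) \<rparr>"

definition preordered_dyadic_algebra :: "('a, 'z) ring_scheme \<Rightarrow> 'a set \<Rightarrow> bool" where
  "preordered_dyadic_algebra Q Qp \<longleftrightarrow>
     (\<exists>h \<in> ring_hom dyadic_ring Q. \<forall>x \<in> carrier dyadic_ring. \<forall>y \<in> carrier dyadic_ring.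
        x \<le> y \<longrightarrow> pre_le Q Qp (h x) (h y))"

end

theory Submission
  imports Defs
begin

text \<open>
  Both sides of the correspondence are described by affine forms. Write \<open>P\<close> for the positive part of
  \<open>R\<close>. An algebra homomorphism \<open>P\<^sup>n \<rightarrow> P\<close> over affine matrices is a map that commutes with mixtures,
  that is, with linear combinations whose weights lie in \<open>P\<close> and sum to \<open>1\<close>. Under the archimedean
  hypotheses every such map \<open>g\<close> has the form \<open>g(v) = \<Sum>\<^sub>i a\<^sub>i v\<^sub>i + c\<close> with \<open>a\<^sub>i\<close> and \<open>c\<close> in \<open>P\<close>
  (\<open>wedge_component_form\<close>). Hence the arrows \<open>n \<rightarrow> m\<close> of the commutant are the \<open>m\<close>-tuples of affine
  forms in \<open>n\<close> variables, and an operation of the commutant is composed of addition, zero, scalar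
  multiplication and the constant \<open>1\<close>: exactly the structure of a pointed module.

  The affine form is found one generating object \<open>G\<close> at a time, by an argument about the ordinary
  ring \<open>\<V>(G, R)\<close>. Put \<open>c = g(0)\<close> and \<open>f = g - c\<close>. Since \<open>R\<close> is firmly archimedean and contains \<open>1/2\<close>,
  every scalar in \<open>P\<close> lies below an invertible one, namely a power of \<open>2\<close>, whose inverse is a legitimate
  weight; mixing with the origin therefore makes \<open>f\<close> homogeneous (\<open>f_scale\<close>), and mixing two vectors
  equally makes it additive (\<open>f_add\<close>). Positivity of \<open>f\<close> is the archimedean property applied to
  \<open>k f(v) + c = g(k v) \<ge> 0\<close> (\<open>f_cone\<close>). The coefficient \<open>g(e\<^sub>i) - g(0)\<close> is an arrow into \<open>R\<close> that is
  positive on all generating objects; because the inclusion of \<open>P\<close> is a strong monomorphism, it factors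
  through \<open>P\<close> (\<open>factor_through_positive\<close>). The equation \<open>g(v) = \<Sum>\<^sub>i a\<^sub>i v\<^sub>i + c\<close> can likewise be tested on
  generating objects.

  It follows that the object of \<open>n \<rightarrow> m\<close> arrows of the commutant exists and is isomorphic to
  \<open>P\<^bsup>m\<times>(n+1)\<^esup>\<close> (\<open>vnat_object_ex\<close>), so that the commutant is a theory with algebras \<open>P\<close> and \<open>[X, P]\<close>
  (\<open>CA_algebra\<close>, \<open>CT_algebra\<close>); preservation of arbitrary conical powers reduces to the designated ones
  (\<open>power_preserved\<close>). A family natural over the commutant commutes with all affine forms, so its
  carrier component is linear and preserves the point (\<open>wedge_linear\<close>); conversely a pointed linear
  map extends coordinatewise to a unique natural family (\<open>linear_extends\<close>, \<open>wedge_determined\<close>). With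
  parameters this says that the equalizer defining the object of pointed module homomorphisms is an
  object of natural transformations (\<open>distribution_object_ex\<close>); over the terminal object it gives the
  bijection of homomorphisms (\<open>distributions_bij\<close>).

  All internal equations are verified on generalized elements. An element at stage \<open>Y\<close> of an object
  is an arrow from \<open>Y\<close>; by the Yoneda lemma, arrows into exponentials agree if they agree when applied
  to all elements at all stages.
\<close>


section \<open>Generalized elements in a cartesian closed category\<close>

locale base =
  fixes \<V> :: "('o, 'm) ccc" (structure)
  assumes base: "is_base_category \<V>"
begin

abbreviation arr where "arr f \<equiv> f \<in> Arr \<V>"
abbreviation obj where "obj A \<equiv> A \<in> Ob \<V>"
abbreviation src where "src \<equiv> Dom \<V>"
abbreviation tgt where "tgt \<equiv> Cod \<V>"
abbreviation ide where "ide \<equiv> Ident \<V>"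
abbreviation hm (\<open>\<H>\<close>) where "\<H> \<equiv> Hom \<V>"
abbreviation pr (\<open>\<langle>_,/ _\<rangle>\<close>) where "\<langle>f, g\<rangle> \<equiv> pair \<V> f g"
abbreviation ap where "ap \<equiv> app \<V>"
abbreviation one_obj (\<open>\<I>\<close>) where "\<I> \<equiv> Term \<V>"
abbreviation bng where "bng \<equiv> bang \<V>"
abbreviation prodo (infixr \<open>\<star>\<close> 75) where "A \<star> B \<equiv> Prod \<V> A B"

lemma cat: "is_category \<V>" and terml: "is_terminal_chosen \<V>" and prod: "is_product_chosen \<V>"
  and exp: "is_exponential_chosen \<V>" and eqs: "has_equalizers \<V>"
  using base unfolding is_base_category_def by auto

lemma hom_iff [simp]: "f \<in> \<H> A B \<longleftrightarrow> arr f \<and> src f = A \<and> tgt f = B"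
  by (auto simp: Hom_def)

lemma src_obj [simp]: "arr f \<Longrightarrow> obj (src f)" and tgt_obj [simp]: "arr f \<Longrightarrow> obj (tgt f)"
  using cat unfolding is_category_def by auto

lemma ide_arr [simp]: "obj A \<Longrightarrow> arr (ide A)" "obj A \<Longrightarrow> src (ide A) = A" "obj A \<Longrightarrow> tgt (ide A) = A"
  using cat unfolding is_category_def by auto

lemma comp_arr [simp]:
  assumes "arr f" "arr g" "tgt f = src g"
  shows "arr (g \<bullet> f)" "src (g \<bullet> f) = src f" "tgt (g \<bullet> f) = tgt g"
  using cat assms unfolding is_category_def by auto

lemma comp_ide [simp]: "arr f \<Longrightarrow> src f = A \<Longrightarrow> f \<bullet> ide A = f" "arr f \<Longrightarrow> tgt f = A \<Longrightarrow> ide A \<bullet> f = f"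
  using cat unfolding is_category_def by auto

lemma comp_assoc [simp]:
  assumes "arr f" "arr g" "arr h" "tgt f = src g" "tgt g = src h"
  shows "(h \<bullet> g) \<bullet> f = h \<bullet> g \<bullet> f"
  using cat assms unfolding is_category_def by auto

lemma term_obj [simp]: "obj \<I>"
  using terml unfolding is_terminal_chosen_def by auto

lemma bang_ex1: "obj X \<Longrightarrow> \<exists>!f. f \<in> \<H> X \<I>"
  using terml unfolding is_terminal_chosen_def by auto

lemma bang_arr [simp]: "obj X \<Longrightarrow> arr (bng X)" "obj X \<Longrightarrow> src (bng X) = X" "obj X \<Longrightarrow> tgt (bng X) = \<I>"
  using theI'[OF bang_ex1, of X] unfolding bang_def by auto

lemma to_term: "f \<in> \<H> X \<I> \<Longrightarrow> f = bng X"
  using bang_ex1[of X] bang_arr[of X] src_obj[of f] by (metis hom_iff)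

lemma bang_comp [simp]: "arr f \<Longrightarrow> tgt f = X \<Longrightarrow> bng X \<bullet> f = bng (src f)"
  by (rule to_term) auto

lemma bang_term [simp]: "bng \<I> = ide \<I>"
  by (rule to_term[symmetric]) auto

lemma prod_obj [simp]: "obj A \<Longrightarrow> obj B \<Longrightarrow> obj (A \<star> B)"
  using prod unfolding is_product_chosen_def by auto

lemma pr_arr [simp]:
  assumes "obj A" "obj B"
  shows "arr (Pr1 \<V> A B)" "src (Pr1 \<V> A B) = A \<star> B" "tgt (Pr1 \<V> A B) = A"
    "arr (Pr2 \<V> A B)" "src (Pr2 \<V> A B) = A \<star> B" "tgt (Pr2 \<V> A B) = B"
  using prod assms unfolding is_product_chosen_def by auto

lemma pair_ex1:
  assumes "arr f" "arr g" "src f = src g"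
  shows "\<exists>!h. h \<in> \<H> (src f) (tgt f \<star> tgt g) \<and> Pr1 \<V> (tgt f) (tgt g) \<bullet> h = f \<and> Pr2 \<V> (tgt f) (tgt g) \<bullet> h = g"
  using prod assms unfolding is_product_chosen_def by auto

lemma pair_arr [simp]:
  assumes "arr f" "arr g" "src f = src g"
  shows "arr \<langle>f, g\<rangle>" "src \<langle>f, g\<rangle> = src f" "tgt \<langle>f, g\<rangle> = tgt f \<star> tgt g"
  using theI'[OF pair_ex1[OF assms]] unfolding pair_def by auto

lemma pr_pair [simp]:
  assumes "arr f" "arr g" "src f = src g" "tgt f = A" "tgt g = B"
  shows "Pr1 \<V> A B \<bullet> \<langle>f, g\<rangle> = f" "Pr2 \<V> A B \<bullet> \<langle>f, g\<rangle> = g"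
  using theI'[OF pair_ex1[OF assms(1-3)]] assms(4,5) unfolding pair_def by auto

lemma prod_eqI:
  assumes "h \<in> \<H> X (A \<star> B)" "k \<in> \<H> X (A \<star> B)" "obj A" "obj B"
    "Pr1 \<V> A B \<bullet> h = Pr1 \<V> A B \<bullet> k" "Pr2 \<V> A B \<bullet> h = Pr2 \<V> A B \<bullet> k"
  shows "h = k"
proof -
  have "\<exists>!l. l \<in> \<H> X (A \<star> B) \<and> Pr1 \<V> A B \<bullet> l = Pr1 \<V> A B \<bullet> k \<and> Pr2 \<V> A B \<bullet> l = Pr2 \<V> A B \<bullet> k"
    using pair_ex1[of "Pr1 \<V> A B \<bullet> k" "Pr2 \<V> A B \<bullet> k"] assms by simp
  then show ?thesis using assms by blast
qed

lemma pair_comp [simp]: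
  assumes "arr f" "arr g" "src f = src g" "arr h" "tgt h = src f"
  shows "\<langle>f, g\<rangle> \<bullet> h = \<langle>f \<bullet> h, g \<bullet> h\<rangle>"
  by (rule prod_eqI[of _ "src h" "tgt f" "tgt g"])
     (use assms in \<open>simp_all flip: comp_assoc\<close>)

lemma pair_eta:
  assumes "h \<in> \<H> X (A \<star> B)" "obj A" "obj B"
  shows "\<langle>Pr1 \<V> A B \<bullet> h, Pr2 \<V> A B \<bullet> h\<rangle> = h"
  by (rule prod_eqI[of _ X A B]) (use assms in simp_all)

lemma pair_pr [simp]: "obj A \<Longrightarrow> obj B \<Longrightarrow> \<langle>Pr1 \<V> A B, Pr2 \<V> A B\<rangle> = ide (A \<star> B)"
  by (rule prod_eqI[of _ "A \<star> B" A B]) simp_all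

lemma pair_inj:
  assumes "arr f" "arr g" "src f = src g" "arr f'" "arr g'" "src f' = src g'"
    "tgt f = tgt f'" "tgt g = tgt g'"
  shows "\<langle>f, g\<rangle> = \<langle>f', g'\<rangle> \<longleftrightarrow> f = f' \<and> g = g'"
  using assms by (metis pr_pair)

lemma parr_arr [simp]:
  assumes "arr f" "arr g"
  shows "arr (parr \<V> f g)" "src (parr \<V> f g) = src f \<star> src g" "tgt (parr \<V> f g) = tgt f \<star> tgt g"
  using assms by (simp_all add: parr_def)

lemma parr_pair [simp]:
  assumes "arr f" "arr g" "arr h" "arr k" "tgt h = src f" "tgt k = src g" "src h = src k"
  shows "parr \<V> f g \<bullet> \<langle>h, k\<rangle> = \<langle>f \<bullet> h, g \<bullet> k\<rangle>"
  using assms by (simp add: parr_def)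

lemma exp_obj [simp]: "obj A \<Longrightarrow> obj B \<Longrightarrow> obj (Exp \<V> A B)"
  using exp unfolding is_exponential_chosen_def by auto

lemma ev_arr [simp]:
  assumes "obj A" "obj B"
  shows "arr (Ev \<V> A B)" "src (Ev \<V> A B) = Exp \<V> A B \<star> A" "tgt (Ev \<V> A B) = B"
  using exp assms unfolding is_exponential_chosen_def by auto

lemma curry_ex1:
  assumes "obj X" "obj A" "arr f" "src f = X \<star> A"
  shows "\<exists>!g. g \<in> \<H> X (Exp \<V> A (tgt f)) \<and> Ev \<V> A (tgt f) \<bullet> parr \<V> g (ide A) = f"
  using exp assms unfolding is_exponential_chosen_def by simp

lemma curry_arr [simp]:
  assumes "obj X" "obj A" "arr f" "src f = X \<star> A"
  shows "arr (curry' \<V> X A f)" "src (curry' \<V> X A f) = X" "tgt (curry' \<V> X A f) = Exp \<V> A (tgt f)"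
  using theI'[OF curry_ex1[OF assms]] unfolding curry'_def by auto

lemma ev_curry:
  assumes "obj X" "obj A" "arr f" "src f = X \<star> A"
  shows "Ev \<V> A (tgt f) \<bullet> parr \<V> (curry' \<V> X A f) (ide A) = f"
  using theI'[OF curry_ex1[OF assms]] unfolding curry'_def by auto

lemma app_arr [simp]:
  assumes "arr f" "arr x" "src f = src x" "tgt f = Exp \<V> A B" "tgt x = A" "obj B"
  shows "arr (ap A B f x)" "src (ap A B f x) = src x" "tgt (ap A B f x) = B"
  using assms tgt_obj[of x] by (simp_all add: app_def)

lemma app_comp [simp]:
  assumes "arr f" "arr x" "src f = src x" "tgt f = Exp \<V> A B" "tgt x = A" "obj B" "arr h" "tgt h = src x"
  shows "ap A B f x \<bullet> h = ap A B (f \<bullet> h) (x \<bullet> h)"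
  using assms tgt_obj[of x] by (simp add: app_def)

lemma app_curry_comp [simp]:
  assumes "obj X" "obj A" "arr f" "src f = X \<star> A" "tgt f = B"
    "arr h" "tgt h = X" "arr x" "tgt x = A" "src x = src h"
  shows "ap A B (curry' \<V> X A f \<bullet> h) x = f \<bullet> \<langle>h, x\<rangle>"
proof -
  have B: "obj B" using assms by auto
  have "f \<bullet> \<langle>h, x\<rangle> = (Ev \<V> A B \<bullet> parr \<V> (curry' \<V> X A f) (ide A)) \<bullet> \<langle>h, x\<rangle>"
    using ev_curry[OF assms(1-4)] assms(5) by simp
  also have "\<dots> = ap A B (curry' \<V> X A f \<bullet> h) x"
    using assms B by (simp add: app_def)
  finally show ?thesis by simp
qed

lemma app_curry [simp]:
  assumes "obj A" "arr f" "src f = X \<star> A" "tgt f = B" "arr x" "tgt x = A" "src x = X"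
  shows "ap A B (curry' \<V> X A f) x = f \<bullet> \<langle>ide X, x\<rangle>"
  using app_curry_comp[of X A f B "ide X" x] src_obj[of x] assms by simp

text \<open>Arrows into an exponential are compared by applying them to all generalized elements;
  this is the Yoneda lemma, and most equations below are verified through it.\<close>

lemma exp_eqI:
  assumes f: "f \<in> \<H> X (Exp \<V> A B)" and g: "g \<in> \<H> X (Exp \<V> A B)" and AB: "obj A" "obj B"
    and eq: "\<And>Y x a. obj Y \<Longrightarrow> x \<in> \<H> Y X \<Longrightarrow> a \<in> \<H> Y A \<Longrightarrow> ap A B (f \<bullet> x) a = ap A B (g \<bullet> x) a"
  shows "f = g"
proof -
  have X: "obj X" using f by auto
  let ?Y = "X \<star> A"
  have e: "ap A B (k \<bullet> Pr1 \<V> X A) (Pr2 \<V> X A) = Ev \<V> A B \<bullet> parr \<V> k (ide A)"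
    if "k \<in> \<H> X (Exp \<V> A B)" for k
    using that X AB by (auto simp: app_def parr_def)
  let ?h = "Ev \<V> A B \<bullet> parr \<V> g (ide A)"
  have "?h \<in> \<H> (X \<star> A) B" using g AB by simp
  then have "\<exists>!k. k \<in> \<H> X (Exp \<V> A B) \<and> Ev \<V> A B \<bullet> parr \<V> k (ide A) = ?h"
    using curry_ex1[of X A ?h] X AB by simp
  moreover have "Ev \<V> A B \<bullet> parr \<V> f (ide A) = ?h"
    using eq[of ?Y "Pr1 \<V> X A" "Pr2 \<V> X A"] X AB e[OF f] e[OF g] by simp
  ultimately show ?thesis using f g by blast
qed

lemma name_arr [simp]:
  assumes "arr f"
  shows "arr (name_of \<V> f)" "src (name_of \<V> f) = \<I>" "tgt (name_of \<V> f) = Exp \<V> (src f) (tgt f)"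
  using assms by (simp_all add: name_of_def)

lemma app_name [simp]:
  assumes "arr f" "src f = A" "tgt f = B" "arr x" "tgt x = A" "arr t" "tgt t = \<I>" "src t = src x"
  shows "ap A B (name_of \<V> f \<bullet> t) x = f \<bullet> x"
  using assms src_obj[of f] by (auto simp: name_of_def)

lemma name_inj:
  assumes f: "f \<in> \<H> A B" and g: "g \<in> \<H> A B" and eq: "name_of \<V> f = name_of \<V> g"
  shows "f = g"
proof -
  have A: "obj A" using f by auto
  have "f \<bullet> ide A = ap A B (name_of \<V> g \<bullet> bng A) (ide A)"
    using f A eq by (subst app_name[symmetric, of f A B _ "bng A"]) auto
  also have "\<dots> = g \<bullet> ide A" using g A by simp
  finally show ?thesis using f g by simp
qed

text \<open>A global element of an exponential is the name of an arrow, recovered by applying it to the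
  identity.\<close>

lemma name_surj:
  assumes "g \<in> \<H> \<I> (Exp \<V> A B)" "obj A" "obj B"
  shows "\<exists>f \<in> \<H> A B. name_of \<V> f = g"
proof
  let ?f = "ap A B (g \<bullet> bng A) (ide A)"
  show f: "?f \<in> \<H> A B" using assms by auto
  show "name_of \<V> ?f = g"
  proof (rule exp_eqI[of _ \<I> A B])
    fix Y x a assume Y: "obj Y" "x \<in> \<H> Y \<I>" "a \<in> \<H> Y A"
    then show "ap A B (name_of \<V> ?f \<bullet> x) a = ap A B (g \<bullet> x) a"
      using f assms to_term[of x Y] by simp
  qed (use assms f in auto)
qed

section \<open>Designated powers\<close>

lemma pow_obj [simp]: "obj X \<Longrightarrow> obj (pow \<V> X n)"
  by (induction X n rule: pow.induct) auto

lemma proj_arr [simp]: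
  assumes "obj X" "i < n"
  shows "arr (proj \<V> X n i)" "src (proj \<V> X n i) = pow \<V> X n" "tgt (proj \<V> X n i) = X"
proof -
  have "i < n \<longrightarrow> arr (proj \<V> X n i) \<and> src (proj \<V> X n i) = pow \<V> X n \<and> tgt (proj \<V> X n i) = X"
    using assms(1) by (induction X n i rule: proj.induct) (auto simp: less_Suc_eq)
  then show "arr (proj \<V> X n i)" "src (proj \<V> X n i) = pow \<V> X n" "tgt (proj \<V> X n i) = X"
    using assms(2) by auto
qed

lemma pow_eqI:
  assumes "h \<in> \<H> Y (pow \<V> X n)" "k \<in> \<H> Y (pow \<V> X n)" "obj X"
    "\<And>i. i < n \<Longrightarrow> proj \<V> X n i \<bullet> h = proj \<V> X n i \<bullet> k"
  shows "h = k"
  using assms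
proof (induction X n arbitrary: h k rule: pow.induct)
  case (1 X)
  then show ?case using to_term[of h Y] to_term[of k Y] by simp
next
  case (2 X)
  then show ?case by (metis One_nat_def comp_ide(2) hom_iff lessI pow.simps(2) proj.simps(1))
next
  case (3 X n)
  let ?Z = "pow \<V> X (Suc n)"
  have Y: "arr h" "arr k" "src h = Y" "src k = Y" "tgt h = ?Z \<star> X" "tgt k = ?Z \<star> X"
    using "3.prems" by auto
  show ?case
  proof (rule prod_eqI[of _ Y ?Z X])
    show "Pr2 \<V> ?Z X \<bullet> h = Pr2 \<V> ?Z X \<bullet> k"
      using "3.prems"(4)[of "Suc n"] by simp
    show "Pr1 \<V> ?Z X \<bullet> h = Pr1 \<V> ?Z X \<bullet> k"
    proof (rule "3.IH")
      fix i assume i: "i < Suc n"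
      have "(proj \<V> X (Suc n) i \<bullet> Pr1 \<V> ?Z X) \<bullet> h = (proj \<V> X (Suc n) i \<bullet> Pr1 \<V> ?Z X) \<bullet> k"
        using "3.prems"(4)[of i] i by simp
      then show "proj \<V> X (Suc n) i \<bullet> Pr1 \<V> ?Z X \<bullet> h = proj \<V> X (Suc n) i \<bullet> Pr1 \<V> ?Z X \<bullet> k"
        using Y i "3.prems"(3) by simp
    qed (use Y "3.prems"(3) in simp_all)
  qed (use Y "3.prems"(3) in simp_all)
qed

lemma tuple_ex:
  assumes "obj X" "obj Y" "\<And>i. i < n \<Longrightarrow> F i \<in> \<H> Y X"
  shows "\<exists>h. h \<in> \<H> Y (pow \<V> X n) \<and> (\<forall>i<n. proj \<V> X n i \<bullet> h = F i)"
  using assms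
proof (induction X n rule: pow.induct)
  case (1 X)
  then show ?case by (intro exI[of _ "bng Y"]) auto
next
  case (2 X)
  then show ?case by (intro exI[of _ "F 0"]) auto
next
  case (3 X n)
  then obtain h where h: "h \<in> \<H> Y (pow \<V> X (Suc n))" "\<forall>i<Suc n. proj \<V> X (Suc n) i \<bullet> h = F i"
    by auto
  have F: "arr (F (Suc n))" "src (F (Suc n)) = Y" "tgt (F (Suc n)) = X" using "3.prems"(3)[of "Suc n"] by auto
  have "proj \<V> X (Suc (Suc n)) i \<bullet> \<langle>h, F (Suc n)\<rangle> = F i" if "i < Suc (Suc n)" for i
    using that h F "3.prems" by (cases "i = Suc n") auto
  then show ?case using h F by (intro exI[of _ "\<langle>h, F (Suc n)\<rangle>"]) auto
qed

lemma tuple_prop: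
  assumes "obj X" "obj Y" "\<And>i. i < n \<Longrightarrow> F i \<in> \<H> Y X"
  shows "tuple \<V> Y X n F \<in> \<H> Y (pow \<V> X n) \<and> (\<forall>i<n. proj \<V> X n i \<bullet> tuple \<V> Y X n F = F i)"
  unfolding tuple_def
proof (rule theI')
  show "\<exists>!h. h \<in> \<H> Y (pow \<V> X n) \<and> (\<forall>i<n. proj \<V> X n i \<bullet> h = F i)"
    using tuple_ex[of X Y n F] pow_eqI[of _ Y X n] assms by (smt (verit))
qed

lemma tuple_arr [simp]:
  assumes "obj X" "obj Y" "\<And>i. i < n \<Longrightarrow> F i \<in> \<H> Y X"
  shows "arr (tuple \<V> Y X n F)" "src (tuple \<V> Y X n F) = Y" "tgt (tuple \<V> Y X n F) = pow \<V> X n"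
  using tuple_prop[of X Y n F] assms by auto

lemma proj_tuple [simp]:
  assumes "i < n" "obj X" "obj Y" "\<And>i. i < n \<Longrightarrow> F i \<in> \<H> Y X"
  shows "proj \<V> X n i \<bullet> tuple \<V> Y X n F = F i"
  using tuple_prop[of X Y n F] assms by auto

lemma tuple_cong [cong]:
  assumes "Y = Y'" "X = X'" "n = n'" "\<And>i. i < n' =simp=> F i = G i"
  shows "tuple \<V> Y X n F = tuple \<V> Y' X' n' G"
  using assms unfolding tuple_def simp_implies_def by simp

lemma tuple_comp [simp]:
  assumes "obj X" "\<And>i. i < n \<Longrightarrow> F i \<in> \<H> Y X" "arr h" "tgt h = Y"
  shows "tuple \<V> Y X n F \<bullet> h = tuple \<V> (src h) X n (\<lambda>i. F i \<bullet> h)"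
proof -
  have Y: "obj Y" using assms by auto
  show ?thesis
    by (rule pow_eqI[of _ "src h" X n]) (use assms Y in \<open>simp_all flip: comp_assoc\<close>)
qed

section \<open>Equalizers\<close>

lemma equalizer_ex:
  assumes "arr f" "arr g" "src f = src g" "tgt f = tgt g"
  shows "\<exists>e. is_equalizer \<V> f g e"
  using eqs assms unfolding has_equalizers_def by blast

lemma equalizerD:
  assumes "is_equalizer \<V> f g e"
  shows "arr e" "tgt e = src f" "f \<bullet> e = g \<bullet> e"
    "h \<in> \<H> Y (src f) \<Longrightarrow> f \<bullet> h = g \<bullet> h \<Longrightarrow> \<exists>!k. k \<in> \<H> Y (src e) \<and> e \<bullet> k = h"
proof -
  note e = assms[unfolded is_equalizer_def]
  show "arr e" "tgt e = src f" "f \<bullet> e = g \<bullet> e" using e by blast+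
  assume h: "h \<in> \<H> Y (src f)" "f \<bullet> h = g \<bullet> h"
  then have "arr h" "src h = Y" "tgt h = src f" by simp_all
  then show "\<exists>!k. k \<in> \<H> Y (src e) \<and> e \<bullet> k = h" using e h(2) by metis
qed

lemma equalizer_is_equalizer:
  assumes "arr f" "arr g" "src f = src g" "tgt f = tgt g"
  shows "is_equalizer \<V> f g (equalizer \<V> f g)"
  unfolding equalizer_def by (rule someI_ex) (rule equalizer_ex[OF assms])

lemma equalizer_monic:
  assumes "is_equalizer \<V> f g e"
  shows "monic \<V> e"
  unfolding monic_def
proof (intro conjI ballI impI)
  have f: "arr f" "arr g" "src g = src f" "tgt g = tgt f" using assms unfolding is_equalizer_def by auto
  note e = equalizerD[OF assms]
  show "arr e" by (rule e(1))
  fix h k assume *: "arr h" "arr k" "src h = src k \<and> tgt h = src e \<and> tgt k = src e \<and> e \<bullet> h = e \<bullet> k"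
  define Y where "Y = src k"
  have hk: "h \<in> \<H> Y (src e)" "k \<in> \<H> Y (src e)" and eq: "e \<bullet> h = e \<bullet> k" using * Y_def by auto
  have "f \<bullet> (e \<bullet> k) = (f \<bullet> e) \<bullet> k" "g \<bullet> (e \<bullet> k) = (g \<bullet> e) \<bullet> k" using hk e(1,2) f by simp_all
  then have "f \<bullet> (e \<bullet> k) = g \<bullet> (e \<bullet> k)" using e(3) by metis
  then have "\<exists>!l. l \<in> \<H> Y (src e) \<and> e \<bullet> l = e \<bullet> k" using hk e(1,2) by (intro e(4)) simp_all
  then show "h = k" using hk eq by blast
qed

end

section \<open>Enriched structure in terms of generalized elements\<close>

context base
begin

text \<open>The axioms of a \<open>\<V>\<close>-category, required of all generalized elements of the hom-objects rather than
  of the projections from products of hom-objects.\<close>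

definition stage_cat :: "('x, 'o, 'm, 'z) vcat_scheme \<Rightarrow> bool" where
  "stage_cat A \<longleftrightarrow> VObj A = UNIV \<and> (\<forall>a b. obj (VHom A a b)) \<and>
     (\<forall>a. VId A a \<in> \<H> \<I> (VHom A a a)) \<and>
     (\<forall>a b c. VComp A a b c \<in> \<H> (VHom A b c \<star> VHom A a b) (VHom A a c)) \<and>
     (\<forall>a b Y f. f \<in> \<H> Y (VHom A a b) \<longrightarrow>
        VComp A a b b \<bullet> \<langle>VId A b \<bullet> bng Y, f\<rangle> = f \<and> VComp A a a b \<bullet> \<langle>f, VId A a \<bullet> bng Y\<rangle> = f) \<and>
     (\<forall>a b c d Y h g f. h \<in> \<H> Y (VHom A c d) \<longrightarrow> g \<in> \<H> Y (VHom A b c) \<longrightarrow> f \<in> \<H> Y (VHom A a b) \<longrightarrow>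
        VComp A a b d \<bullet> \<langle>VComp A b c d \<bullet> \<langle>h, g\<rangle>, f\<rangle> = VComp A a c d \<bullet> \<langle>h, VComp A a b c \<bullet> \<langle>g, f\<rangle>\<rangle>)"

lemma stage_catD:
  assumes A: "stage_cat A"
  shows "VObj A = UNIV" "obj (VHom A a b)" "VId A a \<in> \<H> \<I> (VHom A a a)"
    "VComp A a b c \<in> \<H> (VHom A b c \<star> VHom A a b) (VHom A a c)"
    "f \<in> \<H> Y (VHom A a b) \<Longrightarrow> VComp A a b b \<bullet> \<langle>VId A b \<bullet> bng Y, f\<rangle> = f"
    "f \<in> \<H> Y (VHom A a b) \<Longrightarrow> VComp A a a b \<bullet> \<langle>f, VId A a \<bullet> bng Y\<rangle> = f"
    "h \<in> \<H> Y (VHom A c d) \<Longrightarrow> g \<in> \<H> Y (VHom A b c) \<Longrightarrow> f \<in> \<H> Y (VHom A a b) \<Longrightarrow>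
        VComp A a b d \<bullet> \<langle>VComp A b c d \<bullet> \<langle>h, g\<rangle>, f\<rangle> = VComp A a c d \<bullet> \<langle>h, VComp A a b c \<bullet> \<langle>g, f\<rangle>\<rangle>"
proof -
  note a = A[unfolded stage_cat_def]
  note 1 = a[THEN conjunct2] note 2 = 1[THEN conjunct2] note 3 = 2[THEN conjunct2]
  note 4 = 3[THEN conjunct2] note 5 = 4[THEN conjunct2]
  show "VObj A = UNIV" by (rule a[THEN conjunct1])
  show "obj (VHom A a b)" by (rule 1[THEN conjunct1, rule_format])
  show "VId A a \<in> \<H> \<I> (VHom A a a)" by (rule 2[THEN conjunct1, rule_format])
  show "VComp A a b c \<in> \<H> (VHom A b c \<star> VHom A a b) (VHom A a c)"
    by (rule 3[THEN conjunct1, rule_format])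
  show "VComp A a b b \<bullet> \<langle>VId A b \<bullet> bng Y, f\<rangle> = f" "VComp A a a b \<bullet> \<langle>f, VId A a \<bullet> bng Y\<rangle> = f"
    if "f \<in> \<H> Y (VHom A a b)" 
    by (rule 4[THEN conjunct1, rule_format, OF that, THEN conjunct1])
      (rule 4[THEN conjunct1, rule_format, OF that, THEN conjunct2])
  show "VComp A a b d \<bullet> \<langle>VComp A b c d \<bullet> \<langle>h, g\<rangle>, f\<rangle> = VComp A a c d \<bullet> \<langle>h, VComp A a b c \<bullet> \<langle>g, f\<rangle>\<rangle>"
    if "h \<in> \<H> Y (VHom A c d)" "g \<in> \<H> Y (VHom A b c)" "f \<in> \<H> Y (VHom A a b)"
    by (rule 5[rule_format, OF that])
qed

lemma stage_cat_is_vcat: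
  assumes A: "stage_cat A"
  shows "is_vcat \<V> A"
proof -
  note D = stage_catD[OF A]
  have "VComp A a b d \<bullet> \<langle>VComp A b c d \<bullet> \<langle>Pr1 \<V> H K \<bullet> Pr1 \<V> (H \<star> K) L, Pr2 \<V> H K \<bullet> Pr1 \<V> (H \<star> K) L\<rangle>, Pr2 \<V> (H \<star> K) L\<rangle> =
     VComp A a c d \<bullet> \<langle>Pr1 \<V> H K \<bullet> Pr1 \<V> (H \<star> K) L, VComp A a b c \<bullet> \<langle>Pr2 \<V> H K \<bullet> Pr1 \<V> (H \<star> K) L, Pr2 \<V> (H \<star> K) L\<rangle>\<rangle>"
    if "H = VHom A c d" "K = VHom A b c" "L = VHom A a b" for a b c d H K L
    using D(2) by (intro D(7)[of _ "(H \<star> K) \<star> L"]) (simp_all add: that)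
  moreover have "VComp A a b b \<bullet> \<langle>VId A b \<bullet> bng (VHom A a b), ide (VHom A a b)\<rangle> = ide (VHom A a b)"
    "VComp A a a b \<bullet> \<langle>ide (VHom A a b), VId A a \<bullet> bng (VHom A a b)\<rangle> = ide (VHom A a b)" for a b
    by (rule D(5) D(6); simp add: D(2))+
  ultimately show ?thesis unfolding is_vcat_def Let_def
    by (intro conjI ballI) (rule D(2-4) | assumption | blast)+
qed

definition stage_typed :: "('x, 'o, 'm, 'z) vcat_scheme \<Rightarrow> ('x, 'o, 'm) vfun \<Rightarrow> bool" where
  "stage_typed A F \<longleftrightarrow> VObj A = UNIV \<and> (\<forall>a. obj (FObj F a)) \<and>
     (\<forall>a b. FMap F a b \<in> \<H> (VHom A a b) (Exp \<V> (FObj F a) (FObj F b)))"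

text \<open>The action of an element \<open>h\<close> of a hom-object, through the functor \<open>F\<close>, on an element \<open>u\<close> of \<open>F a\<close>.\<close>

definition act :: "('x, 'o, 'm) vfun \<Rightarrow> 'x \<Rightarrow> 'x \<Rightarrow> 'm \<Rightarrow> 'm \<Rightarrow> 'm" where
  "act F a b h u = ap (FObj F a) (FObj F b) (FMap F a b \<bullet> h) u"

lemma act_arr [simp]:
  assumes "stage_typed A F" "arr h" "tgt h = VHom A a b" "arr u" "tgt u = FObj F a" "src u = src h"
  shows "arr (act F a b h u)" "src (act F a b h u) = src h" "tgt (act F a b h u) = FObj F b"
  using assms unfolding stage_typed_def act_def by simp_all

lemma act_comp:
  assumes "stage_typed A F" "arr h" "tgt h = VHom A a b" "arr u" "tgt u = FObj F a" "src u = src h"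
    "arr y" "tgt y = src h"
  shows "act F a b h u \<bullet> y = act F a b (h \<bullet> y) (u \<bullet> y)"
  using assms unfolding stage_typed_def act_def by simp

text \<open>A \<open>\<V>\<close>-functor into \<open>\<V>\<close> amounts to a unital and associative action of the hom-objects at every stage.\<close>

definition stage_fun :: "('x, 'o, 'm, 'z) vcat_scheme \<Rightarrow> ('x, 'o, 'm) vfun \<Rightarrow> bool" where
  "stage_fun A F \<longleftrightarrow> stage_typed A F \<and>
     (\<forall>a Y u. u \<in> \<H> Y (FObj F a) \<longrightarrow> act F a a (VId A a \<bullet> bng Y) u = u) \<and>
     (\<forall>a b c Y g f u. g \<in> \<H> Y (VHom A b c) \<longrightarrow> f \<in> \<H> Y (VHom A a b) \<longrightarrow> u \<in> \<H> Y (FObj F a) \<longrightarrow>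
        act F a c (VComp A a b c \<bullet> \<langle>g, f\<rangle>) u = act F b c g (act F a b f u))"

lemma stage_typedD:
  assumes "stage_typed A F"
  shows "VObj A = UNIV" "obj (FObj F a)" "arr (FMap F a b)" "src (FMap F a b) = VHom A a b"
    "tgt (FMap F a b) = Exp \<V> (FObj F a) (FObj F b)" "obj (VHom A a b)"
  using assms src_obj[of "FMap F a b"] unfolding stage_typed_def by simp_all

lemma stage_funD:
  assumes F: "stage_fun A F"
  shows "stage_typed A F" "u \<in> \<H> Y (FObj F a) \<Longrightarrow> act F a a (VId A a \<bullet> bng Y) u = u"
    "g \<in> \<H> Y (VHom A b c) \<Longrightarrow> f \<in> \<H> Y (VHom A a b) \<Longrightarrow> u \<in> \<H> Y (FObj F a) \<Longrightarrow>
        act F a c (VComp A a b c \<bullet> \<langle>g, f\<rangle>) u = act F b c g (act F a b f u)"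
proof -
  note a = F[unfolded stage_fun_def] note 1 = a[THEN conjunct2]
  show "stage_typed A F" by (rule a[THEN conjunct1])
  show "u \<in> \<H> Y (FObj F a) \<Longrightarrow> act F a a (VId A a \<bullet> bng Y) u = u"
    by (rule 1[THEN conjunct1, rule_format])
  show "g \<in> \<H> Y (VHom A b c) \<Longrightarrow> f \<in> \<H> Y (VHom A a b) \<Longrightarrow> u \<in> \<H> Y (FObj F a) \<Longrightarrow>
        act F a c (VComp A a b c \<bullet> \<langle>g, f\<rangle>) u = act F b c g (act F a b f u)"
    by (rule 1[THEN conjunct2, rule_format])
qed

lemma self_comp_arr [simp]:
  assumes "obj A" "obj B" "obj C"
  shows "arr (VComp (self_vcat \<V>) A B C)" "src (VComp (self_vcat \<V>) A B C) = Exp \<V> B C \<star> Exp \<V> A B"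
    "tgt (VComp (self_vcat \<V>) A B C) = Exp \<V> A C"
  using assms by (simp_all add: self_vcat_def Let_def)

lemma app_self_comp [simp]:
  assumes "obj A" "obj B" "obj C" "arr g" "tgt g = Exp \<V> B C" "arr f" "tgt f = Exp \<V> A B" "src f = src g"
    "arr u" "tgt u = A" "src u = src g"
  shows "ap A C (VComp (self_vcat \<V>) A B C \<bullet> \<langle>g, f\<rangle>) u = ap B C g (ap A B f u)"
  using assms by (simp add: self_vcat_def Let_def)

lemma stage_fun_is_vfunctor:
  assumes A: "stage_cat A" and F: "stage_fun A F"
  shows "is_vfunctor \<V> A (self_vcat \<V>) F"
  unfolding is_vfunctor_def
proof (intro conjI ballI)
  note f = stage_typedD[OF stage_funD(1)[OF F]]
  have a: "obj (VHom A a b)" "arr (VId A a)" "src (VId A a) = \<I>" "tgt (VId A a) = VHom A a a"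
    "arr (VComp A a b c)" "src (VComp A a b c) = VHom A b c \<star> VHom A a b" "tgt (VComp A a b c) = VHom A a c"
    for a b c using stage_catD(2-4)[OF A] by simp_all
  fix a b c
  let ?a = "FObj F a" and ?b = "FObj F b" and ?c = "FObj F c"
  show "?a \<in> VObj (self_vcat \<V>)" using f by (simp add: self_vcat_def)
  show "FMap F a b \<in> \<H> (VHom A a b) (VHom (self_vcat \<V>) ?a ?b)"
    using f by (simp add: self_vcat_def)
  show "FMap F a a \<bullet> VId A a = VId (self_vcat \<V>) ?a"
  proof (rule exp_eqI[of _ \<I> ?a ?a])
    fix Y x u assume Y: "obj Y" "x \<in> \<H> Y \<I>" "u \<in> \<H> Y ?a"
    then show "ap ?a ?a ((FMap F a a \<bullet> VId A a) \<bullet> x) u = ap ?a ?a (VId (self_vcat \<V>) ?a \<bullet> x) u"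
      using a f to_term[of x Y] stage_funD(2)[OF F Y(3)] by (simp add: self_vcat_def act_def)
  qed (use a f in \<open>simp_all add: self_vcat_def\<close>)
  show "FMap F a c \<bullet> VComp A a b c = VComp (self_vcat \<V>) ?a ?b ?c \<bullet> parr \<V> (FMap F b c) (FMap F a b)"
  proof (rule exp_eqI[of _ "VHom A b c \<star> VHom A a b" ?a ?c])
    fix Y x u assume Y: "obj Y" "x \<in> \<H> Y (VHom A b c \<star> VHom A a b)" "u \<in> \<H> Y ?a"
    let ?g = "Pr1 \<V> (VHom A b c) (VHom A a b) \<bullet> x" and ?f = "Pr2 \<V> (VHom A b c) (VHom A a b) \<bullet> x"
    have x: "\<langle>?g, ?f\<rangle> = x" using pair_eta[OF Y(2)] a by simp
    have "ap ?a ?c ((FMap F a c \<bullet> VComp A a b c) \<bullet> \<langle>?g, ?f\<rangle>) u =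
       ap ?a ?c ((VComp (self_vcat \<V>) ?a ?b ?c \<bullet> parr \<V> (FMap F b c) (FMap F a b)) \<bullet> \<langle>?g, ?f\<rangle>) u"
      using a f Y stage_funD(3)[OF F, of ?g Y b c ?f a u] by (simp add: act_def)
    then show "ap ?a ?c ((FMap F a c \<bullet> VComp A a b c) \<bullet> x) u =
       ap ?a ?c ((VComp (self_vcat \<V>) ?a ?b ?c \<bullet> parr \<V> (FMap F b c) (FMap F a b)) \<bullet> x) u"
      unfolding x .
  qed (use a f in simp_all)
qed

text \<open>Naturality of a family with parameters in \<open>X\<close> is an equation between elements of an internal hom out
  of \<open>X \<times> A(a,b)\<close>; evaluating it at elements \<open>x\<close>, \<open>h\<close> and \<open>u\<close> gives the familiar naturality square.\<close>

lemma wedge_iff: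
  assumes F: "stage_typed A F" and G: "stage_typed A G"
  shows "vnat_wedge \<V> A F G X \<alpha> \<longleftrightarrow> obj X \<and> (\<forall>a. \<alpha> a \<in> \<H> X (Exp \<V> (FObj F a) (FObj G a))) \<and>
    (\<forall>a b Y x h u. x \<in> \<H> Y X \<longrightarrow> h \<in> \<H> Y (VHom A a b) \<longrightarrow> u \<in> \<H> Y (FObj F a) \<longrightarrow>
       ap (FObj F b) (FObj G b) (\<alpha> b \<bullet> x) (act F a b h u) =
       act G a b h (ap (FObj F a) (FObj G a) (\<alpha> a \<bullet> x) u))" (is "?L \<longleftrightarrow> ?X \<and> ?T \<and> ?R")
proof -
  note f = F[unfolded stage_typed_def] and g = G[unfolded stage_typed_def]
  have H: "obj (VHom A a b)" for a b
    using f src_obj[of "FMap F a b"] by simp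
  have "(let H = VHom A a b; x = Pr1 \<V> X H; h = Pr2 \<V> X H
        in VComp (self_vcat \<V>) (FObj F a) (FObj F b) (FObj G b) \<bullet> pair \<V> (\<alpha> b \<bullet> x) (FMap F a b \<bullet> h)
             = VComp (self_vcat \<V>) (FObj F a) (FObj G a) (FObj G b) \<bullet> pair \<V> (FMap G a b \<bullet> h) (\<alpha> a \<bullet> x))
     \<longleftrightarrow> (\<forall>Y x h u. x \<in> \<H> Y X \<longrightarrow> h \<in> \<H> Y (VHom A a b) \<longrightarrow> u \<in> \<H> Y (FObj F a) \<longrightarrow>
       ap (FObj F b) (FObj G b) (\<alpha> b \<bullet> x) (act F a b h u) =
       act G a b h (ap (FObj F a) (FObj G a) (\<alpha> a \<bullet> x) u))"
    (is "?l \<longleftrightarrow> ?r") if XT: ?X ?T for a b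
  proof
    assume l: ?l
    show ?r
    proof (intro allI impI)
      fix Y x h u assume *: "x \<in> \<H> Y X" "h \<in> \<H> Y (VHom A a b)" "u \<in> \<H> Y (FObj F a)"
      from l have "ap (FObj F a) (FObj G b) ((VComp (self_vcat \<V>) (FObj F a) (FObj F b) (FObj G b) \<bullet> pair \<V> (\<alpha> b \<bullet> Pr1 \<V> X (VHom A a b)) (FMap F a b \<bullet> Pr2 \<V> X (VHom A a b))) \<bullet> \<langle>x, h\<rangle>) u
       = ap (FObj F a) (FObj G b) ((VComp (self_vcat \<V>) (FObj F a) (FObj G a) (FObj G b) \<bullet> pair \<V> (FMap G a b \<bullet> Pr2 \<V> X (VHom A a b)) (\<alpha> a \<bullet> Pr1 \<V> X (VHom A a b))) \<bullet> \<langle>x, h\<rangle>) u"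
        by (simp only: Let_def)
      then show "ap (FObj F b) (FObj G b) (\<alpha> b \<bullet> x) (act F a b h u) =
       act G a b h (ap (FObj F a) (FObj G a) (\<alpha> a \<bullet> x) u)"
        using * f g XT H by (simp add: act_def)
    qed
  next
    assume r: ?r
    show ?l unfolding Let_def
    proof (rule exp_eqI[of _ "X \<star> VHom A a b" "FObj F a" "FObj G b"])
      fix Y z u assume *: "obj Y" "z \<in> \<H> Y (X \<star> VHom A a b)" "u \<in> \<H> Y (FObj F a)"
      show "ap (FObj F a) (FObj G b) ((VComp (self_vcat \<V>) (FObj F a) (FObj F b) (FObj G b) \<bullet> pair \<V> (\<alpha> b \<bullet> Pr1 \<V> X (VHom A a b)) (FMap F a b \<bullet> Pr2 \<V> X (VHom A a b))) \<bullet> z) u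
       = ap (FObj F a) (FObj G b) ((VComp (self_vcat \<V>) (FObj F a) (FObj G a) (FObj G b) \<bullet> pair \<V> (FMap G a b \<bullet> Pr2 \<V> X (VHom A a b)) (\<alpha> a \<bullet> Pr1 \<V> X (VHom A a b))) \<bullet> z) u"
        using * f g XT H r[rule_format, of "Pr1 \<V> X (VHom A a b) \<bullet> z" Y "Pr2 \<V> X (VHom A a b) \<bullet> z" u]
        by (simp add: act_def)
    qed (use XT f g H in simp_all)
  qed
  then show ?thesis using f unfolding vnat_wedge_def by (auto simp del: hom_iff)
qed

text \<open>Natural transformations are the natural families parametrized by the terminal object, because the
  projection from \<open>1 \<times> A(a,b)\<close> is invertible.\<close>

lemma vnat_iff_wedge:
  assumes F: "stage_typed A F" and G: "stage_typed A G"
    and \<theta>: "\<And>a. \<theta> a \<in> \<H> (FObj F a) (FObj G a)"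
  shows "is_vnat \<V> A F G \<theta> \<longleftrightarrow> vnat_wedge \<V> A F G \<I> (\<lambda>a. name_of \<V> (\<theta> a))"
proof -
  note f = F[unfolded stage_typed_def] and g = G[unfolded stage_typed_def]
  have H: "obj (VHom A a b)" for a b
    using f src_obj[of "FMap F a b"] by simp
  have t: "arr (\<theta> a)" "src (\<theta> a) = FObj F a" "tgt (\<theta> a) = FObj G a" for a using \<theta>[of a] by auto
  have "(let H = VHom A a b; x = Pr1 \<V> \<I> H; h = Pr2 \<V> \<I> H
        in VComp (self_vcat \<V>) (FObj F a) (FObj F b) (FObj G b) \<bullet> pair \<V> (name_of \<V> (\<theta> b) \<bullet> x) (FMap F a b \<bullet> h)
             = VComp (self_vcat \<V>) (FObj F a) (FObj G a) (FObj G b) \<bullet> pair \<V> (FMap G a b \<bullet> h) (name_of \<V> (\<theta> a) \<bullet> x))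
    \<longleftrightarrow> (let H = VHom A a b
        in VComp (self_vcat \<V>) (FObj F a) (FObj F b) (FObj G b) \<bullet>
             pair \<V> (name_of \<V> (\<theta> b) \<bullet> bng H) (FMap F a b)
           = VComp (self_vcat \<V>) (FObj F a) (FObj G a) (FObj G b) \<bullet>
             pair \<V> (FMap G a b) (name_of \<V> (\<theta> a) \<bullet> bng H))" (is "?l \<longleftrightarrow> ?r") for a b
  proof
    let ?H = "VHom A a b"
    assume ?l
    then have "(VComp (self_vcat \<V>) (FObj F a) (FObj F b) (FObj G b) \<bullet> pair \<V> (name_of \<V> (\<theta> b) \<bullet> Pr1 \<V> \<I> ?H) (FMap F a b \<bullet> Pr2 \<V> \<I> ?H)) \<bullet> \<langle>bng ?H, ide ?H\<rangle>
             = (VComp (self_vcat \<V>) (FObj F a) (FObj G a) (FObj G b) \<bullet> pair \<V> (FMap G a b \<bullet> Pr2 \<V> \<I> ?H) (name_of \<V> (\<theta> a) \<bullet> Pr1 \<V> \<I> ?H)) \<bullet> \<langle>bng ?H, ide ?H\<rangle>"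
      by (simp only: Let_def)
    then show ?r using f g t H by (simp add: Let_def)
  next
    let ?H = "VHom A a b"
    assume ?r
    then have "(VComp (self_vcat \<V>) (FObj F a) (FObj F b) (FObj G b) \<bullet>
             pair \<V> (name_of \<V> (\<theta> b) \<bullet> bng ?H) (FMap F a b)) \<bullet> Pr2 \<V> \<I> ?H
           = (VComp (self_vcat \<V>) (FObj F a) (FObj G a) (FObj G b) \<bullet>
             pair \<V> (FMap G a b) (name_of \<V> (\<theta> a) \<bullet> bng ?H)) \<bullet> Pr2 \<V> \<I> ?H"
      by (simp only: Let_def)
    moreover have "Pr1 \<V> \<I> ?H = bng (\<I> \<star> ?H)" using H by (intro to_term) simp
    ultimately show ?l using f g t H by (simp add: Let_def)
  qed
  then show ?thesis using f g t unfolding vnat_wedge_def is_vnat_def by simp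
qed

section \<open>Preservation of conical powers\<close>

text \<open>The names \<open>p i\<close> of arrows exhibit \<open>C\<close> as an ordinary \<open>n\<close>-th power of \<open>X\<close> in \<open>\<V>\<close>; this is what an
  algebra has to achieve on the images of the projections of a conical power.\<close>

definition power_via :: "'o \<Rightarrow> 'o \<Rightarrow> nat \<Rightarrow> (nat \<Rightarrow> 'm) \<Rightarrow> bool" where
  "power_via C X n p \<longleftrightarrow> obj C \<and> obj X \<and> (\<forall>i<n. p i \<in> \<H> \<I> (Exp \<V> C X)) \<and>
     (\<forall>Y F. obj Y \<longrightarrow> (\<forall>i<n. F i \<in> \<H> Y X) \<longrightarrow>
        (\<exists>!h. h \<in> \<H> Y C \<and> (\<forall>i<n. ap C X (p i \<bullet> bng Y) h = F i)))"

text \<open>In \<open>\<V>\<close> over itself an ordinary power whose universal property is tested at all stages is already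
  conical: a family of elements of \<open>[k, X]\<close> at stage \<open>Y\<close> is a family of elements of \<open>X\<close> at stage
  \<open>Y \<times> k\<close>.\<close>

lemma conical_in_self:
  assumes "power_via C X n p"
  shows "is_conical_power \<V> (self_vcat \<V>) C X n p"
  unfolding is_conical_power_def
proof (intro conjI ballI)
  have C: "obj C" "obj X" and p: "\<And>i. i < n \<Longrightarrow> p i \<in> \<H> \<I> (Exp \<V> C X)"
    and ex: "\<And>Y F. obj Y \<Longrightarrow> (\<And>i. i < n \<Longrightarrow> F i \<in> \<H> Y X) \<Longrightarrow>
        \<exists>!h. h \<in> \<H> Y C \<and> (\<forall>i<n. ap C X (p i \<bullet> bng Y) h = F i)"
    using assms unfolding power_via_def by blast+
  show "C \<in> VObj (self_vcat \<V>)" "X \<in> VObj (self_vcat \<V>)" using C by (auto simp: self_vcat_def)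
  show "\<forall>i<n. p i \<in> \<H> \<I> (VHom (self_vcat \<V>) C X)" using p by (simp add: self_vcat_def)
  fix k assume k': "k \<in> VObj (self_vcat \<V>)"
  then have k: "obj k" by (simp add: self_vcat_def)
  have [simp]: "VHom (self_vcat \<V>) = Exp \<V>" by (simp add: self_vcat_def)
  let ?q = "\<lambda>i. VComp (self_vcat \<V>) k C X \<bullet> \<langle>p i \<bullet> bng (Exp \<V> k C), ide (Exp \<V> k C)\<rangle>"
  have q: "ap k X (?q i \<bullet> f) u = ap C X (p i \<bullet> bng Y) (ap k C f u)"
    if "i < n" "f \<in> \<H> Y (Exp \<V> k C)" "u \<in> \<H> Y k" for i Y f u
    using p[OF that(1)] C k that src_obj[of f] by auto
  show "is_power_cone \<V> (VHom (self_vcat \<V>) k C) (VHom (self_vcat \<V>) k X) n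
        (\<lambda>i. VComp (self_vcat \<V>) k C X \<bullet> \<langle>p i \<bullet> bng (VHom (self_vcat \<V>) k C), ide (VHom (self_vcat \<V>) k C)\<rangle>)"
    unfolding is_power_cone_def
  proof (intro conjI ballI allI impI)
    fix i assume "i < n"
    then show "VComp (self_vcat \<V>) k C X \<bullet> \<langle>p i \<bullet> bng (VHom (self_vcat \<V>) k C), ide (VHom (self_vcat \<V>) k C)\<rangle>
      \<in> \<H> (VHom (self_vcat \<V>) k C) (VHom (self_vcat \<V>) k X)"
      using p[of i] C k by simp
  next
    fix Y F assume Y: "obj Y" and F': "\<forall>i<n. F i \<in> \<H> Y (VHom (self_vcat \<V>) k X)"
    then have F: "arr (F i)" "src (F i) = Y" "tgt (F i) = Exp \<V> k X" if "i < n" for i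
      using that by auto
    let ?F = "\<lambda>i. ap k X (F i \<bullet> Pr1 \<V> Y k) (Pr2 \<V> Y k)"
    have "\<exists>!h. h \<in> \<H> (Y \<star> k) C \<and> (\<forall>i<n. ap C X (p i \<bullet> bng (Y \<star> k)) h = ?F i)"
      by (rule ex) (use Y k F C in simp_all)
    then obtain h where h: "arr h" "src h = Y \<star> k" "tgt h = C"
      and hi: "\<And>i. i < n \<Longrightarrow> ap C X (p i \<bullet> bng (Y \<star> k)) h = ?F i" by auto
    let ?h = "curry' \<V> Y k h"
    have "?q i \<bullet> ?h = F i" if i: "i < n" for i
    proof (rule exp_eqI[of _ Y k X])
      fix Z y u assume Z: "obj Z" "y \<in> \<H> Z Y" "u \<in> \<H> Z k"
      have "ap k X ((?q i \<bullet> ?h) \<bullet> y) u = ap k X (?q i \<bullet> (?h \<bullet> y)) u"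
        using p[OF i] C k Y h Z by simp
      also have "\<dots> = ap C X (p i \<bullet> bng Z) (ap k C (?h \<bullet> y) u)"
        using Z Y k h by (intro q i) simp_all
      also have "\<dots> = ap C X (p i \<bullet> bng (Y \<star> k)) h \<bullet> \<langle>y, u\<rangle>"
        using p[OF i] C k Y h Z by simp
      also have "\<dots> = ap k X (F i \<bullet> y) u"
        unfolding hi[OF i] using F[OF i] C k Y Z by simp
      finally show "ap k X ((?q i \<bullet> ?h) \<bullet> y) u = ap k X (F i \<bullet> y) u" .
    qed (use p[OF i] F[OF i] C k Y h in simp_all)
    moreover have "f = g" if f: "f \<in> \<H> Y (Exp \<V> k C)" and g: "g \<in> \<H> Y (Exp \<V> k C)"
      and eq: "\<And>i. i < n \<Longrightarrow> ?q i \<bullet> f = ?q i \<bullet> g" for f g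
    proof (rule exp_eqI[OF f g k C(1)])
      fix Z y u assume Z: "obj Z" "y \<in> \<H> Z Y" "u \<in> \<H> Z k"
      have f': "arr f" "src f = Y" "tgt f = Exp \<V> k C" and g': "arr g" "src g = Y" "tgt g = Exp \<V> k C"
        using f g by auto
      have "ap C X (p i \<bullet> bng Z) (ap k C (f \<bullet> y) u) = ap C X (p i \<bullet> bng Z) (ap k C (g \<bullet> y) u)"
        if i: "i < n" for i
      proof -
        have "ap k X (?q i \<bullet> f \<bullet> y) u = ap k X (?q i \<bullet> g \<bullet> y) u"
        proof -
          have "(?q i \<bullet> f) \<bullet> y = (?q i \<bullet> g) \<bullet> y" using eq[OF i] by simp
          moreover have "(?q i \<bullet> f) \<bullet> y = ?q i \<bullet> f \<bullet> y" "(?q i \<bullet> g) \<bullet> y = ?q i \<bullet> g \<bullet> y"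
            using p[OF i] C k f' g' Z Y by simp_all
          ultimately show ?thesis by simp
        qed
        then show ?thesis using q[OF i, of "f \<bullet> y" Z u] q[OF i, of "g \<bullet> y" Z u] f' g' Z
          by (simp del: app_self_comp)
      qed
      moreover have "\<exists>!h. h \<in> \<H> Z C \<and> (\<forall>i<n. ap C X (p i \<bullet> bng Z) h = ap C X (p i \<bullet> bng Z) (ap k C (g \<bullet> y) u))"
        by (rule ex) (use Z C k p g' in simp_all)
      moreover have "ap k C (f \<bullet> y) u \<in> \<H> Z C" "ap k C (g \<bullet> y) u \<in> \<H> Z C"
        using f' g' Z C k by simp_all
      ultimately show "ap k C (f \<bullet> y) u = ap k C (g \<bullet> y) u" by blast
    qed
    ultimately show "\<exists>!h. h \<in> \<H> Y (VHom (self_vcat \<V>) k C) \<and> (\<forall>i<n. (VComp (self_vcat \<V>) k C X \<bullet> \<langle>p i \<bullet> bng (VHom (self_vcat \<V>) k C), ide (VHom (self_vcat \<V>) k C)\<rangle>) \<bullet> h = F i)"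
      using Y k h by (intro ex1I[of _ ?h]) (simp_all del: comp_assoc)
  qed (use C k in simp_all)
qed

text \<open>The underlying ordinary universal property of a conical power, obtained at the terminal stage.\<close>

lemma conical_unique_arrow:
  assumes T: "stage_cat T" and con: "is_conical_power \<V> T c x n p"
    and t: "\<And>i. i < n \<Longrightarrow> t i \<in> \<H> \<I> (VHom T k x)"
  shows "\<exists>!s. s \<in> \<H> \<I> (VHom T k c) \<and> (\<forall>i<n. VComp T k c x \<bullet> \<langle>p i, s\<rangle> = t i)"
proof -
  have pc: "is_power_cone \<V> (VHom T k c) (VHom T k x) n
        (\<lambda>i. VComp T k c x \<bullet> \<langle>p i \<bullet> bng (VHom T k c), ide (VHom T k c)\<rangle>)"
    and p: "\<And>i. i < n \<Longrightarrow> p i \<in> \<H> \<I> (VHom T c x)"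
    using con stage_catD(1)[OF T] unfolding is_conical_power_def by auto
  have "\<exists>!s. s \<in> \<H> \<I> (VHom T k c) \<and>
      (\<forall>i<n. (VComp T k c x \<bullet> \<langle>p i \<bullet> bng (VHom T k c), ide (VHom T k c)\<rangle>) \<bullet> s = t i)"
    using pc t unfolding is_power_cone_def by (simp del: hom_iff)
  moreover have "(VComp T k c x \<bullet> \<langle>p i \<bullet> bng (VHom T k c), ide (VHom T k c)\<rangle>) \<bullet> s = VComp T k c x \<bullet> \<langle>p i, s\<rangle>"
    if "i < n" "s \<in> \<H> \<I> (VHom T k c)" for i s
    using p[OF that(1)] that(2) stage_catD(2,4)[OF T] by simp
  ultimately show ?thesis by (smt (verit, best))
qed

text \<open>A functor that sends each designated power \<open>n\<close> of \<open>1\<close> to a power preserves all conical powers.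
  If \<open>c\<close> is a conical \<open>n\<close>-th power of \<open>x\<close> then \<open>c\<close> is a retract of the designated power \<open>n * x\<close> by
  arrows \<open>r : c \<rightarrow> n * x\<close> and \<open>s : n * x \<rightarrow> c\<close> that are compatible with the projections to \<open>1\<close>, the
  pair \<open>(i, j)\<close> of indices being encoded by \<open>i * x + j\<close>; the images of \<open>r\<close> and \<open>s\<close> transport the
  universal property from the designated power.\<close>

lemma power_preserved:
  fixes T :: "('o, 'm) theory_data"
  assumes T: "stage_cat T" and tc: "\<And>n. is_conical_power \<V> T n 1 n (VProj T n)"
    and A: "stage_fun T A"
    and des: "\<And>n. power_via (FObj A n) (FObj A 1) n (\<lambda>i. FMap A n 1 \<bullet> VProj T n i)"
    and con: "is_conical_power \<V> T c x n p"
  shows "power_via (FObj A c) (FObj A x) n (\<lambda>i. FMap A c x \<bullet> p i)"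
proof -
  note At = stage_funD(1)[OF A]
  note Ad = stage_typedD[OF At]
  let ?\<pi> = "VProj T" and ?o = "\<lambda>a b c t s. VComp T a b c \<bullet> \<langle>t, s\<rangle>"
  let ?A = "\<lambda>Y a b t. act A a b (t \<bullet> bng Y)"
  have comp_in: "?o a b c t s \<in> \<H> \<I> (VHom T a c)"
    if "t \<in> \<H> \<I> (VHom T b c)" "s \<in> \<H> \<I> (VHom T a b)" for a b c t s
    using that stage_catD(2,4)[OF T] by simp
  have assoc: "?o a b d (?o b c d h g) f = ?o a c d h (?o a b c g f)"
    if "h \<in> \<H> \<I> (VHom T c d)" "g \<in> \<H> \<I> (VHom T b c)" "f \<in> \<H> \<I> (VHom T a b)" for a b c d f g h
    using stage_catD(7)[OF T that] .
  have A_in: "?A Y a b t u \<in> \<H> Y (FObj A b)"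
    if "obj Y" "t \<in> \<H> \<I> (VHom T a b)" "u \<in> \<H> Y (FObj A a)" for Y a b t u
    using that act_arr[OF At] by simp
  have A_comp: "?A Y a c (?o a b c t s) u = ?A Y b c t (?A Y a b s u)"
    if "obj Y" "t \<in> \<H> \<I> (VHom T b c)" "s \<in> \<H> \<I> (VHom T a b)" "u \<in> \<H> Y (FObj A a)" for Y a b c t s u
    using that stage_funD(3)[OF A, of "t \<bullet> bng Y" Y b c "s \<bullet> bng Y" a u] stage_catD(2,4)[OF T] by simp
  have A_via: "ap (FObj A a) (FObj A b) ((FMap A a b \<bullet> t) \<bullet> bng Y) u = ?A Y a b t u"
    if "obj Y" "t \<in> \<H> \<I> (VHom T a b)" "u \<in> \<H> Y (FObj A a)" for Y a b t u
    using that Ad by (simp add: act_def)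
  have \<pi>: "?\<pi> k j \<in> \<H> \<I> (VHom T k 1)" if "j < k" for k j
    using tc[of k] that unfolding is_conical_power_def by blast
  have p: "p i \<in> \<H> \<I> (VHom T c x)" if "i < n" for i
    using con that unfolding is_conical_power_def by blast
  have \<pi>_ex: "\<exists>!h. h \<in> \<H> Y (FObj A k) \<and> (\<forall>i<k. ?A Y k 1 (?\<pi> k i) h = F i)"
    if Y: "obj Y" and F: "\<And>i. i < k \<Longrightarrow> F i \<in> \<H> Y (FObj A 1)" for Y F k
  proof -
    have "\<exists>!h. h \<in> \<H> Y (FObj A k) \<and> (\<forall>i<k. ap (FObj A k) (FObj A 1) ((FMap A k 1 \<bullet> ?\<pi> k i) \<bullet> bng Y) h = F i)"
      using des[of k] Y F unfolding power_via_def by blast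
    then show ?thesis using A_via[OF Y \<pi>, of _ k] by (smt (verit, best))
  qed
  have \<pi>_eqI: "h = h'"
    if "obj Y" "h \<in> \<H> Y (FObj A k)" "h' \<in> \<H> Y (FObj A k)"
      "\<And>i. i < k \<Longrightarrow> ?A Y k 1 (?\<pi> k i) h = ?A Y k 1 (?\<pi> k i) h'" for Y k h h'
    using \<pi>_ex[of Y k "\<lambda>i. ?A Y k 1 (?\<pi> k i) h'"] A_in[OF that(1) \<pi> that(3)] that by blast
  have ix: "i * x + j < n * x" if "i < n" "j < x" for i j
    using that by (metis add_less_mono1 less_le_trans mult_Suc add.commute Suc_leI mult_le_mono1)
  have dm: "(i * x + j) div x = i" "(i * x + j) mod x = j" if "j < x" for i j
    using that by auto
  have dm_less: "k div x < n" "k mod x < x" if "k < n * x" for k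
    using that by (cases "x = 0"; simp add: less_mult_imp_div_less)+
  have "\<exists>!r. r \<in> \<H> \<I> (VHom T c (n * x)) \<and>
      (\<forall>k<n * x. ?o c (n * x) 1 (?\<pi> (n * x) k) r = ?o c x 1 (?\<pi> x (k mod x)) (p (k div x)))"
    by (rule conical_unique_arrow[OF T tc]) (intro comp_in \<pi> p dm_less)
  then obtain r where r: "r \<in> \<H> \<I> (VHom T c (n * x))"
    and r': "\<And>k. k < n * x \<Longrightarrow> ?o c (n * x) 1 (?\<pi> (n * x) k) r = ?o c x 1 (?\<pi> x (k mod x)) (p (k div x))"
    by blast
  have "\<exists>q. q \<in> \<H> \<I> (VHom T (n * x) x) \<and> (\<forall>j<x. ?o (n * x) x 1 (?\<pi> x j) q = ?\<pi> (n * x) (i * x + j))"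
    if "i < n" for i
    by (rule ex1_implies_ex, rule conical_unique_arrow[OF T tc]) (intro \<pi> ix that)
  then obtain q where q: "\<And>i. i < n \<Longrightarrow> q i \<in> \<H> \<I> (VHom T (n * x) x)"
    and q': "\<And>i j. i < n \<Longrightarrow> j < x \<Longrightarrow> ?o (n * x) x 1 (?\<pi> x j) (q i) = ?\<pi> (n * x) (i * x + j)"
    by metis
  have "\<exists>!s. s \<in> \<H> \<I> (VHom T (n * x) c) \<and> (\<forall>i<n. ?o (n * x) c x (p i) s = q i)"
    by (rule conical_unique_arrow[OF T con q])
  then obtain s where s: "s \<in> \<H> \<I> (VHom T (n * x) c)" and s': "\<And>i. i < n \<Longrightarrow> ?o (n * x) c x (p i) s = q i"
    by blast
  have qr: "?o c (n * x) x (q i) r = p i" if i: "i < n" for i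
  proof -
    have "?o c x 1 (?\<pi> x j) (?o c (n * x) x (q i) r) = ?o c x 1 (?\<pi> x j) (p i)" if j: "j < x" for j
      using assoc[OF \<pi>[OF j] q[OF i] r] q'[OF i j] r'[OF ix[OF i j]] dm[OF j] by metis
    moreover have "\<exists>!t. t \<in> \<H> \<I> (VHom T c x) \<and> (\<forall>j<x. ?o c x 1 (?\<pi> x j) t = ?o c x 1 (?\<pi> x j) (p i))"
      by (rule conical_unique_arrow[OF T tc]) (intro comp_in \<pi> p i)
    ultimately show ?thesis using comp_in[OF q[OF i] r] p[OF i] by blast
  qed
  have sr: "?o c (n * x) c s r = VId T c"
  proof -
    have "?o c c x (p i) (?o c (n * x) c s r) = p i" if i: "i < n" for i
      using assoc[OF p[OF i] s r] s'[OF i] qr[OF i] by simp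
    moreover have "?o c c x (p i) (VId T c) = p i" if i: "i < n" for i
      using stage_catD(6)[OF T p[OF i]] stage_catD(2,3)[OF T, of c] by simp
    moreover have "\<exists>!t. t \<in> \<H> \<I> (VHom T c c) \<and> (\<forall>i<n. ?o c c x (p i) t = p i)"
      by (rule conical_unique_arrow[OF T con p])
    ultimately show ?thesis using comp_in[OF s r] stage_catD(3)[OF T, of c] by blast
  qed
  have "\<exists>!h. h \<in> \<H> Y (FObj A c) \<and> (\<forall>i<n. ?A Y c x (p i) h = F i)"
    if Y: "obj Y" and F: "\<And>i. i < n \<Longrightarrow> F i \<in> \<H> Y (FObj A x)" for Y F
  proof -
    have "\<exists>!h. h \<in> \<H> Y (FObj A (n * x)) \<and>
       (\<forall>k<n * x. ?A Y (n * x) 1 (?\<pi> (n * x) k) h = ?A Y x 1 (?\<pi> x (k mod x)) (F (k div x)))"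
      by (rule \<pi>_ex[OF Y]) (intro A_in Y \<pi> F dm_less)
    then obtain h where h: "h \<in> \<H> Y (FObj A (n * x))"
      and h': "\<And>k. k < n * x \<Longrightarrow> ?A Y (n * x) 1 (?\<pi> (n * x) k) h = ?A Y x 1 (?\<pi> x (k mod x)) (F (k div x))"
      by blast
    have qh: "?A Y (n * x) x (q i) h = F i" if i: "i < n" for i
    proof (rule \<pi>_eqI[OF Y A_in[OF Y q[OF i] h] F[OF i]])
      fix j assume j: "j < x"
      show "?A Y x 1 (?\<pi> x j) (?A Y (n * x) x (q i) h) = ?A Y x 1 (?\<pi> x j) (F i)"
        using A_comp[OF Y \<pi>[OF j] q[OF i] h] q'[OF i j] h'[OF ix[OF i j]] dm[OF j] by metis
    qed
    show ?thesis
    proof (rule ex1I[of _ "?A Y (n * x) c s h"], intro conjI allI impI A_in Y s h)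
      fix i assume i: "i < n"
      show "?A Y c x (p i) (?A Y (n * x) c s h) = F i"
        using A_comp[OF Y p[OF i] s h] s'[OF i] qh[OF i] by simp
    next
      fix g assume "g \<in> \<H> Y (FObj A c) \<and> (\<forall>i<n. ?A Y c x (p i) g = F i)"
      then have g: "g \<in> \<H> Y (FObj A c)" and gi: "\<And>i. i < n \<Longrightarrow> ?A Y c x (p i) g = F i" by blast+
      have "?A Y c (n * x) r g = h"
      proof (rule \<pi>_eqI[OF Y A_in[OF Y r g] h])
        fix k assume k: "k < n * x"
        show "?A Y (n * x) 1 (?\<pi> (n * x) k) (?A Y c (n * x) r g) = ?A Y (n * x) 1 (?\<pi> (n * x) k) h"
          using A_comp[OF Y \<pi>[OF k] r g] r'[OF k] h'[OF k] gi[OF dm_less(1)[OF k]]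
            A_comp[OF Y \<pi>[OF dm_less(2)[OF k]] p[OF dm_less(1)[OF k]] g] by metis
      qed
      then show "g = ?A Y (n * x) c s h"
        using A_comp[OF Y s r g] sr stage_funD(2)[OF A g] by metis
    qed
  qed
  moreover have "(h \<in> \<H> Y (FObj A c) \<and> (\<forall>i<n. ap (FObj A c) (FObj A x) ((FMap A c x \<bullet> p i) \<bullet> bng Y) h = F i)) \<longleftrightarrow>
      (h \<in> \<H> Y (FObj A c) \<and> (\<forall>i<n. ?A Y c x (p i) h = F i))" if Y: "obj Y" for Y F h
    using A_via[OF Y p] by metis
  moreover have "FMap A c x \<bullet> p i \<in> \<H> \<I> (Exp \<V> (FObj A c) (FObj A x))" if "i < n" for i
    using p[OF that] Ad by simp
  ultimately show ?thesis unfolding power_via_def using Ad(2) by simp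
qed

lemma algebraI:
  fixes T :: "('o, 'm) theory_data"
  assumes T: "stage_cat T" and tc: "\<And>n. is_conical_power \<V> T n 1 n (VProj T n)"
    and id: "VProj T 1 0 = VId T 1" and A: "stage_fun T A"
    and des: "\<And>n. power_via (FObj A n) (FObj A 1) n (\<lambda>i. FMap A n 1 \<bullet> VProj T n i)"
  shows "is_algebra \<V> T A"
  unfolding is_algebra_def is_theory_def
  using stage_cat_is_vcat[OF T] stage_catD(1)[OF T] tc id stage_fun_is_vfunctor[OF T A]
    conical_in_self[OF power_preserved[OF T tc A des]] by blast

end

section \<open>Rigs and affine forms\<close>

context base
begin

text \<open>The axioms of a monoid object are equations between projections from a power; precomposing them
  with a tuple of elements turns them into laws for elements at any stage.\<close>

lemma comm_monoid_objectD:
  assumes "is_comm_monoid \<V> M a z"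
  shows "obj M" "arr a" "src a = M \<star> M" "tgt a = M" "arr z" "src z = \<I>" "tgt z = M"
    "\<And>x y w Y. x \<in> \<H> Y M \<Longrightarrow> y \<in> \<H> Y M \<Longrightarrow> w \<in> \<H> Y M \<Longrightarrow>
       a \<bullet> \<langle>a \<bullet> \<langle>x, y\<rangle>, w\<rangle> = a \<bullet> \<langle>x, a \<bullet> \<langle>y, w\<rangle>\<rangle>"
    "\<And>x y Y. x \<in> \<H> Y M \<Longrightarrow> y \<in> \<H> Y M \<Longrightarrow> a \<bullet> \<langle>x, y\<rangle> = a \<bullet> \<langle>y, x\<rangle>"
    "\<And>x Y. x \<in> \<H> Y M \<Longrightarrow> a \<bullet> \<langle>z \<bullet> bng Y, x\<rangle> = x"
proof -
  note d = assms[unfolded is_comm_monoid_def Let_def numeral_3_eq_3 numeral_2_eq_2]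
  show t: "obj M" "arr a" "src a = M \<star> M" "tgt a = M" "arr z" "src z = \<I>" "tgt z = M"
    using d by auto
  show "a \<bullet> \<langle>a \<bullet> \<langle>x, y\<rangle>, w\<rangle> = a \<bullet> \<langle>x, a \<bullet> \<langle>y, w\<rangle>\<rangle>"
    if "x \<in> \<H> Y M" "y \<in> \<H> Y M" "w \<in> \<H> Y M" for x y w Y
  proof -
    let ?p = "proj \<V> M (Suc (Suc (Suc 0)))"
    have "(a \<bullet> \<langle>a \<bullet> \<langle>?p 0, ?p 1\<rangle>, ?p (Suc (Suc 0))\<rangle>) \<bullet> \<langle>\<langle>x, y\<rangle>, w\<rangle> = (a \<bullet> \<langle>?p 0, a \<bullet> \<langle>?p 1, ?p (Suc (Suc 0))\<rangle>\<rangle>) \<bullet> \<langle>\<langle>x, y\<rangle>, w\<rangle>"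
      using d by metis
    then show ?thesis using that t by simp
  qed
  show "a \<bullet> \<langle>x, y\<rangle> = a \<bullet> \<langle>y, x\<rangle>" if "x \<in> \<H> Y M" "y \<in> \<H> Y M" for x y Y
  proof -
    let ?p = "proj \<V> M (Suc (Suc 0))"
    have "(a \<bullet> \<langle>?p 0, ?p 1\<rangle>) \<bullet> \<langle>x, y\<rangle> = (a \<bullet> \<langle>?p 1, ?p 0\<rangle>) \<bullet> \<langle>x, y\<rangle>"
      using d by metis
    then show ?thesis using that t by simp
  qed
  show "a \<bullet> \<langle>z \<bullet> bng Y, x\<rangle> = x" if "x \<in> \<H> Y M" for x Y
  proof -
    have "(a \<bullet> \<langle>z \<bullet> bng M, ide M\<rangle>) \<bullet> x = ide M \<bullet> x" using d by metis
    then show ?thesis using that t by simp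
  qed
qed

lemma comm_monoid_objectI:
  assumes t: "obj M" "a \<in> \<H> (M \<star> M) M" "z \<in> \<H> \<I> M"
    and assoc: "\<And>x y w Y. x \<in> \<H> Y M \<Longrightarrow> y \<in> \<H> Y M \<Longrightarrow> w \<in> \<H> Y M \<Longrightarrow>
       a \<bullet> \<langle>a \<bullet> \<langle>x, y\<rangle>, w\<rangle> = a \<bullet> \<langle>x, a \<bullet> \<langle>y, w\<rangle>\<rangle>"
    and comm: "\<And>x y Y. x \<in> \<H> Y M \<Longrightarrow> y \<in> \<H> Y M \<Longrightarrow> a \<bullet> \<langle>x, y\<rangle> = a \<bullet> \<langle>y, x\<rangle>"
    and null: "\<And>x Y. x \<in> \<H> Y M \<Longrightarrow> a \<bullet> \<langle>z \<bullet> bng Y, x\<rangle> = x"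
  shows "is_comm_monoid \<V> M a z"
  unfolding is_comm_monoid_def Let_def
proof (intro conjI t)
  have p: "proj \<V> M n i \<in> \<H> (pow \<V> M n) M" if "i < n" for n i using t that by simp
  show "a \<bullet> \<langle>a \<bullet> \<langle>proj \<V> M 3 0, proj \<V> M 3 1\<rangle>, proj \<V> M 3 2\<rangle> = a \<bullet> \<langle>proj \<V> M 3 0, a \<bullet> \<langle>proj \<V> M 3 1, proj \<V> M 3 2\<rangle>\<rangle>"
    by (rule assoc; rule p; simp)
  show "a \<bullet> \<langle>proj \<V> M 2 0, proj \<V> M 2 1\<rangle> = a \<bullet> \<langle>proj \<V> M 2 1, proj \<V> M 2 0\<rangle>"
    by (rule comm; rule p; simp)
  show "a \<bullet> \<langle>z \<bullet> bng M, ide M\<rangle> = ide M" by (rule null) (use t in simp)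
qed

end

locale rig = base \<V> for \<V> :: "('o, 'm) ccc" (structure) +
  fixes P :: "('o, 'm) rig_data"
  assumes rig: "is_rig \<V> P"
begin

abbreviation K where "K \<equiv> Car P"
abbreviation plus (infixl \<open>\<boxplus>\<close> 65) where "x \<boxplus> y \<equiv> gplus \<V> P x y"
abbreviation times (infixl \<open>\<boxtimes>\<close> 70) where "x \<boxtimes> y \<equiv> gtimes \<V> P x y"
abbreviation nul where "nul \<equiv> gnull \<V> P"
abbreviation unt where "unt \<equiv> gunit \<V> P"

lemma rig_arr [simp]:
  "obj K" "arr (Plus P)" "src (Plus P) = K \<star> K" "tgt (Plus P) = K" "arr (Null P)" "src (Null P) = \<I>" "tgt (Null P) = K"
  "arr (Times P)" "src (Times P) = K \<star> K" "tgt (Times P) = K" "arr (Unit P)" "src (Unit P) = \<I>" "tgt (Unit P) = K"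
  using rig comm_monoid_objectD(1-7)[of K "Plus P" "Null P"] unfolding is_rig_def by auto

lemma gplus_arr [simp]:
  assumes "arr x" "arr y" "src x = src y" "tgt x = K" "tgt y = K"
  shows "arr (x \<boxplus> y)" "src (x \<boxplus> y) = src y" "tgt (x \<boxplus> y) = K"
    "arr (x \<boxtimes> y)" "src (x \<boxtimes> y) = src y" "tgt (x \<boxtimes> y) = K"
  using assms by (simp_all add: gplus_def gtimes_def)

lemma gnull_arr [simp]:
  assumes "obj X"
  shows "arr (nul X)" "src (nul X) = X" "tgt (nul X) = K" "arr (unt X)" "src (unt X) = X" "tgt (unt X) = K"
  using assms by (simp_all add: gnull_def gunit_def)

lemma gplus_comp [simp]:
  assumes "arr x" "arr y" "src x = src y" "tgt x = K" "tgt y = K" "arr h" "tgt h = src y"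
  shows "(x \<boxplus> y) \<bullet> h = (x \<bullet> h) \<boxplus> (y \<bullet> h)" "(x \<boxtimes> y) \<bullet> h = (x \<bullet> h) \<boxtimes> (y \<bullet> h)"
  using assms by (simp_all add: gplus_def gtimes_def)

lemma gnull_comp [simp]:
  assumes "arr h" "tgt h = X"
  shows "nul X \<bullet> h = nul (src h)" "unt X \<bullet> h = unt (src h)"
  using assms src_obj[of h] tgt_obj[of h] by (simp_all add: gnull_def gunit_def)

lemma plus_laws:
  assumes x: "x \<in> \<H> Y K"
  shows "y \<in> \<H> Y K \<Longrightarrow> w \<in> \<H> Y K \<Longrightarrow> x \<boxplus> y \<boxplus> w = x \<boxplus> (y \<boxplus> w)"
    "y \<in> \<H> Y K \<Longrightarrow> x \<boxplus> y = y \<boxplus> x" "nul Y \<boxplus> x = x" "x \<boxplus> nul Y = x"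
proof -
  have m: "is_comm_monoid \<V> K (Plus P) (Null P)" using rig unfolding is_rig_def by blast
  note d = comm_monoid_objectD(8-)[OF m, folded gplus_def gnull_def]
  show "y \<in> \<H> Y K \<Longrightarrow> w \<in> \<H> Y K \<Longrightarrow> x \<boxplus> y \<boxplus> w = x \<boxplus> (y \<boxplus> w)" by (rule d(1)[OF x])
  show "y \<in> \<H> Y K \<Longrightarrow> x \<boxplus> y = y \<boxplus> x" by (rule d(2)[OF x])
  show l: "nul Y \<boxplus> x = x" by (rule d(3)[OF x])
  show "x \<boxplus> nul Y = x" using l d(2)[OF x, of "nul Y"] x by auto
qed

lemma times_laws:
  assumes x: "x \<in> \<H> Y K"
  shows "y \<in> \<H> Y K \<Longrightarrow> w \<in> \<H> Y K \<Longrightarrow> x \<boxtimes> y \<boxtimes> w = x \<boxtimes> (y \<boxtimes> w)"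
    "y \<in> \<H> Y K \<Longrightarrow> w \<in> \<H> Y K \<Longrightarrow> x \<boxtimes> (y \<boxplus> w) = (x \<boxtimes> y) \<boxplus> (x \<boxtimes> w)"
    "y \<in> \<H> Y K \<Longrightarrow> w \<in> \<H> Y K \<Longrightarrow> (x \<boxplus> y) \<boxtimes> w = (x \<boxtimes> w) \<boxplus> (y \<boxtimes> w)"
    "unt Y \<boxtimes> x = x" "x \<boxtimes> unt Y = x" "nul Y \<boxtimes> x = nul Y" "x \<boxtimes> nul Y = nul Y"
proof -
  note d = rig[unfolded is_rig_def Let_def numeral_3_eq_3 numeral_2_eq_2]
  let ?p = "proj \<V> K (Suc (Suc (Suc 0)))"
  let ?x = "?p 0" and ?y = "?p 1" and ?w = "?p (Suc (Suc 0))"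
  have e: "?x \<boxtimes> ?y \<boxtimes> ?w = ?x \<boxtimes> (?y \<boxtimes> ?w)" "?x \<boxtimes> (?y \<boxplus> ?w) = (?x \<boxtimes> ?y) \<boxplus> (?x \<boxtimes> ?w)"
    "(?x \<boxplus> ?y) \<boxtimes> ?w = (?x \<boxtimes> ?w) \<boxplus> (?y \<boxtimes> ?w)"
    "unt K \<boxtimes> ide K = ide K" "ide K \<boxtimes> unt K = ide K" "nul K \<boxtimes> ide K = nul K" "ide K \<boxtimes> nul K = nul K"
    using d by blast+
  show "x \<boxtimes> y \<boxtimes> w = x \<boxtimes> (y \<boxtimes> w)" "x \<boxtimes> (y \<boxplus> w) = (x \<boxtimes> y) \<boxplus> (x \<boxtimes> w)"
    "(x \<boxplus> y) \<boxtimes> w = (x \<boxtimes> w) \<boxplus> (y \<boxtimes> w)" if "y \<in> \<H> Y K" "w \<in> \<H> Y K"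
    using e(1-3)[THEN arg_cong, of "\<lambda>f. f \<bullet> \<langle>\<langle>x, y\<rangle>, w\<rangle>"] that x by simp_all
  show "unt Y \<boxtimes> x = x" "x \<boxtimes> unt Y = x" "nul Y \<boxtimes> x = nul Y" "x \<boxtimes> nul Y = nul Y"
    using e(4-7)[THEN arg_cong, of "\<lambda>f. f \<bullet> x"] x by simp_all
qed

lemma hom_ring_simps:
  "carrier (hom_ring \<V> Y P) = \<H> Y K" "x \<oplus>\<^bsub>hom_ring \<V> Y P\<^esub> y = x \<boxplus> y" "x \<otimes>\<^bsub>hom_ring \<V> Y P\<^esub> y = x \<boxtimes> y"
  "\<zero>\<^bsub>hom_ring \<V> Y P\<^esub> = nul Y" "\<one>\<^bsub>hom_ring \<V> Y P\<^esub> = unt Y"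
  by (simp_all add: hom_ring_def)

lemma hom_ring_semiring:
  assumes Y: "obj Y"
  shows "semiring (hom_ring \<V> Y P)"
proof (intro semiring.intro semiring_axioms.intro)
  show "abelian_monoid (hom_ring \<V> Y P)"
    by (rule abelian_monoidI) (use plus_laws Y in \<open>auto simp: hom_ring_simps\<close>)
  show "Group.monoid (hom_ring \<V> Y P)"
    by (rule monoidI) (use times_laws Y in \<open>auto simp: hom_ring_simps\<close>)
qed (simp_all add: hom_ring_simps times_laws del: hom_iff)

lemma gsum_cong [cong]:
  assumes "Q = Q'" "Y = Y'" "n = n'" "\<And>i. i < n' =simp=> F i = G i"
  shows "gsum \<V> Q Y n F = gsum \<V> Q' Y' n' G"
proof -
  have "(\<And>i. i < n \<Longrightarrow> F i = G i) \<Longrightarrow> gsum \<V> Q Y n F = gsum \<V> Q Y n G"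
    by (induction n) auto
  then show ?thesis using assms by (simp add: simp_implies_def)
qed

lemma gsum_arr [simp]:
  assumes "obj Y" "\<And>i. i < n \<Longrightarrow> F i \<in> \<H> Y K"
  shows "arr (gsum \<V> P Y n F)" "src (gsum \<V> P Y n F) = Y" "tgt (gsum \<V> P Y n F) = K"
proof -
  have "arr (gsum \<V> P Y n F) \<and> src (gsum \<V> P Y n F) = Y \<and> tgt (gsum \<V> P Y n F) = K"
    using assms(2) by (induction n) (auto simp: assms(1))
  then show "arr (gsum \<V> P Y n F)" "src (gsum \<V> P Y n F) = Y" "tgt (gsum \<V> P Y n F) = K" by auto
qed

lemma gsum_comp [simp]:
  assumes "\<And>i. i < n \<Longrightarrow> F i \<in> \<H> Y K" "arr h" "tgt h = Y"
  shows "gsum \<V> P Y n F \<bullet> h = gsum \<V> P (src h) n (\<lambda>i. F i \<bullet> h)"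
  using assms(1)
proof (induction n)
  case (Suc n)
  have "obj Y" using assms by auto
  then show ?case using Suc.prems Suc.IH assms(2,3) by simp
qed (use assms(2,3) in simp)

lemma gsum_plus:
  assumes Y: "obj Y" and "\<And>i. i < n \<Longrightarrow> F i \<in> \<H> Y K" "\<And>i. i < n \<Longrightarrow> G i \<in> \<H> Y K"
  shows "gsum \<V> P Y n (\<lambda>i. F i \<boxplus> G i) = gsum \<V> P Y n F \<boxplus> gsum \<V> P Y n G"
  using assms(2,3)
proof (induction n)
  case (Suc n)
  interpret S: semiring "hom_ring \<V> Y P" by (rule hom_ring_semiring[OF Y])
  have "gsum \<V> P Y n F \<in> \<H> Y K" "gsum \<V> P Y n G \<in> \<H> Y K" "F n \<in> \<H> Y K" "G n \<in> \<H> Y K"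
    using Suc.prems Y by auto
  then show ?case using Suc.IH Suc.prems S.a_ac
    by (simp add: hom_ring_simps)
qed (use Y plus_laws(3)[of "nul Y" Y] in simp)

lemma gsum_mult:
  assumes Y: "obj Y" and "\<And>i. i < n \<Longrightarrow> F i \<in> \<H> Y K" and r: "r \<in> \<H> Y K"
  shows "gsum \<V> P Y n (\<lambda>i. r \<boxtimes> F i) = r \<boxtimes> gsum \<V> P Y n F"
    "gsum \<V> P Y n (\<lambda>i. F i \<boxtimes> r) = gsum \<V> P Y n F \<boxtimes> r"
proof -
  show "gsum \<V> P Y n (\<lambda>i. r \<boxtimes> F i) = r \<boxtimes> gsum \<V> P Y n F"
    using assms(2)
  proof (induction n)
    case (Suc n)
    then show ?case using times_laws(2)[OF r, of "gsum \<V> P Y n F" "F n"] Y by simp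
  qed (use Y times_laws(7)[OF r] in simp)
  show "gsum \<V> P Y n (\<lambda>i. F i \<boxtimes> r) = gsum \<V> P Y n F \<boxtimes> r"
    using assms(2)
  proof (induction n)
    case (Suc n)
    then show ?case using times_laws(3)[of "gsum \<V> P Y n F" Y "F n" r] r Y by simp
  qed (use Y times_laws(6)[OF r] in simp)
qed

lemma gsum_null:
  assumes "obj Y"
  shows "gsum \<V> P Y n (\<lambda>i. nul Y) = nul Y"
  using assms plus_laws(3)[of "nul Y" Y] by (induction n) auto

definition delta :: "'o \<Rightarrow> nat \<Rightarrow> nat \<Rightarrow> 'm" where
  "delta Y i j = (if i = j then unt Y else nul Y)"

lemma delta_arr [simp]:
  assumes "obj Y"
  shows "arr (delta Y i j)" "src (delta Y i j) = Y" "tgt (delta Y i j) = K"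
  using assms by (auto simp: delta_def)

lemma delta_comp [simp]: "arr h \<Longrightarrow> tgt h = Y \<Longrightarrow> delta Y i j \<bullet> h = delta (src h) i j"
  by (auto simp: delta_def)

lemma gsum_delta:
  assumes Y: "obj Y" and "\<And>i. i < n \<Longrightarrow> F i \<in> \<H> Y K"
  shows "gsum \<V> P Y n (\<lambda>i. delta Y k i \<boxtimes> F i) = (if k < n then F k else nul Y)"
  using assms(2)
proof (induction n)
  case (Suc n)
  have d: "delta Y k n \<boxtimes> F n = (if k = n then F n else nul Y)"
    using times_laws(4,6)[OF Suc.prems[of n]] by (auto simp: delta_def)
  show ?case
  proof (cases "k < n")
    case True
    then show ?thesis using Suc d plus_laws(4)[OF Suc.prems[of k]] by simp
  next
    case False
    then show ?thesis using Suc d plus_laws(3)[OF Suc.prems[of k]] plus_laws(3)[of "nul Y" Y] Y by (cases "k = n") auto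
  qed
qed simp

text \<open>The affine form with linear coefficients \<open>q 0, \<dots>, q (n - 1)\<close> and constant term \<open>q n\<close>.\<close>

definition form :: "'o \<Rightarrow> nat \<Rightarrow> (nat \<Rightarrow> 'm) \<Rightarrow> (nat \<Rightarrow> 'm) \<Rightarrow> 'm" where
  "form Y n q v = gsum \<V> P Y n (\<lambda>i. q i \<boxtimes> v i) \<boxplus> q n"

lemma form_cong [cong]:
  assumes "Y = Y'" "n = n'" "\<And>i. i \<le> n' =simp=> q i = q' i" "\<And>i. i < n' =simp=> v i = v' i"
  shows "form Y n q v = form Y' n' q' v'"
  using assms unfolding form_def simp_implies_def by simp

lemma form_arr [simp]:
  assumes "obj Y" "\<And>i. i \<le> n \<Longrightarrow> q i \<in> \<H> Y K" "\<And>i. i < n \<Longrightarrow> v i \<in> \<H> Y K"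
  shows "arr (form Y n q v)" "src (form Y n q v) = Y" "tgt (form Y n q v) = K"
  using assms by (simp_all add: form_def)

lemma form_comp [simp]:
  assumes "\<And>i. i \<le> n \<Longrightarrow> q i \<in> \<H> Y K" "\<And>i. i < n \<Longrightarrow> v i \<in> \<H> Y K" "arr h" "tgt h = Y"
  shows "form Y n q v \<bullet> h = form (src h) n (\<lambda>i. q i \<bullet> h) (\<lambda>i. v i \<bullet> h)"
proof -
  have "obj Y" using assms by auto
  then show ?thesis using assms by (simp add: form_def)
qed

lemma form_null:
  assumes Y: "obj Y" and q: "\<And>i. i \<le> n \<Longrightarrow> q i \<in> \<H> Y K"
  shows "form Y n q (\<lambda>i. nul Y) = q n"
proof -
  have "gsum \<V> P Y n (\<lambda>i. q i \<boxtimes> nul Y) = gsum \<V> P Y n (\<lambda>i. nul Y)"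
    using times_laws(7)[of _ Y] q by simp
  then show ?thesis using Y q plus_laws(3)[of "q n" Y] by (simp add: form_def gsum_null)
qed

lemma gsum_swap:
  assumes Y: "obj Y" and "\<And>i k. i < n \<Longrightarrow> k < l \<Longrightarrow> F i k \<in> \<H> Y K"
  shows "gsum \<V> P Y n (\<lambda>i. gsum \<V> P Y l (F i)) = gsum \<V> P Y l (\<lambda>k. gsum \<V> P Y n (\<lambda>i. F i k))"
  using assms(2)
proof (induction n)
  case (Suc n)
  then show ?case using Y by (simp add: gsum_plus)
qed (use Y in \<open>simp add: gsum_null\<close>)

end

text \<open>Commutativity is stated for elements, since for the positive part of a commutative ring it is
  inherited along a monomorphism.\<close>

locale comm_rig = rig \<V> P for \<V> :: "('o, 'm) ccc" (structure) and P +
  assumes times_comm: "\<And>x y Y. x \<in> \<H> Y K \<Longrightarrow> y \<in> \<H> Y K \<Longrightarrow> x \<boxtimes> y = y \<boxtimes> x"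
begin

lemma times_left_comm:
  assumes "x \<in> \<H> Y K" "y \<in> \<H> Y K" "w \<in> \<H> Y K"
  shows "x \<boxtimes> (y \<boxtimes> w) = y \<boxtimes> (x \<boxtimes> w)"
  using times_laws(1)[of x Y y w] times_laws(1)[of y Y x w] times_comm[of x Y y] assms by simp

lemma form_delta:
  assumes Y: "obj Y" and q: "\<And>i. i \<le> n \<Longrightarrow> q i \<in> \<H> Y K" and k: "k < n"
  shows "form Y n q (delta Y k) = q k \<boxplus> q n"
proof -
  have "gsum \<V> P Y n (\<lambda>i. q i \<boxtimes> delta Y k i) = gsum \<V> P Y n (\<lambda>i. delta Y k i \<boxtimes> q i)"
    using times_comm[of _ Y] q Y by simp
  then show ?thesis using gsum_delta[of Y n q k] k q Y by (simp add: form_def)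
qed

text \<open>An affine form commutes with mixtures: the linear part does so because scalars commute, and
  the constant term is reproduced because the weights \<open>w k\<close> sum to \<open>1\<close>.\<close>

lemma form_mixture:
  assumes Y: "obj Y" and q: "\<And>i. i \<le> n \<Longrightarrow> q i \<in> \<H> Y K"
    and v: "\<And>i k. i < n \<Longrightarrow> k < l \<Longrightarrow> v i k \<in> \<H> Y K"
    and w: "\<And>k. k < l \<Longrightarrow> w k \<in> \<H> Y K" and sum: "gsum \<V> P Y l w = unt Y"
  shows "form Y n q (\<lambda>i. gsum \<V> P Y l (\<lambda>k. w k \<boxtimes> v i k)) = gsum \<V> P Y l (\<lambda>k. w k \<boxtimes> form Y n q (\<lambda>i. v i k))"
proof -
  have "gsum \<V> P Y l (\<lambda>k. w k \<boxtimes> form Y n q (\<lambda>i. v i k)) =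
      gsum \<V> P Y l (\<lambda>k. (w k \<boxtimes> gsum \<V> P Y n (\<lambda>i. q i \<boxtimes> v i k)) \<boxplus> (w k \<boxtimes> q n))"
    unfolding form_def using Y q v w by (simp add: times_laws(2)[of _ Y])
  also have "\<dots> = gsum \<V> P Y l (\<lambda>k. w k \<boxtimes> gsum \<V> P Y n (\<lambda>i. q i \<boxtimes> v i k)) \<boxplus> gsum \<V> P Y l (\<lambda>k. w k \<boxtimes> q n)"
    using Y q v w by (simp add: gsum_plus)
  also have "gsum \<V> P Y l (\<lambda>k. w k \<boxtimes> q n) = q n"
    using Y q w sum times_laws(4)[of "q n" Y] by (simp add: gsum_mult(2))
  also have "gsum \<V> P Y l (\<lambda>k. w k \<boxtimes> gsum \<V> P Y n (\<lambda>i. q i \<boxtimes> v i k)) =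
      gsum \<V> P Y l (\<lambda>k. gsum \<V> P Y n (\<lambda>i. w k \<boxtimes> (q i \<boxtimes> v i k)))"
    using Y q v w by (simp add: gsum_mult(1))
  also have "\<dots> = gsum \<V> P Y n (\<lambda>i. gsum \<V> P Y l (\<lambda>k. w k \<boxtimes> (q i \<boxtimes> v i k)))"
    using Y q v w by (intro gsum_swap) simp_all
  also have "\<dots> = gsum \<V> P Y n (\<lambda>i. gsum \<V> P Y l (\<lambda>k. q i \<boxtimes> (w k \<boxtimes> v i k)))"
    using q v w by (simp add: times_left_comm[of _ Y "q _"])
  also have "\<dots> = gsum \<V> P Y n (\<lambda>i. q i \<boxtimes> gsum \<V> P Y l (\<lambda>k. w k \<boxtimes> v i k))"
    using Y q v w by (simp add: gsum_mult(1))
  finally show ?thesis by (simp add: form_def)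
qed

end

section \<open>Affine maps on the positive cone of an archimedean ring\<close>

locale archimedean_cone = cring Q for Q :: "('a, 'z) ring_scheme" (structure) +
  fixes Qp :: "'a set"
  assumes cone_sub: "Qp \<subseteq> carrier Q"
    and cone_add: "\<And>x y. x \<in> Qp \<Longrightarrow> y \<in> Qp \<Longrightarrow> x \<oplus> y \<in> Qp"
    and cone_mult: "\<And>x y. x \<in> Qp \<Longrightarrow> y \<in> Qp \<Longrightarrow> x \<otimes> y \<in> Qp"
    and cone_zero: "\<zero> \<in> Qp" and cone_one: "\<one> \<in> Qp"
    and firm: "firmly_archimedean Q Qp"
    and half_ex: "\<exists>h \<in> Qp. h \<oplus> h = \<one>"
begin

lemma cone_closed [simp]: "x \<in> Qp \<Longrightarrow> x \<in> carrier Q"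
  using cone_sub by blast

lemma nat_add_pow_closed: "x \<in> Qp \<Longrightarrow> [(n::nat)] \<cdot> x \<in> Qp"
  by (induction n) (auto simp: cone_add cone_zero)

text \<open>The scalar \<open>t\<close> is a power of \<open>2\<close> and \<open>p\<close> the corresponding power of \<open>1/2\<close>. Doubling \<open>t\<close> raises the natural
  number below it by at least \<open>1\<close>, because \<open>t\<close> itself is at least \<open>1\<close>; this is why the excess of \<open>t\<close>
  over \<open>1\<close> is carried through the induction.\<close>

lemma invertible_above_nat:
  "\<exists>p \<in> Qp. \<exists>t \<in> Qp. \<exists>s \<in> Qp. \<exists>t' \<in> Qp. p \<otimes> t = \<one> \<and> t = ([(n::nat)] \<cdot> \<one>) \<oplus> s \<and> t = \<one> \<oplus> t'"
proof (induction n)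
  case 0
  then show ?case using cone_one cone_zero
    by (intro bexI[of _ \<one>] bexI[of _ \<zero>]) auto
next
  case (Suc n)
  obtain h where h: "h \<in> Qp" "h \<oplus> h = \<one>" using half_ex by blast
  obtain p t s t' where *: "p \<in> Qp" "t \<in> Qp" "s \<in> Qp" "t' \<in> Qp"
    and e: "p \<otimes> t = \<one>" "t = ([n] \<cdot> \<one>) \<oplus> s" "t = \<one> \<oplus> t'" using Suc by blast
  have "(p \<otimes> h) \<otimes> (t \<oplus> t) = (p \<otimes> t) \<otimes> (h \<oplus> h)" using *[THEN cone_closed] h(1)[THEN cone_closed] by algebra
  then have 1: "(p \<otimes> h) \<otimes> (t \<oplus> t) = \<one>" using e h by simp
  have n: "[n] \<cdot> \<one> \<in> carrier Q" by simp
  have "t \<oplus> t = (([n] \<cdot> \<one>) \<oplus> s) \<oplus> (\<one> \<oplus> t')" using e by simp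
  also have "\<dots> = (([n] \<cdot> \<one>) \<oplus> \<one>) \<oplus> (s \<oplus> t')" using *[THEN cone_closed] n by algebra
  finally have 2: "t \<oplus> t = ([Suc n] \<cdot> \<one>) \<oplus> (s \<oplus> t')" by simp
  have "t \<oplus> t = (\<one> \<oplus> t') \<oplus> t" using e by simp
  then have 3: "t \<oplus> t = \<one> \<oplus> (t' \<oplus> t)" using * by (simp add: a_assoc)
  have "p \<otimes> h \<in> Qp" "t \<oplus> t \<in> Qp" "s \<oplus> t' \<in> Qp" "t' \<oplus> t \<in> Qp"
    using * h(1) cone_add cone_mult by blast+
  then show ?case using 1 2 3 by blast
qed

lemma invertible_above:
  assumes r: "r \<in> Qp"
  obtains p t s t' where "p \<in> Qp" "t \<in> Qp" "s \<in> Qp" "t' \<in> Qp"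
    "p \<otimes> t = \<one>" "t = r \<oplus> s" "t = \<one> \<oplus> t'"
proof -
  obtain n :: nat where n: "([n] \<cdot> \<one>) \<ominus> r \<in> Qp"
    using firm r unfolding firmly_archimedean_def pre_le_def by blast
  obtain p t s t' where *: "p \<in> Qp" "t \<in> Qp" "s \<in> Qp" "t' \<in> Qp"
    and e: "p \<otimes> t = \<one>" "t = ([n] \<cdot> \<one>) \<oplus> s" "t = \<one> \<oplus> t'" using invertible_above_nat[of n] by blast
  have "a \<oplus> s = r \<oplus> ((a \<ominus> r) \<oplus> s)" if "a \<in> carrier Q" for a
    using that r[THEN cone_closed] *(3)[THEN cone_closed] by algebra
  then have "([n] \<cdot> \<one>) \<oplus> s = r \<oplus> ((([n] \<cdot> \<one>) \<ominus> r) \<oplus> s)" by simp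
  then have "t = r \<oplus> ((([n] \<cdot> \<one>) \<ominus> r) \<oplus> s)" using e(2) by metis
  then show thesis using that * e(1,3) cone_add[OF n *(3)] by blast
qed

lemma cone_if_bounded_below:
  assumes x: "x \<in> carrier Q" and c: "c \<in> carrier Q" and b: "\<And>n::nat. c \<oplus> ([n] \<cdot> x) \<in> Qp"
  shows "x \<in> Qp"
proof -
  have "c \<ominus> ([n] \<cdot> (\<ominus> x)) = c \<oplus> ([n] \<cdot> x)" for n :: nat
    using x c by (simp add: add.nat_pow_inv[symmetric] minus_eq flip: a_inv_def)
  then have "pre_le Q Qp (\<ominus> x) \<zero>"
    using firm x c b unfolding firmly_archimedean_def archimedean_preordered_ring_def pre_le_def
    by (metis a_inv_closed)
  then show ?thesis using x by (simp add: pre_le_def minus_eq)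
qed

end

text \<open>The map \<open>\<phi>\<close> takes families indexed by all natural numbers but looks only at the first \<open>n\<close> entries.
  This is forced by stating the mixture law for any \<open>w\<close> that agrees with the mixture in those entries.\<close>

locale mixture_map = archimedean_cone Q Qp for Q :: "('a, 'z) ring_scheme" (structure) and Qp +
  fixes n :: nat and \<phi> :: "(nat \<Rightarrow> 'a) \<Rightarrow> 'a"
  assumes \<phi>_cone: "\<And>v. (\<And>i. i < n \<Longrightarrow> v i \<in> Qp) \<Longrightarrow> \<phi> v \<in> Qp"
    and mixture: "\<And>u v w r s. (\<And>i. i < n \<Longrightarrow> u i \<in> Qp) \<Longrightarrow> (\<And>i. i < n \<Longrightarrow> v i \<in> Qp) \<Longrightarrow>
        r \<in> Qp \<Longrightarrow> s \<in> Qp \<Longrightarrow> r \<oplus> s = \<one> \<Longrightarrow> (\<And>i. i < n \<Longrightarrow> w i = (r \<otimes> u i) \<oplus> (s \<otimes> v i)) \<Longrightarrow>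
        \<phi> w = (r \<otimes> \<phi> u) \<oplus> (s \<otimes> \<phi> v)"
begin

definition c where "c = \<phi> (\<lambda>_. \<zero>)"
definition f where "f v = \<phi> v \<ominus> c"

lemma c_cone: "c \<in> Qp" unfolding c_def by (rule \<phi>_cone) (rule cone_zero)

lemma c_closed [simp]: "c \<in> carrier Q" using c_cone by simp

lemma f_closed [simp]: "(\<And>i. i < n \<Longrightarrow> v i \<in> Qp) \<Longrightarrow> f v \<in> carrier Q"
  unfolding f_def using \<phi>_cone[of v] by simp

lemma \<phi>_eq: "(\<And>i. i < n \<Longrightarrow> v i \<in> Qp) \<Longrightarrow> \<phi> v = f v \<oplus> c"
  unfolding f_def using \<phi>_cone[of v, THEN cone_closed] c_closed by algebra

lemma f_cong:
  assumes v: "\<And>i. i < n \<Longrightarrow> v i \<in> Qp" and w: "\<And>i. i < n \<Longrightarrow> w i = v i"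
  shows "f w = f v"
proof -
  have "\<phi> w = (\<one> \<otimes> \<phi> v) \<oplus> (\<zero> \<otimes> \<phi> v)"
    by (rule mixture) (use v w cone_one cone_zero in auto)
  then show ?thesis using \<phi>_cone[OF v] by (simp add: f_def)
qed

text \<open>Mixing with the origin turns affinity into homogeneity: with \<open>t\<close> an invertible scalar that
  exceeds both \<open>r\<close> and \<open>1\<close> and \<open>p\<close> its inverse, \<open>r v\<close> is the mixture of \<open>t v\<close> and \<open>0\<close> with weight
  \<open>p r\<close>, and \<open>v\<close> is the mixture of \<open>t v\<close> and \<open>0\<close> with weight \<open>p\<close>.\<close>

lemma f_scale:
  assumes r: "r \<in> Qp" and v: "\<And>i. i < n \<Longrightarrow> v i \<in> Qp" and w: "\<And>i. i < n \<Longrightarrow> w i = r \<otimes> v i"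
  shows "f w = r \<otimes> f v"
proof -
  obtain p t s t' where *: "p \<in> Qp" "t \<in> Qp" "s \<in> Qp" "t' \<in> Qp"
    and e: "p \<otimes> t = \<one>" "t = r \<oplus> s" "t = \<one> \<oplus> t'" using invertible_above[OF r] by blast
  note C = *[THEN cone_closed] r[THEN cone_closed]
  define u where "u = (\<lambda>i. t \<otimes> v i)"
  have u: "\<And>i. i < n \<Longrightarrow> u i \<in> Qp" unfolding u_def using * v cone_mult by blast
  have tu: "\<phi> u \<in> carrier Q" using u \<phi>_cone cone_closed by blast
  have pu: "p \<otimes> u i = v i" if "i < n" for i
  proof -
    have "p \<otimes> u i = (p \<otimes> t) \<otimes> v i" unfolding u_def using C v[OF that, THEN cone_closed] by (simp add: m_assoc)
    then show ?thesis using e v[OF that] by simp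
  qed
  have "(p \<otimes> r) \<oplus> (p \<otimes> s) = p \<otimes> t" unfolding e(2) using C by algebra
  then have s1: "(p \<otimes> r) \<oplus> (p \<otimes> s) = \<one>" using e by simp
  have "p \<oplus> (p \<otimes> t') = p \<otimes> t" unfolding e(3) using C by algebra
  then have s2: "p \<oplus> (p \<otimes> t') = \<one>" using e by simp
  have "w i = ((p \<otimes> r) \<otimes> u i) \<oplus> ((p \<otimes> s) \<otimes> \<zero>)" if i: "i < n" for i
  proof -
    have "((p \<otimes> r) \<otimes> u i) \<oplus> ((p \<otimes> s) \<otimes> \<zero>) = r \<otimes> (p \<otimes> u i)" using C u[OF i, THEN cone_closed] by algebra
    then show ?thesis using pu[OF i] w[OF i] by simp
  qed
  then have "\<phi> w = ((p \<otimes> r) \<otimes> \<phi> u) \<oplus> ((p \<otimes> s) \<otimes> c)"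
    unfolding c_def using * r u s1 cone_mult cone_zero by (intro mixture) auto
  then have fw: "f w = ((p \<otimes> r) \<otimes> \<phi> u) \<oplus> ((p \<otimes> s) \<otimes> c) \<ominus> ((p \<otimes> r) \<oplus> (p \<otimes> s)) \<otimes> c"
    unfolding f_def s1 by simp
  have "v i = (p \<otimes> u i) \<oplus> ((p \<otimes> t') \<otimes> \<zero>)" if i: "i < n" for i
    using pu[OF i] C v[OF i] by simp
  then have "\<phi> v = (p \<otimes> \<phi> u) \<oplus> ((p \<otimes> t') \<otimes> c)"
    unfolding c_def using * u s2 cone_mult cone_zero by (intro mixture) auto
  then have fv: "f v = (p \<otimes> \<phi> u) \<oplus> ((p \<otimes> t') \<otimes> c) \<ominus> (p \<oplus> (p \<otimes> t')) \<otimes> c"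
    unfolding f_def s2 by simp
  show ?thesis unfolding fw fv using C tu c_closed by algebra
qed

text \<open>The sum \<open>u + v\<close> is the equal mixture of \<open>2 u\<close> and \<open>2 v\<close>, and \<open>f\<close> is homogeneous.\<close>

lemma f_add:
  assumes u: "\<And>i. i < n \<Longrightarrow> u i \<in> Qp" and v: "\<And>i. i < n \<Longrightarrow> v i \<in> Qp" and w: "\<And>i. i < n \<Longrightarrow> w i = u i \<oplus> v i"
  shows "f w = f u \<oplus> f v"
proof -
  obtain h where h: "h \<in> Qp" "h \<oplus> h = \<one>" using half_ex by blast
  have two: "\<one> \<oplus> \<one> \<in> Qp" using cone_one cone_add by blast
  have hh: "h \<otimes> ((\<one> \<oplus> \<one>) \<otimes> x) = x" if "x \<in> carrier Q" for x
  proof -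
    have "h \<otimes> ((\<one> \<oplus> \<one>) \<otimes> x) = (h \<oplus> h) \<otimes> x" using that h(1)[THEN cone_closed] by algebra
    then show ?thesis using h(2) that by simp
  qed
  let ?u = "\<lambda>i. (\<one> \<oplus> \<one>) \<otimes> u i" and ?v = "\<lambda>i. (\<one> \<oplus> \<one>) \<otimes> v i"
  have u': "\<And>i. i < n \<Longrightarrow> ?u i \<in> Qp" and v': "\<And>i. i < n \<Longrightarrow> ?v i \<in> Qp" using u v two cone_mult by auto
  have "\<phi> w = (h \<otimes> \<phi> ?u) \<oplus> (h \<otimes> \<phi> ?v)"
    using u' v' h w hh u v by (intro mixture) auto
  also have "\<phi> ?u = ((\<one> \<oplus> \<one>) \<otimes> f u) \<oplus> c" using \<phi>_eq[of ?u] f_scale[OF two u] u' by simp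
  also have "\<phi> ?v = ((\<one> \<oplus> \<one>) \<otimes> f v) \<oplus> c" using \<phi>_eq[of ?v] f_scale[OF two v] v' by simp
  finally have w': "\<phi> w = (h \<otimes> (((\<one> \<oplus> \<one>) \<otimes> f u) \<oplus> c)) \<oplus> (h \<otimes> (((\<one> \<oplus> \<one>) \<otimes> f v) \<oplus> c))" .
  have fuv: "f u \<in> carrier Q" "f v \<in> carrier Q" using u v by auto
  have "\<phi> w = (h \<otimes> ((\<one> \<oplus> \<one>) \<otimes> f u)) \<oplus> (h \<otimes> ((\<one> \<oplus> \<one>) \<otimes> f v)) \<oplus> ((h \<oplus> h) \<otimes> c)"
    unfolding w' using fuv h(1)[THEN cone_closed] c_closed by algebra
  also have "\<dots> = f u \<oplus> f v \<oplus> c" using hh fuv h(2) by simp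
  finally have "f w = f u \<oplus> f v \<oplus> c \<ominus> c" unfolding f_def[of w] by simp
  then show ?thesis using fuv c_closed by algebra
qed

text \<open>The linear part is positive: \<open>c + n f(v) = c + f(n v) = \<phi>(n v)\<close> is positive for all \<open>n\<close>, so the
  multiples of \<open>- f(v)\<close> are bounded above by \<open>c\<close>, and the archimedean property applies.\<close>

lemma f_cone:
  assumes v: "\<And>i. i < n \<Longrightarrow> v i \<in> Qp"
  shows "f v \<in> Qp"
proof (rule cone_if_bounded_below)
  show "f v \<in> carrier Q" using v by simp
  show "c \<oplus> ([k] \<cdot> f v) \<in> Qp" for k :: nat
  proof -
    let ?r = "[k] \<cdot> \<one>"
    have r: "?r \<in> Qp" by (rule nat_add_pow_closed[OF cone_one])
    have "f (\<lambda>i. ?r \<otimes> v i) = ?r \<otimes> f v" by (rule f_scale[OF r v]) auto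
    also have "\<dots> = [k] \<cdot> f v" using v by (simp add: add_pow_ldistr)
    finally have "c \<oplus> ([k] \<cdot> f v) = \<phi> (\<lambda>i. ?r \<otimes> v i)"
      using \<phi>_eq[of "\<lambda>i. ?r \<otimes> v i"] v r cone_mult by (simp add: a_comm)
    then show ?thesis using \<phi>_cone v r cone_mult by simp
  qed
qed simp

definition unit_vector :: "nat \<Rightarrow> nat \<Rightarrow> 'a" where
  "unit_vector i k = (if i = k then \<one> else \<zero>)"

lemma unit_vector_cone: "unit_vector i k \<in> Qp"
  by (simp add: unit_vector_def cone_one cone_zero)

text \<open>A vector is the sum of its coordinates times the unit vectors; the truncations \<open>?t k\<close> of \<open>v\<close> build it
  up one coordinate at a time.\<close>

lemma \<phi>_expansion:
  assumes v: "\<And>i. i < n \<Longrightarrow> v i \<in> Qp"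
  shows "\<phi> v = (\<Oplus>i \<in> {..<n}. f (unit_vector i) \<otimes> v i) \<oplus> c"
proof -
  let ?t = "\<lambda>k i. if i < k then v i else \<zero>"
  have t: "?t k i \<in> Qp" if "i < n" for k i using v that cone_zero by simp
  have fe: "f (unit_vector i) \<in> carrier Q" for i using unit_vector_cone by simp
  have "f (?t k) = (\<Oplus>i \<in> {..<k}. f (unit_vector i) \<otimes> v i)" if "k \<le> n" for k
    using that
  proof (induction k)
    case 0
    have "f (?t 0) = \<zero> \<otimes> f (?t 0)" by (rule f_scale) (use cone_zero in auto)
    then show ?case using cone_zero by simp
  next
    case (Suc k)
    let ?w = "\<lambda>i. v k \<otimes> unit_vector k i"
    have w: "?w i \<in> Qp" if "i < n" for i using v[of k] Suc.prems unit_vector_cone cone_mult by auto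
    have "f (?t (Suc k)) = f (?t k) \<oplus> f ?w"
      by (rule f_add) (use t w v Suc.prems in \<open>auto simp: unit_vector_def less_Suc_eq cone_zero\<close>)
    also have "f ?w = v k \<otimes> f (unit_vector k)"
      by (rule f_scale) (use v Suc.prems unit_vector_cone in auto)
    also have "f (?t k) = (\<Oplus>i \<in> {..<k}. f (unit_vector i) \<otimes> v i)" using Suc by simp
    finally show ?case using Suc.prems v fe
      by (simp add: lessThan_Suc finsum_insert Pi_def a_comm m_comm)
  qed
  from this[of n] have "f (?t n) = (\<Oplus>i \<in> {..<n}. f (unit_vector i) \<otimes> v i)" by simp
  moreover have "f (?t n) = f v" by (rule f_cong) (use v in auto)
  ultimately show ?thesis using \<phi>_eq[OF v] by simp
qed

end

section \<open>Preordered rings and generating classes\<close>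

locale comm_preordered_ring = base \<V> for \<V> :: "('o, 'm) ccc" (structure) +
  fixes R P :: "('o, 'm) rig_data" and \<iota> :: 'm
  assumes cpr: "is_comm_preordered_ring \<V> R P \<iota>"
begin

sublocale R: rig \<V> R
  by unfold_locales (use cpr in \<open>simp add: is_comm_preordered_ring_def is_preordered_ring_def is_ring_def\<close>)

sublocale R: comm_rig \<V> R
proof
  fix x y Y assume *: "x \<in> \<H> Y R.K" "y \<in> \<H> Y R.K"
  let ?p = "proj \<V> R.K (Suc (Suc 0))"
  have "gtimes \<V> R (?p 0) (?p 1) = gtimes \<V> R (?p 1) (?p 0)"
    using cpr by (simp add: is_comm_preordered_ring_def Let_def numeral_2_eq_2)
  then have "gtimes \<V> R (?p 0) (?p 1) \<bullet> \<langle>x, y\<rangle> = gtimes \<V> R (?p 1) (?p 0) \<bullet> \<langle>x, y\<rangle>" by simp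
  then show "gtimes \<V> R x y = gtimes \<V> R y x" using * by simp
qed

sublocale rig \<V> P
  by unfold_locales (use cpr in \<open>simp add: is_comm_preordered_ring_def is_preordered_ring_def\<close>)

lemma incl_arr [simp]: "arr \<iota>" "src \<iota> = K" "tgt \<iota> = R.K"
  using cpr by (simp_all add: is_comm_preordered_ring_def is_preordered_ring_def is_rig_hom_def)

lemma incl_hom:
  assumes "x \<in> \<H> Y K" "y \<in> \<H> Y K"
  shows "\<iota> \<bullet> (x \<boxplus> y) = gplus \<V> R (\<iota> \<bullet> x) (\<iota> \<bullet> y)" "\<iota> \<bullet> (x \<boxtimes> y) = gtimes \<V> R (\<iota> \<bullet> x) (\<iota> \<bullet> y)"
    "\<iota> \<bullet> nul Y = gnull \<V> R Y" "\<iota> \<bullet> unt Y = gunit \<V> R Y"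
proof -
  have h: "\<iota> \<bullet> Plus P = Plus R \<bullet> parr \<V> \<iota> \<iota>" "\<iota> \<bullet> Null P = Null R"
     "\<iota> \<bullet> Times P = Times R \<bullet> parr \<V> \<iota> \<iota>" "\<iota> \<bullet> Unit P = Unit R"
    using cpr by (simp_all add: is_comm_preordered_ring_def is_preordered_ring_def is_rig_hom_def)
  have Y: "obj Y" using assms by auto
  show "\<iota> \<bullet> (x \<boxplus> y) = gplus \<V> R (\<iota> \<bullet> x) (\<iota> \<bullet> y)" "\<iota> \<bullet> (x \<boxtimes> y) = gtimes \<V> R (\<iota> \<bullet> x) (\<iota> \<bullet> y)"
    using h(1,3)[THEN arg_cong, of "\<lambda>f. f \<bullet> \<langle>x, y\<rangle>"] assms by (simp_all add: gplus_def gtimes_def)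
  show "\<iota> \<bullet> nul Y = gnull \<V> R Y" "\<iota> \<bullet> unt Y = gunit \<V> R Y"
    using h(2,4)[THEN arg_cong, of "\<lambda>f. f \<bullet> bng Y"] Y by (simp_all add: gnull_def gunit_def)
qed

lemma incl_inj:
  assumes "x \<in> \<H> Y K" "y \<in> \<H> Y K" "\<iota> \<bullet> x = \<iota> \<bullet> y"
  shows "x = y"
  using cpr assms by (simp add: is_comm_preordered_ring_def is_preordered_ring_def monic_def)

sublocale comm_rig \<V> P
proof
  fix x y Y assume *: "x \<in> \<H> Y K" "y \<in> \<H> Y K"
  have "\<iota> \<bullet> (x \<boxtimes> y) = gtimes \<V> R (\<iota> \<bullet> x) (\<iota> \<bullet> y)" by (rule incl_hom(2)[OF *])
  also have "\<dots> = gtimes \<V> R (\<iota> \<bullet> y) (\<iota> \<bullet> x)" by (rule R.times_comm[of _ Y]) (use * in simp_all)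
  also have "\<dots> = \<iota> \<bullet> (y \<boxtimes> x)" by (rule incl_hom(2)[OF *(2,1), symmetric])
  finally have eq: "\<iota> \<bullet> (x \<boxtimes> y) = \<iota> \<bullet> (y \<boxtimes> x)" .
  show "x \<boxtimes> y = y \<boxtimes> x" by (rule incl_inj[OF _ _ eq, of Y]) (use * in simp_all)
qed

lemma hom_ring_cring:
  assumes Y: "obj Y"
  shows "cring (hom_ring \<V> Y R)"
proof -
  interpret S: semiring "hom_ring \<V> Y R" by (rule R.hom_ring_semiring[OF Y])
  obtain \<nu> where \<nu>: "arr \<nu>" "src \<nu> = R.K" "tgt \<nu> = R.K"
    and \<nu>0: "gplus \<V> R \<nu> (ide R.K) = gnull \<V> R R.K"
    using cpr by (auto simp: is_comm_preordered_ring_def is_preordered_ring_def is_ring_def)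
  show ?thesis
  proof (rule cringI)
    show "abelian_group (hom_ring \<V> Y R)"
    proof (rule abelian_groupI)
      fix x assume x: "x \<in> carrier (hom_ring \<V> Y R)"
      have "gplus \<V> R (\<nu> \<bullet> x) x = gnull \<V> R Y"
        using \<nu>0[THEN arg_cong, of "\<lambda>f. f \<bullet> x"] \<nu> x by (simp add: R.hom_ring_simps)
      then show "\<exists>y\<in>carrier (hom_ring \<V> Y R). y \<oplus>\<^bsub>hom_ring \<V> Y R\<^esub> x = \<zero>\<^bsub>hom_ring \<V> Y R\<^esub>"
        using \<nu> x by (intro bexI[of _ "\<nu> \<bullet> x"]) (simp_all add: R.hom_ring_simps)
    qed (use S.a_closed S.zero_closed S.a_ac S.l_zero in auto)
    show "comm_monoid (hom_ring \<V> Y R)"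
      by (rule Group.comm_monoidI) (use Y R.times_laws(1,4) R.times_comm in \<open>auto simp: R.hom_ring_simps\<close>)
  qed (rule S.l_distr)
qed

text \<open>Addition in \<open>P\<close> is cancellative because \<open>P\<close> embeds in a ring; the coefficients of an affine form
  are unique for this reason.\<close>

lemma plus_cancel:
  assumes "x \<in> \<H> Y K" "y \<in> \<H> Y K" "z \<in> \<H> Y K" "x \<boxplus> z = y \<boxplus> z"
  shows "x = y"
proof -
  have Y: "obj Y" using assms by auto
  interpret S: cring "hom_ring \<V> Y R" by (rule hom_ring_cring[OF Y])
  have "(\<iota> \<bullet> x) \<oplus>\<^bsub>hom_ring \<V> Y R\<^esub> (\<iota> \<bullet> z) = (\<iota> \<bullet> y) \<oplus>\<^bsub>hom_ring \<V> Y R\<^esub> (\<iota> \<bullet> z)"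
    using incl_hom(1)[of x Y z] incl_hom(1)[of y Y z] assms by (simp add: R.hom_ring_simps)
  moreover have "\<iota> \<bullet> x \<in> carrier (hom_ring \<V> Y R)" "\<iota> \<bullet> y \<in> carrier (hom_ring \<V> Y R)" "\<iota> \<bullet> z \<in> carrier (hom_ring \<V> Y R)"
    using assms by (auto simp: R.hom_ring_simps)
  ultimately have "\<iota> \<bullet> x = \<iota> \<bullet> y" using S.add.right_cancel by blast
  then show ?thesis using incl_inj assms by blast
qed

lemma gsum_incl:
  assumes "obj Y" "\<And>i. i < n \<Longrightarrow> F i \<in> \<H> Y K"
  shows "\<iota> \<bullet> gsum \<V> P Y n F = (\<Oplus>\<^bsub>hom_ring \<V> Y R\<^esub>i \<in> {..<n}. \<iota> \<bullet> F i)"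
proof -
  interpret S: cring "hom_ring \<V> Y R" by (rule hom_ring_cring[OF assms(1)])
  show ?thesis
    using assms(2)
  proof (induction n)
    case 0
    then show ?case using incl_hom(3)[of "nul Y" Y "nul Y"] assms(1) by (simp add: R.hom_ring_simps)
  next
    case (Suc n)
    have "\<iota> \<bullet> F i \<in> carrier (hom_ring \<V> Y R)" if "i < Suc n" for i
      using Suc.prems[OF that] by (simp add: R.hom_ring_simps)
    then have "(\<Oplus>\<^bsub>hom_ring \<V> Y R\<^esub>i \<in> {..<Suc n}. \<iota> \<bullet> F i) =
        (\<iota> \<bullet> F n) \<oplus>\<^bsub>hom_ring \<V> Y R\<^esub> (\<Oplus>\<^bsub>hom_ring \<V> Y R\<^esub>i \<in> {..<n}. \<iota> \<bullet> F i)"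
      by (simp add: lessThan_Suc S.finsum_insert Pi_def)
    also have "\<dots> = gplus \<V> R (\<iota> \<bullet> gsum \<V> P Y n F) (\<iota> \<bullet> F n)"
    proof -
      have "\<iota> \<bullet> gsum \<V> P Y n F \<in> \<H> Y R.K" "\<iota> \<bullet> F n \<in> \<H> Y R.K"
        using Suc.prems assms(1) by simp_all
      then show ?thesis using Suc.IH[symmetric] R.plus_laws(2) Suc.prems
        by (simp add: R.hom_ring_simps del: hom_iff)
    qed
    finally show ?case
      using incl_hom(1)[of "gsum \<V> P Y n F" Y "F n"] Suc.prems assms(1) by simp
  qed
qed

end

locale firm_preordered_ring = comm_preordered_ring \<V> R P \<iota> for \<V> :: "('o, 'm) ccc" (structure) and R P \<iota> +
  fixes \<G> :: "'o set"
  assumes strong: "strong_mono \<V> \<iota>" and gen: "generating \<V> \<G>"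
    and firm: "\<And>G. G \<in> \<G> \<Longrightarrow> firmly_archimedean (hom_ring \<V> G R) (hom_pos \<V> G \<iota>)"
    and dyadic: "\<And>G. G \<in> \<G> \<Longrightarrow> preordered_dyadic_algebra (hom_ring \<V> G R) (hom_pos \<V> G \<iota>)"
begin

lemma gen_obj [simp]: "G \<in> \<G> \<Longrightarrow> obj G"
  using gen by (auto simp: generating_def)

lemma gen_eqI:
  assumes "f \<in> \<H> A B" "g \<in> \<H> A B" "\<And>G x. G \<in> \<G> \<Longrightarrow> x \<in> \<H> G A \<Longrightarrow> f \<bullet> x = g \<bullet> x"
  shows "f = g"
proof -
  have "obj A" "obj B" using assms by auto
  then show ?thesis using gen assms unfolding generating_def by blast
qed

text \<open>Positivity is detected on the generating class: the pullback of \<open>\<iota>\<close> along \<open>a\<close> is epic because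
  every arrow from a generating object factors through it, so the diagonal fill-in property of the
  strong monomorphism \<open>\<iota>\<close> provides the factorization of \<open>a\<close>.\<close>

lemma factor_through_positive:
  assumes a: "a \<in> \<H> X R.K"
    and pos: "\<And>G x. G \<in> \<G> \<Longrightarrow> x \<in> \<H> G X \<Longrightarrow> \<exists>k \<in> \<H> G K. \<iota> \<bullet> k = a \<bullet> x"
  shows "\<exists>q \<in> \<H> X K. \<iota> \<bullet> q = a"
proof -
  have X: "obj X" and a': "arr a" "src a = X" "tgt a = R.K" using a by auto
  \<comment> \<open>The pullback of \<open>\<iota>\<close> along \<open>a\<close> is constructed as an equalizer on the product.\<close>
  obtain e where e: "is_equalizer \<V> (\<iota> \<bullet> Pr1 \<V> K X) (a \<bullet> Pr2 \<V> K X) e"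
    using equalizer_ex[of "\<iota> \<bullet> Pr1 \<V> K X" "a \<bullet> Pr2 \<V> K X"] a' X by auto
  have e': "arr e" "tgt e = K \<star> X" and ee: "(\<iota> \<bullet> Pr1 \<V> K X) \<bullet> e = (a \<bullet> Pr2 \<V> K X) \<bullet> e"
    using equalizerD(1-3)[OF e] a' X by simp_all
  have el: "\<exists>l. l \<in> \<H> Y (src e) \<and> e \<bullet> l = h"
    if "h \<in> \<H> Y (K \<star> X)" "(\<iota> \<bullet> Pr1 \<V> K X) \<bullet> h = (a \<bullet> Pr2 \<V> K X) \<bullet> h" for h Y
    using equalizerD(4)[OF e, of h Y] that a' X by auto
  let ?m = "Pr2 \<V> K X \<bullet> e" and ?u = "Pr1 \<V> K X \<bullet> e"
  have m: "?m \<in> \<H> (src e) X" and u: "?u \<in> \<H> (src e) K" using e' X by auto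
  have "epic \<V> ?m" unfolding epic_def
  proof (intro conjI ballI impI)
    show "arr ?m" using m by simp
    fix f g assume fg: "arr f" "arr g"
      "tgt f = tgt g \<and> src f = tgt ?m \<and> src g = tgt ?m \<and> f \<bullet> ?m = g \<bullet> ?m"
    have "src f = X" "src g = X" using fg(3) m by auto
    show "f = g"
    proof (rule gen_eqI[of _ X "tgt g"])
      show "f \<in> \<H> X (tgt g)" "g \<in> \<H> X (tgt g)" using fg m by auto
      fix G x assume G: "G \<in> \<G>" and x: "x \<in> \<H> G X"
      obtain k where k: "k \<in> \<H> G K" "\<iota> \<bullet> k = a \<bullet> x" using pos[OF G x] by blast
      obtain l where l: "l \<in> \<H> G (src e)" "e \<bullet> l = \<langle>k, x\<rangle>"
        using el[of "\<langle>k, x\<rangle>" G] k x a X by auto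
      have "?m \<bullet> l = x" using l k x e' X by simp
      moreover have "(f \<bullet> ?m) \<bullet> l = (g \<bullet> ?m) \<bullet> l" using fg(3) by simp
      moreover have "(f \<bullet> ?m) \<bullet> l = f \<bullet> (?m \<bullet> l)" "(g \<bullet> ?m) \<bullet> l = g \<bullet> (?m \<bullet> l)"
        using fg(1,2) \<open>src f = X\<close> \<open>src g = X\<close> m l X e' by simp_all
      ultimately show "f \<bullet> x = g \<bullet> x" by simp
    qed
  qed
  note epic = this
  have t: "tgt ?m = X" "src ?m = src e" using m by simp_all
  have "\<exists>!d. d \<in> \<H> (tgt ?m) (src \<iota>) \<and> d \<bullet> ?m = ?u \<and> \<iota> \<bullet> d = a"
  proof (rule strong[unfolded strong_mono_def, THEN conjunct2, rule_format, OF epic])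
    show "?u \<in> \<H> (src ?m) (src \<iota>)" unfolding t using u by simp
    show "a \<in> \<H> (tgt ?m) (tgt \<iota>)" unfolding t using a by simp
    show "\<iota> \<bullet> ?u = a \<bullet> ?m" using ee e' X a' by simp
  qed
  then show ?thesis unfolding t incl_arr by blast
qed

text \<open>The element \<open>1/2\<close> is the image of the dyadic number \<open>1/2\<close>, which is positive because the structure
  map is monotone.\<close>

lemma hom_pos_cone:
  assumes G: "G \<in> \<G>"
  shows "archimedean_cone (hom_ring \<V> G R) (hom_pos \<V> G \<iota>)"
proof -
  have G': "obj G" using G by simp
  interpret S: cring "hom_ring \<V> G R" by (rule hom_ring_cring[OF G'])
  let ?Q = "hom_ring \<V> G R"
  have pos: "\<iota> \<bullet> k \<in> hom_pos \<V> G \<iota>" if "k \<in> \<H> G K" for k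
    using that unfolding hom_pos_def by simp
  have ex: "\<exists>k \<in> \<H> G K. x = \<iota> \<bullet> k" if "x \<in> hom_pos \<V> G \<iota>" for x
    using that unfolding hom_pos_def by auto
  have z: "gnull \<V> R G = \<iota> \<bullet> nul G" "gunit \<V> R G = \<iota> \<bullet> unt G"
    using incl_hom(3,4)[of "nul G" G "nul G"] G' by auto
  have half: "\<exists>x \<in> hom_pos \<V> G \<iota>. x \<oplus>\<^bsub>?Q\<^esub> x = \<one>\<^bsub>?Q\<^esub>"
  proof -
    obtain h where h: "h \<in> ring_hom dyadic_ring ?Q"
      and mono: "\<And>x y. x \<in> carrier dyadic_ring \<Longrightarrow> y \<in> carrier dyadic_ring \<Longrightarrow> x \<le> y \<Longrightarrow> pre_le ?Q (hom_pos \<V> G \<iota>) (h x) (h y)"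
      using dyadic[OF G] unfolding preordered_dyadic_algebra_def by blast
    have c: "(0::rat) \<in> carrier dyadic_ring" "(1/2::rat) \<in> carrier dyadic_ring"
    proof -
      have "(0::rat) = of_int 0 / 2 ^ 0" "(1/2::rat) = of_int 1 / 2 ^ 1" by simp_all
      then show "(0::rat) \<in> carrier dyadic_ring" "(1/2::rat) \<in> carrier dyadic_ring"
        unfolding dyadic_ring_def partial_object.simps by blast+
    qed
    have "h (0 + 0) = h 0 \<oplus>\<^bsub>?Q\<^esub> h 0" "h (1/2 + 1/2) = h (1/2) \<oplus>\<^bsub>?Q\<^esub> h (1/2)"
      using ring_hom_add[OF h c(1) c(1)] ring_hom_add[OF h c(2) c(2)] by (simp_all add: dyadic_ring_def)
    moreover have "h 1 = \<one>\<^bsub>?Q\<^esub>" using ring_hom_one[OF h] by (simp add: dyadic_ring_def)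
    moreover have hc: "h 0 \<in> carrier ?Q" "h (1/2) \<in> carrier ?Q" using ring_hom_closed[OF h] c by auto
    ultimately have h0: "h 0 = \<zero>\<^bsub>?Q\<^esub>" and h2: "h (1/2) \<oplus>\<^bsub>?Q\<^esub> h (1/2) = \<one>\<^bsub>?Q\<^esub>"
      by (auto simp: S.add.l_cancel_one)
    have "h (1/2) \<ominus>\<^bsub>?Q\<^esub> h 0 \<in> hom_pos \<V> G \<iota>"
      using mono[OF c] unfolding pre_le_def by simp
    then show ?thesis using h0 h2 hc by (auto simp: S.minus_eq)
  qed
  show ?thesis
  proof (unfold_locales)
    show "hom_pos \<V> G \<iota> \<subseteq> carrier ?Q" by (auto simp: hom_pos_def R.hom_ring_simps)
    fix x y assume "x \<in> hom_pos \<V> G \<iota>" "y \<in> hom_pos \<V> G \<iota>"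
    then obtain k l where kl: "k \<in> \<H> G K" "l \<in> \<H> G K" "x = \<iota> \<bullet> k" "y = \<iota> \<bullet> l" using ex by metis
    show "x \<oplus>\<^bsub>?Q\<^esub> y \<in> hom_pos \<V> G \<iota>" "x \<otimes>\<^bsub>?Q\<^esub> y \<in> hom_pos \<V> G \<iota>"
      using incl_hom(1,2)[OF kl(1,2)] pos[of "k \<boxplus> l"] pos[of "k \<boxtimes> l"] kl by (auto simp: R.hom_ring_simps)
  next
    show "\<zero>\<^bsub>?Q\<^esub> \<in> hom_pos \<V> G \<iota>" "\<one>\<^bsub>?Q\<^esub> \<in> hom_pos \<V> G \<iota>"
      using z pos[of "nul G"] pos[of "unt G"] G' by (auto simp: R.hom_ring_simps)
  qed (use firm[OF G] half in auto)
qed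

end

section \<open>The algebra of affine matrices\<close>

context base
begin

lemma alg_pow_obj: "FObj (alg_pow \<V> T A n) k = pow \<V> (FObj A k) n"
  by (simp add: alg_pow_def)

lemma alg_pow_typed:
  assumes "stage_typed T A"
  shows "stage_typed T (alg_pow \<V> T A n)"
  using stage_typedD[OF assms] unfolding stage_typed_def
  by (simp add: alg_pow_def Let_def)

lemma act_alg_pow:
  assumes "stage_typed T A" "h \<in> \<H> Y (VHom T k l)" "u \<in> \<H> Y (pow \<V> (FObj A k) n)"
  shows "act (alg_pow \<V> T A n) k l h u = tuple \<V> Y (FObj A l) n (\<lambda>i. act A k l h (proj \<V> (FObj A k) n i \<bullet> u))"
  using stage_typedD[OF assms(1)] assms(2,3) unfolding act_def
  by (simp add: alg_pow_def Let_def)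

end

context rig
begin

lemma mat_obj [simp]: "obj (mat \<V> P k n)"
  by (simp add: mat_def)

lemma entry_arr [simp]:
  assumes "i < n" "\<kappa> < k"
  shows "arr (entry \<V> P k n i \<kappa>)" "src (entry \<V> P k n i \<kappa>) = mat \<V> P k n" "tgt (entry \<V> P k n i \<kappa>) = K"
  using assms by (simp_all add: entry_def mat_def)

lemma mk_mat_cong [cong]:
  assumes "Q = Q'" "Y = Y'" "k = k'" "n = n'" "\<And>i \<kappa>. i < n' =simp=> \<kappa> < k' =simp=> F i \<kappa> = G i \<kappa>"
  shows "mk_mat \<V> Q Y k n F = mk_mat \<V> Q' Y' k' n' G"
  using assms unfolding mk_mat_def simp_implies_def by simp

lemma mk_mat_arr [simp]:
  assumes "obj Y" "\<And>i \<kappa>. i < n \<Longrightarrow> \<kappa> < k \<Longrightarrow> F i \<kappa> \<in> \<H> Y K"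
  shows "arr (mk_mat \<V> P Y k n F)" "src (mk_mat \<V> P Y k n F) = Y" "tgt (mk_mat \<V> P Y k n F) = mat \<V> P k n"
  using assms by (simp_all add: mk_mat_def mat_def)

lemma entry_mk_mat [simp]:
  assumes "obj Y" "\<And>i \<kappa>. i < n \<Longrightarrow> \<kappa> < k \<Longrightarrow> F i \<kappa> \<in> \<H> Y K" "i < n" "\<kappa> < k"
  shows "entry \<V> P k n i \<kappa> \<bullet> mk_mat \<V> P Y k n F = F i \<kappa>"
  using assms by (simp add: mk_mat_def entry_def)

lemma mat_eqI:
  assumes "u \<in> \<H> Y (mat \<V> P k n)" "v \<in> \<H> Y (mat \<V> P k n)"
    "\<And>i \<kappa>. i < n \<Longrightarrow> \<kappa> < k \<Longrightarrow> entry \<V> P k n i \<kappa> \<bullet> u = entry \<V> P k n i \<kappa> \<bullet> v"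
  shows "u = v"
proof (rule pow_eqI[of _ Y "pow \<V> K k" n])
  fix i assume i: "i < n"
  show "proj \<V> (pow \<V> K k) n i \<bullet> u = proj \<V> (pow \<V> K k) n i \<bullet> v"
    by (rule pow_eqI[of _ Y K k]) (use assms i in \<open>auto simp: entry_def mat_def\<close>)
qed (use assms in \<open>auto simp: mat_def\<close>)

lemma mk_mat_comp [simp]:
  assumes "\<And>i \<kappa>. i < n \<Longrightarrow> \<kappa> < k \<Longrightarrow> F i \<kappa> \<in> \<H> Y K" "arr h" "tgt h = Y"
  shows "mk_mat \<V> P Y k n F \<bullet> h = mk_mat \<V> P (src h) k n (\<lambda>i \<kappa>. F i \<kappa> \<bullet> h)"
proof -
  have "obj Y" using assms(2,3) by auto
  then show ?thesis using assms by (simp add: mk_mat_def)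
qed

abbreviation aff where "aff \<equiv> aff_incl \<V> P"

lemma aff_equalizer:
  "is_equalizer \<V> (tuple \<V> (mat \<V> P n m) K m (\<lambda>j. gsum \<V> P (mat \<V> P n m) n (entry \<V> P n m j)))
     (tuple \<V> (mat \<V> P n m) K m (\<lambda>j. unt (mat \<V> P n m))) (aff n m)"
  unfolding aff_incl_def by (rule equalizer_is_equalizer) simp_all

lemma aff_arr [simp]: "arr (aff n m)" "tgt (aff n m) = mat \<V> P n m"
  using equalizerD(1,2)[OF aff_equalizer[of n m]] by simp_all

lemma aff_row_sum:
  assumes h: "h \<in> \<H> Y (src (aff k l))" and l: "\<nu> < l"
  shows "gsum \<V> P Y k (\<lambda>\<kappa>. entry \<V> P k l \<nu> \<kappa> \<bullet> aff k l \<bullet> h) = unt Y"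
proof -
  have Y: "obj Y" using h by auto
  have "proj \<V> K l \<nu> \<bullet> (tuple \<V> (mat \<V> P k l) K l (\<lambda>j. gsum \<V> P (mat \<V> P k l) k (entry \<V> P k l j)) \<bullet> aff k l) \<bullet> h
     = proj \<V> K l \<nu> \<bullet> (tuple \<V> (mat \<V> P k l) K l (\<lambda>j. unt (mat \<V> P k l)) \<bullet> aff k l) \<bullet> h"
    unfolding equalizerD(3)[OF aff_equalizer[of k l]] ..
  then show ?thesis using h l Y by simp
qed

text \<open>Elements of the hom-object from \<open>k\<close> to \<open>l\<close> are the matrices of elements whose rows sum to \<open>1\<close>, by
  the universal property of the equalizer.\<close>

lemma aff_element:
  assumes Y: "obj Y" and M: "\<And>\<nu> \<kappa>. \<nu> < l \<Longrightarrow> \<kappa> < k \<Longrightarrow> M \<nu> \<kappa> \<in> \<H> Y K"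
    and sum: "\<And>\<nu>. \<nu> < l \<Longrightarrow> gsum \<V> P Y k (M \<nu>) = unt Y"
  obtains h where "h \<in> \<H> Y (src (aff k l))"
    "\<And>\<nu> \<kappa>. \<nu> < l \<Longrightarrow> \<kappa> < k \<Longrightarrow> entry \<V> P k l \<nu> \<kappa> \<bullet> aff k l \<bullet> h = M \<nu> \<kappa>"
proof -
  let ?M = "mk_mat \<V> P Y k l M"
  have "\<exists>!h. h \<in> \<H> Y (src (aff k l)) \<and> aff k l \<bullet> h = ?M"
  proof (rule equalizerD(4)[OF aff_equalizer])
    show "tuple \<V> (mat \<V> P k l) K l (\<lambda>j. gsum \<V> P (mat \<V> P k l) k (entry \<V> P k l j)) \<bullet> ?M =
      tuple \<V> (mat \<V> P k l) K l (\<lambda>j. unt (mat \<V> P k l)) \<bullet> ?M"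
      using Y M sum by simp
  qed (use Y M in simp)
  then obtain h where "h \<in> \<H> Y (src (aff k l))" "aff k l \<bullet> h = ?M" by blast
  then show thesis using that[of h] Y M by simp
qed

lemma aff_alg_obj [simp]: "FObj (aff_alg \<V> P) k = pow \<V> K k"
  by (simp add: aff_alg_def)

lemma Mat_aff_hom [simp]: "VHom (Mat_aff \<V> P) k l = src (aff k l)"
  by (simp add: Mat_aff_def)

lemma aff_alg_typed: "stage_typed (Mat_aff \<V> P) (aff_alg \<V> P)"
  unfolding stage_typed_def by (simp add: aff_alg_def Let_def) (simp add: Mat_aff_def)

lemma act_aff_alg:
  assumes "h \<in> \<H> Y (src (aff k l))" "u \<in> \<H> Y (pow \<V> K k)"
  shows "act (aff_alg \<V> P) k l h u =
    tuple \<V> Y K l (\<lambda>j. gsum \<V> P Y k (\<lambda>i. (entry \<V> P k l j i \<bullet> aff k l \<bullet> h) \<boxtimes> (proj \<V> K k i \<bullet> u)))"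
  using assms unfolding act_def by (simp add: aff_alg_def Let_def)

text \<open>An element of the \<open>n\<close>-th power at \<open>k\<close> is an array of \<open>n\<close> vectors with \<open>k\<close> entries each; a matrix acts
  on every one of the vectors separately.\<close>

lemma entry_act:
  assumes h: "h \<in> \<H> Y (src (aff k l))" and u: "u \<in> \<H> Y (mat \<V> P k n)" and i: "i < n" "\<nu> < l"
  shows "entry \<V> P l n i \<nu> \<bullet> act (alg_pow \<V> (Mat_aff \<V> P) (aff_alg \<V> P) n) k l h u =
    gsum \<V> P Y k (\<lambda>\<kappa>. (entry \<V> P k l \<nu> \<kappa> \<bullet> aff k l \<bullet> h) \<boxtimes> (entry \<V> P k n i \<kappa> \<bullet> u))"
proof -
  have Y: "obj Y" using h by auto
  have u': "arr u" "src u = Y" "tgt u = pow \<V> (pow \<V> K k) n" using u by (auto simp: mat_def)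
  have "act (alg_pow \<V> (Mat_aff \<V> P) (aff_alg \<V> P) n) k l h u =
     tuple \<V> Y (pow \<V> K l) n (\<lambda>i. act (aff_alg \<V> P) k l h (proj \<V> (pow \<V> K k) n i \<bullet> u))"
    using act_alg_pow[OF aff_alg_typed, of h Y k l u n] h u' by simp
  also have "\<dots> = mk_mat \<V> P Y l n (\<lambda>i \<nu>. gsum \<V> P Y k (\<lambda>\<kappa>. (entry \<V> P k l \<nu> \<kappa> \<bullet> aff k l \<bullet> h) \<boxtimes> (entry \<V> P k n i \<kappa> \<bullet> u)))"
    using h u' by (simp add: act_aff_alg mk_mat_def entry_def)
  finally show ?thesis using h u Y i by simp
qed

end

section \<open>Families of affine forms\<close>

context comm_preordered_ring
begin

abbreviation T where "T \<equiv> Mat_aff \<V> P"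
abbreviation Spow where "Spow \<equiv> alg_pow \<V> T (aff_alg \<V> P)"

lemma Spow_obj [simp]: "FObj (Spow n) k = mat \<V> P k n"
  by (simp add: alg_pow_obj mat_def)

lemma Spow_typed: "stage_typed T (Spow n)"
  by (rule alg_pow_typed[OF aff_alg_typed])

text \<open>The family \<open>\<alpha>\<close>, parametrized by \<open>X\<close>, is given by \<open>m\<close> affine forms in \<open>n\<close> variables: the \<open>j\<close>-th one has
  linear coefficients \<open>q j 0, \<dots>, q j (n - 1)\<close> and constant term \<open>q j n\<close>, and it is applied
  separately to each of the \<open>k\<close> entries of the argument vectors.\<close>

definition has_coefficients :: "nat \<Rightarrow> nat \<Rightarrow> 'o \<Rightarrow> (nat \<Rightarrow> 'm) \<Rightarrow> (nat \<Rightarrow> nat \<Rightarrow> 'm) \<Rightarrow> bool" where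
  "has_coefficients n m X \<alpha> q \<longleftrightarrow>
     (\<forall>k. \<alpha> k \<in> \<H> X (Exp \<V> (mat \<V> P k n) (mat \<V> P k m))) \<and> (\<forall>j<m. \<forall>i\<le>n. q j i \<in> \<H> X K) \<and>
     (\<forall>k Y x u j \<kappa>. x \<in> \<H> Y X \<longrightarrow> u \<in> \<H> Y (mat \<V> P k n) \<longrightarrow> j < m \<longrightarrow> \<kappa> < k \<longrightarrow>
        entry \<V> P k m j \<kappa> \<bullet> ap (mat \<V> P k n) (mat \<V> P k m) (\<alpha> k \<bullet> x) u =
        form Y n (\<lambda>i. q j i \<bullet> x) (\<lambda>i. entry \<V> P k n i \<kappa> \<bullet> u))"

lemma has_coefficientsD:
  assumes "has_coefficients n m X \<alpha> q"
  shows "arr (\<alpha> k)" "src (\<alpha> k) = X" "tgt (\<alpha> k) = Exp \<V> (mat \<V> P k n) (mat \<V> P k m)" "obj X"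
    "j < m \<Longrightarrow> i \<le> n \<Longrightarrow> arr (q j i)" "j < m \<Longrightarrow> i \<le> n \<Longrightarrow> src (q j i) = X" "j < m \<Longrightarrow> i \<le> n \<Longrightarrow> tgt (q j i) = K"
    "x \<in> \<H> Y X \<Longrightarrow> u \<in> \<H> Y (mat \<V> P k n) \<Longrightarrow> j < m \<Longrightarrow> \<kappa> < k \<Longrightarrow>
        entry \<V> P k m j \<kappa> \<bullet> ap (mat \<V> P k n) (mat \<V> P k m) (\<alpha> k \<bullet> x) u =
        form Y n (\<lambda>i. q j i \<bullet> x) (\<lambda>i. entry \<V> P k n i \<kappa> \<bullet> u)"
proof -
  note h = assms[unfolded has_coefficients_def]
  show \<alpha>: "arr (\<alpha> k)" "src (\<alpha> k) = X" "tgt (\<alpha> k) = Exp \<V> (mat \<V> P k n) (mat \<V> P k m)"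
    using h[THEN conjunct1, rule_format, of k] by auto
  then show "obj X" by auto
  show "j < m \<Longrightarrow> i \<le> n \<Longrightarrow> arr (q j i)" "j < m \<Longrightarrow> i \<le> n \<Longrightarrow> src (q j i) = X" "j < m \<Longrightarrow> i \<le> n \<Longrightarrow> tgt (q j i) = K"
    using h[THEN conjunct2, THEN conjunct1, rule_format, of j i] by auto
  show "x \<in> \<H> Y X \<Longrightarrow> u \<in> \<H> Y (mat \<V> P k n) \<Longrightarrow> j < m \<Longrightarrow> \<kappa> < k \<Longrightarrow>
        entry \<V> P k m j \<kappa> \<bullet> ap (mat \<V> P k n) (mat \<V> P k m) (\<alpha> k \<bullet> x) u =
        form Y n (\<lambda>i. q j i \<bullet> x) (\<lambda>i. entry \<V> P k n i \<kappa> \<bullet> u)"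
    by (rule h[THEN conjunct2, THEN conjunct2, rule_format])
qed

text \<open>Naturality of a family of affine forms is the compatibility of affine forms with mixtures, applied to
  each row of an affine matrix.\<close>

lemma coefficients_wedge:
  assumes c: "has_coefficients n m X \<alpha> q"
  shows "vnat_wedge \<V> T (Spow n) (Spow m) X \<alpha>"
  unfolding wedge_iff[OF Spow_typed Spow_typed] Spow_obj Mat_aff_hom
proof (intro conjI allI impI)
  note D = has_coefficientsD[OF c]
  show "obj X" by (rule D)
  show "\<alpha> a \<in> \<H> X (Exp \<V> (mat \<V> P a n) (mat \<V> P a m))" for a using D by simp
  fix k l Y x h u assume x: "x \<in> \<H> Y X" and h: "h \<in> \<H> Y (src (aff k l))" and u: "u \<in> \<H> Y (mat \<V> P k n)"
  have Y: "obj Y" using x by auto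
  have hu: "act (Spow n) k l h u \<in> \<H> Y (mat \<V> P l n)"
    using act_arr[OF Spow_typed, of h k l u n] h u by simp
  have au: "ap (mat \<V> P k n) (mat \<V> P k m) (\<alpha> k \<bullet> x) u \<in> \<H> Y (mat \<V> P k m)"
    using D(1-4) x u by simp
  show "ap (mat \<V> P l n) (mat \<V> P l m) (\<alpha> l \<bullet> x) (act (Spow n) k l h u) =
       act (Spow m) k l h (ap (mat \<V> P k n) (mat \<V> P k m) (\<alpha> k \<bullet> x) u)" (is "?a = ?b")
  proof (rule mat_eqI[of _ Y l m])
    show "?a \<in> \<H> Y (mat \<V> P l m)" using D(1-4) x hu by simp
    show "?b \<in> \<H> Y (mat \<V> P l m)"
      using act_arr[OF Spow_typed, of h k l "ap (mat \<V> P k n) (mat \<V> P k m) (\<alpha> k \<bullet> x) u" m] h au by simp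
    fix j \<nu> assume j: "j < m" "\<nu> < l"
    let ?M = "\<lambda>\<kappa>. entry \<V> P k l \<nu> \<kappa> \<bullet> aff k l \<bullet> h"
    have "entry \<V> P l m j \<nu> \<bullet> ?a = form Y n (\<lambda>i. q j i \<bullet> x) (\<lambda>i. entry \<V> P l n i \<nu> \<bullet> act (Spow n) k l h u)"
      by (rule D(8)[OF x hu j])
    also have "\<dots> = form Y n (\<lambda>i. q j i \<bullet> x) (\<lambda>i. gsum \<V> P Y k (\<lambda>\<kappa>. ?M \<kappa> \<boxtimes> (entry \<V> P k n i \<kappa> \<bullet> u)))"
      using entry_act[OF h u _ j(2)] by simp
    also have "\<dots> = gsum \<V> P Y k (\<lambda>\<kappa>. ?M \<kappa> \<boxtimes> form Y n (\<lambda>i. q j i \<bullet> x) (\<lambda>i. entry \<V> P k n i \<kappa> \<bullet> u))"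
    proof (rule form_mixture[OF Y])
      show "q j i \<bullet> x \<in> \<H> Y K" if "i \<le> n" for i using D(5-7)[OF j(1) that] x by simp
      show "entry \<V> P k n i \<kappa> \<bullet> u \<in> \<H> Y K" if "i < n" "\<kappa> < k" for i \<kappa> using u that by simp
      show "?M \<kappa> \<in> \<H> Y K" if "\<kappa> < k" for \<kappa> using h j that by simp
      show "gsum \<V> P Y k ?M = unt Y" by (rule aff_row_sum[OF h j(2)])
    qed
    also have "\<dots> = gsum \<V> P Y k (\<lambda>\<kappa>. ?M \<kappa> \<boxtimes> (entry \<V> P k m j \<kappa> \<bullet> ap (mat \<V> P k n) (mat \<V> P k m) (\<alpha> k \<bullet> x) u))"
      using D(8)[OF x u j(1)] by simp
    also have "\<dots> = entry \<V> P l m j \<nu> \<bullet> ?b"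
      by (rule entry_act[OF h au j, symmetric])
    finally show "entry \<V> P l m j \<nu> \<bullet> ?a = entry \<V> P l m j \<nu> \<bullet> ?b" .
  qed
qed

lemma coefficients_realized:
  assumes X: "obj X" and q: "\<And>j i. j < m \<Longrightarrow> i \<le> n \<Longrightarrow> q j i \<in> \<H> X K"
  obtains \<alpha> where "has_coefficients n m X \<alpha> q"
proof
  let ?Z = "\<lambda>k. X \<star> mat \<V> P k n"
  let ?\<alpha> = "\<lambda>k. curry' \<V> X (mat \<V> P k n) (mk_mat \<V> P (?Z k) k m (\<lambda>j \<kappa>.
     form (?Z k) n (\<lambda>i. q j i \<bullet> Pr1 \<V> X (mat \<V> P k n)) (\<lambda>i. entry \<V> P k n i \<kappa> \<bullet> Pr2 \<V> X (mat \<V> P k n))))"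
  have q': "arr (q j i)" "src (q j i) = X" "tgt (q j i) = K" if "j < m" "i \<le> n" for j i using q[OF that] by auto
  show "has_coefficients n m X ?\<alpha> q"
    unfolding has_coefficients_def using X q' src_obj by (auto simp flip: src_obj)
qed

text \<open>The coefficients are recovered from the component at \<open>1\<close> by evaluation at the origin and at the unit
  vectors.\<close>

lemma coefficients_unique:
  assumes c: "has_coefficients n m X \<alpha> q" and d: "has_coefficients n m X \<beta> r" and eq: "\<alpha> 1 = \<beta> 1"
  shows "j < m \<Longrightarrow> i \<le> n \<Longrightarrow> q j i = r j i" "\<alpha> k = \<beta> k"
proof -
  note D = has_coefficientsD[OF c] and E = has_coefficientsD[OF d]
  have X: "obj X" by (rule D)
  have form_eq: "form X n (q j) v = form X n (r j) v"
    if j: "j < m" and v: "\<And>i. i < n \<Longrightarrow> v i \<in> \<H> X K" for j v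
  proof -
    let ?u = "mk_mat \<V> P X 1 n (\<lambda>i _. v i)"
    have u: "?u \<in> \<H> X (mat \<V> P 1 n)" using X v by simp
    have "form X n (\<lambda>i. q j i \<bullet> ide X) (\<lambda>i. entry \<V> P 1 n i 0 \<bullet> ?u) = form X n (\<lambda>i. r j i \<bullet> ide X) (\<lambda>i. entry \<V> P 1 n i 0 \<bullet> ?u)"
      using D(8)[of "ide X" X ?u 1 j 0] E(8)[of "ide X" X ?u 1 j 0] u j X eq by (simp del: hom_iff add: hom_iff[of "ide X"])
    then show ?thesis using v X D(5-7)[OF j] E(5-7)[OF j] by simp
  qed
  have n: "q j n = r j n" if j: "j < m" for j
    using form_eq[OF j, of "\<lambda>i. nul X"] form_null[OF X, of n "q j"] form_null[OF X, of n "r j"] X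
      D(5-7)[OF j] E(5-7)[OF j] by simp
  show qr: "q j i = r j i" if j: "j < m" "i \<le> n" for j i
  proof (cases "i = n")
    case False
    then have i: "i < n" using j by simp
    have qi: "q j i \<in> \<H> X K" "r j i \<in> \<H> X K" "r j n \<in> \<H> X K"
      using D(5-7)[OF j] E(5-7)[OF j] E(5-7)[OF j(1), of n] by simp_all
    have "q j i \<boxplus> q j n = r j i \<boxplus> r j n"
      using form_eq[OF j(1), of "delta X i"] form_delta[OF X, of n "q j" i] form_delta[OF X, of n "r j" i] X i
      D(5-7)[OF j(1)] E(5-7)[OF j(1)] by simp
    then show ?thesis using plus_cancel[OF qi] n[OF j(1)] by simp
  qed (use n j in simp)
  show "\<alpha> k = \<beta> k"
  proof (rule exp_eqI[of _ X "mat \<V> P k n" "mat \<V> P k m"])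
    fix Y x u assume "obj Y" and x: "x \<in> \<H> Y X" and u: "u \<in> \<H> Y (mat \<V> P k n)"
    show "ap (mat \<V> P k n) (mat \<V> P k m) (\<alpha> k \<bullet> x) u = ap (mat \<V> P k n) (mat \<V> P k m) (\<beta> k \<bullet> x) u" (is "?a = ?b")
    proof (rule mat_eqI[of _ Y k m])
      show "?a \<in> \<H> Y (mat \<V> P k m)" "?b \<in> \<H> Y (mat \<V> P k m)" using D(1-4) E(1-4) x u by simp_all
      fix j \<kappa> assume j: "j < m" "\<kappa> < k"
      show "entry \<V> P k m j \<kappa> \<bullet> ?a = entry \<V> P k m j \<kappa> \<bullet> ?b"
        using D(8)[OF x u j] E(8)[OF x u j] qr[OF j(1)] by simp
    qed
  qed (use D E in simp_all)
qed

end

section \<open>Natural families are families of affine forms\<close>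

context firm_preordered_ring
begin

text \<open>Coordinate \<open>j\<close> of the carrier component of a natural family, as a function of \<open>n\<close> scalars.\<close>

definition component :: "nat \<Rightarrow> nat \<Rightarrow> (nat \<Rightarrow> 'm) \<Rightarrow> 'o \<Rightarrow> nat \<Rightarrow> 'm \<Rightarrow> (nat \<Rightarrow> 'm) \<Rightarrow> 'm" where
  "component n m \<alpha> Y j x v =
     entry \<V> P 1 m j 0 \<bullet> ap (mat \<V> P 1 n) (mat \<V> P 1 m) (\<alpha> 1 \<bullet> x) (mk_mat \<V> P Y 1 n (\<lambda>i _. v i))"

lemma wedge_arr:
  assumes "vnat_wedge \<V> T (Spow n) (Spow m) X \<alpha>"
  shows "arr (\<alpha> k)" "src (\<alpha> k) = X" "tgt (\<alpha> k) = Exp \<V> (mat \<V> P k n) (mat \<V> P k m)" "obj X"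
  using assms[unfolded wedge_iff[OF Spow_typed Spow_typed], THEN conjunct2, THEN conjunct1, rule_format, of k]
    assms[unfolded wedge_iff[OF Spow_typed Spow_typed], THEN conjunct1] by auto

lemma wedge_entry:
  assumes w: "vnat_wedge \<V> T (Spow n) (Spow m) X \<alpha>"
    and x: "x \<in> \<H> Y X" and h: "h \<in> \<H> Y (src (aff k l))" and u: "u \<in> \<H> Y (mat \<V> P k n)" and j: "j < m" "\<nu> < l"
  shows "entry \<V> P l m j \<nu> \<bullet> ap (mat \<V> P l n) (mat \<V> P l m) (\<alpha> l \<bullet> x) (act (Spow n) k l h u) =
    gsum \<V> P Y k (\<lambda>\<kappa>. (entry \<V> P k l \<nu> \<kappa> \<bullet> aff k l \<bullet> h) \<boxtimes> (entry \<V> P k m j \<kappa> \<bullet> ap (mat \<V> P k n) (mat \<V> P k m) (\<alpha> k \<bullet> x) u))"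
proof -
  have "ap (mat \<V> P l n) (mat \<V> P l m) (\<alpha> l \<bullet> x) (act (Spow n) k l h u) =
     act (Spow m) k l h (ap (mat \<V> P k n) (mat \<V> P k m) (\<alpha> k \<bullet> x) u)"
    using w[unfolded wedge_iff[OF Spow_typed Spow_typed] Spow_obj Mat_aff_hom, THEN conjunct2, THEN conjunct2, rule_format, OF x h u] .
  moreover have "ap (mat \<V> P k n) (mat \<V> P k m) (\<alpha> k \<bullet> x) u \<in> \<H> Y (mat \<V> P k m)"
    using wedge_arr[OF w] x u by simp
  ultimately show ?thesis using entry_act[OF h _ j] by simp
qed

text \<open>A single row of weights is an affine matrix from \<open>k\<close> to \<open>1\<close>, and naturality with respect to it
  expresses compatibility with mixtures of \<open>k\<close> vectors.\<close>

lemma wedge_mixture: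
  assumes w: "vnat_wedge \<V> T (Spow n) (Spow m) X \<alpha>"
    and x: "x \<in> \<H> Y X" and u: "u \<in> \<H> Y (mat \<V> P k n)" and j: "j < m"
    and M: "\<And>\<kappa>. \<kappa> < k \<Longrightarrow> M \<kappa> \<in> \<H> Y K" and sum: "gsum \<V> P Y k M = unt Y"
  shows "component n m \<alpha> Y j x (\<lambda>i. gsum \<V> P Y k (\<lambda>\<kappa>. M \<kappa> \<boxtimes> (entry \<V> P k n i \<kappa> \<bullet> u))) =
    gsum \<V> P Y k (\<lambda>\<kappa>. M \<kappa> \<boxtimes> (entry \<V> P k m j \<kappa> \<bullet> ap (mat \<V> P k n) (mat \<V> P k m) (\<alpha> k \<bullet> x) u))"
proof -
  have Y: "obj Y" using x by auto
  obtain h where h: "h \<in> \<H> Y (src (aff k 1))"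
    and hM: "\<And>\<nu> \<kappa>. \<nu> < 1 \<Longrightarrow> \<kappa> < k \<Longrightarrow> entry \<V> P k 1 \<nu> \<kappa> \<bullet> aff k 1 \<bullet> h = M \<kappa>"
    using aff_element[of Y 1 k "\<lambda>_. M"] Y M sum by blast
  have hM': "entry \<V> P k 1 0 \<kappa> \<bullet> aff k 1 \<bullet> h = M \<kappa>" if "\<kappa> < k" for \<kappa> using hM[of 0 \<kappa>] that by simp
  have "act (Spow n) k 1 h u = mk_mat \<V> P Y 1 n (\<lambda>i _. gsum \<V> P Y k (\<lambda>\<kappa>. M \<kappa> \<boxtimes> (entry \<V> P k n i \<kappa> \<bullet> u)))"
  proof (rule mat_eqI[of _ Y 1 n])
    show "act (Spow n) k 1 h u \<in> \<H> Y (mat \<V> P 1 n)"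
      using act_arr[OF Spow_typed, of h k 1 u n] h u by simp
    show "mk_mat \<V> P Y 1 n (\<lambda>i _. gsum \<V> P Y k (\<lambda>\<kappa>. M \<kappa> \<boxtimes> (entry \<V> P k n i \<kappa> \<bullet> u))) \<in> \<H> Y (mat \<V> P 1 n)"
      using Y M u by simp
    fix i \<kappa> assume i: "i < n" "\<kappa> < (1::nat)"
    then show "entry \<V> P 1 n i \<kappa> \<bullet> act (Spow n) k 1 h u = entry \<V> P 1 n i \<kappa> \<bullet> mk_mat \<V> P Y 1 n (\<lambda>i _. gsum \<V> P Y k (\<lambda>\<kappa>. M \<kappa> \<boxtimes> (entry \<V> P k n i \<kappa> \<bullet> u)))"
      using entry_act[OF h u i] Y M u hM' by simp
  qed
  then show ?thesis
    using wedge_entry[OF w x h u j, of 0] hM' unfolding component_def by simp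
qed

text \<open>Every component of a natural family is determined by the one at \<open>1\<close>: use the row of weights that
  selects the entry \<open>\<kappa>\<close>.\<close>

lemma wedge_component:
  assumes w: "vnat_wedge \<V> T (Spow n) (Spow m) X \<alpha>"
    and x: "x \<in> \<H> Y X" and u: "u \<in> \<H> Y (mat \<V> P k n)" and j: "j < m" "\<kappa> < k"
  shows "entry \<V> P k m j \<kappa> \<bullet> ap (mat \<V> P k n) (mat \<V> P k m) (\<alpha> k \<bullet> x) u =
    component n m \<alpha> Y j x (\<lambda>i. entry \<V> P k n i \<kappa> \<bullet> u)"
proof -
  have Y: "obj Y" using x by auto
  have au: "ap (mat \<V> P k n) (mat \<V> P k m) (\<alpha> k \<bullet> x) u \<in> \<H> Y (mat \<V> P k m)"
    using wedge_arr[OF w] x u by simp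
  have "gsum \<V> P Y k (\<lambda>\<kappa>'. delta Y \<kappa> \<kappa>' \<boxtimes> unt Y) = unt Y"
    using gsum_delta[OF Y, of k "\<lambda>_. unt Y"] j Y by simp
  moreover have "gsum \<V> P Y k (\<lambda>\<kappa>'. delta Y \<kappa> \<kappa>' \<boxtimes> unt Y) = gsum \<V> P Y k (delta Y \<kappa>)"
    using times_laws(5)[of "delta Y \<kappa> _" Y] Y by simp
  ultimately have "component n m \<alpha> Y j x (\<lambda>i. gsum \<V> P Y k (\<lambda>\<kappa>'. delta Y \<kappa> \<kappa>' \<boxtimes> (entry \<V> P k n i \<kappa>' \<bullet> u))) =
    gsum \<V> P Y k (\<lambda>\<kappa>'. delta Y \<kappa> \<kappa>' \<boxtimes> (entry \<V> P k m j \<kappa>' \<bullet> ap (mat \<V> P k n) (mat \<V> P k m) (\<alpha> k \<bullet> x) u))"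
    using Y by (intro wedge_mixture[OF w x u j(1)]) simp_all
  also have "\<dots> = entry \<V> P k m j \<kappa> \<bullet> ap (mat \<V> P k n) (mat \<V> P k m) (\<alpha> k \<bullet> x) u"
    using gsum_delta[OF Y, of k "\<lambda>\<kappa>'. entry \<V> P k m j \<kappa>' \<bullet> ap (mat \<V> P k n) (mat \<V> P k m) (\<alpha> k \<bullet> x) u" \<kappa>] j au by simp
  also have "component n m \<alpha> Y j x (\<lambda>i. gsum \<V> P Y k (\<lambda>\<kappa>'. delta Y \<kappa> \<kappa>' \<boxtimes> (entry \<V> P k n i \<kappa>' \<bullet> u))) =
      component n m \<alpha> Y j x (\<lambda>i. entry \<V> P k n i \<kappa> \<bullet> u)"
    unfolding component_def using gsum_delta[OF Y, of k _ \<kappa>] j u by simp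
  finally show ?thesis by simp
qed

lemma component_cong:
  "(\<And>i. i < n \<Longrightarrow> v i = w i) \<Longrightarrow> component n m \<alpha> Y j x v = component n m \<alpha> Y j x w"
  unfolding component_def by simp

lemma component_arr:
  assumes w: "vnat_wedge \<V> T (Spow n) (Spow m) X \<alpha>"
    and x: "x \<in> \<H> Y X" and v: "\<And>i. i < n \<Longrightarrow> v i \<in> \<H> Y K" and j: "j < m"
  shows "component n m \<alpha> Y j x v \<in> \<H> Y K"
proof -
  have "obj Y" using x by auto
  then show ?thesis using wedge_arr[OF w] x v j by (simp add: component_def)
qed

lemma component_comp:
  assumes w: "vnat_wedge \<V> T (Spow n) (Spow m) X \<alpha>"
    and x: "x \<in> \<H> Y X" and v: "\<And>i. i < n \<Longrightarrow> v i \<in> \<H> Y K" and j: "j < m" and z: "z \<in> \<H> Z Y"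
  shows "component n m \<alpha> Y j x v \<bullet> z = component n m \<alpha> Z j (x \<bullet> z) (\<lambda>i. v i \<bullet> z)"
proof -
  have "obj Y" "obj Z" using x z by auto
  then show ?thesis using wedge_arr[OF w] x v j z by (simp add: component_def)
qed

text \<open>Binary mixtures are the case \<open>k = 2\<close>; they suffice for the analysis of affine maps on a cone.\<close>

lemma component_mixture:
  assumes w: "vnat_wedge \<V> T (Spow n) (Spow m) X \<alpha>" and x: "x \<in> \<H> Y X" and j: "j < m"
    and u: "\<And>i. i < n \<Longrightarrow> u i \<in> \<H> Y K" and v: "\<And>i. i < n \<Longrightarrow> v i \<in> \<H> Y K"
    and r: "r \<in> \<H> Y K" and s: "s \<in> \<H> Y K" and rs: "r \<boxplus> s = unt Y"
  shows "component n m \<alpha> Y j x (\<lambda>i. (r \<boxtimes> u i) \<boxplus> (s \<boxtimes> v i)) =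
    (r \<boxtimes> component n m \<alpha> Y j x u) \<boxplus> (s \<boxtimes> component n m \<alpha> Y j x v)"
proof -
  have Y: "obj Y" using x by auto
  have two: "gsum \<V> P Y 2 F = F 0 \<boxplus> F 1" if "F 0 \<in> \<H> Y K" for F
    using plus_laws(3)[OF that] by (simp add: numeral_2_eq_2)
  let ?M = "\<lambda>\<kappa>::nat. if \<kappa> = 0 then r else s"
  let ?u = "mk_mat \<V> P Y 2 n (\<lambda>i \<kappa>. if \<kappa> = 0 then u i else v i)"
  have U: "?u \<in> \<H> Y (mat \<V> P 2 n)" using Y u v by simp
  have e: "entry \<V> P 2 n i 0 \<bullet> ?u = u i" "entry \<V> P 2 n i 1 \<bullet> ?u = v i" if "i < n" for i
    using entry_mk_mat[of Y n 2 "\<lambda>i \<kappa>. if \<kappa> = 0 then u i else v i" i] Y u v that by simp_all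
  have au: "ap (mat \<V> P 2 n) (mat \<V> P 2 m) (\<alpha> 2 \<bullet> x) ?u \<in> \<H> Y (mat \<V> P 2 m)"
    using wedge_arr[OF w] x U by simp
  have 1: "entry \<V> P 2 m j \<kappa> \<bullet> ap (mat \<V> P 2 n) (mat \<V> P 2 m) (\<alpha> 2 \<bullet> x) ?u =
     component n m \<alpha> Y j x (\<lambda>i. entry \<V> P 2 n i \<kappa> \<bullet> ?u)" if "\<kappa> < 2" for \<kappa>
    by (rule wedge_component[OF w x U j that])
  have c: "component n m \<alpha> Y j x u \<in> \<H> Y K" "component n m \<alpha> Y j x v \<in> \<H> Y K"
    using component_arr[OF w x _ j] u v by blast+
  have "component n m \<alpha> Y j x (\<lambda>i. (r \<boxtimes> u i) \<boxplus> (s \<boxtimes> v i)) =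
     component n m \<alpha> Y j x (\<lambda>i. gsum \<V> P Y 2 (\<lambda>\<kappa>. ?M \<kappa> \<boxtimes> (entry \<V> P 2 n i \<kappa> \<bullet> ?u)))"
    by (rule component_cong, subst two) (use e u r in simp_all)
  also have "\<dots> = gsum \<V> P Y 2 (\<lambda>\<kappa>. ?M \<kappa> \<boxtimes> (entry \<V> P 2 m j \<kappa> \<bullet> ap (mat \<V> P 2 n) (mat \<V> P 2 m) (\<alpha> 2 \<bullet> x) ?u))"
    by (rule wedge_mixture[OF w x U j], simp add: r[simplified] s[simplified]) (subst two, use r rs in simp_all)
  also have "\<dots> = (r \<boxtimes> component n m \<alpha> Y j x u) \<boxplus> (s \<boxtimes> component n m \<alpha> Y j x v)"
  proof -
    have "component n m \<alpha> Y j x (\<lambda>i. entry \<V> P 2 n i 0 \<bullet> ?u) = component n m \<alpha> Y j x u"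
      "component n m \<alpha> Y j x (\<lambda>i. entry \<V> P 2 n i 1 \<bullet> ?u) = component n m \<alpha> Y j x v"
      by (rule component_cong, rule e, assumption)+
    then have "entry \<V> P 2 m j 0 \<bullet> ap (mat \<V> P 2 n) (mat \<V> P 2 m) (\<alpha> 2 \<bullet> x) ?u = component n m \<alpha> Y j x u"
      "entry \<V> P 2 m j 1 \<bullet> ap (mat \<V> P 2 n) (mat \<V> P 2 m) (\<alpha> 2 \<bullet> x) ?u = component n m \<alpha> Y j x v"
      using 1[of 0] 1[of 1] by simp_all
    then show ?thesis using two[of "\<lambda>\<kappa>. ?M \<kappa> \<boxtimes> (entry \<V> P 2 m j \<kappa> \<bullet> ap (mat \<V> P 2 n) (mat \<V> P 2 m) (\<alpha> 2 \<bullet> x) ?u)"] r c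
      by simp
  qed
  finally show ?thesis .
qed

text \<open>The inverse of \<open>\<iota>\<close> on the positive elements at stage \<open>G\<close>; it transports functions of elements of \<open>P\<close>
  to functions on the positive cone of \<open>\<V>(G, R)\<close>.\<close>

definition lift :: "'o \<Rightarrow> 'm \<Rightarrow> 'm" where
  "lift G w = (THE k. k \<in> \<H> G K \<and> \<iota> \<bullet> k = w)"

lemma lift_incl [simp]:
  assumes "k \<in> \<H> G K"
  shows "lift G (\<iota> \<bullet> k) = k"
  unfolding lift_def by (rule the_equality) (use assms incl_inj in blast)+

lemma hom_pos_iff: "w \<in> hom_pos \<V> G \<iota> \<longleftrightarrow> (\<exists>k \<in> \<H> G K. w = \<iota> \<bullet> k)"
  by (auto simp: hom_pos_def)

lemma incl_lift:
  assumes "w \<in> hom_pos \<V> G \<iota>"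
  shows "lift G w \<in> \<H> G K" "\<iota> \<bullet> lift G w = w"
  using assms lift_incl[of _ G] unfolding hom_pos_iff by (metis)+

lemma component_mixture_map:
  assumes G: "G \<in> \<G>" and w: "vnat_wedge \<V> T (Spow n) (Spow m) X \<alpha>" and x: "x \<in> \<H> G X" and j: "j < m"
  shows "mixture_map (hom_ring \<V> G R) (hom_pos \<V> G \<iota>) n
    (\<lambda>w. \<iota> \<bullet> component n m \<alpha> G j x (\<lambda>i. lift G (w i)))"
proof -
  interpret C: archimedean_cone "hom_ring \<V> G R" "hom_pos \<V> G \<iota>" by (rule hom_pos_cone[OF G])
  have G': "obj G" using G by simp
  have c: "component n m \<alpha> G j x (\<lambda>i. lift G (v i)) \<in> \<H> G K"
    if "\<And>i. i < n \<Longrightarrow> v i \<in> hom_pos \<V> G \<iota>" for v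
    using component_arr[OF w x _ j, of "\<lambda>i. lift G (v i)"] incl_lift(1) that by blast
  show ?thesis
  proof
    fix v assume v: "\<And>i. i < n \<Longrightarrow> v i \<in> hom_pos \<V> G \<iota>"
    show "\<iota> \<bullet> component n m \<alpha> G j x (\<lambda>i. lift G (v i)) \<in> hom_pos \<V> G \<iota>"
      unfolding hom_pos_iff using c[of v] v by blast
  next
    fix u v t r s
    assume u: "\<And>i. i < n \<Longrightarrow> u i \<in> hom_pos \<V> G \<iota>" and v: "\<And>i. i < n \<Longrightarrow> v i \<in> hom_pos \<V> G \<iota>"
      and r: "r \<in> hom_pos \<V> G \<iota>" and s: "s \<in> hom_pos \<V> G \<iota>"
      and rs: "r \<oplus>\<^bsub>hom_ring \<V> G R\<^esub> s = \<one>\<^bsub>hom_ring \<V> G R\<^esub>"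
      and t: "\<And>i. i < n \<Longrightarrow> t i = (r \<otimes>\<^bsub>hom_ring \<V> G R\<^esub> u i) \<oplus>\<^bsub>hom_ring \<V> G R\<^esub> (s \<otimes>\<^bsub>hom_ring \<V> G R\<^esub> v i)"
    obtain r' s' where r': "r' \<in> \<H> G K" "r = \<iota> \<bullet> r'" and s': "s' \<in> \<H> G K" "s = \<iota> \<bullet> s'"
      using r s unfolding hom_pos_iff by blast
    let ?u = "\<lambda>i. lift G (u i)" and ?v = "\<lambda>i. lift G (v i)"
    have u': "\<And>i. i < n \<Longrightarrow> ?u i \<in> \<H> G K" and v': "\<And>i. i < n \<Longrightarrow> ?v i \<in> \<H> G K"
      using incl_lift(1) u v by blast+
    have one: "r' \<boxplus> s' = unt G"
    proof (rule incl_inj[of _ G])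
      show "\<iota> \<bullet> (r' \<boxplus> s') = \<iota> \<bullet> unt G"
        using rs incl_hom(1)[OF r'(1) s'(1)] incl_hom(4)[OF r'(1) r'(1)] r'(2) s'(2) by (simp add: R.hom_ring_simps)
    qed (use r' s' G' in simp_all)
    have "lift G (t i) = (r' \<boxtimes> ?u i) \<boxplus> (s' \<boxtimes> ?v i)" if i: "i < n" for i
    proof -
      have ru: "r' \<boxtimes> ?u i \<in> \<H> G K" "s' \<boxtimes> ?v i \<in> \<H> G K" using r' s' u'[OF i] v'[OF i] by simp_all
      have "t i = \<iota> \<bullet> ((r' \<boxtimes> ?u i) \<boxplus> (s' \<boxtimes> ?v i))"
        unfolding t[OF i] incl_hom(1)[OF ru] incl_hom(2)[OF r'(1) u'[OF i]] incl_hom(2)[OF s'(1) v'[OF i]]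
          incl_lift(2)[OF u[OF i]] incl_lift(2)[OF v[OF i]] R.hom_ring_simps r'(2) s'(2) ..
      moreover have "(r' \<boxtimes> ?u i) \<boxplus> (s' \<boxtimes> ?v i) \<in> \<H> G K" using ru by simp
      ultimately show ?thesis by (metis lift_incl)
    qed
    then have "component n m \<alpha> G j x (\<lambda>i. lift G (t i)) = component n m \<alpha> G j x (\<lambda>i. (r' \<boxtimes> ?u i) \<boxplus> (s' \<boxtimes> ?v i))"
      by (rule component_cong)
    also have "\<dots> = (r' \<boxtimes> component n m \<alpha> G j x ?u) \<boxplus> (s' \<boxtimes> component n m \<alpha> G j x ?v)"
      by (rule component_mixture[OF w x j u' v' r'(1) s'(1) one])
    finally have e: "component n m \<alpha> G j x (\<lambda>i. lift G (t i)) = \<dots>" .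
    have cu: "component n m \<alpha> G j x ?u \<in> \<H> G K" "component n m \<alpha> G j x ?v \<in> \<H> G K"
      using c[of u] c[of v] u v by blast+
    have rc: "r' \<boxtimes> component n m \<alpha> G j x ?u \<in> \<H> G K" "s' \<boxtimes> component n m \<alpha> G j x ?v \<in> \<H> G K"
      using cu r' s' by simp_all
    show "\<iota> \<bullet> component n m \<alpha> G j x (\<lambda>i. lift G (t i)) =
        (r \<otimes>\<^bsub>hom_ring \<V> G R\<^esub> (\<iota> \<bullet> component n m \<alpha> G j x ?u)) \<oplus>\<^bsub>hom_ring \<V> G R\<^esub>
        (s \<otimes>\<^bsub>hom_ring \<V> G R\<^esub> (\<iota> \<bullet> component n m \<alpha> G j x ?v))"
      unfolding e incl_hom(1)[OF rc] incl_hom(2)[OF r'(1) cu(1)] incl_hom(2)[OF s'(1) cu(2)] r'(2) s'(2) R.hom_ring_simps ..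
  qed
qed

text \<open>The constant term is the value \<open>c\<close> at the origin, and the coefficient of the \<open>k\<close>-th variable is the
  difference in \<open>R\<close> of the value \<open>b k\<close> at the unit vector and \<open>c\<close>. At each generating object the
  analysis of affine maps on a cone shows that this difference is positive and that the affine form
  so obtained computes the map. The first fact makes the difference factor through \<open>P\<close>, and the
  second one implies the equation at every stage.\<close>

lemma wedge_component_form:
  assumes w: "vnat_wedge \<V> T (Spow n) (Spow m) X \<alpha>" and j: "j < m"
  shows "\<exists>q. (\<forall>i\<le>n. q i \<in> \<H> X K) \<and> (\<forall>Y x v. x \<in> \<H> Y X \<longrightarrow> (\<forall>i<n. v i \<in> \<H> Y K) \<longrightarrow>
    component n m \<alpha> Y j x v = form Y n (\<lambda>i. q i \<bullet> x) v)"
proof -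
  have X: "obj X" by (rule wedge_arr(4)[OF w])
  define b where "b k = component n m \<alpha> X j (ide X) (delta X k)" for k
  define c where "c = component n m \<alpha> X j (ide X) (\<lambda>_. nul X)"
  have b: "b k \<in> \<H> X K" and c: "c \<in> \<H> X K" for k
    unfolding b_def c_def by (rule component_arr[OF w _ _ j]; simp add: X)+
  have bx: "b k \<bullet> x = component n m \<alpha> Y j x (delta Y k)" and cx: "c \<bullet> x = component n m \<alpha> Y j x (\<lambda>_. nul Y)"
    if x: "x \<in> \<H> Y X" for x Y k
    unfolding b_def c_def using component_comp[OF w _ _ j x, of "ide X" "delta X k"]
      component_comp[OF w _ _ j x, of "ide X" "\<lambda>_. nul X"] X x by simp_all
  have cone: "\<exists>f. (\<forall>k<n. f k \<in> hom_pos \<V> G \<iota> \<and> gplus \<V> R (f k) (\<iota> \<bullet> c \<bullet> x) = \<iota> \<bullet> b k \<bullet> x) \<and>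
      (\<forall>v. (\<forall>i<n. v i \<in> \<H> G K) \<longrightarrow> \<iota> \<bullet> component n m \<alpha> G j x v =
         gplus \<V> R (\<Oplus>\<^bsub>hom_ring \<V> G R\<^esub>i\<in>{..<n}. gtimes \<V> R (f i) (\<iota> \<bullet> v i)) (\<iota> \<bullet> c \<bullet> x))"
    if G: "G \<in> \<G>" and x: "x \<in> \<H> G X" for G x
  proof -
    have G': "obj G" using G by simp
    interpret M: mixture_map "hom_ring \<V> G R" "hom_pos \<V> G \<iota>" n
      "\<lambda>w. \<iota> \<bullet> component n m \<alpha> G j x (\<lambda>i. lift G (w i))"
      by (rule component_mixture_map[OF G w x j])
    have nul: "lift G (gnull \<V> R G) = nul G" "lift G (gunit \<V> R G) = unt G"
      using lift_incl[of "nul G" G] lift_incl[of "unt G" G] incl_hom(3,4)[of "nul G" G "nul G"] G' by simp_all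
    have Mc: "M.c = \<iota> \<bullet> c \<bullet> x"
      unfolding M.c_def R.hom_ring_simps nul cx[OF x] ..
    have "(\<lambda>i. lift G (M.unit_vector k i)) = delta G k" for k
      unfolding M.unit_vector_def delta_def R.hom_ring_simps using nul by auto
    then have Mb: "\<iota> \<bullet> component n m \<alpha> G j x (\<lambda>i. lift G (M.unit_vector k i)) = \<iota> \<bullet> b k \<bullet> x" for k
      using bx[OF x] by simp
    show ?thesis
    proof (intro exI[of _ "\<lambda>k. M.f (M.unit_vector k)"] conjI allI impI)
      fix k assume "k < n"
      show "M.f (M.unit_vector k) \<in> hom_pos \<V> G \<iota>" by (rule M.f_cone) (rule M.unit_vector_cone)
      show "gplus \<V> R (M.f (M.unit_vector k)) (\<iota> \<bullet> c \<bullet> x) = \<iota> \<bullet> b k \<bullet> x"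
        using M.\<phi>_eq[of "M.unit_vector k", OF M.unit_vector_cone] unfolding Mb Mc R.hom_ring_simps by (rule sym)
    next
      fix v assume v: "\<forall>i<n. v i \<in> \<H> G K"
      have "\<iota> \<bullet> component n m \<alpha> G j x (\<lambda>i. lift G (\<iota> \<bullet> v i)) =
         gplus \<V> R (\<Oplus>\<^bsub>hom_ring \<V> G R\<^esub>i\<in>{..<n}. gtimes \<V> R (M.f (M.unit_vector i)) (\<iota> \<bullet> v i)) (\<iota> \<bullet> c \<bullet> x)"
        using M.\<phi>_expansion[of "\<lambda>i. \<iota> \<bullet> v i"] v unfolding Mc R.hom_ring_simps hom_pos_iff by blast
      moreover have "component n m \<alpha> G j x (\<lambda>i. lift G (\<iota> \<bullet> v i)) = component n m \<alpha> G j x v"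
        using v by (intro component_cong lift_incl) blast
      ultimately show "\<iota> \<bullet> component n m \<alpha> G j x v =
         gplus \<V> R (\<Oplus>\<^bsub>hom_ring \<V> G R\<^esub>i\<in>{..<n}. gtimes \<V> R (M.f (M.unit_vector i)) (\<iota> \<bullet> v i)) (\<iota> \<bullet> c \<bullet> x)"
        by simp
    qed
  qed
  have "\<exists>p. p \<in> \<H> X K \<and> b k = p \<boxplus> c" if k: "k < n" for k
  proof -
    interpret S: cring "hom_ring \<V> X R" by (rule hom_ring_cring[OF X])
    have bc: "\<iota> \<bullet> b k \<in> carrier (hom_ring \<V> X R)" "\<iota> \<bullet> c \<in> carrier (hom_ring \<V> X R)"
      using b[of k] c by (simp_all add: R.hom_ring_simps)
    define a where "a = (\<iota> \<bullet> b k) \<ominus>\<^bsub>hom_ring \<V> X R\<^esub> (\<iota> \<bullet> c)"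
    have "a \<in> carrier (hom_ring \<V> X R)" "a \<oplus>\<^bsub>hom_ring \<V> X R\<^esub> (\<iota> \<bullet> c) = \<iota> \<bullet> b k"
      unfolding a_def using bc by (simp, algebra)
    then have a: "a \<in> \<H> X R.K" and ab: "gplus \<V> R a (\<iota> \<bullet> c) = \<iota> \<bullet> b k" by (simp_all add: R.hom_ring_simps)
    have "\<exists>p \<in> \<H> X K. \<iota> \<bullet> p = a"
    proof (rule factor_through_positive[OF a])
      fix G x assume G: "G \<in> \<G>" and x: "x \<in> \<H> G X"
      obtain f where f: "f \<in> hom_pos \<V> G \<iota>" "gplus \<V> R f (\<iota> \<bullet> c \<bullet> x) = \<iota> \<bullet> b k \<bullet> x"
        using cone[OF G x] k by blast
      interpret SG: cring "hom_ring \<V> G R" by (rule hom_ring_cring) (use G in simp)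
      have "gplus \<V> R a (\<iota> \<bullet> c) \<bullet> x = (\<iota> \<bullet> b k) \<bullet> x" using ab by simp
      then have "gplus \<V> R (a \<bullet> x) (\<iota> \<bullet> c \<bullet> x) = gplus \<V> R f (\<iota> \<bullet> c \<bullet> x)"
        using f(2) a b[of k] c x by simp
      moreover have "a \<bullet> x \<in> carrier (hom_ring \<V> G R)" "f \<in> carrier (hom_ring \<V> G R)" "\<iota> \<bullet> c \<bullet> x \<in> carrier (hom_ring \<V> G R)"
        using a c x f(1) by (auto simp: R.hom_ring_simps hom_pos_iff)
      ultimately have "a \<bullet> x = f" using SG.add.right_cancel unfolding R.hom_ring_simps by blast
      then show "\<exists>k \<in> \<H> G K. \<iota> \<bullet> k = a \<bullet> x" using f(1) unfolding hom_pos_iff by metis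
    qed
    then obtain p where p: "p \<in> \<H> X K" "\<iota> \<bullet> p = a" by blast
    have "\<iota> \<bullet> b k = \<iota> \<bullet> (p \<boxplus> c)" unfolding incl_hom(1)[OF p(1) c] p(2) ab ..
    then have "b k = p \<boxplus> c" by (rule incl_inj[rotated 2]) (use b p c in simp_all)
    then show ?thesis using p by blast
  qed
  then obtain p where p: "\<And>k. k < n \<Longrightarrow> p k \<in> \<H> X K" and pb: "\<And>k. k < n \<Longrightarrow> b k = p k \<boxplus> c"
    by metis
  \<comment> \<open>The entry with index \<open>n\<close> is the constant term.\<close>
  define q where "q = (\<lambda>i. if i < n then p i else c)"
  have q: "q i \<in> \<H> X K" for i unfolding q_def using p c by auto
  have "component n m \<alpha> Y j x v = form Y n (\<lambda>i. q i \<bullet> x) v"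
    if x: "x \<in> \<H> Y X" and v: "\<And>i. i < n \<Longrightarrow> v i \<in> \<H> Y K" for Y x v
  proof (rule gen_eqI[of _ Y K])
    have Y: "obj Y" using x by auto
    have qx: "q i \<bullet> x \<in> \<H> Y K" for i using q[of i] x by simp
    show "component n m \<alpha> Y j x v \<in> \<H> Y K" by (rule component_arr[OF w x v j])
    show "form Y n (\<lambda>i. q i \<bullet> x) v \<in> \<H> Y K" using Y qx v by simp
    fix G z assume G: "G \<in> \<G>" and z: "z \<in> \<H> G Y"
    have G': "obj G" using G by simp
    have xz: "x \<bullet> z \<in> \<H> G X" and vz: "\<And>i. i < n \<Longrightarrow> v i \<bullet> z \<in> \<H> G K" and qz: "\<And>i. q i \<bullet> x \<bullet> z \<in> \<H> G K"
      using x v z q by simp_all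
    interpret SG: cring "hom_ring \<V> G R" by (rule hom_ring_cring[OF G'])
    obtain f where f: "\<And>k. k < n \<Longrightarrow> f k \<in> hom_pos \<V> G \<iota>"
      and fb: "\<And>k. k < n \<Longrightarrow> gplus \<V> R (f k) (\<iota> \<bullet> c \<bullet> x \<bullet> z) = \<iota> \<bullet> b k \<bullet> x \<bullet> z"
      and fe: "\<iota> \<bullet> component n m \<alpha> G j (x \<bullet> z) (\<lambda>i. v i \<bullet> z) =
         gplus \<V> R (\<Oplus>\<^bsub>hom_ring \<V> G R\<^esub>i\<in>{..<n}. gtimes \<V> R (f i) (\<iota> \<bullet> v i \<bullet> z)) (\<iota> \<bullet> c \<bullet> x \<bullet> z)"
    proof -
      obtain f where f: "\<forall>k<n. f k \<in> hom_pos \<V> G \<iota> \<and> gplus \<V> R (f k) (\<iota> \<bullet> c \<bullet> x \<bullet> z) = \<iota> \<bullet> b k \<bullet> x \<bullet> z"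
        and fe: "\<forall>v. (\<forall>i<n. v i \<in> \<H> G K) \<longrightarrow> \<iota> \<bullet> component n m \<alpha> G j (x \<bullet> z) v =
         gplus \<V> R (\<Oplus>\<^bsub>hom_ring \<V> G R\<^esub>i\<in>{..<n}. gtimes \<V> R (f i) (\<iota> \<bullet> v i)) (\<iota> \<bullet> c \<bullet> x \<bullet> z)"
        using cone[OF G xz] by (elim exE conjE) (rule that)
      show thesis
        by (rule that[of f]) (use f fe[rule_format, of "\<lambda>i. v i \<bullet> z", OF vz] in blast)+
    qed
    have cz: "c \<bullet> x \<bullet> z \<in> \<H> G K" using c x z by simp
    have fq: "f k = \<iota> \<bullet> q k \<bullet> x \<bullet> z" if k: "k < n" for k
    proof -
      have "b k \<bullet> x \<bullet> z = (q k \<bullet> x \<bullet> z) \<boxplus> (c \<bullet> x \<bullet> z)"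
        using pb[OF k] p[OF k] c x z k by (simp add: q_def)
      then have "gplus \<V> R (f k) (\<iota> \<bullet> c \<bullet> x \<bullet> z) = gplus \<V> R (\<iota> \<bullet> q k \<bullet> x \<bullet> z) (\<iota> \<bullet> c \<bullet> x \<bullet> z)"
        using fb[OF k] incl_hom(1)[OF qz cz] by metis
      moreover have "f k \<in> carrier (hom_ring \<V> G R)" "\<iota> \<bullet> q k \<bullet> x \<bullet> z \<in> carrier (hom_ring \<V> G R)"
        "\<iota> \<bullet> c \<bullet> x \<bullet> z \<in> carrier (hom_ring \<V> G R)"
        using f[OF k] qz[of k] cz by (auto simp: R.hom_ring_simps hom_pos_iff)
      ultimately show ?thesis using SG.add.right_cancel unfolding R.hom_ring_simps by blast
    qed
    have "\<iota> \<bullet> gsum \<V> P G n (\<lambda>i. (q i \<bullet> x \<bullet> z) \<boxtimes> (v i \<bullet> z)) =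
        (\<Oplus>\<^bsub>hom_ring \<V> G R\<^esub>i\<in>{..<n}. \<iota> \<bullet> ((q i \<bullet> x \<bullet> z) \<boxtimes> (v i \<bullet> z)))"
      by (rule gsum_incl[OF G']) (use qz vz in simp)
    also have "\<dots> = (\<Oplus>\<^bsub>hom_ring \<V> G R\<^esub>i\<in>{..<n}. gtimes \<V> R (f i) (\<iota> \<bullet> v i \<bullet> z))"
    proof (rule SG.finsum_cong')
      show "(\<lambda>i. gtimes \<V> R (f i) (\<iota> \<bullet> v i \<bullet> z)) \<in> {..<n} \<rightarrow> carrier (hom_ring \<V> G R)"
        using fq qz vz by (simp add: R.hom_ring_simps)
      fix i assume "i \<in> {..<n}"
      then show "\<iota> \<bullet> ((q i \<bullet> x \<bullet> z) \<boxtimes> (v i \<bullet> z)) = gtimes \<V> R (f i) (\<iota> \<bullet> v i \<bullet> z)"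
        using incl_hom(2)[OF qz vz] fq by simp
    qed simp
    finally have s: "(\<Oplus>\<^bsub>hom_ring \<V> G R\<^esub>i\<in>{..<n}. gtimes \<V> R (f i) (\<iota> \<bullet> v i \<bullet> z)) =
      \<iota> \<bullet> gsum \<V> P G n (\<lambda>i. (q i \<bullet> x \<bullet> z) \<boxtimes> (v i \<bullet> z))" ..
    have gs: "gsum \<V> P G n (\<lambda>i. (q i \<bullet> x \<bullet> z) \<boxtimes> (v i \<bullet> z)) \<in> \<H> G K" using G' qz vz by simp
    have "\<iota> \<bullet> component n m \<alpha> G j (x \<bullet> z) (\<lambda>i. v i \<bullet> z) = \<iota> \<bullet> form G n (\<lambda>i. q i \<bullet> x \<bullet> z) (\<lambda>i. v i \<bullet> z)"
      unfolding fe s form_def using incl_hom(1)[OF gs cz] by (simp add: q_def)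
    then have "component n m \<alpha> G j (x \<bullet> z) (\<lambda>i. v i \<bullet> z) = form G n (\<lambda>i. q i \<bullet> x \<bullet> z) (\<lambda>i. v i \<bullet> z)"
    proof (rule incl_inj[rotated 2])
      show "component n m \<alpha> G j (x \<bullet> z) (\<lambda>i. v i \<bullet> z) \<in> \<H> G K" by (rule component_arr[OF w xz vz j])
      show "form G n (\<lambda>i. q i \<bullet> x \<bullet> z) (\<lambda>i. v i \<bullet> z) \<in> \<H> G K" using G' qz vz by simp
    qed
    moreover have "form Y n (\<lambda>i. q i \<bullet> x) v \<bullet> z = form G n (\<lambda>i. q i \<bullet> x \<bullet> z) (\<lambda>i. v i \<bullet> z)"
      using qx v z x q by simp
    ultimately show "component n m \<alpha> Y j x v \<bullet> z = form Y n (\<lambda>i. q i \<bullet> x) v \<bullet> z"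
      by (simp only: component_comp[OF w x v j z])
  qed
  then show ?thesis using q by blast
qed

lemma wedge_has_coefficients:
  assumes w: "vnat_wedge \<V> T (Spow n) (Spow m) X \<alpha>"
  obtains q where "has_coefficients n m X \<alpha> q"
proof -
  obtain q where q: "\<And>j i. j < m \<Longrightarrow> i \<le> n \<Longrightarrow> q j i \<in> \<H> X K"
    and e: "\<And>j Y x v. j < m \<Longrightarrow> x \<in> \<H> Y X \<Longrightarrow> (\<And>i. i < n \<Longrightarrow> v i \<in> \<H> Y K) \<Longrightarrow>
      component n m \<alpha> Y j x v = form Y n (\<lambda>i. q j i \<bullet> x) v"
    using wedge_component_form[OF w] by metis
  have "has_coefficients n m X \<alpha> q"
    unfolding has_coefficients_def
  proof (intro conjI allI impI)
    show "\<alpha> k \<in> \<H> X (Exp \<V> (mat \<V> P k n) (mat \<V> P k m))" for k using wedge_arr[OF w] by simp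
    show "q j i \<in> \<H> X K" if "j < m" "i \<le> n" for j i by (rule q[OF that])
    fix k Y x u j \<kappa>
    assume x: "x \<in> \<H> Y X" and u: "u \<in> \<H> Y (mat \<V> P k n)" and j: "j < m" "\<kappa> < k"
    show "entry \<V> P k m j \<kappa> \<bullet> ap (mat \<V> P k n) (mat \<V> P k m) (\<alpha> k \<bullet> x) u =
        form Y n (\<lambda>i. q j i \<bullet> x) (\<lambda>i. entry \<V> P k n i \<kappa> \<bullet> u)"
      unfolding wedge_component[OF w x u j] by (rule e[OF j(1) x]) (use u j in simp)
  qed
  then show thesis by (rule that)
qed

end

section \<open>Composition of natural families, and cotensors\<close>

context base
begin

lemma wedgeD:
  assumes "stage_typed A F" "stage_typed A G" "vnat_wedge \<V> A F G X \<alpha>"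
  shows "obj X" "arr (\<alpha> a)" "src (\<alpha> a) = X" "tgt (\<alpha> a) = Exp \<V> (FObj F a) (FObj G a)"
    "x \<in> \<H> Y X \<Longrightarrow> h \<in> \<H> Y (VHom A a b) \<Longrightarrow> u \<in> \<H> Y (FObj F a) \<Longrightarrow>
       ap (FObj F b) (FObj G b) (\<alpha> b \<bullet> x) (act F a b h u) =
       act G a b h (ap (FObj F a) (FObj G a) (\<alpha> a \<bullet> x) u)"
proof -
  note w = assms(3)[unfolded wedge_iff[OF assms(1,2)]]
  show "obj X" by (rule w[THEN conjunct1])
  show "arr (\<alpha> a)" "src (\<alpha> a) = X" "tgt (\<alpha> a) = Exp \<V> (FObj F a) (FObj G a)"
    using w[THEN conjunct2, THEN conjunct1, rule_format, of a] by simp_all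
  show "x \<in> \<H> Y X \<Longrightarrow> h \<in> \<H> Y (VHom A a b) \<Longrightarrow> u \<in> \<H> Y (FObj F a) \<Longrightarrow>
       ap (FObj F b) (FObj G b) (\<alpha> b \<bullet> x) (act F a b h u) =
       act G a b h (ap (FObj F a) (FObj G a) (\<alpha> a \<bullet> x) u)"
    by (rule w[THEN conjunct2, THEN conjunct2, rule_format])
qed

lemma wedgeI:
  assumes "stage_typed A F" "stage_typed A G" "obj X" "\<And>a. \<alpha> a \<in> \<H> X (Exp \<V> (FObj F a) (FObj G a))"
    "\<And>a b Y x h u. x \<in> \<H> Y X \<Longrightarrow> h \<in> \<H> Y (VHom A a b) \<Longrightarrow> u \<in> \<H> Y (FObj F a) \<Longrightarrow>
       ap (FObj F b) (FObj G b) (\<alpha> b \<bullet> x) (act F a b h u) =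
       act G a b h (ap (FObj F a) (FObj G a) (\<alpha> a \<bullet> x) u)"
  shows "vnat_wedge \<V> A F G X \<alpha>"
  unfolding wedge_iff[OF assms(1,2)] using assms(3-5) by blast

lemma wedge_precomp:
  assumes F: "stage_typed A F" and G: "stage_typed A G" and w: "vnat_wedge \<V> A F G X \<alpha>" and h: "h \<in> \<H> Y X"
  shows "vnat_wedge \<V> A F G Y (\<lambda>a. \<alpha> a \<bullet> h)"
proof (rule wedgeI[OF F G])
  note D = wedgeD[OF F G w]
  show "obj Y" using h by auto
  show "\<alpha> a \<bullet> h \<in> \<H> Y (Exp \<V> (FObj F a) (FObj G a))" for a using D h by simp
  fix a b Z x k u assume x: "x \<in> \<H> Z Y" and k: "k \<in> \<H> Z (VHom A a b)" and u: "u \<in> \<H> Z (FObj F a)"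
  have "h \<bullet> x \<in> \<H> Z X" using h x by simp
  then show "ap (FObj F b) (FObj G b) ((\<alpha> b \<bullet> h) \<bullet> x) (act F a b k u) =
       act G a b k (ap (FObj F a) (FObj G a) ((\<alpha> a \<bullet> h) \<bullet> x) u)"
    using D(5)[of "h \<bullet> x" Z k a b u] D(2-4) h x k u by simp
qed

lemma wedge_compose:
  assumes F: "stage_typed A F" and G: "stage_typed A G" and H: "stage_typed A H"
    and w: "vnat_wedge \<V> A F G X \<alpha>" and z: "vnat_wedge \<V> A G H X \<beta>"
  shows "vnat_wedge \<V> A F H X (\<lambda>a. VComp (self_vcat \<V>) (FObj F a) (FObj G a) (FObj H a) \<bullet> \<langle>\<beta> a, \<alpha> a\<rangle>)"
proof (rule wedgeI[OF F H])
  note D = wedgeD[OF F G w] and E = wedgeD[OF G H z]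
  note o = stage_typedD(2)[OF F] stage_typedD(2)[OF G] stage_typedD(2)[OF H]
  show "obj X" by (rule D)
  show "VComp (self_vcat \<V>) (FObj F a) (FObj G a) (FObj H a) \<bullet> \<langle>\<beta> a, \<alpha> a\<rangle> \<in> \<H> X (Exp \<V> (FObj F a) (FObj H a))" for a
    using D E o by simp
  fix a b Y x h u assume x: "x \<in> \<H> Y X" and h: "h \<in> \<H> Y (VHom A a b)" and u: "u \<in> \<H> Y (FObj F a)"
  have fu: "act F a b h u \<in> \<H> Y (FObj F b)" using act_arr[OF F] h u by simp
  have au: "ap (FObj F a) (FObj G a) (\<alpha> a \<bullet> x) u \<in> \<H> Y (FObj G a)" using D x u o by simp
  have "ap (FObj F b) (FObj H b) ((VComp (self_vcat \<V>) (FObj F b) (FObj G b) (FObj H b) \<bullet> \<langle>\<beta> b, \<alpha> b\<rangle>) \<bullet> x) (act F a b h u) =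
    ap (FObj G b) (FObj H b) (\<beta> b \<bullet> x) (ap (FObj F b) (FObj G b) (\<alpha> b \<bullet> x) (act F a b h u))"
    using D E o x fu by simp
  also have "\<dots> = act H a b h (ap (FObj G a) (FObj H a) (\<beta> a \<bullet> x) (ap (FObj F a) (FObj G a) (\<alpha> a \<bullet> x) u))"
    unfolding D(5)[OF x h u] by (rule E(5)[OF x h au])
  also have "ap (FObj G a) (FObj H a) (\<beta> a \<bullet> x) (ap (FObj F a) (FObj G a) (\<alpha> a \<bullet> x) u) =
      ap (FObj F a) (FObj H a) ((VComp (self_vcat \<V>) (FObj F a) (FObj G a) (FObj H a) \<bullet> \<langle>\<beta> a, \<alpha> a\<rangle>) \<bullet> x) u"
    using D E o x u by simp
  finally show "ap (FObj F b) (FObj H b) ((VComp (self_vcat \<V>) (FObj F b) (FObj G b) (FObj H b) \<bullet> \<langle>\<beta> b, \<alpha> b\<rangle>) \<bullet> x) (act F a b h u) =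
     act H a b h (ap (FObj F a) (FObj H a) ((VComp (self_vcat \<V>) (FObj F a) (FObj G a) (FObj H a) \<bullet> \<langle>\<beta> a, \<alpha> a\<rangle>) \<bullet> x) u)" .
qed

lemma cotensor_obj: "FObj (alg_cotensor \<V> T X A) k = Exp \<V> X (FObj A k)"
  by (simp add: alg_cotensor_def)

lemma cotensor_typed:
  assumes A: "stage_typed T A" and X: "obj X"
  shows "stage_typed T (alg_cotensor \<V> T X A)"
  using stage_typedD[OF A] X unfolding stage_typed_def by (simp add: alg_cotensor_def Let_def)

text \<open>The action on a cotensor is pointwise. The next lemmas transfer the functor laws and the preservation of
  powers from an algebra to its cotensors by evaluating at points.\<close>

lemma app_act_cotensor:
  assumes A: "stage_typed T A" and X: "obj X"
    and h: "h \<in> \<H> Y (VHom T k l)" and f: "f \<in> \<H> Y (Exp \<V> X (FObj A k))" and y: "y \<in> \<H> Z Y" and v: "v \<in> \<H> Z X"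
  shows "ap X (FObj A l) (act (alg_cotensor \<V> T X A) k l h f \<bullet> y) v = act A k l (h \<bullet> y) (ap X (FObj A k) (f \<bullet> y) v)"
  using stage_typedD[OF A] X h f y v unfolding act_def by (simp add: alg_cotensor_def Let_def)

lemma cotensor_fun:
  assumes T: "stage_cat T" and A: "stage_fun T A" and X: "obj X"
  shows "stage_fun T (alg_cotensor \<V> T X A)"
proof -
  note At = stage_funD(1)[OF A]
  note Bt = cotensor_typed[OF At X]
  let ?B = "alg_cotensor \<V> T X A"
  have o: "obj (FObj A k)" for k by (rule stage_typedD(2)[OF At])
  have tv: "arr (VId T a)" "src (VId T a) = \<I>" "tgt (VId T a) = VHom T a a"
    "arr (VComp T a b c)" "src (VComp T a b c) = VHom T b c \<star> VHom T a b" "tgt (VComp T a b c) = VHom T a c"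
    for a b c using stage_catD(3,4)[OF T] by simp_all
  show ?thesis unfolding stage_fun_def
  proof (intro conjI allI impI)
    show "stage_typed T ?B" by (rule Bt)
    fix a Y f assume f: "f \<in> \<H> Y (FObj ?B a)"
    then have f': "f \<in> \<H> Y (Exp \<V> X (FObj A a))" by (simp add: cotensor_obj)
    have Y: "obj Y" using f by auto
    have i: "VId T a \<bullet> bng Y \<in> \<H> Y (VHom T a a)" using tv Y by simp
    show "act ?B a a (VId T a \<bullet> bng Y) f = f"
    proof (rule exp_eqI[OF _ f' X o])
      show "act ?B a a (VId T a \<bullet> bng Y) f \<in> \<H> Y (Exp \<V> X (FObj A a))"
        using act_arr[OF Bt, of "VId T a \<bullet> bng Y" a a f] i f by (simp add: cotensor_obj)
      fix Z y v assume "obj Z" and y: "y \<in> \<H> Z Y" and v: "v \<in> \<H> Z X"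
      have fv: "ap X (FObj A a) (f \<bullet> y) v \<in> \<H> Z (FObj A a)" using f' y v o by simp
      show "ap X (FObj A a) (act ?B a a (VId T a \<bullet> bng Y) f \<bullet> y) v = ap X (FObj A a) (f \<bullet> y) v"
        using app_act_cotensor[OF At X i f' y v] stage_funD(2)[OF A fv] tv Y y by simp
    qed
  next
    fix a b c Y g h f assume g: "g \<in> \<H> Y (VHom T b c)" and h: "h \<in> \<H> Y (VHom T a b)" and f: "f \<in> \<H> Y (FObj ?B a)"
    then have f': "f \<in> \<H> Y (Exp \<V> X (FObj A a))" by (simp add: cotensor_obj)
    have gh: "VComp T a b c \<bullet> \<langle>g, h\<rangle> \<in> \<H> Y (VHom T a c)" using tv g h by simp
    have hf: "act ?B a b h f \<in> \<H> Y (Exp \<V> X (FObj A b))"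
      using act_arr[OF Bt, of h a b f] h f by (simp add: cotensor_obj)
    show "act ?B a c (VComp T a b c \<bullet> \<langle>g, h\<rangle>) f = act ?B b c g (act ?B a b h f)"
    proof (rule exp_eqI[OF _ _ X o])
      show "act ?B a c (VComp T a b c \<bullet> \<langle>g, h\<rangle>) f \<in> \<H> Y (Exp \<V> X (FObj A c))"
        using act_arr[OF Bt, of "VComp T a b c \<bullet> \<langle>g, h\<rangle>" a c f] gh f by (simp add: cotensor_obj)
      show "act ?B b c g (act ?B a b h f) \<in> \<H> Y (Exp \<V> X (FObj A c))"
        using act_arr[OF Bt, of g b c "act ?B a b h f"] g hf by (simp add: cotensor_obj)
      fix Z y v assume "obj Z" and y: "y \<in> \<H> Z Y" and v: "v \<in> \<H> Z X"
      have fv: "ap X (FObj A a) (f \<bullet> y) v \<in> \<H> Z (FObj A a)" using f' y v o by simp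
      have gy: "g \<bullet> y \<in> \<H> Z (VHom T b c)" "h \<bullet> y \<in> \<H> Z (VHom T a b)" using g h y by simp_all
      show "ap X (FObj A c) (act ?B a c (VComp T a b c \<bullet> \<langle>g, h\<rangle>) f \<bullet> y) v =
         ap X (FObj A c) (act ?B b c g (act ?B a b h f) \<bullet> y) v"
        unfolding app_act_cotensor[OF At X gh f' y v] app_act_cotensor[OF At X g hf y v] app_act_cotensor[OF At X h f' y v]
          stage_funD(3)[OF A gy fv, symmetric] using tv g h y by simp
    qed
  qed
qed

lemma cotensor_power:
  assumes A: "stage_typed T A" and X: "obj X"
    and p: "\<And>i. i < n \<Longrightarrow> p i \<in> \<H> \<I> (VHom T c x)"
    and pow: "power_via (FObj A c) (FObj A x) n (\<lambda>i. FMap A c x \<bullet> p i)"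
  shows "power_via (FObj (alg_cotensor \<V> T X A) c) (FObj (alg_cotensor \<V> T X A) x) n (\<lambda>i. FMap (alg_cotensor \<V> T X A) c x \<bullet> p i)"
  unfolding power_via_def
proof (intro conjI allI impI)
  let ?B = "alg_cotensor \<V> T X A"
  note Bt = cotensor_typed[OF A X]
  note Ad = stage_typedD[OF A] and Bd = stage_typedD[OF Bt]
  show "obj (FObj ?B c)" "obj (FObj ?B x)" using Bd by auto
  show "FMap ?B c x \<bullet> p i \<in> \<H> \<I> (Exp \<V> (FObj ?B c) (FObj ?B x))" if "i < n" for i
    using p[OF that] Bd by simp
  fix Y F assume Y: "obj Y" and F': "\<forall>i<n. F i \<in> \<H> Y (FObj ?B x)"
  then have F: "arr (F i)" "src (F i) = Y" "tgt (F i) = Exp \<V> X (FObj A x)" if "i < n" for i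
    using that by (simp_all add: cotensor_obj)
  have via: "ap X (FObj A x) (ap (FObj ?B c) (FObj ?B x) ((FMap ?B c x \<bullet> p i) \<bullet> bng Y) f \<bullet> y) v =
      ap (FObj A c) (FObj A x) ((FMap A c x \<bullet> p i) \<bullet> bng Z) (ap X (FObj A c) (f \<bullet> y) v)"
    if "i < n" "f \<in> \<H> Y (FObj ?B c)" "y \<in> \<H> Z Y" "v \<in> \<H> Z X" for i f Z y v
  proof -
    have Z: "obj Z" using that by auto
    have f': "f \<in> \<H> Y (Exp \<V> X (FObj A c))" using that(2) by (simp add: cotensor_obj)
    have pY: "p i \<bullet> bng Y \<in> \<H> Y (VHom T c x)" using p[OF that(1)] Y by simp
    have "ap (FObj ?B c) (FObj ?B x) ((FMap ?B c x \<bullet> p i) \<bullet> bng Y) f = act ?B c x (p i \<bullet> bng Y) f"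
      unfolding act_def using p[OF that(1)] Y Bd by simp
    then show ?thesis
      using app_act_cotensor[OF A X pY f' that(3,4)] p[OF that(1)] Y Z Ad that(3) by (simp add: act_def)
  qed
  have ex: "\<exists>!h. h \<in> \<H> Z (FObj A c) \<and> (\<forall>i<n. ap (FObj A c) (FObj A x) ((FMap A c x \<bullet> p i) \<bullet> bng Z) h = G i)"
    if "obj Z" "\<And>i. i < n \<Longrightarrow> G i \<in> \<H> Z (FObj A x)" for Z G
    using pow that unfolding power_via_def by blast
  let ?F = "\<lambda>i. ap X (FObj A x) (F i \<bullet> Pr1 \<V> Y X) (Pr2 \<V> Y X)"
  have "\<exists>!h. h \<in> \<H> (Y \<star> X) (FObj A c) \<and> (\<forall>i<n. ap (FObj A c) (FObj A x) ((FMap A c x \<bullet> p i) \<bullet> bng (Y \<star> X)) h = ?F i)"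
    by (rule ex) (use Y X F Ad in simp_all)
  then obtain h where h: "arr h" "src h = Y \<star> X" "tgt h = FObj A c"
    and hi: "\<And>i. i < n \<Longrightarrow> ap (FObj A c) (FObj A x) ((FMap A c x \<bullet> p i) \<bullet> bng (Y \<star> X)) h = ?F i"
    by auto
  let ?h = "curry' \<V> Y X h"
  have h': "?h \<in> \<H> Y (FObj ?B c)" using h X Y by (simp add: cotensor_obj)
  have pB: "ap (FObj ?B c) (FObj ?B x) ((FMap ?B c x \<bullet> p i) \<bullet> bng Y) f \<in> \<H> Y (Exp \<V> X (FObj A x))"
    if "i < n" "f \<in> \<H> Y (FObj ?B c)" for i f
    using p[OF that(1)] that(2) Bd Ad X Y by (simp add: cotensor_obj)
  show "\<exists>!h. h \<in> \<H> Y (FObj ?B c) \<and> (\<forall>i<n. ap (FObj ?B c) (FObj ?B x) ((FMap ?B c x \<bullet> p i) \<bullet> bng Y) h = F i)"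
  proof (rule ex1I[of _ ?h], intro conjI allI impI)
    show "?h \<in> \<H> Y (FObj ?B c)" by (rule h')
    fix i assume i: "i < n"
    show "ap (FObj ?B c) (FObj ?B x) ((FMap ?B c x \<bullet> p i) \<bullet> bng Y) ?h = F i"
    proof (rule exp_eqI[OF pB[OF i h'] _ X Ad(2)])
      show "F i \<in> \<H> Y (Exp \<V> X (FObj A x))" using F[OF i] by simp
      fix Z y v assume Z: "obj Z" and y: "y \<in> \<H> Z Y" and v: "v \<in> \<H> Z X"
      have "ap (FObj A c) (FObj A x) ((FMap A c x \<bullet> p i) \<bullet> bng Z) (ap X (FObj A c) (?h \<bullet> y) v) =
        ap (FObj A c) (FObj A x) ((FMap A c x \<bullet> p i) \<bullet> bng (Y \<star> X)) h \<bullet> \<langle>y, v\<rangle>"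
        using p[OF i] Ad h X Y Z y v by simp
      also have "\<dots> = ap X (FObj A x) (F i \<bullet> y) v"
        unfolding hi[OF i] using F[OF i] X Y Z y v Ad by simp
      finally show "ap X (FObj A x) (ap (FObj ?B c) (FObj ?B x) ((FMap ?B c x \<bullet> p i) \<bullet> bng Y) ?h \<bullet> y) v = ap X (FObj A x) (F i \<bullet> y) v"
        unfolding via[OF i h' y v] .
    qed
  next
    fix f assume "f \<in> \<H> Y (FObj ?B c) \<and> (\<forall>i<n. ap (FObj ?B c) (FObj ?B x) ((FMap ?B c x \<bullet> p i) \<bullet> bng Y) f = F i)"
    then have f: "f \<in> \<H> Y (FObj ?B c)" and fi: "\<And>i. i < n \<Longrightarrow> ap (FObj ?B c) (FObj ?B x) ((FMap ?B c x \<bullet> p i) \<bullet> bng Y) f = F i"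
      by blast+
    have f': "f \<in> \<H> Y (Exp \<V> X (FObj A c))" "?h \<in> \<H> Y (Exp \<V> X (FObj A c))"
      using f h' unfolding cotensor_obj by blast+
    show "f = ?h"
    proof (rule exp_eqI[OF f' X Ad(2)])
      fix Z y v assume Z: "obj Z" and y: "y \<in> \<H> Z Y" and v: "v \<in> \<H> Z X"
      have "ap (FObj A c) (FObj A x) ((FMap A c x \<bullet> p i) \<bullet> bng Z) (ap X (FObj A c) (f \<bullet> y) v) = ap X (FObj A x) (F i \<bullet> y) v"
        "ap (FObj A c) (FObj A x) ((FMap A c x \<bullet> p i) \<bullet> bng Z) (ap X (FObj A c) (?h \<bullet> y) v) = ap X (FObj A x) (F i \<bullet> y) v"
        if i: "i < n" for i
      proof -
        show "ap (FObj A c) (FObj A x) ((FMap A c x \<bullet> p i) \<bullet> bng Z) (ap X (FObj A c) (f \<bullet> y) v) = ap X (FObj A x) (F i \<bullet> y) v"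
          unfolding via[OF i f y v, symmetric] fi[OF i] ..
        have "ap (FObj A c) (FObj A x) ((FMap A c x \<bullet> p i) \<bullet> bng Z) (ap X (FObj A c) (?h \<bullet> y) v) =
          ap (FObj A c) (FObj A x) ((FMap A c x \<bullet> p i) \<bullet> bng (Y \<star> X)) h \<bullet> \<langle>y, v\<rangle>"
          using p[OF i] Ad h X Y Z y v by simp
        also have "\<dots> = ap X (FObj A x) (F i \<bullet> y) v"
          unfolding hi[OF i] using F[OF i] X Y Z y v Ad by simp
        finally show "ap (FObj A c) (FObj A x) ((FMap A c x \<bullet> p i) \<bullet> bng Z) (ap X (FObj A c) (?h \<bullet> y) v) = ap X (FObj A x) (F i \<bullet> y) v" .
      qed
      moreover have "ap X (FObj A c) (f \<bullet> y) v \<in> \<H> Z (FObj A c)" "ap X (FObj A c) (?h \<bullet> y) v \<in> \<H> Z (FObj A c)"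
        using f' y v Ad by simp_all
      moreover have "ap X (FObj A x) (F i \<bullet> y) v \<in> \<H> Z (FObj A x)" if "i < n" for i
        using F[OF that] y v Ad by simp
      ultimately show "ap X (FObj A c) (f \<bullet> y) v = ap X (FObj A c) (?h \<bullet> y) v"
        using ex[OF Z, of "\<lambda>i. ap X (FObj A x) (F i \<bullet> y) v"] by blast
    qed
  qed
qed

end

lemma (in base) tuple_one:
  assumes "F 0 \<in> \<H> Y X"
  shows "tuple \<V> Y X (Suc 0) F = F 0"
proof -
  have X: "obj X" "obj Y" using assms by auto
  have "proj \<V> X (Suc 0) 0 \<bullet> tuple \<V> Y X (Suc 0) F = F 0"
    by (rule proj_tuple) (use X assms in simp_all)
  moreover have "tuple \<V> Y X (Suc 0) F \<in> \<H> Y X"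
    using tuple_arr[of X Y "Suc 0" F] X assms by simp
  ultimately show ?thesis by simp
qed

section \<open>The commutant\<close>

context comm_preordered_ring
begin

lemma coefficients_precomp:
  assumes c: "has_coefficients n m X \<alpha> q" and h: "h \<in> \<H> Y X"
  shows "has_coefficients n m Y (\<lambda>k. \<alpha> k \<bullet> h) (\<lambda>j i. q j i \<bullet> h)"
  unfolding has_coefficients_def
proof (intro conjI allI impI)
  note D = has_coefficientsD[OF c]
  show "\<alpha> k \<bullet> h \<in> \<H> Y (Exp \<V> (mat \<V> P k n) (mat \<V> P k m))" for k using D h by simp
  show "q j i \<bullet> h \<in> \<H> Y K" if "j < m" "i \<le> n" for j i using D(5-7)[OF that] h by simp
  fix k Z x u j \<kappa> assume x: "x \<in> \<H> Z Y" and u: "u \<in> \<H> Z (mat \<V> P k n)" and j: "j < m" "\<kappa> < k"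
  have "h \<bullet> x \<in> \<H> Z X" using h x by simp
  then show "entry \<V> P k m j \<kappa> \<bullet> ap (mat \<V> P k n) (mat \<V> P k m) ((\<alpha> k \<bullet> h) \<bullet> x) u =
        form Z n (\<lambda>i. (q j i \<bullet> h) \<bullet> x) (\<lambda>i. entry \<V> P k n i \<kappa> \<bullet> u)"
    using D(8)[of "h \<bullet> x" Z u k j \<kappa>] u j D(1-3) D(5-7)[OF j(1)] h x by simp
qed

lemma same_coefficients:
  assumes c: "has_coefficients n m X \<alpha> q" and d: "has_coefficients n m X \<beta> q"
  shows "\<alpha> k = \<beta> k"
proof (rule exp_eqI[of _ X "mat \<V> P k n" "mat \<V> P k m"])
  note D = has_coefficientsD[OF c] and E = has_coefficientsD[OF d]
  show "\<alpha> k \<in> \<H> X (Exp \<V> (mat \<V> P k n) (mat \<V> P k m))" "\<beta> k \<in> \<H> X (Exp \<V> (mat \<V> P k n) (mat \<V> P k m))"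
    using D E by simp_all
  fix Y x u assume "obj Y" and x: "x \<in> \<H> Y X" and u: "u \<in> \<H> Y (mat \<V> P k n)"
  show "ap (mat \<V> P k n) (mat \<V> P k m) (\<alpha> k \<bullet> x) u = ap (mat \<V> P k n) (mat \<V> P k m) (\<beta> k \<bullet> x) u" (is "?a = ?b")
  proof (rule mat_eqI[of _ Y k m])
    show "?a \<in> \<H> Y (mat \<V> P k m)" "?b \<in> \<H> Y (mat \<V> P k m)" using D(1-4) E(1-4) x u by simp_all
    fix j \<kappa> assume j: "j < m" "\<kappa> < k"
    show "entry \<V> P k m j \<kappa> \<bullet> ?a = entry \<V> P k m j \<kappa> \<bullet> ?b"
      using D(8)[OF x u j] E(8)[OF x u j] by simp
  qed
qed simp_all

end

context firm_preordered_ring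
begin

text \<open>The matrices with \<open>n + 1\<close> columns represent the natural families: their generic element is the universal
  matrix of coefficients, and existence and uniqueness of coefficients give the universal property.\<close>

lemma vnat_object_ex: "\<exists>E. is_vnat_object \<V> T (Spow n) (Spow m) E"
proof -
  let ?X = "mat \<V> P (Suc n) m"
  have "entry \<V> P (Suc n) m j i \<in> \<H> ?X K" if "j < m" "i \<le> n" for j i using that by simp
  then obtain \<epsilon> where \<epsilon>: "has_coefficients n m ?X \<epsilon> (entry \<V> P (Suc n) m)"
    using coefficients_realized[of ?X m n "entry \<V> P (Suc n) m"] by auto
  have "is_vnat_object \<V> T (Spow n) (Spow m) (?X, \<epsilon>)"
    unfolding is_vnat_object_def fst_conv snd_conv
  proof (intro conjI allI impI)
    show "vnat_wedge \<V> T (Spow n) (Spow m) ?X \<epsilon>" by (rule coefficients_wedge[OF \<epsilon>])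
    fix X \<alpha> assume "vnat_wedge \<V> T (Spow n) (Spow m) X \<alpha>"
    then obtain q where q: "has_coefficients n m X \<alpha> q" by (rule wedge_has_coefficients)
    note D = has_coefficientsD[OF q]
    let ?h = "mk_mat \<V> P X (Suc n) m q"
    have qi: "q j i \<in> \<H> X K" if "j < m" "i < Suc n" for j i using D(5-7)[of j i] that by simp
    have h: "?h \<in> \<H> X ?X" using D(4) qi by simp
    have "has_coefficients n m X (\<lambda>k. \<epsilon> k \<bullet> ?h) q"
    proof -
      have "has_coefficients n m X (\<lambda>k. \<epsilon> k \<bullet> ?h) (\<lambda>j i. entry \<V> P (Suc n) m j i \<bullet> ?h)"
        by (rule coefficients_precomp[OF \<epsilon> h])
      then show ?thesis using D(4) qi by (simp add: has_coefficients_def del: hom_iff)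
    qed
    then have eh: "\<epsilon> k \<bullet> ?h = \<alpha> k" for k using same_coefficients[OF _ q] by blast
    show "\<exists>!h. h \<in> \<H> X ?X \<and> (\<forall>a\<in>VObj T. \<epsilon> a \<bullet> h = \<alpha> a)"
    proof (rule ex1I[of _ ?h])
      show "?h \<in> \<H> X ?X \<and> (\<forall>a\<in>VObj T. \<epsilon> a \<bullet> ?h = \<alpha> a)" using h eh by blast
      fix g assume g: "g \<in> \<H> X ?X \<and> (\<forall>a\<in>VObj T. \<epsilon> a \<bullet> g = \<alpha> a)"
      then have g': "g \<in> \<H> X ?X" and e1: "\<epsilon> 1 \<bullet> g = \<epsilon> 1 \<bullet> ?h" using eh by (auto simp: Mat_aff_def)
      show "g = ?h"
      proof (rule mat_eqI[OF g' h])
        fix j i assume "j < m" "i < Suc n"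
        then show "entry \<V> P (Suc n) m j i \<bullet> g = entry \<V> P (Suc n) m j i \<bullet> ?h"
          by (intro coefficients_unique(1)[OF coefficients_precomp[OF \<epsilon> g'] coefficients_precomp[OF \<epsilon> h] e1]) simp_all
      qed
    qed
  qed
  then show ?thesis by blast
qed

text \<open>The hom-objects of the commutant are only determined up to isomorphism, so everything below refers to
  the chosen universal family \<open>cfam\<close> on \<open>chom\<close> through its universal property.\<close>

definition cfam :: "nat \<Rightarrow> nat \<Rightarrow> nat \<Rightarrow> 'm" where
  "cfam n m = snd (vnat_object \<V> T (Spow n) (Spow m))"

definition chom :: "nat \<Rightarrow> nat \<Rightarrow> 'o" where
  "chom n m = fst (vnat_object \<V> T (Spow n) (Spow m))"

lemma T_obj [simp]: "VObj T = UNIV"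
  by (simp add: Mat_aff_def)

lemma cfam_universal:
  shows "vnat_wedge \<V> T (Spow n) (Spow m) (chom n m) (cfam n m)"
    "vnat_wedge \<V> T (Spow n) (Spow m) X \<alpha> \<Longrightarrow> \<exists>!h. h \<in> \<H> X (chom n m) \<and> (\<forall>a. cfam n m a \<bullet> h = \<alpha> a)"
proof -
  have "is_vnat_object \<V> T (Spow n) (Spow m) (vnat_object \<V> T (Spow n) (Spow m))"
    unfolding vnat_object_def by (rule someI_ex[OF vnat_object_ex])
  then have u: "vnat_wedge \<V> T (Spow n) (Spow m) (chom n m) (cfam n m) \<and>
     (\<forall>X \<alpha>. vnat_wedge \<V> T (Spow n) (Spow m) X \<alpha> \<longrightarrow>
        (\<exists>!h. h \<in> \<H> X (chom n m) \<and> (\<forall>a \<in> VObj T. cfam n m a \<bullet> h = \<alpha> a)))"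
    unfolding is_vnat_object_def chom_def cfam_def .
  show "vnat_wedge \<V> T (Spow n) (Spow m) (chom n m) (cfam n m)" by (rule u[THEN conjunct1])
  show "\<exists>!h. h \<in> \<H> X (chom n m) \<and> (\<forall>a. cfam n m a \<bullet> h = \<alpha> a)" if "vnat_wedge \<V> T (Spow n) (Spow m) X \<alpha>"
    using u[THEN conjunct2, rule_format, OF that] by simp
qed

lemma cfam_arr [simp]:
  "obj (chom n m)" "arr (cfam n m k)" "src (cfam n m k) = chom n m" "tgt (cfam n m k) = Exp \<V> (mat \<V> P k n) (mat \<V> P k m)"
  using wedge_arr[OF cfam_universal(1)] by simp_all

text \<open>The carrier component separates elements of the hom-object, because it determines the coefficients
  and these determine the family.\<close>

lemma cfam_mono:
  assumes h: "h \<in> \<H> Y (chom n m)" and h': "h' \<in> \<H> Y (chom n m)" and eq: "cfam n m 1 \<bullet> h = cfam n m 1 \<bullet> h'"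
  shows "h = h'"
proof -
  have w: "vnat_wedge \<V> T (Spow n) (Spow m) Y (\<lambda>k. cfam n m k \<bullet> g)" if "g \<in> \<H> Y (chom n m)" for g
    by (rule wedge_precomp[OF Spow_typed Spow_typed cfam_universal(1) that])
  obtain q where q: "has_coefficients n m Y (\<lambda>k. cfam n m k \<bullet> h) q" using wedge_has_coefficients[OF w[OF h]] .
  obtain r where r: "has_coefficients n m Y (\<lambda>k. cfam n m k \<bullet> h') r" using wedge_has_coefficients[OF w[OF h']] .
  have "cfam n m k \<bullet> h = cfam n m k \<bullet> h'" for k by (rule coefficients_unique(2)[OF q r eq])
  then show ?thesis using cfam_universal(2)[OF w[OF h']] h h' by blast
qed

abbreviation U where "U \<equiv> commutant \<V> T (aff_alg \<V> P)"
abbreviation CA where "CA \<equiv> commutant_alg \<V> T (aff_alg \<V> P)"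

lemma mat_one: "mat \<V> P 1 n = pow \<V> K n"
  by (simp add: mat_def)

lemma entry_one: "i < n \<Longrightarrow> entry \<V> P 1 n i 0 = proj \<V> K n i"
  by (simp add: entry_def)

lemma U_obj [simp]: "VObj U = UNIV" "VHom U n m = chom n m"
  by (simp_all add: commutant_def Alg_def chom_def)

lemma CA_obj [simp]: "FObj CA n = pow \<V> K n"
  by (simp add: commutant_alg_def carrier_of_def)

lemma CA_map: "FMap CA n m = cfam n m 1"
  by (simp add: commutant_alg_def alg_hom_carrier_def cfam_def)

lemma CA_typed: "stage_typed U CA"
  unfolding stage_typed_def CA_map U_obj CA_obj using mat_one by simp

lemma act_CA_arr [simp]:
  assumes "arr h" "tgt h = chom n m" "arr u" "tgt u = pow \<V> K n" "src u = src h"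
  shows "arr (act CA n m h u)" "src (act CA n m h u) = src h" "tgt (act CA n m h u) = pow \<V> K m"
  using act_arr[OF CA_typed, of h n m u] assms by simp_all

lemma act_CA_comp [simp]:
  assumes "arr h" "tgt h = chom n m" "arr u" "tgt u = pow \<V> K n" "src u = src h" "arr y" "tgt y = src h"
  shows "act CA n m h u \<bullet> y = act CA n m (h \<bullet> y) (u \<bullet> y)"
  using act_comp[OF CA_typed, of h n m u y] assms by simp

lemma act_CA_name:
  assumes h: "h \<in> \<H> \<I> (chom n m)" and f: "f \<in> \<H> (pow \<V> K n) (pow \<V> K m)"
    and eq: "cfam n m 1 \<bullet> h = name_of \<V> f" and u: "u \<in> \<H> Y (pow \<V> K n)"
  shows "act CA n m (h \<bullet> bng Y) u = f \<bullet> u"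
proof -
  have Y: "obj Y" using u by auto
  have "cfam n m 1 \<bullet> h \<bullet> bng Y = name_of \<V> f \<bullet> bng Y"
    using eq[THEN arg_cong, of "\<lambda>t. t \<bullet> bng Y"] h Y by simp
  then show ?thesis unfolding act_def CA_map CA_obj using f u Y by simp
qed

text \<open>Elements of the hom-objects of the commutant are equal as soon as they act in the same way on the
  carrier; the equations of the theory are verified through this principle.\<close>

lemma chom_eqI:
  assumes h: "h \<in> \<H> Y (chom n m)" and h': "h' \<in> \<H> Y (chom n m)"
    and eq: "\<And>Z y u. y \<in> \<H> Z Y \<Longrightarrow> u \<in> \<H> Z (pow \<V> K n) \<Longrightarrow> act CA n m (h \<bullet> y) u = act CA n m (h' \<bullet> y) u"
  shows "h = h'"
proof (rule cfam_mono[OF h h'], rule exp_eqI[of _ Y "pow \<V> K n" "pow \<V> K m"])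
  show "cfam n m 1 \<bullet> h \<in> \<H> Y (Exp \<V> (pow \<V> K n) (pow \<V> K m))" "cfam n m 1 \<bullet> h' \<in> \<H> Y (Exp \<V> (pow \<V> K n) (pow \<V> K m))"
    using h h' mat_one by simp_all
  fix Z y u assume Z: "obj Z" and y: "y \<in> \<H> Z Y" and u: "u \<in> \<H> Z (pow \<V> K n)"
  show "ap (pow \<V> K n) (pow \<V> K m) ((cfam n m 1 \<bullet> h) \<bullet> y) u = ap (pow \<V> K n) (pow \<V> K m) ((cfam n m 1 \<bullet> h') \<bullet> y) u"
    using eq[OF y u] h h' y unfolding act_def CA_map CA_obj by simp
qed simp_all

text \<open>The description of natural families by coefficients, restricted to the carrier.\<close>

definition acts_by :: "nat \<Rightarrow> nat \<Rightarrow> 'o \<Rightarrow> 'm \<Rightarrow> (nat \<Rightarrow> nat \<Rightarrow> 'm) \<Rightarrow> bool" where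
  "acts_by n m Y h q \<longleftrightarrow> h \<in> \<H> Y (chom n m) \<and> (\<forall>j<m. \<forall>i\<le>n. q j i \<in> \<H> Y K) \<and>
    (\<forall>Z y u j. y \<in> \<H> Z Y \<longrightarrow> u \<in> \<H> Z (pow \<V> K n) \<longrightarrow> j < m \<longrightarrow>
      proj \<V> K m j \<bullet> act CA n m (h \<bullet> y) u = form Z n (\<lambda>i. q j i \<bullet> y) (\<lambda>i. proj \<V> K n i \<bullet> u))"

lemma acts_byD:
  assumes "acts_by n m Y h q"
  shows "h \<in> \<H> Y (chom n m)" "j < m \<Longrightarrow> i \<le> n \<Longrightarrow> q j i \<in> \<H> Y K"
    "y \<in> \<H> Z Y \<Longrightarrow> u \<in> \<H> Z (pow \<V> K n) \<Longrightarrow> j < m \<Longrightarrow>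
      proj \<V> K m j \<bullet> act CA n m (h \<bullet> y) u = form Z n (\<lambda>i. q j i \<bullet> y) (\<lambda>i. proj \<V> K n i \<bullet> u)"
  using assms unfolding acts_by_def by blast+

lemma coefficients_acts_by:
  assumes h: "h \<in> \<H> Y (chom n m)" and c: "has_coefficients n m Y (\<lambda>k. cfam n m k \<bullet> h) q"
  shows "acts_by n m Y h q"
  unfolding acts_by_def
proof (intro conjI allI impI h)
  note D = has_coefficientsD[OF c]
  show "q j i \<in> \<H> Y K" if "j < m" "i \<le> n" for j i using D(5-7)[OF that] by simp
  fix Z y u j assume y: "y \<in> \<H> Z Y" and u: "u \<in> \<H> Z (pow \<V> K n)" and j: "j < m"
  have "entry \<V> P 1 m j 0 \<bullet> ap (mat \<V> P 1 n) (mat \<V> P 1 m) ((cfam n m 1 \<bullet> h) \<bullet> y) u =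
    form Z n (\<lambda>i. q j i \<bullet> y) (\<lambda>i. entry \<V> P 1 n i 0 \<bullet> u)"
    by (rule D(8)) (use y u j mat_one in simp_all)
  moreover have "(cfam n m 1 \<bullet> h) \<bullet> y = cfam n m 1 \<bullet> h \<bullet> y" using h y by simp
  moreover have e: "form Z n (\<lambda>i. q j i \<bullet> y) (\<lambda>i. entry \<V> P 1 n i 0 \<bullet> u) = form Z n (\<lambda>i. q j i \<bullet> y) (\<lambda>i. proj \<V> K n i \<bullet> u)"
    by (rule form_cong, unfold simp_implies_def) (rule refl | subst entry_one, assumption)+
  ultimately show "proj \<V> K m j \<bullet> act CA n m (h \<bullet> y) u = form Z n (\<lambda>i. q j i \<bullet> y) (\<lambda>i. proj \<V> K n i \<bullet> u)"
    unfolding act_def CA_map CA_obj mat_one using j by (simp only: entry_one e)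
qed

lemma acts_by_ex:
  assumes h: "h \<in> \<H> Y (chom n m)"
  obtains q where "acts_by n m Y h q"
proof -
  obtain q where "has_coefficients n m Y (\<lambda>k. cfam n m k \<bullet> h) q"
    using wedge_has_coefficients[OF wedge_precomp[OF Spow_typed Spow_typed cfam_universal(1) h]] .
  then show thesis by (rule that[OF coefficients_acts_by[OF h]])
qed

lemma acts_by_realized:
  assumes Y: "obj Y" and q: "\<And>j i. j < m \<Longrightarrow> i \<le> n \<Longrightarrow> q j i \<in> \<H> Y K"
  obtains h where "acts_by n m Y h q"
proof -
  obtain \<alpha> where \<alpha>: "has_coefficients n m Y \<alpha> q" using coefficients_realized[OF Y q] .
  obtain h where h: "h \<in> \<H> Y (chom n m)" and e: "\<And>a. cfam n m a \<bullet> h = \<alpha> a"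
    using cfam_universal(2)[OF coefficients_wedge[OF \<alpha>]] by blast
  have "acts_by n m Y h q" by (rule coefficients_acts_by[OF h]) (simp add: e \<alpha>)
  then show thesis by (rule that)
qed

text \<open>Composition is defined by a universal property that holds at all components; at the carrier it says
  that composites act by composition.\<close>

lemma U_comp:
  "VComp U n m l \<in> \<H> (chom m l \<star> chom n m) (chom n l)"
  "g \<in> \<H> Y (chom m l) \<Longrightarrow> f \<in> \<H> Y (chom n m) \<Longrightarrow> u \<in> \<H> Y (pow \<V> K n) \<Longrightarrow>
     act CA n l (VComp U n m l \<bullet> \<langle>g, f\<rangle>) u = act CA m l g (act CA n m f u)"
proof -
  let ?X = "chom m l \<star> chom n m"
  let ?p = "Pr1 \<V> (chom m l) (chom n m)" and ?q = "Pr2 \<V> (chom m l) (chom n m)"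
  let ?\<gamma> = "\<lambda>a. VComp (self_vcat \<V>) (FObj (Spow n) a) (FObj (Spow m) a) (FObj (Spow l) a) \<bullet> parr \<V> (cfam m l a) (cfam n m a)"
  have "vnat_wedge \<V> T (Spow n) (Spow l) ?X (\<lambda>a. VComp (self_vcat \<V>) (FObj (Spow n) a) (FObj (Spow m) a) (FObj (Spow l) a) \<bullet>
      \<langle>cfam m l a \<bullet> ?p, cfam n m a \<bullet> ?q\<rangle>)"
    by (intro wedge_compose Spow_typed wedge_precomp[OF _ _ cfam_universal(1)]) simp_all
  then have w: "vnat_wedge \<V> T (Spow n) (Spow l) ?X ?\<gamma>" by (simp add: parr_def)
  have e: "VComp U n m l = (THE h. h \<in> \<H> ?X (chom n l) \<and> (\<forall>a. cfam n l a \<bullet> h = ?\<gamma> a))"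
    by (simp add: commutant_def Alg_def chom_def cfam_def Let_def)
  have c: "VComp U n m l \<in> \<H> ?X (chom n l)" "cfam n l 1 \<bullet> VComp U n m l = ?\<gamma> 1"
    using theI'[OF cfam_universal(2)[OF w]] unfolding e by blast+
  show "VComp U n m l \<in> \<H> ?X (chom n l)" by (rule c)
  assume g: "g \<in> \<H> Y (chom m l)" and f: "f \<in> \<H> Y (chom n m)" and u: "u \<in> \<H> Y (pow \<V> K n)"
  have "cfam n l 1 \<bullet> (VComp U n m l \<bullet> \<langle>g, f\<rangle>) = (cfam n l 1 \<bullet> VComp U n m l) \<bullet> \<langle>g, f\<rangle>"
    using c(1) g f by simp
  also have "\<dots> = VComp (self_vcat \<V>) (mat \<V> P 1 n) (mat \<V> P 1 m) (mat \<V> P 1 l) \<bullet> \<langle>cfam m l 1 \<bullet> g, cfam n m 1 \<bullet> f\<rangle>"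
    unfolding c(2) using g f by simp
  finally have "cfam n l 1 \<bullet> (VComp U n m l \<bullet> \<langle>g, f\<rangle>) = \<dots>" .
  then show "act CA n l (VComp U n m l \<bullet> \<langle>g, f\<rangle>) u = act CA m l g (act CA n m f u)"
    unfolding act_def CA_map CA_obj mat_one[symmetric] using g f u mat_one by simp
qed

lemma U_id:
  "VId U n \<in> \<H> \<I> (chom n n)" "u \<in> \<H> Y (pow \<V> K n) \<Longrightarrow> act CA n n (VId U n \<bullet> bng Y) u = u"
proof -
  have w: "vnat_wedge \<V> T (Spow n) (Spow n) \<I> (\<lambda>a. name_of \<V> (ide (FObj (Spow n) a)))"
  proof (rule wedgeI[OF Spow_typed Spow_typed])
    fix a b Y x h u assume "x \<in> \<H> Y \<I>" "h \<in> \<H> Y (VHom T a b)" "u \<in> \<H> Y (FObj (Spow n) a)"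
    then show "ap (FObj (Spow n) b) (FObj (Spow n) b) (name_of \<V> (ide (FObj (Spow n) b)) \<bullet> x) (act (Spow n) a b h u) =
       act (Spow n) a b h (ap (FObj (Spow n) a) (FObj (Spow n) a) (name_of \<V> (ide (FObj (Spow n) a)) \<bullet> x) u)"
      using act_arr[OF Spow_typed, of h a b u n] by simp
  qed simp_all
  have e: "VId U n = (THE h. h \<in> \<H> \<I> (chom n n) \<and> (\<forall>a. cfam n n a \<bullet> h = name_of \<V> (ide (FObj (Spow n) a))))"
    by (simp add: commutant_def Alg_def chom_def cfam_def Let_def)
  have c: "VId U n \<in> \<H> \<I> (chom n n)" "cfam n n 1 \<bullet> VId U n = name_of \<V> (ide (FObj (Spow n) 1))"
    using theI'[OF cfam_universal(2)[OF w]] unfolding e by blast+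
  show "VId U n \<in> \<H> \<I> (chom n n)" by (rule c)
  assume u: "u \<in> \<H> Y (pow \<V> K n)"
  have "act CA n n (VId U n \<bullet> bng Y) u = ide (pow \<V> K n) \<bullet> u"
    by (rule act_CA_name[OF c(1) _ _ u]) (use c(2) mat_one in simp_all)
  then show "act CA n n (VId U n \<bullet> bng Y) u = u" using u by simp
qed

text \<open>The projections of a pointwise power are natural because matrices act on each factor separately.\<close>

lemma U_proj:
  assumes i: "i < n"
  shows "VProj U n i \<in> \<H> \<I> (chom n 1)"
    "u \<in> \<H> Y (pow \<V> K n) \<Longrightarrow> act CA n 1 (VProj U n i \<bullet> bng Y) u = proj \<V> K n i \<bullet> u"
proof -
  let ?S = "aff_alg \<V> P"
  have t: "FObj (Spow n) a = pow \<V> (pow \<V> K a) n" "FObj (Spow 1) a = pow \<V> K a" for n a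
    by (simp_all add: mat_def)
  have w: "vnat_wedge \<V> T (Spow n) (Spow 1) \<I> (\<lambda>a. name_of \<V> (proj \<V> (pow \<V> K a) n i))"
  proof (rule wedgeI[OF Spow_typed Spow_typed])
    show "name_of \<V> (proj \<V> (pow \<V> K a) n i) \<in> \<H> \<I> (Exp \<V> (FObj (Spow n) a) (FObj (Spow 1) a))" for a
      unfolding t using i by simp
    fix a b Y x h u assume x: "x \<in> \<H> Y \<I>" and h: "h \<in> \<H> Y (VHom T a b)" and u: "u \<in> \<H> Y (FObj (Spow n) a)"
    have u': "u \<in> \<H> Y (pow \<V> (FObj ?S a) n)" using u unfolding t by simp
    have pu: "proj \<V> (pow \<V> K a) n i \<bullet> u \<in> \<H> Y (pow \<V> (FObj ?S a) 1)" using u' i by simp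
    have Y: "obj Y" using x by auto
    have s: "act ?S a b h w \<in> \<H> Y (pow \<V> K b)" if "w \<in> \<H> Y (pow \<V> K a)" for w
      using act_arr[OF aff_alg_typed, of h a b w] h that by simp
    have hu: "act (Spow n) a b h u \<in> \<H> Y (pow \<V> (pow \<V> K b) n)"
      using act_arr[OF Spow_typed, of h a b u n] h u t(1) by simp
    have "ap (FObj (Spow n) b) (FObj (Spow 1) b) (name_of \<V> (proj \<V> (pow \<V> K b) n i) \<bullet> x) (act (Spow n) a b h u) =
       proj \<V> (pow \<V> K b) n i \<bullet> act (Spow n) a b h u"
      unfolding t using hu x i by simp
    also have "\<dots> = act ?S a b h (proj \<V> (pow \<V> K a) n i \<bullet> u)"
      unfolding act_alg_pow[OF aff_alg_typed h u'] aff_alg_obj using i Y u' s by simp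
    also have "\<dots> = act (Spow 1) a b h (proj \<V> (pow \<V> K a) n i \<bullet> u)"
      unfolding act_alg_pow[OF aff_alg_typed h pu] aff_alg_obj using Y pu s[of "proj \<V> (pow \<V> K a) n i \<bullet> u"]
      by (simp add: tuple_one)
    also have "proj \<V> (pow \<V> K a) n i \<bullet> u = ap (FObj (Spow n) a) (FObj (Spow 1) a) (name_of \<V> (proj \<V> (pow \<V> K a) n i) \<bullet> x) u"
      unfolding t using u' x i by simp
    finally show "ap (FObj (Spow n) b) (FObj (Spow 1) b) (name_of \<V> (proj \<V> (pow \<V> K b) n i) \<bullet> x) (act (Spow n) a b h u) =
       act (Spow 1) a b h (ap (FObj (Spow n) a) (FObj (Spow 1) a) (name_of \<V> (proj \<V> (pow \<V> K a) n i) \<bullet> x) u)" .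
  qed simp
  have e: "VProj U n i = (THE h. h \<in> \<H> \<I> (chom n 1) \<and> (\<forall>a. cfam n 1 a \<bullet> h = name_of \<V> (proj \<V> (pow \<V> K a) n i)))"
    by (simp add: commutant_def Alg_def chom_def cfam_def Let_def)
  have c: "VProj U n i \<in> \<H> \<I> (chom n 1)" "cfam n 1 1 \<bullet> VProj U n i = name_of \<V> (proj \<V> (pow \<V> K 1) n i)"
    using theI'[OF cfam_universal(2)[OF w]] unfolding e by blast+
  show "VProj U n i \<in> \<H> \<I> (chom n 1)" by (rule c)
  show "act CA n 1 (VProj U n i \<bullet> bng Y) u = proj \<V> K n i \<bullet> u" if u: "u \<in> \<H> Y (pow \<V> K n)"
    by (rule act_CA_name[OF c(1) _ _ u]) (use c(2) i in simp_all)
qed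

lemma U_proj_one: "VProj U 1 0 = VId U 1"
  by (simp add: commutant_def Alg_def mat_def)

end

section \<open>The commutant as a theory, and its algebras\<close>

context firm_preordered_ring
begin

lemma U_comp_arr [simp]:
  "arr (VComp U n m l)" "src (VComp U n m l) = chom m l \<star> chom n m" "tgt (VComp U n m l) = chom n l"
  using U_comp(1)[of n m l] by simp_all

lemma U_id_arr [simp]: "arr (VId U n)" "src (VId U n) = \<I>" "tgt (VId U n) = chom n n"
  using U_id(1)[of n] by simp_all

lemma U_stage_cat: "stage_cat U"
  unfolding stage_cat_def U_obj
proof (intro conjI allI impI)
  show "VId U a \<in> \<H> \<I> (chom a a)" for a by (rule U_id)
  show "VComp U a b c \<in> \<H> (chom b c \<star> chom a b) (chom a c)" for a b c by (rule U_comp)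
  show "VComp U a b b \<bullet> \<langle>VId U b \<bullet> bng Y, f\<rangle> = f" if f: "f \<in> \<H> Y (chom a b)" for a b Y f
  proof (rule chom_eqI[of _ Y a b])
    have Y: "obj Y" using f by auto
    show "VComp U a b b \<bullet> \<langle>VId U b \<bullet> bng Y, f\<rangle> \<in> \<H> Y (chom a b)" using f Y by simp
    fix Z y u assume y: "y \<in> \<H> Z Y" and u: "u \<in> \<H> Z (pow \<V> K a)"
    have Z: "obj Z" using y by auto
    have fu: "act CA a b (f \<bullet> y) u \<in> \<H> Z (pow \<V> K b)" using f y u by simp
    have "act CA a b (VComp U a b b \<bullet> \<langle>VId U b \<bullet> bng Z, f \<bullet> y\<rangle>) u = act CA b b (VId U b \<bullet> bng Z) (act CA a b (f \<bullet> y) u)"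
      by (rule U_comp(2)) (use f y u Z in simp_all)
    then show "act CA a b ((VComp U a b b \<bullet> \<langle>VId U b \<bullet> bng Y, f\<rangle>) \<bullet> y) u = act CA a b (f \<bullet> y) u"
      unfolding U_id(2)[OF fu] using f y Y Z by simp
  qed (rule f)
  show "VComp U a a b \<bullet> \<langle>f, VId U a \<bullet> bng Y\<rangle> = f" if f: "f \<in> \<H> Y (chom a b)" for a b Y f
  proof (rule chom_eqI[of _ Y a b])
    have Y: "obj Y" using f by auto
    show "VComp U a a b \<bullet> \<langle>f, VId U a \<bullet> bng Y\<rangle> \<in> \<H> Y (chom a b)" using f Y by simp
    fix Z y u assume y: "y \<in> \<H> Z Y" and u: "u \<in> \<H> Z (pow \<V> K a)"
    have Z: "obj Z" using y by auto
    have "act CA a b (VComp U a a b \<bullet> \<langle>f \<bullet> y, VId U a \<bullet> bng Z\<rangle>) u = act CA a b (f \<bullet> y) (act CA a a (VId U a \<bullet> bng Z) u)"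
      by (rule U_comp(2)) (use f y u Z in simp_all)
    then show "act CA a b ((VComp U a a b \<bullet> \<langle>f, VId U a \<bullet> bng Y\<rangle>) \<bullet> y) u = act CA a b (f \<bullet> y) u"
      unfolding U_id(2)[OF u] using f y Y Z by simp
  qed (rule f)
  show "VComp U a b d \<bullet> \<langle>VComp U b c d \<bullet> \<langle>h, g\<rangle>, f\<rangle> = VComp U a c d \<bullet> \<langle>h, VComp U a b c \<bullet> \<langle>g, f\<rangle>\<rangle>"
    if h: "h \<in> \<H> Y (chom c d)" and g: "g \<in> \<H> Y (chom b c)" and f: "f \<in> \<H> Y (chom a b)" for a b c d Y h g f
  proof (rule chom_eqI[of _ Y a d])
    show "VComp U a b d \<bullet> \<langle>VComp U b c d \<bullet> \<langle>h, g\<rangle>, f\<rangle> \<in> \<H> Y (chom a d)"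
      "VComp U a c d \<bullet> \<langle>h, VComp U a b c \<bullet> \<langle>g, f\<rangle>\<rangle> \<in> \<H> Y (chom a d)" using f g h by simp_all
    fix Z y u assume y: "y \<in> \<H> Z Y" and u: "u \<in> \<H> Z (pow \<V> K a)"
    have t: "h \<bullet> y \<in> \<H> Z (chom c d)" "g \<bullet> y \<in> \<H> Z (chom b c)" "f \<bullet> y \<in> \<H> Z (chom a b)" using f g h y by simp_all
    have hg: "VComp U b c d \<bullet> \<langle>h \<bullet> y, g \<bullet> y\<rangle> \<in> \<H> Z (chom b d)" "VComp U a b c \<bullet> \<langle>g \<bullet> y, f \<bullet> y\<rangle> \<in> \<H> Z (chom a c)"
      using t by simp_all
    have fu: "act CA a b (f \<bullet> y) u \<in> \<H> Z (pow \<V> K b)" using t u by simp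
    have "act CA a d (VComp U a b d \<bullet> \<langle>VComp U b c d \<bullet> \<langle>h \<bullet> y, g \<bullet> y\<rangle>, f \<bullet> y\<rangle>) u =
      act CA a d (VComp U a c d \<bullet> \<langle>h \<bullet> y, VComp U a b c \<bullet> \<langle>g \<bullet> y, f \<bullet> y\<rangle>\<rangle>) u"
      unfolding U_comp(2)[OF hg(1) t(3) u] U_comp(2)[OF t(1,2) fu] U_comp(2)[OF t(1) hg(2) u] U_comp(2)[OF t(2,3) u] ..
    then show "act CA a d ((VComp U a b d \<bullet> \<langle>VComp U b c d \<bullet> \<langle>h, g\<rangle>, f\<rangle>) \<bullet> y) u =
       act CA a d ((VComp U a c d \<bullet> \<langle>h, VComp U a b c \<bullet> \<langle>g, f\<rangle>\<rangle>) \<bullet> y) u"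
      using f g h y by simp
  qed
qed (rule refl cfam_arr)+

lemma CA_fun: "stage_fun U CA"
  unfolding stage_fun_def U_obj CA_obj using CA_typed U_id(2) U_comp(2) by blast

text \<open>A family of \<open>n\<close> arrows \<open>k \<rightarrow> 1\<close> consists of \<open>n\<close> affine forms; an arrow \<open>k \<rightarrow> n\<close> with these forms as its
  rows is the required factorization.\<close>

lemma U_conical: "is_conical_power \<V> U n 1 n (VProj U n)"
  unfolding is_conical_power_def U_obj
proof (intro conjI ballI)
  show "\<forall>i<n. VProj U n i \<in> \<H> \<I> (chom n 1)" using U_proj(1) by blast
  fix k :: nat
  let ?q = "\<lambda>i. VComp U k n 1 \<bullet> \<langle>VProj U n i \<bullet> bng (chom k n), ide (chom k n)\<rangle>"
  have p: "arr (VProj U n i)" "src (VProj U n i) = \<I>" "tgt (VProj U n i) = chom n 1" if "i < n" for i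
    using U_proj(1)[OF that] by simp_all
  have q: "act CA k 1 ((?q i \<bullet> h) \<bullet> y) u = proj \<V> K n i \<bullet> act CA k n (h \<bullet> y) u"
    if i: "i < n" and h: "h \<in> \<H> Y (chom k n)" and y: "y \<in> \<H> Z Y" and u: "u \<in> \<H> Z (pow \<V> K k)" for i h Y y Z u
  proof -
    have Z: "obj Z" "obj Y" using y by auto
    have hu: "act CA k n (h \<bullet> y) u \<in> \<H> Z (pow \<V> K n)" using h y u by simp
    have e: "(?q i \<bullet> h) \<bullet> y = VComp U k n 1 \<bullet> \<langle>VProj U n i \<bullet> bng Z, h \<bullet> y\<rangle>"
      using p[OF i] h y Z by simp
    have pZ: "VProj U n i \<bullet> bng Z \<in> \<H> Z (chom n 1)" and hy: "h \<bullet> y \<in> \<H> Z (chom k n)"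
      using p[OF i] h y Z by simp_all
    show ?thesis unfolding e U_comp(2)[OF pZ hy u] by (rule U_proj(2)[OF i hu])
  qed
  show "is_power_cone \<V> (chom k n) (chom k 1) n ?q"
    unfolding is_power_cone_def
  proof (intro conjI ballI allI impI)
    show "obj (chom k n)" "obj (chom k 1)" by simp_all
    show "?q i \<in> \<H> (chom k n) (chom k 1)" if "i < n" for i using p[OF that] by simp
    fix Y F assume Y: "obj Y" and F: "\<forall>i<n. F i \<in> \<H> Y (chom k 1)"
    have "\<exists>r. acts_by k 1 Y (F i) r" if "i < n" for i using acts_by_ex F that by blast
    then obtain r where r: "\<And>i. i < n \<Longrightarrow> acts_by k 1 Y (F i) (r i)" by metis
    have "r i 0 l \<in> \<H> Y K" if "i < n" "l \<le> k" for i l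
      using acts_byD(2)[OF r[OF that(1)] _ that(2)] by simp
    then obtain h where h: "acts_by k n Y h (\<lambda>i. r i 0)" using acts_by_realized[OF Y, of n k "\<lambda>i. r i 0"] by blast
    have h': "h \<in> \<H> Y (chom k n)" by (rule acts_byD(1)[OF h])
    have qt: "?q i \<bullet> g \<in> \<H> Y (chom k 1)" if "i < n" "g \<in> \<H> Y (chom k n)" for i g using p[OF that(1)] that(2) Y by simp
    show "\<exists>!h. h \<in> \<H> Y (chom k n) \<and> (\<forall>i<n. ?q i \<bullet> h = F i)"
    proof (rule ex1I[of _ h], intro conjI allI impI h')
      fix i assume i: "i < n"
      have Fi: "F i \<in> \<H> Y (chom k 1)" using F i by blast
      show "?q i \<bullet> h = F i"
      proof (rule chom_eqI[OF qt[OF i h'] Fi])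
        fix Z y u assume y: "y \<in> \<H> Z Y" and u: "u \<in> \<H> Z (pow \<V> K k)"
        have Fu: "act CA k 1 (F i \<bullet> y) u \<in> \<H> Z K" using Fi y u by simp
        have "act CA k 1 ((?q i \<bullet> h) \<bullet> y) u = form Z k (\<lambda>l. r i 0 l \<bullet> y) (\<lambda>l. proj \<V> K k l \<bullet> u)"
          unfolding q[OF i h' y u] by (rule acts_byD(3)[OF h y u i])
        also have "\<dots> = proj \<V> K 1 0 \<bullet> act CA k 1 (F i \<bullet> y) u"
          by (rule acts_byD(3)[OF r[OF i] y u, symmetric]) simp
        finally show "act CA k 1 ((?q i \<bullet> h) \<bullet> y) u = act CA k 1 (F i \<bullet> y) u" using Fu by simp
      qed
    next
      fix g assume "g \<in> \<H> Y (chom k n) \<and> (\<forall>i<n. ?q i \<bullet> g = F i)"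
      then have g: "g \<in> \<H> Y (chom k n)" and gi: "\<And>i. i < n \<Longrightarrow> ?q i \<bullet> g = F i" by blast+
      show "g = h"
      proof (rule chom_eqI[OF g h'])
        fix Z y u assume y: "y \<in> \<H> Z Y" and u: "u \<in> \<H> Z (pow \<V> K k)"
        show "act CA k n (g \<bullet> y) u = act CA k n (h \<bullet> y) u"
        proof (rule pow_eqI[of _ Z K n])
          show "act CA k n (g \<bullet> y) u \<in> \<H> Z (pow \<V> K n)" "act CA k n (h \<bullet> y) u \<in> \<H> Z (pow \<V> K n)"
            using g h' y u by simp_all
          fix i assume i: "i < n"
          have Fi: "F i \<in> \<H> Y (chom k 1)" using F i by blast
          have Fu: "act CA k 1 (F i \<bullet> y) u \<in> \<H> Z K" using Fi y u by simp
          have "proj \<V> K n i \<bullet> act CA k n (g \<bullet> y) u = proj \<V> K 1 0 \<bullet> act CA k 1 (F i \<bullet> y) u"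
            unfolding q[OF i g y u, symmetric] gi[OF i] using Fu by simp
          also have "\<dots> = form Z k (\<lambda>l. r i 0 l \<bullet> y) (\<lambda>l. proj \<V> K k l \<bullet> u)"
            by (rule acts_byD(3)[OF r[OF i] y u]) simp
          also have "\<dots> = proj \<V> K n i \<bullet> act CA k n (h \<bullet> y) u"
            by (rule acts_byD(3)[OF h y u i, symmetric])
          finally show "proj \<V> K n i \<bullet> act CA k n (g \<bullet> y) u = proj \<V> K n i \<bullet> act CA k n (h \<bullet> y) u" .
        qed simp
      qed
    qed
  qed
qed simp_all

lemma CA_power: "power_via (FObj CA n) (FObj CA 1) n (\<lambda>i. FMap CA n 1 \<bullet> VProj U n i)"
  unfolding power_via_def
proof (intro conjI allI impI)
  note t = stage_typedD[OF CA_typed]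
  show "obj (FObj CA n)" "obj (FObj CA 1)" by simp_all
  show m: "FMap CA n 1 \<bullet> VProj U n i \<in> \<H> \<I> (Exp \<V> (FObj CA n) (FObj CA 1))" if "i < n" for i
    using U_proj(1)[OF that] t by simp
  fix Y F assume Y: "obj Y" and F: "\<forall>i<n. F i \<in> \<H> Y (FObj CA 1)"
  have via: "ap (FObj CA n) (FObj CA 1) ((FMap CA n 1 \<bullet> VProj U n i) \<bullet> bng Y) h = proj \<V> K n i \<bullet> h"
    if "i < n" "h \<in> \<H> Y (pow \<V> K n)" for i h
    using U_proj(1)[OF that(1)] U_proj(2)[OF that] that(2) Y t unfolding act_def by simp
  have F': "F i \<in> \<H> Y K" if "i < n" for i using F that by simp
  show "\<exists>!h. h \<in> \<H> Y (FObj CA n) \<and> (\<forall>i<n. ap (FObj CA n) (FObj CA 1) ((FMap CA n 1 \<bullet> VProj U n i) \<bullet> bng Y) h = F i)"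
  proof (rule ex1I[of _ "tuple \<V> Y K n F"], intro conjI allI impI)
    show tF: "tuple \<V> Y K n F \<in> \<H> Y (FObj CA n)" using Y F' by simp
    show "ap (FObj CA n) (FObj CA 1) ((FMap CA n 1 \<bullet> VProj U n i) \<bullet> bng Y) (tuple \<V> Y K n F) = F i" if "i < n" for i
      using via[OF that] tF Y F' that by simp
    fix h assume "h \<in> \<H> Y (FObj CA n) \<and> (\<forall>i<n. ap (FObj CA n) (FObj CA 1) ((FMap CA n 1 \<bullet> VProj U n i) \<bullet> bng Y) h = F i)"
    then have h: "h \<in> \<H> Y (pow \<V> K n)" and hi: "\<And>i. i < n \<Longrightarrow> ap (FObj CA n) (FObj CA 1) ((FMap CA n 1 \<bullet> VProj U n i) \<bullet> bng Y) h = F i"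
      unfolding CA_obj by blast+
    have "proj \<V> K n i \<bullet> h = F i" if "i < n" for i using via[OF that h] hi[OF that] by metis
    then show "h = tuple \<V> Y K n F" by (intro pow_eqI[OF h]) (use Y F' in simp_all)
  qed
qed

lemma CA_algebra: "CA \<in> VObj (Alg \<V> U)"
  using algebraI[OF U_stage_cat U_conical U_proj_one CA_fun CA_power] by (simp add: Alg_def)

abbreviation CT where "CT X \<equiv> alg_cotensor \<V> U X CA"

lemma CT_algebra:
  assumes X: "obj X"
  shows "CT X \<in> VObj (Alg \<V> U)"
proof -
  have "power_via (FObj (CT X) n) (FObj (CT X) 1) n (\<lambda>i. FMap (CT X) n 1 \<bullet> VProj U n i)" for n
    by (rule cotensor_power[OF CA_typed X _ CA_power]) (use U_proj(1) in simp)
  then show ?thesis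
    using algebraI[OF U_stage_cat U_conical U_proj_one cotensor_fun[OF U_stage_cat CA_fun X]] by (simp add: Alg_def)
qed

end

section \<open>Pointed modules\<close>

context rig
begin

lemma pmodI:
  assumes m: "is_comm_monoid \<V> (MCar M) (MPlus M) (MNull M)"
    and t: "MAct M \<in> \<H> (K \<star> MCar M) (MCar M)" "MPt M \<in> \<H> \<I> (MCar M)"
    and l: "\<And>Y r s f. r \<in> \<H> Y K \<Longrightarrow> s \<in> \<H> Y K \<Longrightarrow> f \<in> \<H> Y (MCar M) \<Longrightarrow>
        MAct M \<bullet> \<langle>r \<boxtimes> s, f\<rangle> = MAct M \<bullet> \<langle>r, MAct M \<bullet> \<langle>s, f\<rangle>\<rangle> \<and>
        MAct M \<bullet> \<langle>r \<boxplus> s, f\<rangle> = MPlus M \<bullet> \<langle>MAct M \<bullet> \<langle>r, f\<rangle>, MAct M \<bullet> \<langle>s, f\<rangle>\<rangle>"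
    and r: "\<And>Y r f g. r \<in> \<H> Y K \<Longrightarrow> f \<in> \<H> Y (MCar M) \<Longrightarrow> g \<in> \<H> Y (MCar M) \<Longrightarrow>
        MAct M \<bullet> \<langle>r, MPlus M \<bullet> \<langle>f, g\<rangle>\<rangle> = MPlus M \<bullet> \<langle>MAct M \<bullet> \<langle>r, f\<rangle>, MAct M \<bullet> \<langle>r, g\<rangle>\<rangle>"
    and u: "\<And>Y f. f \<in> \<H> Y (MCar M) \<Longrightarrow> MAct M \<bullet> \<langle>unt Y, f\<rangle> = f \<and> MAct M \<bullet> \<langle>nul Y, f\<rangle> = MNull M \<bullet> bng Y"
    and z: "\<And>Y r. r \<in> \<H> Y K \<Longrightarrow> MAct M \<bullet> \<langle>r, MNull M \<bullet> bng Y\<rangle> = MNull M \<bullet> bng Y"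
  shows "is_pmod \<V> P M"
proof -
  have N: "obj (MCar M)" using m unfolding is_comm_monoid_def by blast
  note l' = l[of "Pr1 \<V> K K \<bullet> Pr1 \<V> (K \<star> K) (MCar M)" "(K \<star> K) \<star> MCar M" "Pr2 \<V> K K \<bullet> Pr1 \<V> (K \<star> K) (MCar M)" "Pr2 \<V> (K \<star> K) (MCar M)"]
  note r' = r[of "Pr1 \<V> K (MCar M \<star> MCar M)" "K \<star> MCar M \<star> MCar M" "Pr1 \<V> (MCar M) (MCar M) \<bullet> Pr2 \<V> K (MCar M \<star> MCar M)"
     "Pr2 \<V> (MCar M) (MCar M) \<bullet> Pr2 \<V> K (MCar M \<star> MCar M)"]
  show ?thesis
    unfolding is_pmod_def Let_def
    by (intro conjI m t l'[THEN conjunct1] l'[THEN conjunct2] r' u[of "ide (MCar M)" "MCar M", THEN conjunct1]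
        u[of "ide (MCar M)" "MCar M", THEN conjunct2] z[of "ide K" K]) (simp_all add: N)
qed

lemma rig_pmod_is_pmod: "is_pmod \<V> P (rig_pmod P)"
proof (rule pmodI)
  show "is_comm_monoid \<V> (MCar (rig_pmod P)) (MPlus (rig_pmod P)) (MNull (rig_pmod P))"
    using rig by (simp add: is_rig_def rig_pmod_def)
qed (use times_laws plus_laws in \<open>simp_all add: rig_pmod_def flip: gplus_def gtimes_def gnull_def del: hom_iff\<close>, simp_all)

abbreviation FM where "FM X \<equiv> cotensor_pmod \<V> P X"

lemma FM_simps [simp]:
  assumes X: "obj X"
  shows "MCar (FM X) = Exp \<V> X K"
    "arr (MPlus (FM X))" "src (MPlus (FM X)) = Exp \<V> X K \<star> Exp \<V> X K" "tgt (MPlus (FM X)) = Exp \<V> X K"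
    "arr (MNull (FM X))" "src (MNull (FM X)) = \<I>" "tgt (MNull (FM X)) = Exp \<V> X K"
    "arr (MAct (FM X))" "src (MAct (FM X)) = K \<star> Exp \<V> X K" "tgt (MAct (FM X)) = Exp \<V> X K"
    "arr (MPt (FM X))" "src (MPt (FM X)) = \<I>" "tgt (MPt (FM X)) = Exp \<V> X K"
  using X by (simp_all add: cotensor_pmod_def Let_def)

lemma FM_app [simp]:
  assumes X: "obj X" and v: "arr v" "tgt v = X"
  shows "arr f \<Longrightarrow> tgt f = Exp \<V> X K \<Longrightarrow> arr g \<Longrightarrow> tgt g = Exp \<V> X K \<Longrightarrow> src f = src v \<Longrightarrow> src g = src v \<Longrightarrow>
      ap X K (MPlus (FM X) \<bullet> \<langle>f, g\<rangle>) v = ap X K f v \<boxplus> ap X K g v"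
    "arr r \<Longrightarrow> tgt r = K \<Longrightarrow> arr f \<Longrightarrow> tgt f = Exp \<V> X K \<Longrightarrow> src r = src v \<Longrightarrow> src f = src v \<Longrightarrow>
      ap X K (MAct (FM X) \<bullet> \<langle>r, f\<rangle>) v = r \<boxtimes> ap X K f v"
  using X v src_obj[of v] by (simp_all add: cotensor_pmod_def Let_def)

lemma exp_K_eqI:
  assumes "f \<in> \<H> Y (Exp \<V> X K)" "g \<in> \<H> Y (Exp \<V> X K)" "obj X"
    "\<And>Z y v. y \<in> \<H> Z Y \<Longrightarrow> v \<in> \<H> Z X \<Longrightarrow> ap X K (f \<bullet> y) v = ap X K (g \<bullet> y) v"
  shows "f = g"
  by (rule exp_eqI[OF assms(1,2,3)]) (use assms(4) in simp_all)

lemma FM_null_app: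
  assumes "obj X" "v \<in> \<H> Z X"
  shows "ap X K (MNull (FM X) \<bullet> bng Z) v = nul Z" "ap X K (MPt (FM X) \<bullet> bng Z) v = unt Z"
proof -
  have "obj Z" using assms(2) by auto
  then show "ap X K (MNull (FM X) \<bullet> bng Z) v = nul Z" "ap X K (MPt (FM X) \<bullet> bng Z) v = unt Z"
    using assms by (simp_all add: cotensor_pmod_def Let_def)
qed

lemma cotensor_is_pmod:
  assumes X: "obj X"
  shows "is_pmod \<V> P (FM X)"
proof (rule pmodI)
  show "is_comm_monoid \<V> (MCar (FM X)) (MPlus (FM X)) (MNull (FM X))"
  proof (rule comm_monoid_objectI)
    fix x y w Y assume *: "x \<in> \<H> Y (MCar (FM X))" "y \<in> \<H> Y (MCar (FM X))" "w \<in> \<H> Y (MCar (FM X))"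
    show "MPlus (FM X) \<bullet> \<langle>MPlus (FM X) \<bullet> \<langle>x, y\<rangle>, w\<rangle> = MPlus (FM X) \<bullet> \<langle>x, MPlus (FM X) \<bullet> \<langle>y, w\<rangle>\<rangle>"
      by (rule exp_K_eqI[of _ Y X]) (use * X in \<open>simp_all add: plus_laws(1)\<close>)
  next
    fix x y Y assume *: "x \<in> \<H> Y (MCar (FM X))" "y \<in> \<H> Y (MCar (FM X))"
    show "MPlus (FM X) \<bullet> \<langle>x, y\<rangle> = MPlus (FM X) \<bullet> \<langle>y, x\<rangle>"
      by (rule exp_K_eqI[of _ Y X]) (use * X plus_laws(2) in simp_all)
  next
    fix x Y assume *: "x \<in> \<H> Y (MCar (FM X))"
    then have Y: "obj Y" by auto
    show "MPlus (FM X) \<bullet> \<langle>MNull (FM X) \<bullet> bng Y, x\<rangle> = x"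
      by (rule exp_K_eqI[of _ Y X]) (use * X Y in \<open>simp_all add: FM_null_app plus_laws(3)\<close>)
  qed (use X in simp_all)
next
  fix Y r s f assume *: "r \<in> \<H> Y K" "s \<in> \<H> Y K" "f \<in> \<H> Y (MCar (FM X))"
  have "MAct (FM X) \<bullet> \<langle>r \<boxtimes> s, f\<rangle> = MAct (FM X) \<bullet> \<langle>r, MAct (FM X) \<bullet> \<langle>s, f\<rangle>\<rangle>"
    by (rule exp_K_eqI[of _ Y X]) (use * X in \<open>simp_all add: times_laws(1)\<close>)
  moreover have "MAct (FM X) \<bullet> \<langle>r \<boxplus> s, f\<rangle> = MPlus (FM X) \<bullet> \<langle>MAct (FM X) \<bullet> \<langle>r, f\<rangle>, MAct (FM X) \<bullet> \<langle>s, f\<rangle>\<rangle>"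
    by (rule exp_K_eqI[of _ Y X]) (use * X in \<open>simp_all add: times_laws(3)\<close>)
  ultimately show "MAct (FM X) \<bullet> \<langle>r \<boxtimes> s, f\<rangle> = MAct (FM X) \<bullet> \<langle>r, MAct (FM X) \<bullet> \<langle>s, f\<rangle>\<rangle> \<and>
     MAct (FM X) \<bullet> \<langle>r \<boxplus> s, f\<rangle> = MPlus (FM X) \<bullet> \<langle>MAct (FM X) \<bullet> \<langle>r, f\<rangle>, MAct (FM X) \<bullet> \<langle>s, f\<rangle>\<rangle>" by blast
next
  fix Y r f g assume *: "r \<in> \<H> Y K" "f \<in> \<H> Y (MCar (FM X))" "g \<in> \<H> Y (MCar (FM X))"
  show "MAct (FM X) \<bullet> \<langle>r, MPlus (FM X) \<bullet> \<langle>f, g\<rangle>\<rangle> = MPlus (FM X) \<bullet> \<langle>MAct (FM X) \<bullet> \<langle>r, f\<rangle>, MAct (FM X) \<bullet> \<langle>r, g\<rangle>\<rangle>"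
    by (rule exp_K_eqI[of _ Y X]) (use * X in \<open>simp_all add: times_laws(2)\<close>)
next
  fix Y f assume *: "f \<in> \<H> Y (MCar (FM X))"
  then have Y: "obj Y" by auto
  have "MAct (FM X) \<bullet> \<langle>unt Y, f\<rangle> = f"
    by (rule exp_K_eqI[of _ Y X]) (use * X Y in \<open>simp_all add: times_laws(4)\<close>)
  moreover have "MAct (FM X) \<bullet> \<langle>nul Y, f\<rangle> = MNull (FM X) \<bullet> bng Y"
    by (rule exp_K_eqI[of _ Y X]) (use * X Y in \<open>simp_all add: times_laws(6) FM_null_app\<close>)
  ultimately show "MAct (FM X) \<bullet> \<langle>unt Y, f\<rangle> = f \<and> MAct (FM X) \<bullet> \<langle>nul Y, f\<rangle> = MNull (FM X) \<bullet> bng Y" by blast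
next
  fix Y r assume *: "r \<in> \<H> Y K"
  then have Y: "obj Y" by auto
  show "MAct (FM X) \<bullet> \<langle>r, MNull (FM X) \<bullet> bng Y\<rangle> = MNull (FM X) \<bullet> bng Y"
    by (rule exp_K_eqI[of _ Y X]) (use * X Y in \<open>simp_all add: times_laws(7) FM_null_app\<close>)
qed (use X in simp_all)

end

context rig
begin

lemma pmodD:
  assumes "is_pmod \<V> P M"
  shows "obj (MCar M)" "arr (MPlus M)" "src (MPlus M) = MCar M \<star> MCar M" "tgt (MPlus M) = MCar M"
    "arr (MNull M)" "src (MNull M) = \<I>" "tgt (MNull M) = MCar M"
    "arr (MAct M)" "src (MAct M) = K \<star> MCar M" "tgt (MAct M) = MCar M"
    "arr (MPt M)" "src (MPt M) = \<I>" "tgt (MPt M) = MCar M"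
proof -
  have 1: "MAct M \<in> \<H> (K \<star> MCar M) (MCar M)" "MPt M \<in> \<H> \<I> (MCar M)"
    and 2: "is_comm_monoid \<V> (MCar M) (MPlus M) (MNull M)"
    using assms unfolding is_pmod_def by blast+
  show "obj (MCar M)" "arr (MPlus M)" "src (MPlus M) = MCar M \<star> MCar M" "tgt (MPlus M) = MCar M"
    "arr (MNull M)" "src (MNull M) = \<I>" "tgt (MNull M) = MCar M"
    by (rule comm_monoid_objectD[OF 2])+
  show "arr (MAct M)" "src (MAct M) = K \<star> MCar M" "tgt (MAct M) = MCar M"
    "arr (MPt M)" "src (MPt M) = \<I>" "tgt (MPt M) = MCar M" using 1 by simp_all
qed

text \<open>The arrow \<open>\<mu>\<close> is a family of maps \<open>M \<rightarrow> N\<close> with parameters in \<open>W\<close>, each of which is a homomorphism of pointed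
  modules.\<close>

definition linear_at :: "('o, 'm) pmod_data \<Rightarrow> ('o, 'm) pmod_data \<Rightarrow> 'o \<Rightarrow> 'm \<Rightarrow> bool" where
  "linear_at M N W \<mu> \<longleftrightarrow> \<mu> \<in> \<H> W (Exp \<V> (MCar M) (MCar N)) \<and>
     (\<forall>Y x f g. x \<in> \<H> Y W \<longrightarrow> f \<in> \<H> Y (MCar M) \<longrightarrow> g \<in> \<H> Y (MCar M) \<longrightarrow>
        ap (MCar M) (MCar N) (\<mu> \<bullet> x) (MPlus M \<bullet> \<langle>f, g\<rangle>) =
        MPlus N \<bullet> \<langle>ap (MCar M) (MCar N) (\<mu> \<bullet> x) f, ap (MCar M) (MCar N) (\<mu> \<bullet> x) g\<rangle>) \<and>
     (\<forall>Y x. x \<in> \<H> Y W \<longrightarrow> ap (MCar M) (MCar N) (\<mu> \<bullet> x) (MNull M \<bullet> bng Y) = MNull N \<bullet> bng Y) \<and>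
     (\<forall>Y x r f. x \<in> \<H> Y W \<longrightarrow> r \<in> \<H> Y K \<longrightarrow> f \<in> \<H> Y (MCar M) \<longrightarrow>
        ap (MCar M) (MCar N) (\<mu> \<bullet> x) (MAct M \<bullet> \<langle>r, f\<rangle>) = MAct N \<bullet> \<langle>r, ap (MCar M) (MCar N) (\<mu> \<bullet> x) f\<rangle>) \<and>
     (\<forall>Y x. x \<in> \<H> Y W \<longrightarrow> ap (MCar M) (MCar N) (\<mu> \<bullet> x) (MPt M \<bullet> bng Y) = MPt N \<bullet> bng Y)"

lemma linear_atD:
  assumes "linear_at M N W \<mu>"
  shows "\<mu> \<in> \<H> W (Exp \<V> (MCar M) (MCar N))"
    "x \<in> \<H> Y W \<Longrightarrow> f \<in> \<H> Y (MCar M) \<Longrightarrow> g \<in> \<H> Y (MCar M) \<Longrightarrow>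
        ap (MCar M) (MCar N) (\<mu> \<bullet> x) (MPlus M \<bullet> \<langle>f, g\<rangle>) =
        MPlus N \<bullet> \<langle>ap (MCar M) (MCar N) (\<mu> \<bullet> x) f, ap (MCar M) (MCar N) (\<mu> \<bullet> x) g\<rangle>"
    "x \<in> \<H> Y W \<Longrightarrow> ap (MCar M) (MCar N) (\<mu> \<bullet> x) (MNull M \<bullet> bng Y) = MNull N \<bullet> bng Y"
    "x \<in> \<H> Y W \<Longrightarrow> r \<in> \<H> Y K \<Longrightarrow> f \<in> \<H> Y (MCar M) \<Longrightarrow>
        ap (MCar M) (MCar N) (\<mu> \<bullet> x) (MAct M \<bullet> \<langle>r, f\<rangle>) = MAct N \<bullet> \<langle>r, ap (MCar M) (MCar N) (\<mu> \<bullet> x) f\<rangle>"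
    "x \<in> \<H> Y W \<Longrightarrow> ap (MCar M) (MCar N) (\<mu> \<bullet> x) (MPt M \<bullet> bng Y) = MPt N \<bullet> bng Y"
proof -
  note 1 = assms[unfolded linear_at_def]
  note 2 = 1[THEN conjunct2] note 3 = 2[THEN conjunct2] note 4 = 3[THEN conjunct2]
  show "\<mu> \<in> \<H> W (Exp \<V> (MCar M) (MCar N))" by (rule 1[THEN conjunct1])
  show "x \<in> \<H> Y W \<Longrightarrow> f \<in> \<H> Y (MCar M) \<Longrightarrow> g \<in> \<H> Y (MCar M) \<Longrightarrow>
        ap (MCar M) (MCar N) (\<mu> \<bullet> x) (MPlus M \<bullet> \<langle>f, g\<rangle>) =
        MPlus N \<bullet> \<langle>ap (MCar M) (MCar N) (\<mu> \<bullet> x) f, ap (MCar M) (MCar N) (\<mu> \<bullet> x) g\<rangle>"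
    by (rule 2[THEN conjunct1, rule_format])
  show "x \<in> \<H> Y W \<Longrightarrow> ap (MCar M) (MCar N) (\<mu> \<bullet> x) (MNull M \<bullet> bng Y) = MNull N \<bullet> bng Y"
    by (rule 3[THEN conjunct1, rule_format])
  show "x \<in> \<H> Y W \<Longrightarrow> r \<in> \<H> Y K \<Longrightarrow> f \<in> \<H> Y (MCar M) \<Longrightarrow>
        ap (MCar M) (MCar N) (\<mu> \<bullet> x) (MAct M \<bullet> \<langle>r, f\<rangle>) = MAct N \<bullet> \<langle>r, ap (MCar M) (MCar N) (\<mu> \<bullet> x) f\<rangle>"
    by (rule 4[THEN conjunct1, rule_format])
  show "x \<in> \<H> Y W \<Longrightarrow> ap (MCar M) (MCar N) (\<mu> \<bullet> x) (MPt M \<bullet> bng Y) = MPt N \<bullet> bng Y"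
    by (rule 4[THEN conjunct2, rule_format])
qed

text \<open>The four components of the parallel pair compare both sides of the four preservation laws; evaluated
  at elements they become the clauses of linearity.\<close>

lemma pmod_hom_equalizer:
  assumes M: "is_pmod \<V> P M" and N: "is_pmod \<V> P N"
  shows "\<exists>F G. is_equalizer \<V> F G (pmod_hom_incl \<V> P M N) \<and> src F = Exp \<V> (MCar M) (MCar N) \<and>
    (\<forall>W \<mu>. \<mu> \<in> \<H> W (Exp \<V> (MCar M) (MCar N)) \<longrightarrow> (F \<bullet> \<mu> = G \<bullet> \<mu> \<longleftrightarrow> linear_at M N W \<mu>))"
proof -
  note m = pmodD[OF M] and n = pmodD[OF N]
  define A B H where "A = MCar M" and "B = MCar N" and "H = Exp \<V> A B"
  define add1 where "add1 = curry' \<V> H (A \<star> A) (ap A B (Pr1 \<V> H (A \<star> A)) (MPlus M \<bullet> \<langle>Pr1 \<V> A A \<bullet> Pr2 \<V> H (A \<star> A), Pr2 \<V> A A \<bullet> Pr2 \<V> H (A \<star> A)\<rangle>))"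
  define add2 where "add2 = curry' \<V> H (A \<star> A) (MPlus N \<bullet> \<langle>ap A B (Pr1 \<V> H (A \<star> A)) (Pr1 \<V> A A \<bullet> Pr2 \<V> H (A \<star> A)), ap A B (Pr1 \<V> H (A \<star> A)) (Pr2 \<V> A A \<bullet> Pr2 \<V> H (A \<star> A))\<rangle>)"
  define act1 where "act1 = curry' \<V> H (K \<star> A) (ap A B (Pr1 \<V> H (K \<star> A)) (MAct M \<bullet> \<langle>Pr1 \<V> K A \<bullet> Pr2 \<V> H (K \<star> A), Pr2 \<V> K A \<bullet> Pr2 \<V> H (K \<star> A)\<rangle>))"
  define act2 where "act2 = curry' \<V> H (K \<star> A) (MAct N \<bullet> \<langle>Pr1 \<V> K A \<bullet> Pr2 \<V> H (K \<star> A), ap A B (Pr1 \<V> H (K \<star> A)) (Pr2 \<V> K A \<bullet> Pr2 \<V> H (K \<star> A))\<rangle>)"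
  define null1 where "null1 = ap A B (ide H) (MNull M \<bullet> bng H)"
  define null2 where "null2 = MNull N \<bullet> bng H"
  define pt1 where "pt1 = ap A B (ide H) (MPt M \<bullet> bng H)"
  define pt2 where "pt2 = MPt N \<bullet> bng H"
  note defs = add1_def add2_def act1_def act2_def null1_def null2_def pt1_def pt2_def
  let ?F = "\<langle>\<langle>add1, null1\<rangle>, \<langle>act1, pt1\<rangle>\<rangle>" and ?G = "\<langle>\<langle>add2, null2\<rangle>, \<langle>act2, pt2\<rangle>\<rangle>"
  have mt: "arr (MPlus M)" "src (MPlus M) = A \<star> A" "tgt (MPlus M) = A" "arr (MNull M)" "src (MNull M) = \<I>" "tgt (MNull M) = A"
     "arr (MAct M)" "src (MAct M) = K \<star> A" "tgt (MAct M) = A" "arr (MPt M)" "src (MPt M) = \<I>" "tgt (MPt M) = A"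
     "arr (MPlus N)" "src (MPlus N) = B \<star> B" "tgt (MPlus N) = B" "arr (MNull N)" "src (MNull N) = \<I>" "tgt (MNull N) = B"
     "arr (MAct N)" "src (MAct N) = K \<star> B" "tgt (MAct N) = B" "arr (MPt N)" "src (MPt N) = \<I>" "tgt (MPt N) = B"
    using m n unfolding A_def B_def by simp_all
  have AB: "obj A" "obj B" "obj H" using m n unfolding A_def B_def H_def by simp_all
  have e: "pmod_hom_incl \<V> P M N = equalizer \<V> ?F ?G"
    unfolding pmod_hom_incl_def Let_def defs A_def B_def H_def ..
  have t: "arr add1" "src add1 = H" "tgt add1 = Exp \<V> (A \<star> A) B" "arr add2" "src add2 = H" "tgt add2 = Exp \<V> (A \<star> A) B"
    "arr act1" "src act1 = H" "tgt act1 = Exp \<V> (K \<star> A) B" "arr act2" "src act2 = H" "tgt act2 = Exp \<V> (K \<star> A) B"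
    "arr null1" "src null1 = H" "tgt null1 = B" "arr null2" "src null2 = H" "tgt null2 = B"
    "arr pt1" "src pt1 = H" "tgt pt1 = B" "arr pt2" "src pt2 = H" "tgt pt2 = B"
    unfolding defs using mt AB by (simp_all add: H_def)
  have eq: "is_equalizer \<V> ?F ?G (pmod_hom_incl \<V> P M N)"
    unfolding e by (rule equalizer_is_equalizer) (use t in simp_all)
  have lin: "?F \<bullet> \<mu> = ?G \<bullet> \<mu> \<longleftrightarrow> linear_at M N W \<mu>" if \<mu>: "\<mu> \<in> \<H> W H" for W \<mu>
  proof -
    have \<mu>': "arr \<mu>" "src \<mu> = W" "tgt \<mu> = Exp \<V> A B" and W: "obj W" using \<mu> unfolding H_def by auto
    have "?F \<bullet> \<mu> = ?G \<bullet> \<mu> \<longleftrightarrow> (add1 \<bullet> \<mu> = add2 \<bullet> \<mu> \<and> null1 \<bullet> \<mu> = null2 \<bullet> \<mu>) \<and> (act1 \<bullet> \<mu> = act2 \<bullet> \<mu> \<and> pt1 \<bullet> \<mu> = pt2 \<bullet> \<mu>)"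
      using t \<mu> by (simp add: pair_inj)
    moreover have "add1 \<bullet> \<mu> = add2 \<bullet> \<mu> \<longleftrightarrow> (\<forall>Y x f g. x \<in> \<H> Y W \<longrightarrow> f \<in> \<H> Y A \<longrightarrow> g \<in> \<H> Y A \<longrightarrow>
        ap A B (\<mu> \<bullet> x) (MPlus M \<bullet> \<langle>f, g\<rangle>) = MPlus N \<bullet> \<langle>ap A B (\<mu> \<bullet> x) f, ap A B (\<mu> \<bullet> x) g\<rangle>)"
    proof -
      have s: "ap (A \<star> A) B ((add1 \<bullet> \<mu>) \<bullet> x) \<langle>f, g\<rangle> = ap A B (\<mu> \<bullet> x) (MPlus M \<bullet> \<langle>f, g\<rangle>)"
        "ap (A \<star> A) B ((add2 \<bullet> \<mu>) \<bullet> x) \<langle>f, g\<rangle> = MPlus N \<bullet> \<langle>ap A B (\<mu> \<bullet> x) f, ap A B (\<mu> \<bullet> x) g\<rangle>"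
        if "x \<in> \<H> Y W" "f \<in> \<H> Y A" "g \<in> \<H> Y A" for Y x f g
        unfolding add1_def add2_def using that mt AB \<mu>' by (simp_all add: H_def)
      show ?thesis
      proof (intro iffI allI impI)
        assume *: "add1 \<bullet> \<mu> = add2 \<bullet> \<mu>"
        show "ap A B (\<mu> \<bullet> x) (MPlus M \<bullet> \<langle>f, g\<rangle>) = MPlus N \<bullet> \<langle>ap A B (\<mu> \<bullet> x) f, ap A B (\<mu> \<bullet> x) g\<rangle>"
          if "x \<in> \<H> Y W" "f \<in> \<H> Y A" "g \<in> \<H> Y A" for Y x f g
          using s[OF that] * by metis
      next
        assume *: "\<forall>Y x f g. x \<in> \<H> Y W \<longrightarrow> f \<in> \<H> Y A \<longrightarrow> g \<in> \<H> Y A \<longrightarrow>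
          ap A B (\<mu> \<bullet> x) (MPlus M \<bullet> \<langle>f, g\<rangle>) = MPlus N \<bullet> \<langle>ap A B (\<mu> \<bullet> x) f, ap A B (\<mu> \<bullet> x) g\<rangle>"
        show "add1 \<bullet> \<mu> = add2 \<bullet> \<mu>"
        proof (rule exp_eqI[of _ W "A \<star> A" B])
          fix Y x p assume x: "x \<in> \<H> Y W" and p: "p \<in> \<H> Y (A \<star> A)"
          have pp: "Pr1 \<V> A A \<bullet> p \<in> \<H> Y A" "Pr2 \<V> A A \<bullet> p \<in> \<H> Y A" using p AB by simp_all
          have "ap (A \<star> A) B ((add1 \<bullet> \<mu>) \<bullet> x) \<langle>Pr1 \<V> A A \<bullet> p, Pr2 \<V> A A \<bullet> p\<rangle> = ap (A \<star> A) B ((add2 \<bullet> \<mu>) \<bullet> x) \<langle>Pr1 \<V> A A \<bullet> p, Pr2 \<V> A A \<bullet> p\<rangle>"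
            unfolding s[OF x pp] using * x pp by blast
          then show "ap (A \<star> A) B ((add1 \<bullet> \<mu>) \<bullet> x) p = ap (A \<star> A) B ((add2 \<bullet> \<mu>) \<bullet> x) p"
            unfolding pair_eta[OF p AB(1,1)] .
        qed (use t \<mu>' AB in \<open>simp_all add: H_def\<close>)
      qed
    qed
    moreover have "act1 \<bullet> \<mu> = act2 \<bullet> \<mu> \<longleftrightarrow> (\<forall>Y x r f. x \<in> \<H> Y W \<longrightarrow> r \<in> \<H> Y K \<longrightarrow> f \<in> \<H> Y A \<longrightarrow>
        ap A B (\<mu> \<bullet> x) (MAct M \<bullet> \<langle>r, f\<rangle>) = MAct N \<bullet> \<langle>r, ap A B (\<mu> \<bullet> x) f\<rangle>)"
    proof -
      have s: "ap (K \<star> A) B ((act1 \<bullet> \<mu>) \<bullet> x) \<langle>r, f\<rangle> = ap A B (\<mu> \<bullet> x) (MAct M \<bullet> \<langle>r, f\<rangle>)"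
        "ap (K \<star> A) B ((act2 \<bullet> \<mu>) \<bullet> x) \<langle>r, f\<rangle> = MAct N \<bullet> \<langle>r, ap A B (\<mu> \<bullet> x) f\<rangle>"
        if "x \<in> \<H> Y W" "r \<in> \<H> Y K" "f \<in> \<H> Y A" for Y x r f
        unfolding act1_def act2_def using that mt AB \<mu>' by (simp_all add: H_def)
      show ?thesis
      proof (intro iffI allI impI)
        assume *: "act1 \<bullet> \<mu> = act2 \<bullet> \<mu>"
        show "ap A B (\<mu> \<bullet> x) (MAct M \<bullet> \<langle>r, f\<rangle>) = MAct N \<bullet> \<langle>r, ap A B (\<mu> \<bullet> x) f\<rangle>"
          if "x \<in> \<H> Y W" "r \<in> \<H> Y K" "f \<in> \<H> Y A" for Y x r f
          using s[OF that] * by metis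
      next
        assume *: "\<forall>Y x r f. x \<in> \<H> Y W \<longrightarrow> r \<in> \<H> Y K \<longrightarrow> f \<in> \<H> Y A \<longrightarrow>
          ap A B (\<mu> \<bullet> x) (MAct M \<bullet> \<langle>r, f\<rangle>) = MAct N \<bullet> \<langle>r, ap A B (\<mu> \<bullet> x) f\<rangle>"
        show "act1 \<bullet> \<mu> = act2 \<bullet> \<mu>"
        proof (rule exp_eqI[of _ W "K \<star> A" B])
          fix Y x p assume x: "x \<in> \<H> Y W" and p: "p \<in> \<H> Y (K \<star> A)"
          have pp: "Pr1 \<V> K A \<bullet> p \<in> \<H> Y K" "Pr2 \<V> K A \<bullet> p \<in> \<H> Y A" using p AB by simp_all
          have "ap (K \<star> A) B ((act1 \<bullet> \<mu>) \<bullet> x) \<langle>Pr1 \<V> K A \<bullet> p, Pr2 \<V> K A \<bullet> p\<rangle> = ap (K \<star> A) B ((act2 \<bullet> \<mu>) \<bullet> x) \<langle>Pr1 \<V> K A \<bullet> p, Pr2 \<V> K A \<bullet> p\<rangle>"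
            unfolding s[OF x pp] using * x pp by blast
          then show "ap (K \<star> A) B ((act1 \<bullet> \<mu>) \<bullet> x) p = ap (K \<star> A) B ((act2 \<bullet> \<mu>) \<bullet> x) p"
            unfolding pair_eta[OF p rig_arr(1) AB(1)] .
        qed (use t \<mu>' AB in \<open>simp_all add: H_def\<close>)
      qed
    qed
    moreover have point: "ap A B (ide H) (c \<bullet> bng H) \<bullet> \<mu> = (d \<bullet> bng H) \<bullet> \<mu> \<longleftrightarrow>
        (\<forall>Y x. x \<in> \<H> Y W \<longrightarrow> ap A B (\<mu> \<bullet> x) (c \<bullet> bng Y) = d \<bullet> bng Y)"
      if c: "arr c" "src c = \<I>" "tgt c = A" and d: "arr d" "src d = \<I>" "tgt d = B" for c d
    proof -
      have s: "ap A B (ide H) (c \<bullet> bng H) \<bullet> \<mu> = ap A B \<mu> (c \<bullet> bng W)" "(d \<bullet> bng H) \<bullet> \<mu> = d \<bullet> bng W"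
        using c d \<mu>' AB by (simp_all add: H_def)
      show ?thesis unfolding s
      proof (intro iffI allI impI)
        assume *: "ap A B \<mu> (c \<bullet> bng W) = d \<bullet> bng W"
        fix Y x assume x: "x \<in> \<H> Y W"
        show "ap A B (\<mu> \<bullet> x) (c \<bullet> bng Y) = d \<bullet> bng Y"
          using *[THEN arg_cong, of "\<lambda>f. f \<bullet> x"] x c d \<mu>' AB W by simp
      next
        assume *: "\<forall>Y x. x \<in> \<H> Y W \<longrightarrow> ap A B (\<mu> \<bullet> x) (c \<bullet> bng Y) = d \<bullet> bng Y"
        show "ap A B \<mu> (c \<bullet> bng W) = d \<bullet> bng W"
          using *[rule_format, of "ide W" W] \<mu>' W by simp
      qed
    qed
    ultimately show ?thesis
      unfolding linear_at_def null1_def null2_def pt1_def pt2_def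
        point[OF mt(4-6,16-18)] point[OF mt(10-12,22-24)]
      using \<mu> unfolding H_def A_def B_def by blast
  qed
  show ?thesis
    by (intro exI[of _ ?F] exI[of _ ?G] conjI eq) (use t lin in \<open>auto simp: A_def B_def H_def\<close>)
qed

text \<open>Homomorphisms are the linear families parametrized by the terminal object; conversely the
  equations between arrows follow from the generic elements, which are the projections.\<close>

lemma pmod_hom_iff_linear:
  assumes M: "is_pmod \<V> P M" and N: "is_pmod \<V> P N" and \<mu>: "\<mu> \<in> \<H> (MCar M) (MCar N)"
  shows "is_pmod_hom \<V> P M N \<mu> \<longleftrightarrow> linear_at M N \<I> (name_of \<V> \<mu>)"
proof -
  note m = pmodD[OF M] and n = pmodD[OF N]
  let ?A = "MCar M" and ?B = "MCar N"
  have \<mu>': "arr \<mu>" "src \<mu> = ?A" "tgt \<mu> = ?B" using \<mu> by simp_all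
  have name: "ap ?A ?B (name_of \<V> \<mu> \<bullet> x) f = \<mu> \<bullet> f" if "x \<in> \<H> Y \<I>" "f \<in> \<H> Y ?A" for Y x f
    using \<mu>' that by simp
  show ?thesis
  proof
    assume h: "is_pmod_hom \<V> P M N \<mu>"
    then have e: "\<mu> \<bullet> MPlus M = MPlus N \<bullet> parr \<V> \<mu> \<mu>" "\<mu> \<bullet> MNull M = MNull N"
      "\<mu> \<bullet> MAct M = MAct N \<bullet> parr \<V> (ide K) \<mu>" "\<mu> \<bullet> MPt M = MPt N"
      unfolding is_pmod_hom_def by blast+
    show "linear_at M N \<I> (name_of \<V> \<mu>)"
      unfolding linear_at_def
    proof (intro conjI allI impI)
      show "name_of \<V> \<mu> \<in> \<H> \<I> (Exp \<V> ?A ?B)" using \<mu>' by simp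
      fix Y x assume x: "x \<in> \<H> Y \<I>"
      have Y: "obj Y" using x by auto
      show "ap ?A ?B (name_of \<V> \<mu> \<bullet> x) (MPlus M \<bullet> \<langle>f, g\<rangle>) = MPlus N \<bullet> \<langle>ap ?A ?B (name_of \<V> \<mu> \<bullet> x) f, ap ?A ?B (name_of \<V> \<mu> \<bullet> x) g\<rangle>"
        if "f \<in> \<H> Y ?A" "g \<in> \<H> Y ?A" for f g
        using e(1)[THEN arg_cong, of "\<lambda>t. t \<bullet> \<langle>f, g\<rangle>"] that x \<mu>' m n by simp
      show "ap ?A ?B (name_of \<V> \<mu> \<bullet> x) (MAct M \<bullet> \<langle>r, f\<rangle>) = MAct N \<bullet> \<langle>r, ap ?A ?B (name_of \<V> \<mu> \<bullet> x) f\<rangle>"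
        if "r \<in> \<H> Y K" "f \<in> \<H> Y ?A" for r f
        using e(3)[THEN arg_cong, of "\<lambda>t. t \<bullet> \<langle>r, f\<rangle>"] that x \<mu>' m n by simp
      show "ap ?A ?B (name_of \<V> \<mu> \<bullet> x) (MNull M \<bullet> bng Y) = MNull N \<bullet> bng Y"
        using e(2)[THEN arg_cong, of "\<lambda>t. t \<bullet> bng Y"] x Y \<mu>' m n by simp
      show "ap ?A ?B (name_of \<V> \<mu> \<bullet> x) (MPt M \<bullet> bng Y) = MPt N \<bullet> bng Y"
        using e(4)[THEN arg_cong, of "\<lambda>t. t \<bullet> bng Y"] x Y \<mu>' m n by simp
    qed
  next
    assume l: "linear_at M N \<I> (name_of \<V> \<mu>)"
    note L = linear_atD[OF l]
    show "is_pmod_hom \<V> P M N \<mu>"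
      unfolding is_pmod_hom_def
    proof (intro conjI M N \<mu>)
      have "\<mu> \<bullet> MPlus M \<bullet> \<langle>Pr1 \<V> ?A ?A, Pr2 \<V> ?A ?A\<rangle> = MPlus N \<bullet> \<langle>\<mu> \<bullet> Pr1 \<V> ?A ?A, \<mu> \<bullet> Pr2 \<V> ?A ?A\<rangle>"
        using L(2)[of "bng (?A \<star> ?A)" "?A \<star> ?A" "Pr1 \<V> ?A ?A" "Pr2 \<V> ?A ?A"] \<mu>' m n by (simp del: pair_pr)
      then show "\<mu> \<bullet> MPlus M = MPlus N \<bullet> parr \<V> \<mu> \<mu>" using \<mu>' m by (simp add: parr_def)
      have "\<mu> \<bullet> MAct M \<bullet> \<langle>Pr1 \<V> K ?A, Pr2 \<V> K ?A\<rangle> = MAct N \<bullet> \<langle>Pr1 \<V> K ?A, \<mu> \<bullet> Pr2 \<V> K ?A\<rangle>"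
        using L(4)[of "bng (K \<star> ?A)" "K \<star> ?A" "Pr1 \<V> K ?A" "Pr2 \<V> K ?A"] \<mu>' m n by (simp del: pair_pr)
      then show "\<mu> \<bullet> MAct M = MAct N \<bullet> parr \<V> (ide K) \<mu>" using \<mu>' m by (simp add: parr_def)
      have i: "ide \<I> \<in> \<H> \<I> \<I>" and c: "MNull M \<bullet> bng \<I> \<in> \<H> \<I> ?A" "MPt M \<bullet> bng \<I> \<in> \<H> \<I> ?A"
        using m by simp_all
      show "\<mu> \<bullet> MNull M = MNull N" using trans[OF name[OF i c(1), symmetric] L(3)[OF i]] m n by simp
      show "\<mu> \<bullet> MPt M = MPt N" using trans[OF name[OF i c(2), symmetric] L(5)[OF i]] m n by simp
    qed
  qed
qed

end

section \<open>Natural families over the commutant are linear maps\<close>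

context firm_preordered_ring
begin

lemma pow_one: "pow \<V> K 1 = K" "proj \<V> K 1 0 = ide K"
  by simp_all

lemma CT_obj: "FObj (CT X) a = Exp \<V> X (pow \<V> K a)"
  by (simp add: cotensor_obj)

lemma CT_typed: "obj X \<Longrightarrow> stage_typed U (CT X)"
  by (rule cotensor_typed[OF CA_typed])

lemma act_CT_arr [simp]:
  assumes "obj X" "arr h" "tgt h = chom a b" "arr f" "tgt f = Exp \<V> X (pow \<V> K a)" "src f = src h"
  shows "arr (act (CT X) a b h f)" "src (act (CT X) a b h f) = src h" "tgt (act (CT X) a b h f) = Exp \<V> X (pow \<V> K b)"
  using act_arr[OF CT_typed[OF assms(1)], of h a b f] assms by (simp_all add: CT_obj)

lemma app_act_CT:
  assumes X: "obj X" and h: "h \<in> \<H> Y (chom a b)" and f: "f \<in> \<H> Y (Exp \<V> X (pow \<V> K a))"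
    and y: "y \<in> \<H> Z Y" and v: "v \<in> \<H> Z X"
  shows "ap X (pow \<V> K b) (act (CT X) a b h f \<bullet> y) v = act CA a b (h \<bullet> y) (ap X (pow \<V> K a) (f \<bullet> y) v)"
  using app_act_cotensor[OF CA_typed X, of h Y a b f y Z v] h f y v by simp

definition coord :: "'o \<Rightarrow> nat \<Rightarrow> nat \<Rightarrow> 'm \<Rightarrow> 'm" where
  "coord X a i f = curry' \<V> (src f) X (proj \<V> K a i \<bullet> ap X (pow \<V> K a) (f \<bullet> Pr1 \<V> (src f) X) (Pr2 \<V> (src f) X))"

lemma coord_arr [simp]:
  assumes "obj X" "i < a" "arr f" "tgt f = Exp \<V> X (pow \<V> K a)"
  shows "arr (coord X a i f)" "src (coord X a i f) = src f" "tgt (coord X a i f) = Exp \<V> X K"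
  unfolding coord_def using assms by simp_all

lemma app_coord [simp]:
  assumes "obj X" "i < a" "arr f" "tgt f = Exp \<V> X (pow \<V> K a)" "arr y" "tgt y = src f" "arr v" "tgt v = X" "src v = src y"
  shows "ap X K (coord X a i f \<bullet> y) v = proj \<V> K a i \<bullet> ap X (pow \<V> K a) (f \<bullet> y) v"
  unfolding coord_def using assms by simp

lemma coord_comp:
  assumes "obj X" "i < a" "arr f" "tgt f = Exp \<V> X (pow \<V> K a)" "arr y" "tgt y = src f"
  shows "coord X a i f \<bullet> y = coord X a i (f \<bullet> y)"
  by (rule exp_K_eqI[of _ "src y" X]) (use assms in simp_all)

lemma coord_one:
  assumes X: "obj X" and f: "f \<in> \<H> Y (Exp \<V> X K)"
  shows "coord X 1 0 f = f"
  by (rule exp_K_eqI[of _ Y X]) (use assms in simp_all)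

text \<open>Affine forms in elements of \<open>[X, K]\<close>, computed pointwise.\<close>

definition exp_form :: "'o \<Rightarrow> 'o \<Rightarrow> nat \<Rightarrow> (nat \<Rightarrow> 'm) \<Rightarrow> (nat \<Rightarrow> 'm) \<Rightarrow> 'm" where
  "exp_form X Y a q g = curry' \<V> Y X (form (Y \<star> X) a (\<lambda>i. q i \<bullet> Pr1 \<V> Y X) (\<lambda>i. ap X K (g i \<bullet> Pr1 \<V> Y X) (Pr2 \<V> Y X)))"

lemma exp_form_cong:
  assumes "\<And>i. i \<le> a \<Longrightarrow> q i = q' i" "\<And>i. i < a \<Longrightarrow> g i = g' i"
  shows "exp_form X Y a q g = exp_form X Y a q' g'"
  unfolding exp_form_def using assms by simp

lemma exp_form_arr:
  assumes X: "obj X" and Y: "obj Y" and q: "\<And>i. i \<le> a \<Longrightarrow> q i \<in> \<H> Y K" and g: "\<And>i. i < a \<Longrightarrow> g i \<in> \<H> Y (Exp \<V> X K)"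
  shows "exp_form X Y a q g \<in> \<H> Y (Exp \<V> X K)"
  unfolding exp_form_def using assms by simp

lemma app_exp_form:
  assumes X: "obj X" and q: "\<And>i. i \<le> a \<Longrightarrow> q i \<in> \<H> Y K" and g: "\<And>i. i < a \<Longrightarrow> g i \<in> \<H> Y (Exp \<V> X K)"
    and y: "y \<in> \<H> Z Y" and v: "v \<in> \<H> Z X"
  shows "ap X K (exp_form X Y a q g \<bullet> y) v = form Z a (\<lambda>i. q i \<bullet> y) (\<lambda>i. ap X K (g i \<bullet> y) v)"
proof -
  have "obj Y" using y by auto
  then show ?thesis unfolding exp_form_def using assms by simp
qed

text \<open>An arrow of the commutant acts on \<open>[X, P\<^sup>a]\<close> by applying its affine forms to the coordinates.\<close>

lemma coord_act:
  assumes X: "obj X" and h: "acts_by a b Y h q" and f: "f \<in> \<H> Y (Exp \<V> X (pow \<V> K a))" and j: "j < b"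
  shows "coord X b j (act (CT X) a b h f) = exp_form X Y a (q j) (\<lambda>i. coord X a i f)"
proof (rule exp_K_eqI[of _ Y X])
  note h' = acts_byD(1)[OF h]
  have Y: "obj Y" using f by auto
  have qj: "q j i \<in> \<H> Y K" if "i \<le> a" for i by (rule acts_byD(2)[OF h j that])
  have c: "coord X a i f \<in> \<H> Y (Exp \<V> X K)" if "i < a" for i using that X f by simp
  show "coord X b j (act (CT X) a b h f) \<in> \<H> Y (Exp \<V> X K)" using X h' f j by simp
  show "exp_form X Y a (q j) (\<lambda>i. coord X a i f) \<in> \<H> Y (Exp \<V> X K)" by (rule exp_form_arr[OF X Y qj c])
  fix Z y v assume y: "y \<in> \<H> Z Y" and v: "v \<in> \<H> Z X"
  have fv: "ap X (pow \<V> K a) (f \<bullet> y) v \<in> \<H> Z (pow \<V> K a)" using f y v by simp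
  have "ap X K (coord X b j (act (CT X) a b h f) \<bullet> y) v = proj \<V> K b j \<bullet> act CA a b (h \<bullet> y) (ap X (pow \<V> K a) (f \<bullet> y) v)"
    using app_act_CT[OF X h' f y v] X h' f j y v by simp
  also have "\<dots> = form Z a (\<lambda>i. q j i \<bullet> y) (\<lambda>i. proj \<V> K a i \<bullet> ap X (pow \<V> K a) (f \<bullet> y) v)"
    by (rule acts_byD(3)[OF h y fv j])
  also have "\<dots> = form Z a (\<lambda>i. q j i \<bullet> y) (\<lambda>i. ap X K (coord X a i f \<bullet> y) v)"
    using X f y v by simp
  also have "\<dots> = ap X K (exp_form X Y a (q j) (\<lambda>i. coord X a i f) \<bullet> y) v"
    by (rule app_exp_form[symmetric]) (rule X qj c y v; assumption?)+
  finally show "ap X K (coord X b j (act (CT X) a b h f) \<bullet> y) v = ap X K (exp_form X Y a (q j) (\<lambda>i. coord X a i f) \<bullet> y) v" .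
qed (rule X)

text \<open>An affine form is a linear combination plus a multiple of the constant function \<open>1\<close>. The partial sums
  \<open>S n\<close> of the linear combination are treated by induction, and the constant term is a multiple of
  the point.\<close>

lemma linear_exp_form:
  assumes X: "obj X" and l: "linear_at (FM X) (rig_pmod P) W \<mu>" and x: "x \<in> \<H> Y W"
    and q: "\<And>i. i \<le> a \<Longrightarrow> q i \<in> \<H> Y K" and g: "\<And>i. i < a \<Longrightarrow> g i \<in> \<H> Y (Exp \<V> X K)"
  shows "ap (Exp \<V> X K) K (\<mu> \<bullet> x) (exp_form X Y a q g) = form Y a q (\<lambda>i. ap (Exp \<V> X K) K (\<mu> \<bullet> x) (g i))"
proof -
  have Y: "obj Y" using x by auto
  have m: "arr \<mu>" "src \<mu> = W" "tgt \<mu> = Exp \<V> (Exp \<V> X K) K"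
    using linear_atD(1)[OF l] X by (simp_all add: rig_pmod_def)
  note L = linear_atD(2-5)[OF l, unfolded FM_simps(1)[OF X] rig_pmod_def pmod_data.simps,
    folded gplus_def gtimes_def gnull_def gunit_def]
  define S where "S n = curry' \<V> Y X (gsum \<V> P (Y \<star> X) n (\<lambda>i. (q i \<bullet> Pr1 \<V> Y X) \<boxtimes> ap X K (g i \<bullet> Pr1 \<V> Y X) (Pr2 \<V> Y X)))" for n
  have Sa: "S n \<in> \<H> Y (Exp \<V> X K)" if "n \<le> a" for n
    unfolding S_def using X Y q g that by simp
  have S_app: "ap X K (S n \<bullet> y) v = gsum \<V> P Z n (\<lambda>i. (q i \<bullet> y) \<boxtimes> ap X K (g i \<bullet> y) v)"
    if "n \<le> a" "y \<in> \<H> Z Y" "v \<in> \<H> Z X" for n y v Z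
    unfolding S_def using X Y q g that by simp
  have sum: "ap (Exp \<V> X K) K (\<mu> \<bullet> x) (S n) = gsum \<V> P Y n (\<lambda>i. q i \<boxtimes> ap (Exp \<V> X K) K (\<mu> \<bullet> x) (g i))" if "n \<le> a" for n
    using that
  proof (induction n)
    case 0
    have "S 0 = MNull (FM X) \<bullet> bng Y"
      by (rule exp_K_eqI[OF Sa]) (use X Y S_app[of 0] in \<open>simp_all add: FM_null_app\<close>)
    then show ?case using L(2)[OF x] by simp
  next
    case (Suc n)
    have n: "q n \<in> \<H> Y K" "g n \<in> \<H> Y (Exp \<V> X K)" using q g Suc.prems by simp_all
    have act: "MAct (FM X) \<bullet> \<langle>q n, g n\<rangle> \<in> \<H> Y (Exp \<V> X K)" using n X by simp
    have "S (Suc n) = MPlus (FM X) \<bullet> \<langle>S n, MAct (FM X) \<bullet> \<langle>q n, g n\<rangle>\<rangle>"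
    proof (rule exp_K_eqI[OF Sa[OF Suc.prems] _ X])
      show "MPlus (FM X) \<bullet> \<langle>S n, MAct (FM X) \<bullet> \<langle>q n, g n\<rangle>\<rangle> \<in> \<H> Y (Exp \<V> X K)"
        using Sa[of n] act Suc.prems X by simp
      fix Z y v assume y: "y \<in> \<H> Z Y" and v: "v \<in> \<H> Z X"
      have 1: "ap X K (S (Suc n) \<bullet> y) v = gsum \<V> P Z n (\<lambda>i. (q i \<bullet> y) \<boxtimes> ap X K (g i \<bullet> y) v) \<boxplus> ((q n \<bullet> y) \<boxtimes> ap X K (g n \<bullet> y) v)"
        using S_app[OF Suc.prems y v] by simp
      have 2: "ap X K ((MPlus (FM X) \<bullet> \<langle>S n, MAct (FM X) \<bullet> \<langle>q n, g n\<rangle>\<rangle>) \<bullet> y) v = ap X K (S n \<bullet> y) v \<boxplus> ((q n \<bullet> y) \<boxtimes> ap X K (g n \<bullet> y) v)"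
        using Sa[of n] Suc.prems n X y v by simp
      show "ap X K (S (Suc n) \<bullet> y) v = ap X K ((MPlus (FM X) \<bullet> \<langle>S n, MAct (FM X) \<bullet> \<langle>q n, g n\<rangle>\<rangle>) \<bullet> y) v"
        unfolding 1 2 using S_app[of n y Z v] y v Suc.prems by simp
    qed
    then show ?case using L(1)[OF x Sa act] L(3)[OF x n] Suc by simp
  qed
  have qa: "q a \<in> \<H> Y K" using q by simp
  have pt: "MPt (FM X) \<bullet> bng Y \<in> \<H> Y (Exp \<V> X K)" using X Y by simp
  have c: "MAct (FM X) \<bullet> \<langle>q a, MPt (FM X) \<bullet> bng Y\<rangle> \<in> \<H> Y (Exp \<V> X K)" using qa pt X by simp
  have "exp_form X Y a q g = MPlus (FM X) \<bullet> \<langle>S a, MAct (FM X) \<bullet> \<langle>q a, MPt (FM X) \<bullet> bng Y\<rangle>\<rangle>"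
  proof (rule exp_K_eqI[OF exp_form_arr[where q = q and g = g, OF X Y q g] _ X])
    show "MPlus (FM X) \<bullet> \<langle>S a, MAct (FM X) \<bullet> \<langle>q a, MPt (FM X) \<bullet> bng Y\<rangle>\<rangle> \<in> \<H> Y (Exp \<V> X K)"
      using Sa[of a] c X by simp
    fix Z y v assume y: "y \<in> \<H> Z Y" and v: "v \<in> \<H> Z X"
    have qy: "q a \<bullet> y \<in> \<H> Z K" using qa y by simp
    have "ap X K ((MPlus (FM X) \<bullet> \<langle>S a, MAct (FM X) \<bullet> \<langle>q a, MPt (FM X) \<bullet> bng Y\<rangle>\<rangle>) \<bullet> y) v =
       ap X K (S a \<bullet> y) v \<boxplus> ((q a \<bullet> y) \<boxtimes> unt Z)"
      using Sa[of a] qa X Y y v src_obj[of y] by (simp add: FM_null_app)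
    moreover have "ap X K (exp_form X Y a q g \<bullet> y) v = form Z a (\<lambda>i. q i \<bullet> y) (\<lambda>i. ap X K (g i \<bullet> y) v)"
      by (rule app_exp_form) (rule X q g y v; assumption?)+
    ultimately show "ap X K (exp_form X Y a q g \<bullet> y) v = ap X K ((MPlus (FM X) \<bullet> \<langle>S a, MAct (FM X) \<bullet> \<langle>q a, MPt (FM X) \<bullet> bng Y\<rangle>\<rangle>) \<bullet> y) v"
      unfolding form_def S_app[OF order_refl y v] times_laws(5)[OF qy] by simp
  qed
  then show ?thesis
    using L(1)[OF x Sa c] L(3)[OF x qa pt] L(4)[OF x] sum[of a] times_laws(5)[OF qa] by (simp add: form_def)
qed

text \<open>Naturality with respect to the projections expresses every component of a natural family by the one
  at the carrier.\<close>

lemma wedge_coord: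
  assumes X: "obj X" and w: "vnat_wedge \<V> U (CT X) CA W \<alpha>" and x: "x \<in> \<H> Y W"
    and f: "f \<in> \<H> Y (Exp \<V> X (pow \<V> K a))" and i: "i < a"
  shows "proj \<V> K a i \<bullet> ap (Exp \<V> X (pow \<V> K a)) (pow \<V> K a) (\<alpha> a \<bullet> x) f = ap (Exp \<V> X K) K (\<alpha> 1 \<bullet> x) (coord X a i f)"
proof -
  note D = wedgeD[OF CT_typed[OF X] CA_typed w, unfolded CT_obj CA_obj U_obj]
  have Y: "obj Y" using x by auto
  have p: "VProj U a i \<bullet> bng Y \<in> \<H> Y (chom a 1)" using U_proj(1)[OF i] Y by simp
  have c: "act (CT X) a 1 (VProj U a i \<bullet> bng Y) f = coord X a i f"
  proof (rule exp_K_eqI[of _ Y X])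
    show "act (CT X) a 1 (VProj U a i \<bullet> bng Y) f \<in> \<H> Y (Exp \<V> X K)"
      using act_CT_arr[OF X, of "VProj U a i \<bullet> bng Y" a 1 f] p f by simp
    show "coord X a i f \<in> \<H> Y (Exp \<V> X K)" using X i f by simp
    fix Z y v assume y: "y \<in> \<H> Z Y" and v: "v \<in> \<H> Z X"
    have fv: "ap X (pow \<V> K a) (f \<bullet> y) v \<in> \<H> Z (pow \<V> K a)" using f y v by simp
    have "(VProj U a i \<bullet> bng Y) \<bullet> y = VProj U a i \<bullet> bng Z" using U_proj(1)[OF i] Y y by simp
    then show "ap X K (act (CT X) a 1 (VProj U a i \<bullet> bng Y) f \<bullet> y) v = ap X K (coord X a i f \<bullet> y) v"
      using app_act_CT[OF X p f y v] U_proj(2)[OF i fv] X i f y v by simp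
  qed (rule X)
  have af: "ap (Exp \<V> X (pow \<V> K a)) (pow \<V> K a) (\<alpha> a \<bullet> x) f \<in> \<H> Y (pow \<V> K a)" using D(1-4) x f by simp
  show ?thesis
    using D(5)[OF x p f] unfolding c U_proj(2)[OF i af] pow_one ..
qed

text \<open>Every affine form is an arrow of the commutant, so the carrier component commutes with it.\<close>

lemma wedge_form:
  assumes X: "obj X" and w: "vnat_wedge \<V> U (CT X) CA W \<alpha>" and x: "x \<in> \<H> Y W"
    and q: "\<And>i. i \<le> a \<Longrightarrow> q i \<in> \<H> Y K" and g: "\<And>i. i < a \<Longrightarrow> g i \<in> \<H> Y (Exp \<V> X K)"
  shows "ap (Exp \<V> X K) K (\<alpha> 1 \<bullet> x) (exp_form X Y a q g) = form Y a q (\<lambda>i. ap (Exp \<V> X K) K (\<alpha> 1 \<bullet> x) (g i))"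
proof -
  note D = wedgeD[OF CT_typed[OF X] CA_typed w, unfolded CT_obj CA_obj U_obj]
  have Y: "obj Y" using x by auto
  obtain h where h: "acts_by a 1 Y h (\<lambda>_. q)" using acts_by_realized[OF Y, of 1 a "\<lambda>_. q"] q by blast
  note h' = acts_byD(1)[OF h]
  \<comment> \<open>The element of \<open>[X, P\<^sup>a]\<close> whose coordinates are the \<open>g i\<close>.\<close>
  let ?f = "curry' \<V> Y X (tuple \<V> (Y \<star> X) K a (\<lambda>i. ap X K (g i \<bullet> Pr1 \<V> Y X) (Pr2 \<V> Y X)))"
  have f: "?f \<in> \<H> Y (Exp \<V> X (pow \<V> K a))" using X Y g by simp
  have cf: "coord X a i ?f = g i" if i: "i < a" for i
  proof (rule exp_K_eqI[of _ Y X])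
    show "coord X a i ?f \<in> \<H> Y (Exp \<V> X K)" using f X i by simp
    fix Z y v assume y: "y \<in> \<H> Z Y" and v: "v \<in> \<H> Z X"
    have "ap X K (coord X a i ?f \<bullet> y) v = proj \<V> K a i \<bullet> ap X (pow \<V> K a) (?f \<bullet> y) v"
      by (rule app_coord) (use f X i y v in simp_all)
    also have "\<dots> = ap X K (g i \<bullet> y) v" using X Y g i y v src_obj[of y] by auto
    finally show "ap X K (coord X a i ?f \<bullet> y) v = ap X K (g i \<bullet> y) v" .
  qed (use X g i in simp_all)
  have af: "ap (Exp \<V> X (pow \<V> K a)) (pow \<V> K a) (\<alpha> a \<bullet> x) ?f \<in> \<H> Y (pow \<V> K a)" using D(1-4) x f by simp
  have hf: "act (CT X) a 1 h ?f \<in> \<H> Y (Exp \<V> X K)" using act_CT_arr[OF X, of h a 1 ?f] h' f by simp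
  have "act (CT X) a 1 h ?f = coord X 1 0 (act (CT X) a 1 h ?f)" by (rule coord_one[OF X hf, symmetric])
  also have "\<dots> = exp_form X Y a q (\<lambda>i. coord X a i ?f)" by (rule coord_act[OF X h f]) simp
  also have "\<dots> = exp_form X Y a q g" by (rule exp_form_cong) (use cf in simp_all)
  finally have e: "act (CT X) a 1 h ?f = exp_form X Y a q g" .
  have hY: "h \<bullet> ide Y = h" using h' by simp
  have ha: "act CA a 1 h (ap (Exp \<V> X (pow \<V> K a)) (pow \<V> K a) (\<alpha> a \<bullet> x) ?f) \<in> \<H> Y K"
    using act_CA_arr[of h a 1 "ap (Exp \<V> X (pow \<V> K a)) (pow \<V> K a) (\<alpha> a \<bullet> x) ?f"] h' af by simp
  have "ap (Exp \<V> X K) K (\<alpha> 1 \<bullet> x) (exp_form X Y a q g) = act CA a 1 h (ap (Exp \<V> X (pow \<V> K a)) (pow \<V> K a) (\<alpha> a \<bullet> x) ?f)"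
    using D(5)[OF x h' f] unfolding e pow_one .
  also have "\<dots> = proj \<V> K 1 0 \<bullet> act CA a 1 (h \<bullet> ide Y) (ap (Exp \<V> X (pow \<V> K a)) (pow \<V> K a) (\<alpha> a \<bullet> x) ?f)"
    unfolding hY pow_one using ha by simp
  also have "\<dots> = form Y a (\<lambda>i. q i \<bullet> ide Y) (\<lambda>i. proj \<V> K a i \<bullet> ap (Exp \<V> X (pow \<V> K a)) (pow \<V> K a) (\<alpha> a \<bullet> x) ?f)"
    by (rule acts_byD(3)[OF h _ af]) (use Y in simp_all)
  also have "\<dots> = form Y a q (\<lambda>i. ap (Exp \<V> X K) K (\<alpha> 1 \<bullet> x) (g i))"
    by (rule form_cong) (use q wedge_coord[OF X w x f] cf in \<open>simp_all add: simp_implies_def\<close>)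
  finally show ?thesis .
qed

text \<open>Addition, zero, scalar action and point of \<open>[X, K]\<close> are themselves affine forms, so a natural
  family, which commutes with all affine forms, is linear and preserves the point.\<close>

lemma wedge_linear:
  assumes X: "obj X" and w: "vnat_wedge \<V> U (CT X) CA W \<alpha>"
  shows "linear_at (FM X) (rig_pmod P) W (\<alpha> 1)"
proof -
  note D = wedgeD[OF CT_typed[OF X] CA_typed w, unfolded CT_obj CA_obj U_obj]
  let ?E = "Exp \<V> X K"
  have ef: "exp_form X Y a q g = t"
    if t: "t \<in> \<H> Y ?E" and q: "\<And>i. i \<le> a \<Longrightarrow> q i \<in> \<H> Y K" and g: "\<And>i. i < a \<Longrightarrow> g i \<in> \<H> Y ?E"
      and e: "\<And>Z y v. y \<in> \<H> Z Y \<Longrightarrow> v \<in> \<H> Z X \<Longrightarrow> form Z a (\<lambda>i. q i \<bullet> y) (\<lambda>i. ap X K (g i \<bullet> y) v) = ap X K (t \<bullet> y) v"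
    for Y a q g t
  proof -
    have Y: "obj Y" using t by auto
    show ?thesis
      by (rule exp_K_eqI[OF exp_form_arr[where q = q and g = g, OF X Y q g] t X])
        (simp_all only: app_exp_form[where q = q and g = g, OF X q g] e)
  qed
  have unit: "form Z 0 q v = q 0" if "q 0 \<in> \<H> Z K" for Z q v
    using plus_laws(3)[OF that] by (simp add: form_def)
  show ?thesis
    unfolding linear_at_def FM_simps(1)[OF X] rig_pmod_def pmod_data.simps
  proof (intro conjI allI impI)
    show "\<alpha> 1 \<in> \<H> W (Exp \<V> ?E K)" using D(2-4)[of 1] by simp
    fix Y x assume x: "x \<in> \<H> Y W"
    have Y: "obj Y" using x by auto
    have ap_in: "ap ?E K (\<alpha> 1 \<bullet> x) t \<in> \<H> Y K" if "t \<in> \<H> Y ?E" for t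
      using D(2-4)[of 1] x that by simp
    have two: "form Z 2 (\<lambda>i. if i < 2 then unt Z else nul Z) v = v 0 \<boxplus> v 1" if v: "v 0 \<in> \<H> Z K" "v 1 \<in> \<H> Z K" for Z v
    proof -
      have vv: "v 0 \<boxplus> v 1 \<in> \<H> Z K" using v by simp
      show ?thesis
        using plus_laws(3)[OF v(1)] plus_laws(4)[OF vv] times_laws(4)[OF v(1)] times_laws(4)[OF v(2)]
        by (simp add: form_def numeral_2_eq_2)
    qed
    show "ap ?E K (\<alpha> 1 \<bullet> x) (MPlus (FM X) \<bullet> \<langle>f, g\<rangle>) = Plus P \<bullet> \<langle>ap ?E K (\<alpha> 1 \<bullet> x) f, ap ?E K (\<alpha> 1 \<bullet> x) g\<rangle>"
      if f: "f \<in> \<H> Y ?E" and g: "g \<in> \<H> Y ?E" for f g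
    proof -
      \<comment> \<open>Addition is the form in two variables with coefficients \<open>1\<close>, \<open>1\<close> and constant term \<open>0\<close>.\<close>
      let ?q = "\<lambda>i::nat. if i < 2 then unt Y else nul Y" and ?g = "\<lambda>i::nat. if i = 0 then f else g"
      have q: "?q i \<in> \<H> Y K" and g': "?g i \<in> \<H> Y ?E" for i using Y f g by simp_all
      have "exp_form X Y 2 ?q ?g = MPlus (FM X) \<bullet> \<langle>f, g\<rangle>"
      proof (rule ef[of _ Y 2 ?q ?g, OF _ q g'])
        show "MPlus (FM X) \<bullet> \<langle>f, g\<rangle> \<in> \<H> Y ?E" using X f g by simp
        fix Z y v assume y: "y \<in> \<H> Z Y" and v: "v \<in> \<H> Z X"
        have fv: "ap X K (f \<bullet> y) v \<in> \<H> Z K" "ap X K (g \<bullet> y) v \<in> \<H> Z K" using f g y v by simp_all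
        have "form Z 2 (\<lambda>i. ?q i \<bullet> y) (\<lambda>i. ap X K (?g i \<bullet> y) v) = form Z 2 (\<lambda>i. if i < 2 then unt Z else nul Z) (\<lambda>i. ap X K (?g i \<bullet> y) v)"
          by (rule form_cong) (use y in \<open>auto simp: simp_implies_def\<close>)
        also have "\<dots> = ap X K (f \<bullet> y) v \<boxplus> ap X K (g \<bullet> y) v"
          using two[of "\<lambda>i. ap X K (?g i \<bullet> y) v" Z] fv by simp
        also have "\<dots> = ap X K ((MPlus (FM X) \<bullet> \<langle>f, g\<rangle>) \<bullet> y) v"
          using X f g y v by simp
        finally show "form Z 2 (\<lambda>i. ?q i \<bullet> y) (\<lambda>i. ap X K (?g i \<bullet> y) v) = ap X K ((MPlus (FM X) \<bullet> \<langle>f, g\<rangle>) \<bullet> y) v" .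
      qed
      then have "ap ?E K (\<alpha> 1 \<bullet> x) (MPlus (FM X) \<bullet> \<langle>f, g\<rangle>) = form Y 2 ?q (\<lambda>i. ap ?E K (\<alpha> 1 \<bullet> x) (?g i))"
        using wedge_form[where q = ?q and g = ?g, OF X w x q g', of 2] by simp
      then show ?thesis
        using two[of "\<lambda>i. ap ?E K (\<alpha> 1 \<bullet> x) (?g i)" Y] ap_in[OF f] ap_in[OF g] by (simp add: gplus_def)
    qed
    show "ap ?E K (\<alpha> 1 \<bullet> x) (MNull (FM X) \<bullet> bng Y) = Null P \<bullet> bng Y"
    proof -
      have q: "nul Y \<in> \<H> Y K" using Y by simp
      have "exp_form X Y 0 (\<lambda>_. nul Y) (\<lambda>_. MNull (FM X) \<bullet> bng Y) = MNull (FM X) \<bullet> bng Y"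
      proof (rule ef[of _ Y 0 "\<lambda>_. nul Y", OF _ q])
        fix Z y v assume y: "y \<in> \<H> Z Y" and v: "v \<in> \<H> Z X"
        have Z: "obj Z" using y by auto
        show "form Z 0 (\<lambda>i. nul Y \<bullet> y) (\<lambda>i. ap X K ((MNull (FM X) \<bullet> bng Y) \<bullet> y) v) = ap X K ((MNull (FM X) \<bullet> bng Y) \<bullet> y) v"
          using unit[of "\<lambda>_. nul Z" Z] FM_null_app(1)[OF X v] X Y Z y by simp
      qed (use X Y in simp_all)
      then have "ap ?E K (\<alpha> 1 \<bullet> x) (MNull (FM X) \<bullet> bng Y) = form Y 0 (\<lambda>_. nul Y) (\<lambda>i. ap ?E K (\<alpha> 1 \<bullet> x) (MNull (FM X) \<bullet> bng Y))"
        using wedge_form[where q = "\<lambda>_. nul Y" and a = 0 and g = "\<lambda>_. MNull (FM X) \<bullet> bng Y", OF X w x q] by simp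
      also have "\<dots> = nul Y" by (rule unit[OF q])
      finally show ?thesis by (simp add: gnull_def)
    qed
    show "ap ?E K (\<alpha> 1 \<bullet> x) (MPt (FM X) \<bullet> bng Y) = Unit P \<bullet> bng Y"
    proof -
      have q: "unt Y \<in> \<H> Y K" using Y by simp
      have "exp_form X Y 0 (\<lambda>_. unt Y) (\<lambda>_. MPt (FM X) \<bullet> bng Y) = MPt (FM X) \<bullet> bng Y"
      proof (rule ef[of _ Y 0 "\<lambda>_. unt Y", OF _ q])
        fix Z y v assume y: "y \<in> \<H> Z Y" and v: "v \<in> \<H> Z X"
        have Z: "obj Z" using y by auto
        show "form Z 0 (\<lambda>i. unt Y \<bullet> y) (\<lambda>i. ap X K ((MPt (FM X) \<bullet> bng Y) \<bullet> y) v) = ap X K ((MPt (FM X) \<bullet> bng Y) \<bullet> y) v"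
          using unit[of "\<lambda>_. unt Z" Z] FM_null_app(2)[OF X v] X Y Z y by simp
      qed (use X Y in simp_all)
      then have "ap ?E K (\<alpha> 1 \<bullet> x) (MPt (FM X) \<bullet> bng Y) = form Y 0 (\<lambda>_. unt Y) (\<lambda>i. ap ?E K (\<alpha> 1 \<bullet> x) (MPt (FM X) \<bullet> bng Y))"
        using wedge_form[where q = "\<lambda>_. unt Y" and a = 0 and g = "\<lambda>_. MPt (FM X) \<bullet> bng Y", OF X w x q] by simp
      also have "\<dots> = unt Y" by (rule unit[OF q])
      finally show ?thesis by (simp add: gunit_def)
    qed
    show "ap ?E K (\<alpha> 1 \<bullet> x) (MAct (FM X) \<bullet> \<langle>r, f\<rangle>) = Times P \<bullet> \<langle>r, ap ?E K (\<alpha> 1 \<bullet> x) f\<rangle>"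
      if r: "r \<in> \<H> Y K" and f: "f \<in> \<H> Y ?E" for r f
    proof -
      \<comment> \<open>Multiplication by \<open>r\<close> is the form in one variable with coefficient \<open>r\<close> and constant term \<open>0\<close>.\<close>
      let ?q = "\<lambda>i::nat. if i = 0 then r else nul Y"
      have q: "?q i \<in> \<H> Y K" for i using Y r by simp
      have one: "form Z (Suc 0) (\<lambda>i. if i = 0 then s else nul Z) v = s \<boxtimes> v 0"
        if s: "s \<in> \<H> Z K" and v: "v 0 \<in> \<H> Z K" for Z s v
      proof -
        have sv: "s \<boxtimes> v 0 \<in> \<H> Z K" using s v by simp
        show ?thesis using plus_laws(3,4)[OF sv] by (simp add: form_def)
      qed
      have "exp_form X Y (Suc 0) ?q (\<lambda>_. f) = MAct (FM X) \<bullet> \<langle>r, f\<rangle>"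
      proof (rule ef[of _ Y "Suc 0" ?q "\<lambda>_. f", OF _ q f])
        show "MAct (FM X) \<bullet> \<langle>r, f\<rangle> \<in> \<H> Y ?E" using X f r by simp
        fix Z y v assume y: "y \<in> \<H> Z Y" and v: "v \<in> \<H> Z X"
        have fv: "ap X K (f \<bullet> y) v \<in> \<H> Z K" and ry: "r \<bullet> y \<in> \<H> Z K" using f r y v by simp_all
        have "form Z (Suc 0) (\<lambda>i. ?q i \<bullet> y) (\<lambda>i. ap X K (f \<bullet> y) v) = form Z (Suc 0) (\<lambda>i. if i = 0 then r \<bullet> y else nul Z) (\<lambda>i. ap X K (f \<bullet> y) v)"
          by (rule form_cong) (use y in \<open>auto simp: simp_implies_def\<close>)
        also have "\<dots> = (r \<bullet> y) \<boxtimes> ap X K (f \<bullet> y) v" by (rule one[OF ry fv])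
        also have "\<dots> = ap X K ((MAct (FM X) \<bullet> \<langle>r, f\<rangle>) \<bullet> y) v"
          using X f r y v by simp
        finally show "form Z (Suc 0) (\<lambda>i. ?q i \<bullet> y) (\<lambda>i. ap X K (f \<bullet> y) v) = ap X K ((MAct (FM X) \<bullet> \<langle>r, f\<rangle>) \<bullet> y) v" .
      qed
      then have "ap ?E K (\<alpha> 1 \<bullet> x) (MAct (FM X) \<bullet> \<langle>r, f\<rangle>) = form Y (Suc 0) ?q (\<lambda>i. ap ?E K (\<alpha> 1 \<bullet> x) f)"
        using wedge_form[where q = ?q and g = "\<lambda>_. f", OF X w x q f, of "Suc 0"] by simp
      also have "\<dots> = r \<boxtimes> ap ?E K (\<alpha> 1 \<bullet> x) f" by (rule one[OF r ap_in[OF f]])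
      finally show ?thesis by (simp add: gtimes_def)
    qed
  qed
qed

lemma wedge_determined:
  assumes X: "obj X" and w: "vnat_wedge \<V> U (CT X) CA W \<alpha>" and z: "vnat_wedge \<V> U (CT X) CA W \<beta>"
    and eq: "\<alpha> 1 = \<beta> 1"
  shows "\<alpha> a = \<beta> a"
proof (rule exp_eqI[of _ W "Exp \<V> X (pow \<V> K a)" "pow \<V> K a"])
  note D = wedgeD[OF CT_typed[OF X] CA_typed w, unfolded CT_obj CA_obj U_obj]
  note E = wedgeD[OF CT_typed[OF X] CA_typed z, unfolded CT_obj CA_obj U_obj]
  show "\<alpha> a \<in> \<H> W (Exp \<V> (Exp \<V> X (pow \<V> K a)) (pow \<V> K a))" "\<beta> a \<in> \<H> W (Exp \<V> (Exp \<V> X (pow \<V> K a)) (pow \<V> K a))"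
    using D E by simp_all
  fix Y x f assume Y: "obj Y" and x: "x \<in> \<H> Y W" and f: "f \<in> \<H> Y (Exp \<V> X (pow \<V> K a))"
  show "ap (Exp \<V> X (pow \<V> K a)) (pow \<V> K a) (\<alpha> a \<bullet> x) f = ap (Exp \<V> X (pow \<V> K a)) (pow \<V> K a) (\<beta> a \<bullet> x) f"
  proof (rule pow_eqI[of _ Y K a])
    show "ap (Exp \<V> X (pow \<V> K a)) (pow \<V> K a) (\<alpha> a \<bullet> x) f \<in> \<H> Y (pow \<V> K a)"
      "ap (Exp \<V> X (pow \<V> K a)) (pow \<V> K a) (\<beta> a \<bullet> x) f \<in> \<H> Y (pow \<V> K a)"
      using D(1-4) E(1-4) x f by simp_all
    fix i assume i: "i < a"
    show "proj \<V> K a i \<bullet> ap (Exp \<V> X (pow \<V> K a)) (pow \<V> K a) (\<alpha> a \<bullet> x) f = proj \<V> K a i \<bullet> ap (Exp \<V> X (pow \<V> K a)) (pow \<V> K a) (\<beta> a \<bullet> x) f"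
      unfolding wedge_coord[OF X w x f i] wedge_coord[OF X z x f i] eq ..
  qed simp
qed (use X in simp_all)

text \<open>The extension applies \<open>\<mu>\<close> to each coordinate. It is natural because a linear map commutes with the
  affine forms of which the arrows of the commutant consist.\<close>

lemma linear_extends:
  assumes X: "obj X" and l: "linear_at (FM X) (rig_pmod P) W \<mu>"
  shows "\<exists>\<alpha>. vnat_wedge \<V> U (CT X) CA W \<alpha> \<and> \<alpha> 1 = \<mu>"
proof -
  let ?E = "\<lambda>a. Exp \<V> X (pow \<V> K a)"
  have m: "arr \<mu>" "src \<mu> = W" "tgt \<mu> = Exp \<V> (Exp \<V> X K) K"
    using linear_atD(1)[OF l] X by (simp_all add: rig_pmod_def)
  have W: "obj W" using m by auto
  define \<alpha> where "\<alpha> a = curry' \<V> W (?E a) (tuple \<V> (W \<star> ?E a) K a (\<lambda>i.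
     ap (Exp \<V> X K) K (\<mu> \<bullet> Pr1 \<V> W (?E a)) (coord X a i (Pr2 \<V> W (?E a)))))" for a
  have \<alpha>: "\<alpha> a \<in> \<H> W (Exp \<V> (?E a) (pow \<V> K a))" for a
    unfolding \<alpha>_def using X W m by simp
  have \<alpha>_arr: "ap (?E a) (pow \<V> K a) (\<alpha> a \<bullet> x) f \<in> \<H> Y (pow \<V> K a)"
    if "x \<in> \<H> Y W" "f \<in> \<H> Y (?E a)" for a x f Y
    using \<alpha>[of a] that by simp
  have \<alpha>_app: "proj \<V> K a i \<bullet> ap (?E a) (pow \<V> K a) (\<alpha> a \<bullet> x) f = ap (Exp \<V> X K) K (\<mu> \<bullet> x) (coord X a i f)"
    if "i < a" "x \<in> \<H> Y W" "f \<in> \<H> Y (?E a)" for a i x f Y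
  proof -
    have Y: "obj Y" using that by auto
    show ?thesis unfolding \<alpha>_def using that X W Y m by (simp add: coord_comp)
  qed
  have "vnat_wedge \<V> U (CT X) CA W \<alpha>"
  proof (rule wedgeI[OF CT_typed[OF X] CA_typed W], unfold CT_obj CA_obj U_obj)
    show "\<alpha> a \<in> \<H> W (Exp \<V> (?E a) (pow \<V> K a))" for a by (rule \<alpha>)
    fix a b Y x h f assume x: "x \<in> \<H> Y W" and h: "h \<in> \<H> Y (chom a b)" and f: "f \<in> \<H> Y (?E a)"
    have Y: "obj Y" using x by auto
    have hf: "act (CT X) a b h f \<in> \<H> Y (?E b)" using X h f by simp
    obtain q where q: "acts_by a b Y h q" using acts_by_ex[OF h] .
    show "ap (?E b) (pow \<V> K b) (\<alpha> b \<bullet> x) (act (CT X) a b h f) = act CA a b h (ap (?E a) (pow \<V> K a) (\<alpha> a \<bullet> x) f)"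
    proof (rule pow_eqI[of _ Y K b])
      show "ap (?E b) (pow \<V> K b) (\<alpha> b \<bullet> x) (act (CT X) a b h f) \<in> \<H> Y (pow \<V> K b)" by (rule \<alpha>_arr[OF x hf])
      show "act CA a b h (ap (?E a) (pow \<V> K a) (\<alpha> a \<bullet> x) f) \<in> \<H> Y (pow \<V> K b)"
        using \<alpha>_arr[OF x f] h by simp
      fix j assume j: "j < b"
      have qj: "q j i \<in> \<H> Y K" if "i \<le> a" for i by (rule acts_byD(2)[OF q j that])
      have c: "coord X a i f \<in> \<H> Y (Exp \<V> X K)" if "i < a" for i using that X f by simp
      have hY: "h \<bullet> ide Y = h" using h by simp
      have "proj \<V> K b j \<bullet> ap (?E b) (pow \<V> K b) (\<alpha> b \<bullet> x) (act (CT X) a b h f) =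
        form Y a (q j) (\<lambda>i. ap (Exp \<V> X K) K (\<mu> \<bullet> x) (coord X a i f))"
        unfolding \<alpha>_app[OF j x hf] coord_act[OF X q f j] by (rule linear_exp_form[OF X l x qj c])
      also have "\<dots> = form Y a (\<lambda>i. q j i \<bullet> ide Y) (\<lambda>i. proj \<V> K a i \<bullet> ap (?E a) (pow \<V> K a) (\<alpha> a \<bullet> x) f)"
        by (rule form_cong) (use qj \<alpha>_app[OF _ x f] in \<open>simp_all add: simp_implies_def\<close>)
      also have "\<dots> = proj \<V> K b j \<bullet> act CA a b (h \<bullet> ide Y) (ap (?E a) (pow \<V> K a) (\<alpha> a \<bullet> x) f)"
        by (rule acts_byD(3)[OF q _ \<alpha>_arr[OF x f] j, symmetric]) (use Y in simp)
      finally show "proj \<V> K b j \<bullet> ap (?E b) (pow \<V> K b) (\<alpha> b \<bullet> x) (act (CT X) a b h f) =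
         proj \<V> K b j \<bullet> act CA a b h (ap (?E a) (pow \<V> K a) (\<alpha> a \<bullet> x) f)" unfolding hY .
    qed simp
  qed
  moreover have "\<alpha> 1 = \<mu>"
  proof (rule exp_eqI[of _ W "Exp \<V> X K" K])
    show "\<alpha> 1 \<in> \<H> W (Exp \<V> (Exp \<V> X K) K)" using \<alpha>[of 1] unfolding pow_one .
    fix Y x f assume x: "x \<in> \<H> Y W" and f: "f \<in> \<H> Y (Exp \<V> X K)"
    have f': "f \<in> \<H> Y (Exp \<V> X (pow \<V> K 1))" using f by simp
    have "ide K \<bullet> ap (Exp \<V> X K) K (\<alpha> 1 \<bullet> x) f = ap (Exp \<V> X K) K (\<mu> \<bullet> x) f"
      using \<alpha>_app[OF _ x f', of 0] unfolding coord_one[OF X f] pow_one by simp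
    then show "ap (Exp \<V> X K) K (\<alpha> 1 \<bullet> x) f = ap (Exp \<V> X K) K (\<mu> \<bullet> x) f"
      using \<alpha>_arr[OF x f'] unfolding pow_one by simp
  qed (use m X in simp_all)
  ultimately show ?thesis by blast
qed

end

section \<open>Functional distributions and pointed module homomorphisms\<close>

context firm_preordered_ring
begin

lemma module_hom_equalizer:
  assumes X: "obj X"
  obtains F G where "is_equalizer \<V> F G (pmod_hom_incl \<V> P (FM X) (rig_pmod P))"
    "src F = Exp \<V> (Exp \<V> X K) K"
    "\<And>W \<mu>. \<mu> \<in> \<H> W (Exp \<V> (Exp \<V> X K) K) \<Longrightarrow> F \<bullet> \<mu> = G \<bullet> \<mu> \<longleftrightarrow> linear_at (FM X) (rig_pmod P) W \<mu>"
proof -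
  have c: "MCar (FM X) = Exp \<V> X K" "MCar (rig_pmod P) = K" using X by (simp_all add: rig_pmod_def)
  show thesis
    using pmod_hom_equalizer[OF cotensor_is_pmod[OF X] rig_pmod_is_pmod] that unfolding c by blast
qed

lemma module_hom_incl:
  assumes X: "obj X"
  defines "e \<equiv> pmod_hom_incl \<V> P (FM X) (rig_pmod P)"
  shows "monic \<V> e" "arr e" "tgt e = Exp \<V> (Exp \<V> X K) K" "linear_at (FM X) (rig_pmod P) (src e) e"
    "linear_at (FM X) (rig_pmod P) W \<mu> \<Longrightarrow> \<exists>!h. h \<in> \<H> W (src e) \<and> e \<bullet> h = \<mu>"
proof -
  obtain F G where eq: "is_equalizer \<V> F G e" and F: "src F = Exp \<V> (Exp \<V> X K) K"
    and lin: "\<And>W \<mu>. \<mu> \<in> \<H> W (Exp \<V> (Exp \<V> X K) K) \<Longrightarrow> F \<bullet> \<mu> = G \<bullet> \<mu> \<longleftrightarrow> linear_at (FM X) (rig_pmod P) W \<mu>"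
    by (rule module_hom_equalizer[OF X, folded e_def]) (rule that)
  note E = equalizerD[OF eq]
  show "monic \<V> e" by (rule equalizer_monic[OF eq])
  show e: "arr e" "tgt e = Exp \<V> (Exp \<V> X K) K" using E(1,2) F by simp_all
  have "e \<in> \<H> (src e) (Exp \<V> (Exp \<V> X K) K)" using e by simp
  from lin[OF this] show "linear_at (FM X) (rig_pmod P) (src e) e" using E(3) by blast
  assume l: "linear_at (FM X) (rig_pmod P) W \<mu>"
  have m: "\<mu> \<in> \<H> W (Exp \<V> (Exp \<V> X K) K)" using linear_atD(1)[OF l] X by (simp add: rig_pmod_def)
  show "\<exists>!h. h \<in> \<H> W (src e) \<and> e \<bullet> h = \<mu>"
    by (rule E(4)) (use m F lin[OF m] l in simp_all)
qed

lemma wedge_precomp_CT: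
  assumes X: "obj X" and w: "vnat_wedge \<V> U (CT X) CA W \<alpha>" and h: "h \<in> \<H> Y W"
  shows "vnat_wedge \<V> U (CT X) CA Y (\<lambda>a. \<alpha> a \<bullet> h)"
  by (rule wedge_precomp[OF CT_typed[OF X] CA_typed w h])

text \<open>The universal pointed linear map extends to a natural family, which is universal because natural families and
  pointed linear maps with parameters in any object correspond to each other.\<close>

lemma distribution_object_ex:
  assumes X: "obj X"
  shows "\<exists>E. is_vnat_object \<V> U (CT X) CA E"
proof -
  let ?e = "pmod_hom_incl \<V> P (FM X) (rig_pmod P)"
  note e = module_hom_incl[OF X]
  obtain \<epsilon> where \<epsilon>: "vnat_wedge \<V> U (CT X) CA (src ?e) \<epsilon>" and \<epsilon>1: "\<epsilon> 1 = ?e"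
    using linear_extends[OF X e(4)] by blast
  have "is_vnat_object \<V> U (CT X) CA (src ?e, \<epsilon>)"
    unfolding is_vnat_object_def fst_conv snd_conv
  proof (intro conjI allI impI \<epsilon>)
    fix W \<alpha> assume w: "vnat_wedge \<V> U (CT X) CA W \<alpha>"
    have u: "\<exists>!h. h \<in> \<H> W (src ?e) \<and> ?e \<bullet> h = \<alpha> 1" by (rule e(5)[OF wedge_linear[OF X w]])
    then obtain h where h: "h \<in> \<H> W (src ?e)" "?e \<bullet> h = \<alpha> 1" by blast
    have "\<epsilon> a \<bullet> h = \<alpha> a" for a
      by (rule wedge_determined[OF X wedge_precomp_CT[OF X \<epsilon> h(1)] w]) (simp only: \<epsilon>1 h(2))
    then show "\<exists>!h. h \<in> \<H> W (src ?e) \<and> (\<forall>a\<in>VObj U. \<epsilon> a \<bullet> h = \<alpha> a)"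
      using h u \<epsilon>1 by (intro ex1I[of _ h]) (simp, metis U_obj(1) UNIV_I)
  qed
  then show ?thesis by blast
qed

lemma distribution_object_universal:
  assumes X: "obj X"
  defines "E \<equiv> vnat_object \<V> U (CT X) CA"
  shows "vnat_wedge \<V> U (CT X) CA (fst E) (snd E)"
    "vnat_wedge \<V> U (CT X) CA W \<alpha> \<Longrightarrow> \<exists>!h. h \<in> \<H> W (fst E) \<and> (\<forall>a. snd E a \<bullet> h = \<alpha> a)"
proof -
  have u: "is_vnat_object \<V> U (CT X) CA E"
    unfolding E_def vnat_object_def by (rule someI_ex[OF distribution_object_ex[OF X]])
  show "vnat_wedge \<V> U (CT X) CA (fst E) (snd E)"
    by (rule u[unfolded is_vnat_object_def, THEN conjunct1])
  show "\<exists>!h. h \<in> \<H> W (fst E) \<and> (\<forall>a. snd E a \<bullet> h = \<alpha> a)" if "vnat_wedge \<V> U (CT X) CA W \<alpha>"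
    using u[unfolded is_vnat_object_def, THEN conjunct2, rule_format, OF that] by simp
qed

text \<open>The object of distributions and the equalizer represent the same families, so the comparison arrows
  \<open>\<phi>\<close> and \<open>\<psi>\<close> obtained from the two universal properties are mutually inverse.\<close>

lemma incl_same_subobject:
  assumes X: "obj X"
  defines "i \<equiv> functional_distribution_incl \<V> T (aff_alg \<V> P) X"
    and "D \<equiv> functional_distribution_object \<V> T (aff_alg \<V> P) X"
    and "e \<equiv> pmod_hom_incl \<V> P (FM X) (rig_pmod P)"
  shows "i \<in> \<H> D (Exp \<V> (Exp \<V> X K) K)" "same_subobject \<V> i e"
proof -
  let ?E = "vnat_object \<V> U (CT X) CA"
  note e = module_hom_incl[OF X, folded e_def]
  note w = distribution_object_universal(1)[OF X] and univ = distribution_object_universal(2)[OF X]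
  have i: "i = snd ?E 1" and D: "D = fst ?E"
    unfolding i_def D_def functional_distribution_incl_def functional_distribution_object_def alg_hom_carrier_def
    by (simp_all add: Alg_def)
  note W = wedgeD[OF CT_typed[OF X] CA_typed w, unfolded CT_obj CA_obj U_obj]
  show iD: "i \<in> \<H> D (Exp \<V> (Exp \<V> X K) K)" using W(2-4)[of 1] unfolding i D by simp
  then have i': "arr i" "src i = D" "tgt i = Exp \<V> (Exp \<V> X K) K" by simp_all
  have inj: "h = k" if h: "h \<in> \<H> Y D" and k: "k \<in> \<H> Y D" and eq: "i \<bullet> h = i \<bullet> k" for Y h k
  proof -
    have wh: "vnat_wedge \<V> U (CT X) CA Y (\<lambda>a. snd ?E a \<bullet> h)" and wk: "vnat_wedge \<V> U (CT X) CA Y (\<lambda>a. snd ?E a \<bullet> k)"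
      by (rule wedge_precomp_CT[OF X w]; use h k in \<open>simp only: D\<close>)+
    have "snd ?E a \<bullet> h = snd ?E a \<bullet> k" for a
      by (rule wedge_determined[OF X wh wk]) (use eq in \<open>simp only: i\<close>)
    then show ?thesis using univ[OF wk] h k unfolding D by blast
  qed
  have mi: "monic \<V> i"
    unfolding monic_def
  proof (intro conjI ballI impI i'(1))
    fix h k assume "arr h" "arr k" and *: "src h = src k \<and> tgt h = src i \<and> tgt k = src i \<and> i \<bullet> h = i \<bullet> k"
    then show "h = k" using i'(2) by (intro inj[of h "src k" k]) auto
  qed
  obtain \<phi> where \<phi>: "\<phi> \<in> \<H> D (src e)" "e \<bullet> \<phi> = i"
    using e(5)[OF wedge_linear[OF X w, folded i D]] by blast
  obtain \<epsilon> where \<epsilon>: "vnat_wedge \<V> U (CT X) CA (src e) \<epsilon>" "\<epsilon> 1 = e"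
    using linear_extends[OF X e(4)] by blast
  obtain \<psi> where \<psi>: "\<psi> \<in> \<H> (src e) D" "i \<bullet> \<psi> = e"
    using univ[OF \<epsilon>(1)] \<epsilon>(2) unfolding i D by metis
  have Dobj: "obj D" using i' src_obj by metis
  have p: "arr \<phi>" "src \<phi> = D" "tgt \<phi> = src e" "arr \<psi>" "src \<psi> = src e" "tgt \<psi> = D" using \<phi>(1) \<psi>(1) by simp_all
  have "\<psi> \<bullet> \<phi> = ide D"
  proof (rule inj)
    show "\<psi> \<bullet> \<phi> \<in> \<H> D D" "ide D \<in> \<H> D D" using p Dobj by simp_all
    have "i \<bullet> \<psi> \<bullet> \<phi> = (i \<bullet> \<psi>) \<bullet> \<phi>" using p i' by simp
    then show "i \<bullet> \<psi> \<bullet> \<phi> = i \<bullet> ide D" unfolding \<psi>(2) \<phi>(2) using i' by simp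
  qed
  moreover have "\<phi> \<bullet> \<psi> = ide (src e)"
  proof -
    have "e \<bullet> \<phi> \<bullet> \<psi> = (e \<bullet> \<phi>) \<bullet> \<psi>" using p e(2) by simp
    then have eq: "e \<bullet> \<phi> \<bullet> \<psi> = e \<bullet> ide (src e)" unfolding \<phi>(2) \<psi>(2) using e(2) by simp
    have o: "obj (src e)" using e(2) by simp
    have "\<phi> \<bullet> \<psi> \<in> \<H> (src e) (src e)" "ide (src e) \<in> \<H> (src e) (src e)" using p o by simp_all
    moreover have "\<exists>!h. h \<in> \<H> (src e) (src e) \<and> e \<bullet> h = e" by (rule e(5)[OF e(4)])
    moreover have "e \<bullet> ide (src e) = e" using e(2) by simp
    ultimately show ?thesis using eq by metis
  qed
  ultimately show "same_subobject \<V> i e"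
    unfolding same_subobject_def i'(2,3) e(3) using mi e(1) \<phi> \<psi>(1) by blast
qed

text \<open>Apply the correspondence of natural families and pointed linear maps to the terminal object of
  parameters, where both are names of arrows.\<close>

lemma distributions_bij:
  assumes X: "obj X"
  shows "bij_betw (\<lambda>\<theta>. \<theta> 1) {\<theta>. functional_distribution \<V> T (aff_alg \<V> P) X \<theta>}
     {\<mu>. is_pmod_hom \<V> P (FM X) (rig_pmod P) \<mu>}"
proof -
  let ?E = "\<lambda>a. Exp \<V> X (pow \<V> K a)"
  have c: "MCar (FM X) = Exp \<V> X K" "MCar (rig_pmod P) = K" using X by (simp_all add: rig_pmod_def)
  have fd: "functional_distribution \<V> T (aff_alg \<V> P) X \<theta> \<longleftrightarrow>
      (\<forall>a. \<theta> a \<in> \<H> (?E a) (pow \<V> K a)) \<and> vnat_wedge \<V> U (CT X) CA \<I> (\<lambda>a. name_of \<V> (\<theta> a))" for \<theta>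
  proof -
    have "functional_distribution \<V> T (aff_alg \<V> P) X \<theta> \<longleftrightarrow> is_vnat \<V> U (CT X) CA \<theta>"
      unfolding functional_distribution_def is_alg_hom_def using CT_algebra[OF X] CA_algebra by blast
    moreover have "\<theta> a \<in> \<H> (?E a) (pow \<V> K a)" if "is_vnat \<V> U (CT X) CA \<theta>" for a
      using that unfolding is_vnat_def CT_obj CA_obj U_obj by blast
    moreover have "is_vnat \<V> U (CT X) CA \<theta> \<longleftrightarrow> vnat_wedge \<V> U (CT X) CA \<I> (\<lambda>a. name_of \<V> (\<theta> a))"
      if "\<forall>a. \<theta> a \<in> \<H> (?E a) (pow \<V> K a)"
      by (rule vnat_iff_wedge[OF CT_typed[OF X] CA_typed]) (use that in \<open>simp only: CT_obj CA_obj\<close>)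
    ultimately show ?thesis by blast
  qed
  have hom: "is_pmod_hom \<V> P (FM X) (rig_pmod P) \<mu> \<longleftrightarrow>
      \<mu> \<in> \<H> (Exp \<V> X K) K \<and> linear_at (FM X) (rig_pmod P) \<I> (name_of \<V> \<mu>)" for \<mu>
  proof -
    have "\<mu> \<in> \<H> (Exp \<V> X K) K" if "is_pmod_hom \<V> P (FM X) (rig_pmod P) \<mu>"
      using that unfolding is_pmod_hom_def c by blast
    moreover have "is_pmod_hom \<V> P (FM X) (rig_pmod P) \<mu> \<longleftrightarrow> linear_at (FM X) (rig_pmod P) \<I> (name_of \<V> \<mu>)"
      if "\<mu> \<in> \<H> (Exp \<V> X K) K"
      by (rule pmod_hom_iff_linear[OF cotensor_is_pmod[OF X] rig_pmod_is_pmod]) (use that in \<open>simp only: c\<close>)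
    ultimately show ?thesis by blast
  qed
  show ?thesis
  proof (rule bij_betwI')
    fix \<theta> \<eta> assume "\<theta> \<in> {\<theta>. functional_distribution \<V> T (aff_alg \<V> P) X \<theta>}" "\<eta> \<in> {\<theta>. functional_distribution \<V> T (aff_alg \<V> P) X \<theta>}"
    then have \<theta>: "\<And>a. \<theta> a \<in> \<H> (?E a) (pow \<V> K a)" "vnat_wedge \<V> U (CT X) CA \<I> (\<lambda>a. name_of \<V> (\<theta> a))"
      and \<eta>: "\<And>a. \<eta> a \<in> \<H> (?E a) (pow \<V> K a)" "vnat_wedge \<V> U (CT X) CA \<I> (\<lambda>a. name_of \<V> (\<eta> a))"
      unfolding mem_Collect_eq fd by blast+
    show "(\<theta> 1 = \<eta> 1) = (\<theta> = \<eta>)"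
    proof
      assume eq: "\<theta> 1 = \<eta> 1"
      have "name_of \<V> (\<theta> a) = name_of \<V> (\<eta> a)" for a
        by (rule wedge_determined[OF X \<theta>(2) \<eta>(2)]) (simp only: eq)
      then have "\<theta> a = \<eta> a" for a by (rule name_inj[OF \<theta>(1) \<eta>(1)])
      then show "\<theta> = \<eta>" by blast
    qed simp
  next
    fix \<theta> assume "\<theta> \<in> {\<theta>. functional_distribution \<V> T (aff_alg \<V> P) X \<theta>}"
    then have \<theta>: "\<And>a. \<theta> a \<in> \<H> (?E a) (pow \<V> K a)" "vnat_wedge \<V> U (CT X) CA \<I> (\<lambda>a. name_of \<V> (\<theta> a))"
      unfolding mem_Collect_eq fd by blast+
    show "\<theta> 1 \<in> {\<mu>. is_pmod_hom \<V> P (FM X) (rig_pmod P) \<mu>}"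
      unfolding mem_Collect_eq hom using \<theta>(1)[of 1] wedge_linear[OF X \<theta>(2)] unfolding pow_one by blast
  next
    fix \<mu> assume "\<mu> \<in> {\<mu>. is_pmod_hom \<V> P (FM X) (rig_pmod P) \<mu>}"
    then have \<mu>: "\<mu> \<in> \<H> (Exp \<V> X K) K" "linear_at (FM X) (rig_pmod P) \<I> (name_of \<V> \<mu>)"
      unfolding mem_Collect_eq hom by blast+
    obtain \<alpha> where \<alpha>: "vnat_wedge \<V> U (CT X) CA \<I> \<alpha>" "\<alpha> 1 = name_of \<V> \<mu>"
      using linear_extends[OF X \<mu>(2)] by blast
    note A = wedgeD[OF CT_typed[OF X] CA_typed \<alpha>(1), unfolded CT_obj CA_obj U_obj]
    have "\<exists>f \<in> \<H> (?E a) (pow \<V> K a). name_of \<V> f = \<alpha> a" for a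
      by (rule name_surj) (use A(2-4) X in simp_all)
    then obtain \<theta> where \<theta>: "\<And>a. \<theta> a \<in> \<H> (?E a) (pow \<V> K a)" "\<And>a. name_of \<V> (\<theta> a) = \<alpha> a"
      by metis
    have "name_of \<V> (\<theta> 1) = name_of \<V> \<mu>" unfolding \<theta>(2) \<alpha>(2) ..
    then have "\<theta> 1 = \<mu>" by (rule name_inj[OF \<theta>(1)[of 1, unfolded pow_one] \<mu>(1)])
    moreover have "functional_distribution \<V> T (aff_alg \<V> P) X \<theta>"
      unfolding fd \<theta>(2) using \<theta>(1) \<alpha>(1) by blast
    ultimately show "\<exists>\<theta> \<in> {\<theta>. functional_distribution \<V> T (aff_alg \<V> P) X \<theta>}. \<mu> = \<theta> 1" by blast
  qed
qed

end

theorem corollary10p7: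
  fixes \<V> :: "('o, 'm) ccc"
    and R R\<^sub>p :: "('o, 'm) rig_data"
    and \<iota> :: 'm
    and \<G> :: "'o set"
    and V :: 'o
  assumes "is_base_category \<V>"
    and "is_comm_preordered_ring \<V> R R\<^sub>p \<iota>"
    and "strong_mono \<V> \<iota>"
    and "generating \<V> \<G>"
    and "\<And>G. G \<in> \<G> \<Longrightarrow>
           firmly_archimedean (hom_ring \<V> G R) (hom_pos \<V> G \<iota>) \<and>
           preordered_dyadic_algebra (hom_ring \<V> G R) (hom_pos \<V> G \<iota>)"
    and "V \<in> Ob \<V>"
  shows "bij_betw (\<lambda>\<theta>. \<theta> 1)
           {\<theta>. functional_distribution \<V> (Mat_aff \<V> R\<^sub>p) (aff_alg \<V> R\<^sub>p) V \<theta>}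
           {\<mu>. is_pmod_hom \<V> R\<^sub>p (cotensor_pmod \<V> R\<^sub>p V) (rig_pmod R\<^sub>p) \<mu>}
       \<and> functional_distribution_incl \<V> (Mat_aff \<V> R\<^sub>p) (aff_alg \<V> R\<^sub>p) V
           \<in> Hom \<V> (functional_distribution_object \<V> (Mat_aff \<V> R\<^sub>p) (aff_alg \<V> R\<^sub>p) V)
               (Exp \<V> (Exp \<V> V (Car R\<^sub>p)) (Car R\<^sub>p))
       \<and> same_subobject \<V>
           (functional_distribution_incl \<V> (Mat_aff \<V> R\<^sub>p) (aff_alg \<V> R\<^sub>p) V)
           (pmod_hom_incl \<V> R\<^sub>p (cotensor_pmod \<V> R\<^sub>p V) (rig_pmod R\<^sub>p))"
proof -
  interpret firm_preordered_ring \<V> R R\<^sub>p \<iota> \<G>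
    by unfold_locales (use assms in blast)+
  show ?thesis
    using distributions_bij[OF assms(6)] incl_same_subobject[OF assms(6)] by blast
qed

end
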